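(* Let $\mathbb{K}$ be an algebraically closed field of characteristic zero, let $\Sigma$ be a complete fan in $N_{\mathbb{Q}}$, where $N$ is a free abelian group of rank $n$, and let $X(\Sigma)$ be the associated complete toric variety over $\mathbb{K}$ with dense torus $T$. Then $X(\Sigma)$ admits an automorphism (of algebraic varieties) which maps some $T$-invariant point of $X(\Sigma)$ into the dense torus $T$ if and only if there exists a smooth full-dimensional cone $\sigma\in\Sigma$ such that $$\Sigma(1)\setminus\sigma(1)\subset -\sigma.$$ Moreover, for such a cone $\sigma$, the $T$-invariant point of $X(\Sigma)$ corresponding to $\sigma$ is mapped into $T$ by some automorphism of $X(\Sigma)$.
   Context: $N_{\mathbb{Q}}=N\otimes_{\mathbb{Z}}\mathbb{Q}$. $\Sigma(1)$ denotes the set of one-dimensional cones (rays) of $\Sigma$ and $\sigma(1)$ the set of rays of the cone $\sigma$; the inclusion means that every ray of $\Sigma$ that is not a ray of $\sigma$ is contained in the cone $-\sigma=\{-v\mid v\in\sigma\}$. A full-dimensional cone is smooth if the primitive lattice generators of its rays form a $\mathbb{Z}$-basis of $N$. Each full-dimensional cone of $\Sigma$ corresponds to a $T$-invariant (i.e. $T$-fixed) point of $X(\Sigma)$, by the orbit-cone correspondence. *)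

theory Defs
  imports "HOL-Analysis.Abstract_Topology" "HOL-Computational_Algebra.Polynomial"
begin

text \<open>
  A lattice is presented as a subgroup \<open>N\<close> of a rational vector space \<open>'v\<close>: it is free of rank
  \<open>n\<close>, and it spans \<open>'v\<close> over the rationals.  As \<open>N \<otimes> \<rat> \<rightarrow> 'v\<close> is always injective for a subgroup
  of a rational vector space, the spanning condition says exactly that \<open>'v\<close> is \<open>N \<otimes> \<rat>\<close>.
\<close>

definition int_basis :: "(rat \<Rightarrow> 'v::ab_group_add \<Rightarrow> 'v) \<Rightarrow> 'v set \<Rightarrow> 'v set \<Rightarrow> bool" where
  "int_basis scale B N \<longleftrightarrow>
     finite B \<and>
     N = {\<Sum>b\<in>B. scale (of_int (c b)) b | c :: 'v \<Rightarrow> int. True} \<and>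
     (\<forall>c :: 'v \<Rightarrow> int. (\<Sum>b\<in>B. scale (of_int (c b)) b) = 0 \<longrightarrow> (\<forall>b\<in>B. c b = 0))"

type_synonym ('v, 'k) chart_point = "('v \<Rightarrow> rat) \<Rightarrow> 'k"
type_synonym ('v, 'k) toric_point = "('v set \<times> ('v, 'k) chart_point) set"

locale toric_lattice = vector_space scale
  for scale :: "rat \<Rightarrow> 'v::ab_group_add \<Rightarrow> 'v" +
  fixes N :: "'v set" and n :: nat
  assumes free_of_rank: "\<exists>B. int_basis scale B N \<and> card B = n"
    and span_lattice: "span N = UNIV"
begin

definition rational_cone :: "'v set \<Rightarrow> bool" where
  "rational_cone \<sigma> \<longleftrightarrow>
     (\<exists>S. finite S \<and> S \<subseteq> N \<and> \<sigma> = {\<Sum>v\<in>S. scale (c v) v | c. \<forall>v\<in>S. 0 \<le> c v})"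

definition strongly_convex :: "'v set \<Rightarrow> bool" where
  "strongly_convex \<sigma> \<longleftrightarrow> \<sigma> \<inter> uminus ` \<sigma> = {0}"

text \<open>The cone itself is one of its faces (take \<open>m = 0\<close>).\<close>

definition face_of :: "'v set \<Rightarrow> 'v set \<Rightarrow> bool" where
  "face_of \<tau> \<sigma> \<longleftrightarrow>
     (\<exists>m. Vector_Spaces.linear scale (*) m \<and> (\<forall>v\<in>\<sigma>. 0 \<le> m v) \<and> \<tau> = {v\<in>\<sigma>. m v = 0})"

definition fan :: "'v set set \<Rightarrow> bool" where
  "fan \<Sigma> \<longleftrightarrow>
     finite \<Sigma> \<and> \<Sigma> \<noteq> {} \<and>
     (\<forall>\<sigma>\<in>\<Sigma>. rational_cone \<sigma> \<and> strongly_convex \<sigma>) \<and>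
     (\<forall>\<sigma>\<in>\<Sigma>. \<forall>\<tau>. face_of \<tau> \<sigma> \<longrightarrow> \<tau> \<in> \<Sigma>) \<and>
     (\<forall>\<sigma>\<in>\<Sigma>. \<forall>\<tau>\<in>\<Sigma>. face_of (\<sigma> \<inter> \<tau>) \<sigma> \<and> face_of (\<sigma> \<inter> \<tau>) \<tau>)"

definition complete_fan :: "'v set set \<Rightarrow> bool" where
  "complete_fan \<Sigma> \<longleftrightarrow> fan \<Sigma> \<and> \<Union>\<Sigma> = UNIV"

definition fan_rays :: "'v set set \<Rightarrow> 'v set set" where
  "fan_rays \<Sigma> = {\<rho>\<in>\<Sigma>. dim \<rho> = 1}"

definition cone_rays :: "'v set \<Rightarrow> 'v set set" where
  "cone_rays \<sigma> = {\<rho>. face_of \<rho> \<sigma> \<and> dim \<rho> = 1}"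

definition full_dimensional :: "'v set \<Rightarrow> bool" where
  "full_dimensional \<sigma> \<longleftrightarrow> dim \<sigma> = n"

definition primitive :: "'v \<Rightarrow> bool" where
  "primitive v \<longleftrightarrow>
     v \<in> N \<and> v \<noteq> 0 \<and> (\<forall>w\<in>N. \<forall>k::nat. v = scale (of_nat k) w \<longrightarrow> k = 1)"

definition primitive_generators :: "'v set \<Rightarrow> 'v set" where
  "primitive_generators \<sigma> = {v. primitive v \<and> (\<exists>\<rho>\<in>cone_rays \<sigma>. v \<in> \<rho>)}"

text \<open>To be used for full-dimensional cones only.\<close>

definition smooth_cone :: "'v set \<Rightarrow> bool" where
  "smooth_cone \<sigma> \<longleftrightarrow> int_basis scale (primitive_generators \<sigma>) N"

text \<open>
  \<open>dual_monoid \<sigma>\<close> is \<open>\<sigma>\<^sup>\<or> \<inter> M\<close>, where the dual lattice \<open>M\<close> consists of the linear forms that are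
  integral on \<open>N\<close>.  Since \<open>'k\<close> will be algebraically closed, the closed points of the affine
  toric variety \<open>Spec 'k[\<sigma>\<^sup>\<or> \<inter> M]\<close> are the monoid homomorphisms from \<open>\<sigma>\<^sup>\<or> \<inter> M\<close> to the
  multiplicative monoid of \<open>'k\<close>; \<open>restrict\<close> makes them equal as soon as they agree on \<open>\<sigma>\<^sup>\<or> \<inter> M\<close>.
\<close>

definition dual_monoid :: "'v set \<Rightarrow> ('v \<Rightarrow> rat) set" where
  "dual_monoid \<sigma> =
     {m. Vector_Spaces.linear scale (*) m \<and> m ` N \<subseteq> \<int> \<and> (\<forall>v\<in>\<sigma>. 0 \<le> m v)}"

definition chart :: "'v set \<Rightarrow> ('v, 'k::field) chart_point set" where
  "chart \<sigma> =
     {x \<in> extensional (dual_monoid \<sigma>).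
        x (\<lambda>_. 0) = 1 \<and>
        (\<forall>m\<in>dual_monoid \<sigma>. \<forall>m'\<in>dual_monoid \<sigma>. x (\<lambda>v. m v + m' v) = x m * x m')}"

definition coordinate_ring :: "'v set \<Rightarrow> (('v, 'k::field) chart_point \<Rightarrow> 'k) set" where
  "coordinate_ring \<sigma> =
     {\<lambda>x. \<Sum>m\<in>F. c m * x m | F c. finite F \<and> F \<subseteq> dual_monoid \<sigma>}"

text \<open>The generating sets are the principal open sets, a base of the Zariski topology.\<close>

definition chart_topology :: "'v set \<Rightarrow> ('v, 'k::field) chart_point topology" where
  "chart_topology \<sigma> =
     topology_generated_by {{x \<in> chart \<sigma>. f x \<noteq> 0} | f. f \<in> coordinate_ring \<sigma>}"

definition chart_regular ::
    "'v set \<Rightarrow> ('v, 'k::field) chart_point set \<Rightarrow> (('v, 'k) chart_point \<Rightarrow> 'k) \<Rightarrow> bool" where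
  "chart_regular \<sigma> W f \<longleftrightarrow>
     (\<forall>x\<in>W. \<exists>W'. openin (chart_topology \<sigma>) W' \<and> x \<in> W' \<and> W' \<subseteq> W \<and>
        (\<exists>g\<in>coordinate_ring \<sigma>. \<exists>h\<in>coordinate_ring \<sigma>.
           \<forall>y\<in>W'. h y \<noteq> 0 \<and> f y = g y / h y))"

text \<open>
  The variety is glued from the charts: for \<open>\<sigma>\<close> and \<open>\<tau>\<close> in the fan, the chart of \<open>\<sigma> \<inter> \<tau>\<close> maps to
  the charts of \<open>\<sigma>\<close> and \<open>\<tau>\<close> by restriction of homomorphisms, and the two images of a point are
  identified.  A point of the variety is a class of pairs (cone, point of its chart).
\<close>

definition gluing ::
    "'v set set \<Rightarrow> (('v set \<times> ('v, 'k::field) chart_point) \<times> ('v set \<times> ('v, 'k) chart_point)) set"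
  where
  "gluing \<Sigma> =
     {((\<sigma>, restrict z (dual_monoid \<sigma>)), (\<tau>, restrict z (dual_monoid \<tau>))) | \<sigma> \<tau> z.
        \<sigma> \<in> \<Sigma> \<and> \<tau> \<in> \<Sigma> \<and> z \<in> chart (\<sigma> \<inter> \<tau>)}"

definition toric_variety :: "'v set set \<Rightarrow> ('v, 'k::field) toric_point set" where
  "toric_variety \<Sigma> = (SIGMA \<sigma>:\<Sigma>. chart \<sigma>) // gluing \<Sigma>"

definition chart_map ::
    "'v set set \<Rightarrow> 'v set \<Rightarrow> ('v, 'k::field) chart_point \<Rightarrow> ('v, 'k) toric_point"
  where
  "chart_map \<Sigma> \<sigma> x = gluing \<Sigma> `` {(\<sigma>, x)}"

definition toric_topology ::
    "'v set set \<Rightarrow> ('v, 'k::field) toric_point topology" where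
  "toric_topology \<Sigma> =
     topology (\<lambda>U. U \<subseteq> toric_variety \<Sigma> \<and>
       (\<forall>\<sigma>\<in>\<Sigma>. openin (chart_topology \<sigma>) {x \<in> chart \<sigma>. chart_map \<Sigma> \<sigma> x \<in> U}))"

definition regular_on ::
    "'v set set \<Rightarrow> ('v, 'k::field) toric_point set
      \<Rightarrow> (('v, 'k) toric_point \<Rightarrow> 'k) \<Rightarrow> bool" where
  "regular_on \<Sigma> U f \<longleftrightarrow>
     (\<forall>\<sigma>\<in>\<Sigma>. chart_regular \<sigma> {x \<in> chart \<sigma>. chart_map \<Sigma> \<sigma> x \<in> U} (f \<circ> chart_map \<Sigma> \<sigma>))"

definition endomorphism ::
    "'v set set \<Rightarrow> (('v, 'k::field) toric_point
      \<Rightarrow> ('v, 'k) toric_point) \<Rightarrow> bool" where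
  "endomorphism \<Sigma> \<phi> \<longleftrightarrow>
     continuous_map (toric_topology \<Sigma>) (toric_topology \<Sigma>) \<phi> \<and>
     (\<forall>U f. openin (toric_topology \<Sigma>) U \<and> regular_on \<Sigma> U f \<longrightarrow>
        regular_on \<Sigma> {p \<in> toric_variety \<Sigma>. \<phi> p \<in> U} (f \<circ> \<phi>))"

definition automorphism ::
    "'v set set \<Rightarrow> (('v, 'k::field) toric_point
      \<Rightarrow> ('v, 'k) toric_point) \<Rightarrow> bool" where
  "automorphism \<Sigma> \<phi> \<longleftrightarrow>
     endomorphism \<Sigma> \<phi> \<and>
     (\<exists>\<psi>. endomorphism \<Sigma> \<psi> \<and> (\<forall>p\<in>toric_variety \<Sigma>. \<psi> (\<phi> p) = p \<and> \<phi> (\<psi> p) = p))"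

text \<open>
  The chart of the zero cone consists of the group homomorphisms from \<open>M\<close> to the multiplicative
  group of \<open>'k\<close>, i.e. it is the torus; it acts on every chart by pointwise multiplication.
\<close>

definition dense_torus :: "'v set set \<Rightarrow> ('v, 'k::field) toric_point set" where
  "dense_torus \<Sigma> = chart_map \<Sigma> {0} ` chart {0}"

definition chart_act ::
    "('v, 'k::field) chart_point \<Rightarrow> 'v set \<Rightarrow> ('v, 'k) chart_point \<Rightarrow> ('v, 'k) chart_point" where
  "chart_act t \<sigma> x = restrict (\<lambda>m. t m * x m) (dual_monoid \<sigma>)"

definition torus_act ::
    "('v, 'k::field) chart_point \<Rightarrow> ('v, 'k) toric_point
      \<Rightarrow> ('v, 'k) toric_point" where
  "torus_act t p = (\<lambda>(\<sigma>, x). (\<sigma>, chart_act t \<sigma> x)) ` p"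

definition torus_invariant ::
    "'v set set \<Rightarrow> ('v, 'k::field) toric_point \<Rightarrow> bool" where
  "torus_invariant \<Sigma> p \<longleftrightarrow> p \<in> toric_variety \<Sigma> \<and> (\<forall>t\<in>chart {0}. torus_act t p = p)"

text \<open>
  The orbit-cone correspondence assigns to \<open>\<sigma>\<close> the torus orbit of its distinguished point, the
  homomorphism that is 1 on \<open>\<sigma>\<^sup>\<bottom> \<inter> M\<close> and 0 elsewhere.  For a full-dimensional \<open>\<sigma>\<close> that orbit is
  the distinguished point alone.
\<close>

definition distinguished_point :: "'v set set \<Rightarrow> 'v set \<Rightarrow> ('v, 'k::field) toric_point"
  where
  "distinguished_point \<Sigma> \<sigma> =
     chart_map \<Sigma> \<sigma> (restrict (\<lambda>m. if \<forall>v\<in>\<sigma>. m v = 0 then 1 else 0) (dual_monoid \<sigma>))"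

lemma openin_toric_topology:
  fixes U :: "('v, 'k::field) toric_point set"
  shows "openin (toric_topology \<Sigma>) U \<longleftrightarrow>
     U \<subseteq> toric_variety \<Sigma> \<and>
     (\<forall>\<sigma>\<in>\<Sigma>. openin (chart_topology \<sigma>) {x \<in> chart \<sigma>. chart_map \<Sigma> \<sigma> x \<in> U})"
proof -
  have "istopology (\<lambda>U :: ('v, 'k) toric_point set. U \<subseteq> toric_variety \<Sigma> \<and>
      (\<forall>\<sigma>\<in>\<Sigma>. openin (chart_topology \<sigma>) {x \<in> chart \<sigma>. chart_map \<Sigma> \<sigma> x \<in> U}))"
    unfolding istopology_def
  proof (intro conjI allI impI ballI)
    fix S T :: "('v, 'k) toric_point set" and \<sigma>
    assume "S \<subseteq> toric_variety \<Sigma> \<and>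
        (\<forall>\<sigma>\<in>\<Sigma>. openin (chart_topology \<sigma>) {x \<in> chart \<sigma>. chart_map \<Sigma> \<sigma> x \<in> S})"
      and "T \<subseteq> toric_variety \<Sigma> \<and>
        (\<forall>\<sigma>\<in>\<Sigma>. openin (chart_topology \<sigma>) {x \<in> chart \<sigma>. chart_map \<Sigma> \<sigma> x \<in> T})"
      and "\<sigma> \<in> \<Sigma>"
    then have "openin (chart_topology \<sigma>)
        ({x \<in> chart \<sigma>. chart_map \<Sigma> \<sigma> x \<in> S} \<inter> {x \<in> chart \<sigma>. chart_map \<Sigma> \<sigma> x \<in> T})"
      by (intro openin_Int) auto
    also have "{x \<in> chart \<sigma>. chart_map \<Sigma> \<sigma> x \<in> S} \<inter> {x \<in> chart \<sigma>. chart_map \<Sigma> \<sigma> x \<in> T}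
        = {x \<in> chart \<sigma>. chart_map \<Sigma> \<sigma> x \<in> S \<inter> T}"
      by auto
    finally show "openin (chart_topology \<sigma>) {x \<in> chart \<sigma>. chart_map \<Sigma> \<sigma> x \<in> S \<inter> T}" .
  next
    fix \<K> :: "('v, 'k) toric_point set set" and \<sigma>
    assume \<K>: "\<forall>S\<in>\<K>. S \<subseteq> toric_variety \<Sigma> \<and>
        (\<forall>\<sigma>\<in>\<Sigma>. openin (chart_topology \<sigma>) {x \<in> chart \<sigma>. chart_map \<Sigma> \<sigma> x \<in> S})"
      and "\<sigma> \<in> \<Sigma>"
    then have "openin (chart_topology \<sigma>) (\<Union>S\<in>\<K>. {x \<in> chart \<sigma>. chart_map \<Sigma> \<sigma> x \<in> S})"
      by (intro openin_Union) auto
    also have "(\<Union>S\<in>\<K>. {x \<in> chart \<sigma>. chart_map \<Sigma> \<sigma> x \<in> S})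
        = {x \<in> chart \<sigma>. chart_map \<Sigma> \<sigma> x \<in> \<Union>\<K>}"
      by auto
    finally show "openin (chart_topology \<sigma>) {x \<in> chart \<sigma>. chart_map \<Sigma> \<sigma> x \<in> \<Union>\<K>}" .
  qed auto
  then show ?thesis
    by (simp add: toric_topology_def topology_inverse')
qed

lemma zero_mem_dual_monoid: "(\<lambda>_. 0) \<in> dual_monoid \<sigma>"
proof -
  have "Vector_Spaces.linear scale (*) (\<lambda>_. 0 :: rat)"
    by (intro Vector_Spaces.linear.intro module_hom.intro vector_space_axioms)
       (unfold_locales, simp_all add: algebra_simps)
  then show ?thesis
    by (auto simp: dual_monoid_def)
qed

lemma dual_monoid_antimono: "\<tau> \<subseteq> \<sigma> \<Longrightarrow> dual_monoid \<sigma> \<subseteq> dual_monoid \<tau>"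
  by (auto simp: dual_monoid_def)

lemma add_mem_dual_monoid:
  assumes "m \<in> dual_monoid \<sigma>" "m' \<in> dual_monoid \<sigma>"
  shows "(\<lambda>v. m v + m' v) \<in> dual_monoid \<sigma>"
proof -
  interpret vector_space_pair scale "(*) :: rat \<Rightarrow> rat \<Rightarrow> rat"
    by unfold_locales (simp_all add: algebra_simps)
  show ?thesis
    using assms by (auto simp: dual_monoid_def intro!: linear_compose_add Ints_add)
qed

lemma topspace_chart_topology:
  "topspace (chart_topology \<sigma> :: ('v, 'k::field) chart_point topology) = chart \<sigma>"
proof -
  have "(\<lambda>x :: ('v, 'k) chart_point. x (\<lambda>_. 0)) \<in> coordinate_ring \<sigma>"
    unfolding coordinate_ring_def using zero_mem_dual_monoid
    by (auto intro!: exI[of _ "{\<lambda>_. 0}"] exI[of _ "\<lambda>_. 1"])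
  moreover have "chart \<sigma> = {x \<in> chart \<sigma> :: ('v, 'k) chart_point set. x (\<lambda>_. 0) \<noteq> 0}"
    by (auto simp: chart_def)
  ultimately show ?thesis
    unfolding chart_topology_def topology_generated_by_topspace by blast
qed

lemma chart_map_mem:
  "\<sigma> \<in> \<Sigma> \<Longrightarrow> x \<in> chart \<sigma> \<Longrightarrow> chart_map \<Sigma> \<sigma> x \<in> toric_variety \<Sigma>"
  unfolding toric_variety_def chart_map_def by (intro quotientI) auto

lemma topspace_toric_topology:
  "topspace (toric_topology \<Sigma> :: ('v, 'k::field) toric_point topology) = toric_variety \<Sigma>"
proof -
  have "openin (toric_topology \<Sigma> :: ('v, 'k) toric_point topology) (toric_variety \<Sigma>)"
    unfolding openin_toric_topology
  proof (intro conjI ballI)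
    fix \<sigma> assume "\<sigma> \<in> \<Sigma>"
    then have "{x \<in> chart \<sigma>. chart_map \<Sigma> \<sigma> x \<in> (toric_variety \<Sigma> :: ('v, 'k) toric_point set)}
        = topspace (chart_topology \<sigma>)"
      by (auto simp: topspace_chart_topology chart_map_mem)
    then show "openin (chart_topology \<sigma>)
        {x \<in> chart \<sigma>. chart_map \<Sigma> \<sigma> x \<in> (toric_variety \<Sigma> :: ('v, 'k) toric_point set)}"
      by (metis openin_topspace)
  qed simp
  then show ?thesis
    by (meson openin_subset openin_toric_topology openin_topspace subset_antisym)
qed

lemma chart_act_mem:
  assumes "t \<in> chart {0}" "x \<in> chart \<sigma>" "0 \<in> \<sigma>"
  shows "chart_act t \<sigma> x \<in> chart \<sigma>"
proof -
  have "dual_monoid \<sigma> \<subseteq> dual_monoid {0}"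
    using assms(3) by (intro dual_monoid_antimono) auto
  then show ?thesis
    using assms(1,2) zero_mem_dual_monoid[of \<sigma>]
    by (auto simp: chart_def chart_act_def add_mem_dual_monoid subset_iff)
qed

lemma chart_act_gluing:
  assumes t: "t \<in> chart {0}" and "((\<sigma>, x), (\<tau>, y)) \<in> gluing \<Sigma>" and "0 \<in> \<sigma>" "0 \<in> \<tau>"
  shows "((\<sigma>, chart_act t \<sigma> x), (\<tau>, chart_act t \<tau> y)) \<in> gluing \<Sigma>"
proof -
  obtain z where z: "\<sigma> \<in> \<Sigma>" "\<tau> \<in> \<Sigma>" "z \<in> chart (\<sigma> \<inter> \<tau>)"
      "x = restrict z (dual_monoid \<sigma>)" "y = restrict z (dual_monoid \<tau>)"
    using assms(2) unfolding gluing_def by blast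
  let ?z = "chart_act t (\<sigma> \<inter> \<tau>) z"
  have "?z \<in> chart (\<sigma> \<inter> \<tau>)"
    using t z(3) assms(3,4) by (intro chart_act_mem) auto
  moreover have "chart_act t \<sigma> x = restrict ?z (dual_monoid \<sigma>)"
      "chart_act t \<tau> y = restrict ?z (dual_monoid \<tau>)"
    using z(4,5) dual_monoid_antimono[of "\<sigma> \<inter> \<tau>" \<sigma>] dual_monoid_antimono[of "\<sigma> \<inter> \<tau>" \<tau>]
    by (auto simp: chart_act_def restrict_def fun_eq_iff)
  ultimately show ?thesis
    using z(1,2) unfolding gluing_def by blast
qed

text \<open>The action on classes is well defined and is induced by the action on the charts.\<close>

lemma torus_act_chart_map:
  assumes t: "t \<in> chart {0}" and zero: "\<And>\<sigma>. \<sigma> \<in> \<Sigma> \<Longrightarrow> 0 \<in> \<sigma>"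
    and "\<sigma> \<in> \<Sigma>" and x: "x \<in> chart \<sigma>"
  shows "torus_act t (chart_map \<Sigma> \<sigma> x) = chart_map \<Sigma> \<sigma> (chart_act t \<sigma> x)"
proof -
  define s where "s = restrict (\<lambda>m. inverse (t m)) (dual_monoid {0})"
  have neg: "(\<lambda>v. - m v) \<in> dual_monoid {0}" if "m \<in> dual_monoid {0}" for m
  proof -
    interpret vector_space_pair scale "(*) :: rat \<Rightarrow> rat \<Rightarrow> rat"
      by unfold_locales (simp_all add: algebra_simps)
    interpret m: Vector_Spaces.linear scale "(*)" m
      using that by (simp add: dual_monoid_def)
    show ?thesis
      using that by (auto simp: dual_monoid_def m.zero intro!: linear_compose_neg)
  qed
  have nz: "t m \<noteq> 0" if "m \<in> dual_monoid {0}" for m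
  proof -
    have "t (\<lambda>v. m v + - m v) = t m * t (\<lambda>v. - m v)"
      using t that neg[OF that] by (simp only: chart_def mem_Collect_eq)
    then show ?thesis
      using t by (auto simp: chart_def)
  qed
  have s: "s \<in> chart {0}"
    using t by (auto simp: s_def chart_def zero_mem_dual_monoid add_mem_dual_monoid)
  have sub: "dual_monoid \<tau> \<subseteq> dual_monoid {0}" if "\<tau> \<in> \<Sigma>" for \<tau>
    using zero[OF that] by (intro dual_monoid_antimono) auto
  have inv: "chart_act t \<tau> (chart_act s \<tau> y) = y" "chart_act s \<tau> (chart_act t \<tau> y) = y"
    if "\<tau> \<in> \<Sigma>" "y \<in> extensional (dual_monoid \<tau>)" for \<tau> y
    using sub[OF that(1)] nz that(2)
    by (auto simp: chart_act_def s_def restrict_def fun_eq_iff extensional_def subset_iff)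
  have ext: "\<tau> \<in> \<Sigma> \<and> y \<in> extensional (dual_monoid \<tau>)"
    if "((\<rho>, w), (\<tau>, y)) \<in> gluing \<Sigma>" for \<rho> w \<tau> y
    using that by (auto simp: gluing_def)
  have xe: "x \<in> extensional (dual_monoid \<sigma>)"
    using x by (simp add: chart_def)
  show ?thesis
  proof (intro set_eqI iffI)
    fix p assume "p \<in> torus_act t (chart_map \<Sigma> \<sigma> x)"
    then show "p \<in> chart_map \<Sigma> \<sigma> (chart_act t \<sigma> x)"
      using chart_act_gluing[OF t] zero ext \<open>\<sigma> \<in> \<Sigma>\<close>
      by (fastforce simp: torus_act_def chart_map_def)
  next
    fix p assume p: "p \<in> chart_map \<Sigma> \<sigma> (chart_act t \<sigma> x)"
    obtain \<tau> y where [simp]: "p = (\<tau>, y)" by (cases p)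
    have g: "((\<sigma>, chart_act t \<sigma> x), (\<tau>, y)) \<in> gluing \<Sigma>"
      using p by (simp add: chart_map_def)
    have "((\<sigma>, x), (\<tau>, chart_act s \<tau> y)) \<in> gluing \<Sigma>"
      using chart_act_gluing[OF s g] ext[OF g] zero \<open>\<sigma> \<in> \<Sigma>\<close> inv(2)[OF \<open>\<sigma> \<in> \<Sigma>\<close> xe] by auto
    moreover have "(\<tau>, y) = (\<tau>, chart_act t \<tau> (chart_act s \<tau> y))"
      using inv(1) ext[OF g] by auto
    ultimately show "p \<in> torus_act t (chart_map \<Sigma> \<sigma> x)"
      unfolding torus_act_def chart_map_def by force
  qed
qed

lemma strongly_convex_zero: "strongly_convex \<sigma> \<Longrightarrow> 0 \<in> \<sigma>"
  by (auto simp: strongly_convex_def)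

lemma full_dimensional_span:
  assumes "full_dimensional \<sigma>"
  shows "span \<sigma> = UNIV"
proof -
  obtain B where B: "int_basis scale B N" "card B = n"
    using free_of_rank by blast
  have fin: "finite B" and N: "N = {\<Sum>b\<in>B. scale (of_int (c b)) b | c :: 'v \<Rightarrow> int. True}"
    using B(1) by (auto simp: int_basis_def)
  have "N \<subseteq> span B"
    unfolding N by (auto intro!: span_sum span_scale intro: span_base)
  then have spanB: "span B = UNIV"
    using span_lattice span_mono[of N "span B"] by (simp add: span_span top.extremum_unique)
  obtain C where C: "C \<subseteq> B" "independent C" "span C = UNIV"
    using maximal_independent_subset[of B] spanB span_mono span_span
    by (metis (no_types, lifting) UNIV_I subset_antisym subset_UNIV)
  interpret fd: finite_dimensional_vector_space scale C
    using C fin by unfold_locales (auto intro: finite_subset)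
  have "card C \<le> n"
    using C(1) fin B(2) by (metis card_mono)
  moreover have "dim \<sigma> = n"
    using assms by (simp add: full_dimensional_def)
  moreover have "dim (UNIV :: 'v set) = card C"
    by (simp add: fd.dim_UNIV)
  moreover have "dim \<sigma> \<le> dim (UNIV :: 'v set)"
    by (intro fd.dim_subset) simp
  ultimately show ?thesis
    using fd.dim_eq_full[of \<sigma>] fd.dimension_def by auto
qed

lemma distinguished_point_invariant:
  assumes "fan \<Sigma>" "\<sigma> \<in> \<Sigma>" "full_dimensional \<sigma>"
  shows "torus_invariant \<Sigma> (distinguished_point \<Sigma> \<sigma> :: ('v, 'k::field) toric_point)"
proof -
  let ?x = "restrict (\<lambda>m. if \<forall>v\<in>\<sigma>. m v = 0 then 1 else 0) (dual_monoid \<sigma>)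
    :: ('v, 'k) chart_point"
  have zero: "0 \<in> \<tau>" if "\<tau> \<in> \<Sigma>" for \<tau>
    using assms(1) that by (auto simp: fan_def intro: strongly_convex_zero)
  have x: "?x \<in> chart \<sigma>"
    unfolding chart_def
  proof (intro CollectI conjI ballI)
    fix m m' assume m: "m \<in> dual_monoid \<sigma>" and m': "m' \<in> dual_monoid \<sigma>"
    have "m v + m' v = 0 \<longleftrightarrow> m v = 0 \<and> m' v = 0" if "v \<in> \<sigma>" for v
      using m m' that by (auto simp: dual_monoid_def add_nonneg_eq_0_iff)
    then show "?x (\<lambda>v. m v + m' v) = ?x m * ?x m'"
      using m m' by (auto simp: add_mem_dual_monoid)
  qed (auto simp: zero_mem_dual_monoid)
  have m0: "m = (\<lambda>_. 0)" if "m \<in> dual_monoid \<sigma>" "\<forall>v\<in>\<sigma>. m v = 0" for m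
  proof -
    interpret m: Vector_Spaces.linear scale "(*)" m
      using that(1) by (simp add: dual_monoid_def)
    show ?thesis
      using m.eq_0_on_span[of \<sigma>] that(2) full_dimensional_span[OF assms(3)] by blast
  qed
  have "chart_act t \<sigma> ?x = ?x" if "t \<in> chart {0}" for t
  proof
    fix m
    consider "m \<notin> dual_monoid \<sigma>" | "m = (\<lambda>_. 0)" |
        "m \<in> dual_monoid \<sigma>" "\<not> (\<forall>v\<in>\<sigma>. m v = 0)"
      using m0 by blast
    then show "chart_act t \<sigma> ?x m = ?x m"
    proof cases
      case 3
      then show ?thesis
        by (simp add: chart_act_def del: ball_simps)
    qed (use that in \<open>simp_all add: chart_act_def chart_def zero_mem_dual_monoid\<close>)
  qed
  then show ?thesis
    using x zero assms(2) torus_act_chart_map[of _ \<Sigma> \<sigma> ?x]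
    by (auto simp: torus_invariant_def distinguished_point_def chart_map_mem)
qed

end

end

theory Submission
  imports Defs "HOL-Library.Function_Algebras"
begin

text \<open>
  If \<open>\<sigma>\<close> is smooth with generators \<open>b\<^sub>1, \<dots>, b\<^sub>n\<close> and every other ray lies in \<open>-\<sigma>\<close>, then minus each
  element of the basis dual to \<open>b\<^sub>1, \<dots>, b\<^sub>n\<close> is a Demazure root.  The corresponding root automorphism
  changes only the \<open>i\<close>-th coordinate on the chart of \<open>\<sigma>\<close>, which is an affine space, and translates
  it; composing the \<open>n\<close> translations moves the origin into the torus.

  Conversely, let \<open>\<phi>\<close> move the fixed point \<open>x\<close> of \<open>\<sigma>\<close> into the torus.  At a point of the torus
  the one-parameter subgroups span a tangent space of dimension \<open>n\<close>, and \<open>\<phi>\<close> transports them to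
  vector fields \<open>\<delta>\<close> on the variety.  Pairing with the indecomposable elements of the monoid
  \<open>\<sigma>\<^sup>\<or> \<inter> M\<close>, which are linearly independent in the cotangent space at \<open>x\<close>, shows that there are at most
  \<open>n\<close> of them, so \<open>\<sigma>\<close> is smooth; moreover for every coordinate \<open>x\<^sub>i\<close> on the chart some \<open>\<delta>\<close> has
  \<open>\<delta>(x\<^sub>i) \<noteq> 0\<close> at \<open>x\<close>.  If a ray generated by \<open>w\<close> outside \<open>\<sigma>\<close> had a positive \<open>i\<close>-th coordinate, then
  some other coordinate of \<open>w\<close> would be nonzero, and \<open>\<delta>\<close> would yield a regular function on a
  punctured plane (with coordinates a parameter transversal to the divisor of \<open>w\<close> and a parameter
  tending to \<open>x\<close>) that is a nonzero constant on one axis and vanishes on the other.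
\<close>

text \<open>A root automorphism is polynomial only on the charts of cones containing
  \<open>e\<close>. On any other chart it multiplies characters by powers of
  \<open>1 + s * y u\<close>, which breaks down where this factor vanishes. But there
  \<open>y u\<close> is nonzero, so the point comes from the face \<open>u = 0\<close>, and
  completeness puts that face into a cone containing \<open>e\<close>. In the converse, the function
  \<open>\<delta>(x_i)\<close> need not vanish along the divisor of \<open>w\<close>, although
  \<open>x_i\<close> does. Differentiating a character \<open>m\<close> with \<open>m w = 0\<close>
  repairs this: it is a unit on the chart of the ray, so its derivative is regular there, and a
  factor \<open>x_i\<close> then forces vanishing. The price is a term with the factor
  \<open>x_i / x_j\<close>, singular at the fixed point; it is tamed by approaching that point in a
  direction along which \<open>x_i\<close> decays faster than \<open>x_j\<close>. Algebraic
  closedness enters because it makes locally rational functions on the line polynomial.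
  Characteristic zero enters through the separation of characters by the torus, interpolation, and
  the fact that the integer \<open>d j w\<close> stays nonzero in the field.\<close>

context toric_lattice
begin

subsection \<open>Linear forms and the lattice\<close>

lemma linear_form_iff:
  "Vector_Spaces.linear scale (*) (m :: 'v \<Rightarrow> rat) \<longleftrightarrow>
     (\<forall>x y. m (x + y) = m x + m y) \<and> (\<forall>c x. m (scale c x) = c * m x)"
proof
  assume "Vector_Spaces.linear scale (*) m"
  then interpret Vector_Spaces.linear scale "(*)" m .
  show "(\<forall>x y. m (x + y) = m x + m y) \<and> (\<forall>c x. m (scale c x) = c * m x)"
    by (simp add: add scale)
next
  assume "(\<forall>x y. m (x + y) = m x + m y) \<and> (\<forall>c x. m (scale c x) = c * m x)"
  then show "Vector_Spaces.linear scale (*) m"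
    by (intro Vector_Spaces.linear.intro module_hom.intro vector_space_axioms
          vector_space.intro module_hom_axioms.intro module.intro)
       (auto simp: algebra_simps)
qed

abbreviation lin :: "('v \<Rightarrow> rat) \<Rightarrow> bool" where
  "lin \<equiv> Vector_Spaces.linear scale (*)"

lemma lin_add: "lin m \<Longrightarrow> m (x + y) = m x + m y"
  and lin_scale: "lin m \<Longrightarrow> m (scale c x) = c * m x"
  by (simp_all add: linear_form_iff)

lemma lin_zero: "lin m \<Longrightarrow> m 0 = 0"
  using lin_scale[of m 0 0] by simp

lemma lin_neg: "lin m \<Longrightarrow> m (- x) = - m x"
  using lin_scale[of m "-1" x] by simp

lemma lin_diff: "lin m \<Longrightarrow> m (x - y) = m x - m y"
  using lin_add[of m x "- y"] by (simp add: lin_neg)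

lemma lin_sum: "lin m \<Longrightarrow> m (\<Sum>i\<in>I. f i) = (\<Sum>i\<in>I. m (f i))"
  by (induction I rule: infinite_finite_induct) (simp_all add: lin_zero lin_add)

lemma lin_comb: "lin m \<Longrightarrow> m (\<Sum>v\<in>S. scale (c v) v) = (\<Sum>v\<in>S. c v * m v)"
  by (simp add: lin_sum lin_scale)

lemma lin_0 [intro]: "lin (\<lambda>_. 0)"
  and lin_plus [intro]: "lin m \<Longrightarrow> lin m' \<Longrightarrow> lin (\<lambda>v. m v + m' v)"
  and lin_mult [intro]: "lin m \<Longrightarrow> lin (\<lambda>v. a * m v)"
  and lin_uminus [intro]: "lin m \<Longrightarrow> lin (\<lambda>v. - m v)"
  by (simp_all add: linear_form_iff algebra_simps)

lemma lin_sum_forms [intro]: "(\<And>i. i \<in> I \<Longrightarrow> lin (f i)) \<Longrightarrow> lin (\<lambda>v. \<Sum>i\<in>I. f i v)"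
  by (induction I rule: infinite_finite_induct) auto

lemma lin_extend:
  assumes "independent B"
  shows "\<exists>m. lin m \<and> (\<forall>b\<in>B. m b = f b)"
proof -
  interpret vector_space_pair scale "(*) :: rat \<Rightarrow> rat \<Rightarrow> rat"
    by unfold_locales (simp_all add: algebra_simps)
  show ?thesis
    using linear_independent_extend[OF assms, of f] by auto
qed

text \<open>A maximal independent subset of \<open>A\<close> stays independent after adding
  \<open>v\<close>, so a form can be prescribed on both.\<close>

lemma separating_form:
  assumes "v \<notin> span A"
  shows "\<exists>m. lin m \<and> (\<forall>a\<in>A. m a = 0) \<and> m v = 1"
proof -
  obtain C where C: "C \<subseteq> A" "independent C" "A \<subseteq> span C"
    using maximal_independent_subset by metis
  have v: "v \<notin> span C"
    using assms C(1) span_mono by blast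
  then have "independent (insert v C)"
    using C(2) by (simp add: independent_insert)
  then obtain m where m: "lin m" "\<forall>b\<in>insert v C. m b = (if b = v then 1 else 0)"
    using lin_extend[of "insert v C" "\<lambda>b. if b = v then 1 else 0"] by blast
  interpret m: Vector_Spaces.linear scale "(*)" m by (fact m(1))
  have "v \<notin> C"
    using v span_base by blast
  then have "\<forall>b\<in>C. m b = 0"
    using m(2) by auto
  then have "\<forall>a\<in>A. m a = 0"
    using C(3) m.eq_0_on_span by blast
  then show ?thesis
    using m by auto
qed

lemma form_nonzero:
  assumes "v \<noteq> 0"
  shows "\<exists>m. lin m \<and> m v \<noteq> 0"
  using separating_form[of v "{}"] assms by auto

lemma form_eq_0_on_span: "lin m \<Longrightarrow> \<forall>a\<in>A. m a = 0 \<Longrightarrow> v \<in> span A \<Longrightarrow> m v = 0"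
proof -
  assume "lin m" and A: "\<forall>a\<in>A. m a = 0" "v \<in> span A"
  then interpret m: Vector_Spaces.linear scale "(*)" m by simp
  show ?thesis
    using m.eq_0_on_span A by blast
qed

lemma common_denominator:
  fixes q :: "'i \<Rightarrow> rat"
  assumes "finite I"
  shows "\<exists>k::nat. k > 0 \<and> (\<forall>i\<in>I. of_nat k * q i \<in> \<int>)"
  using assms
proof (induction I)
  case (insert i I)
  then obtain k :: nat where k: "k > 0" "\<forall>i\<in>I. of_nat k * q i \<in> \<int>"
    by blast
  obtain a b where ab: "q i = of_int a / of_int b" "b > 0"
    using quotient_of_div[of "q i"] quotient_of_denom_pos[of "q i"] by (cases "quotient_of (q i)") auto
  have "of_nat (nat b * k) * q i = of_int (a * int k)"
    using ab by (simp add: field_simps)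
  moreover have "of_nat (nat b * k) * q j \<in> \<int>" if "j \<in> I" for j
    using Ints_mult[OF Ints_of_nat[of "nat b"], of "of_nat k * q j"] k(2) that by (simp add: mult.assoc)
  ultimately show ?case
    using k(1) ab(2) by (intro exI[of _ "nat b * k"]) (auto intro: Ints_of_int simp del: of_nat_mult of_int_mult)
qed (auto intro: exI[of _ 1])

lemma int_basis_lattice_iff:
  "int_basis scale B N \<Longrightarrow> x \<in> N \<longleftrightarrow> (\<exists>c :: 'v \<Rightarrow> int. x = (\<Sum>b\<in>B. scale (of_int (c b)) b))"
  by (auto simp: int_basis_def)

lemma int_basis_coords:
  assumes "int_basis scale B N" "x \<in> N"
  obtains c :: "'v \<Rightarrow> int" where "x = (\<Sum>b\<in>B. scale (of_int (c b)) b)"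
  using assms by (auto simp: int_basis_def)

lemma int_basis_mem: "int_basis scale B N \<Longrightarrow> b \<in> B \<Longrightarrow> b \<in> N"
proof -
  assume B: "int_basis scale B N" and b: "b \<in> B"
  have "finite B"
    using B by (simp add: int_basis_def)
  then have "(\<Sum>c\<in>B. scale (of_int (if c = b then 1 else 0)) c) = b"
    using b by (subst sum.remove[of _ b]) (auto intro!: sum.neutral)
  then show ?thesis
    unfolding int_basis_lattice_iff[OF B] by (intro exI[of _ "\<lambda>c. if c = b then 1 else 0"]) (rule sym)
qed

text \<open>Clearing denominators turns a rational relation into an integral one.\<close>

lemma int_basis_independent:
  assumes B: "int_basis scale B N"
  shows "independent B"
proof -
  have fin: "finite B"
    using B by (simp add: int_basis_def)
  have "\<forall>b\<in>B. u b = 0" if u: "(\<Sum>b\<in>B. scale (u b) b) = 0" for u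
  proof -
    obtain k :: nat where k: "k > 0" "\<forall>b\<in>B. of_nat k * u b \<in> \<int>"
      using common_denominator[OF fin] by blast
    have "\<forall>b\<in>B. \<exists>c::int. of_nat k * u b = of_int c"
      using k(2) Ints_cases by metis
    then obtain c :: "'v \<Rightarrow> int" where c: "\<forall>b\<in>B. of_nat k * u b = of_int (c b)"
      by metis
    have "(\<Sum>b\<in>B. scale (of_int (c b)) b) = (\<Sum>b\<in>B. scale (of_nat k) (scale (u b) b))"
      using c by (intro sum.cong) auto
    also have "\<dots> = 0"
      using u by (simp add: scale_sum_right[symmetric] del: scale_scale)
    finally have "\<forall>b\<in>B. c b = 0"
      using B by (simp add: int_basis_def)
    then show ?thesis
      using c k(1) by auto
  qed
  then show ?thesis
    using dependent_finite[OF fin] by blast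
qed

lemma int_basis_span:
  assumes B: "int_basis scale B N"
  shows "span B = UNIV"
proof -
  have "N \<subseteq> span B"
    using B by (auto simp: int_basis_def intro!: span_sum span_scale intro: span_base)
  then show ?thesis
    using span_lattice span_mono[of N "span B"] by (simp add: span_span top.extremum_unique)
qed

lemma finite_dimensional:
  assumes B: "int_basis scale B N"
  shows "finite_dimensional_vector_space scale B"
  using int_basis_independent[OF B] int_basis_span[OF B] B
  by unfold_locales (auto simp: int_basis_def)

lemma dim_univ: "dim (UNIV :: 'v set) = n"
proof -
  obtain B where B: "int_basis scale B N" "card B = n"
    using free_of_rank by blast
  interpret fd: finite_dimensional_vector_space scale B
    by (rule finite_dimensional[OF B(1)])
  show ?thesis
    using B fd.dim_UNIV by simp
qed

lemma int_basis_card: "int_basis scale B N \<Longrightarrow> card B = n"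
proof -
  assume B: "int_basis scale B N"
  interpret fd: finite_dimensional_vector_space scale B
    by (rule finite_dimensional[OF B])
  show ?thesis
    using fd.dim_UNIV dim_univ by simp
qed

lemma lattice_closed:
  shows lattice_zero: "0 \<in> N"
    and lattice_add: "x \<in> N \<Longrightarrow> y \<in> N \<Longrightarrow> x + y \<in> N"
    and lattice_int: "x \<in> N \<Longrightarrow> scale (of_int k) x \<in> N"
proof -
  obtain B where B0: "int_basis scale B N"
    using free_of_rank by blast
  note B = int_basis_lattice_iff[OF B0]
  show "0 \<in> N"
    unfolding B by (rule exI[of _ "\<lambda>_. 0"]) simp
  show "x + y \<in> N" if xy: "x \<in> N" "y \<in> N"
  proof -
    obtain c where c: "x = (\<Sum>b\<in>B. scale (of_int (c b)) b)"
      using int_basis_coords[OF B0 xy(1)] by metis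
    obtain d where d: "y = (\<Sum>b\<in>B. scale (of_int (d b)) b)"
      using int_basis_coords[OF B0 xy(2)] by metis
    from c d have "x + y = (\<Sum>b\<in>B. scale (of_int (c b + d b)) b)"
      by (simp add: scale_left_distrib sum.distrib)
    then show ?thesis
      unfolding B by (rule exI[of _ "\<lambda>b. c b + d b"])
  qed
  show "scale (of_int k) x \<in> N" if xN: "x \<in> N"
  proof -
    obtain c where "x = (\<Sum>b\<in>B. scale (of_int (c b)) b)"
      using int_basis_coords[OF B0 xN] by metis
    then have "scale (of_int k) x = (\<Sum>b\<in>B. scale (of_int (k * c b)) b)"
      by (simp add: scale_sum_right)
    then show ?thesis
      unfolding B by (rule exI[of _ "\<lambda>b. k * c b"])
  qed
qed

lemma lattice_sum: "(\<And>i. i \<in> I \<Longrightarrow> f i \<in> N) \<Longrightarrow> (\<Sum>i\<in>I. f i) \<in> N"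
  by (induction I rule: infinite_finite_induct) (auto simp: lattice_zero lattice_add)

abbreviation dual_lattice :: "('v \<Rightarrow> rat) set" where
  "dual_lattice \<equiv> dual_monoid {0}"

lemma dual_lattice_iff: "m \<in> dual_lattice \<longleftrightarrow> lin m \<and> m ` N \<subseteq> \<int>"
  by (auto simp: dual_monoid_def lin_zero)

lemma dual_monoid_iff: "m \<in> dual_monoid \<sigma> \<longleftrightarrow> m \<in> dual_lattice \<and> (\<forall>v\<in>\<sigma>. 0 \<le> m v)"
  by (auto simp: dual_monoid_def lin_zero)

lemma dual_lattice_lin: "m \<in> dual_lattice \<Longrightarrow> lin m"
  by (simp add: dual_lattice_iff)

lemma dual_monoid_lin: "m \<in> dual_monoid \<sigma> \<Longrightarrow> lin m"
  by (simp add: dual_monoid_def)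

lemma dual_monoid_dual_lattice: "m \<in> dual_monoid \<sigma> \<Longrightarrow> m \<in> dual_lattice"
  using dual_monoid_iff by blast

lemma dual_lattice_floor: "m \<in> dual_lattice \<Longrightarrow> v \<in> N \<Longrightarrow> of_int \<lfloor>m v\<rfloor> = m v"
  by (auto simp: dual_lattice_iff image_subset_iff elim: Ints_cases)

lemma dual_lattice_add: "m \<in> dual_lattice \<Longrightarrow> m' \<in> dual_lattice \<Longrightarrow> (\<lambda>v. m v + m' v) \<in> dual_lattice"
  by (rule add_mem_dual_monoid)

lemma dual_lattice_int: "m \<in> dual_lattice \<Longrightarrow> (\<lambda>v. of_int k * m v) \<in> dual_lattice"
  by (auto simp: dual_lattice_iff)

lemma dual_lattice_uminus: "m \<in> dual_lattice \<Longrightarrow> (\<lambda>v. - m v) \<in> dual_lattice"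
  by (auto simp: dual_lattice_iff)

lemma dual_monoid_nat: "m \<in> dual_monoid \<sigma> \<Longrightarrow> (\<lambda>v. of_nat k * m v) \<in> dual_monoid \<sigma>"
  using dual_lattice_int[of m "int k"] by (auto simp: dual_monoid_iff[of _ \<sigma>])

lemma dual_monoid_sum:
  "(\<And>i. i \<in> I \<Longrightarrow> f i \<in> dual_monoid \<sigma>) \<Longrightarrow> (\<lambda>v. \<Sum>i\<in>I. f i v) \<in> dual_monoid \<sigma>"
  by (induction I rule: infinite_finite_induct)
     (simp_all add: zero_mem_dual_monoid add_mem_dual_monoid)

lemma integral_multiple:
  assumes "lin m"
  shows "\<exists>k::nat. k > 0 \<and> (\<lambda>v. of_nat k * m v) \<in> dual_lattice"
proof -
  obtain B where B: "int_basis scale B N"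
    using free_of_rank by blast
  then have fin: "finite B"
    by (simp add: int_basis_def)
  obtain k :: nat where k: "k > 0" "\<forall>b\<in>B. of_nat k * m b \<in> \<int>"
    using common_denominator[OF fin] by blast
  have "of_nat k * m v \<in> \<int>" if xN: "v \<in> N" for v
  proof -
    obtain c where "v = (\<Sum>b\<in>B. scale (of_int (c b)) b)"
      using int_basis_coords[OF B xN] by metis
    then have "of_nat k * m v = (\<Sum>b\<in>B. of_int (c b) * (of_nat k * m b))"
      by (simp add: lin_comb[OF assms] sum_distrib_left algebra_simps)
    also have "\<dots> \<in> \<int>"
      using k(2) by (intro Ints_sum Ints_mult[OF Ints_of_int]) auto
    finally show ?thesis .
  qed
  then show ?thesis
    using k(1) assms by (auto simp: dual_lattice_iff)
qed

lemma dual_basis: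
  assumes B: "int_basis scale B N"
  shows "\<exists>d. \<forall>b\<in>B. d b \<in> dual_lattice \<and> (\<forall>b'\<in>B. d b b' = (if b' = b then 1 else 0))"
proof -
  have fin: "finite B"
    using B by (auto simp: int_basis_def)
  have "\<exists>m\<in>dual_lattice. \<forall>b'\<in>B. m b' = (if b' = b then 1 else 0)" if "b \<in> B" for b
  proof -
    obtain m where m: "lin m" "\<forall>b'\<in>B. m b' = (if b' = b then 1 else 0)"
      using lin_extend[OF int_basis_independent[OF B], of "\<lambda>b'. if b' = b then 1 else 0"] by metis
    have "m v \<in> \<int>" if xN: "v \<in> N" for v
    proof -
      obtain c where "v = (\<Sum>b\<in>B. scale (of_int (c b)) b)"
        using int_basis_coords[OF B xN] by metis
      then have "m v = (\<Sum>b\<in>B. of_int (c b) * m b)"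
        by (simp add: lin_comb[OF m(1)])
      then show ?thesis
        using m(2) by (auto intro!: Ints_sum Ints_mult)
    qed
    then show ?thesis
      using m by (intro bexI[of _ m]) (auto simp: dual_lattice_iff)
  qed
  then show ?thesis by metis
qed

lemma dual_basis_expand:
  assumes B: "int_basis scale B N"
    and d: "\<forall>b\<in>B. d b \<in> dual_lattice \<and> (\<forall>b'\<in>B. d b b' = (if b' = b then 1 else 0))"
  shows "v = (\<Sum>b\<in>B. scale (d b v) b)"
proof -
  have fin: "finite B"
    using B by (simp add: int_basis_def)
  have "v \<in> span B"
    using int_basis_span[OF B] by simp
  then obtain u where u: "v = (\<Sum>b\<in>B. scale (u b) b)"
    using span_finite[OF fin] by auto
  have "d b v = u b" if "b \<in> B" for b
  proof -
    have "d b v = (\<Sum>b'\<in>B. u b' * d b b')"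
      using d that by (simp add: u lin_comb dual_lattice_lin)
    also have "\<dots> = (\<Sum>b'\<in>B. if b' = b then u b' else 0)"
      using d that by (intro sum.cong) auto
    finally show ?thesis
      using fin that by simp
  qed
  then show ?thesis
    using u by simp
qed

lemma lin_eq_on_basis:
  assumes B: "int_basis scale B N" and "lin m" "lin m'" "\<And>b. b \<in> B \<Longrightarrow> m b = m' b"
  shows "m = m'"
proof
  fix v
  have "v \<in> span B"
    using int_basis_span[OF B] by simp
  moreover have "lin (\<lambda>v. m v + - m' v)"
    using assms(2,3) by (intro lin_plus lin_uminus)
  ultimately show "m v = m' v"
    using form_eq_0_on_span[of "\<lambda>v. m v + - m' v" B v] assms(4) by auto
qed

text \<open>Double duality of the lattice: the coordinates of \<open>v\<close> in a lattice basis
  are its values under the dual basis, hence integers.\<close>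

lemma lattice_of_integral:
  assumes "\<And>m. m \<in> dual_lattice \<Longrightarrow> m v \<in> \<int>"
  shows "v \<in> N"
proof -
  obtain B where B: "int_basis scale B N"
    using free_of_rank by blast
  obtain d where d: "\<forall>b\<in>B. d b \<in> dual_lattice \<and> (\<forall>b'\<in>B. d b b' = (if b' = b then 1 else 0))"
    using dual_basis[OF B] by blast
  have "scale (d b v) b \<in> N" if b: "b \<in> B" for b
  proof -
    obtain k where "d b v = of_int k"
      using assms[of "d b"] d b Ints_cases by metis
    then show ?thesis
      using lattice_int int_basis_mem[OF B b] by simp
  qed
  then show ?thesis
    using dual_basis_expand[OF B d, of v] lattice_sum[of B "\<lambda>b. scale (d b v) b"] by simp
qed

lemma dual_lattice_separates:
  assumes "m \<in> dual_lattice" "m' \<in> dual_lattice" "m \<noteq> m'"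
  shows "\<exists>v\<in>N. m v \<noteq> m' v"
proof -
  obtain B where B: "int_basis scale B N"
    using free_of_rank by blast
  then show ?thesis
    using lin_eq_on_basis[OF B dual_lattice_lin dual_lattice_lin] assms int_basis_mem by blast
qed

subsection \<open>Rational cones\<close>

definition cone_hull :: "'v set \<Rightarrow> 'v set" where
  "cone_hull S = {\<Sum>v\<in>S. scale (c v) v | c. \<forall>v\<in>S. 0 \<le> c v}"

lemma rational_cone_iff: "rational_cone \<sigma> \<longleftrightarrow> (\<exists>S. finite S \<and> S \<subseteq> N \<and> \<sigma> = cone_hull S)"
  by (simp add: rational_cone_def cone_hull_def)

lemma cone_hullI: "(\<And>v. v \<in> S \<Longrightarrow> 0 \<le> c v) \<Longrightarrow> x = (\<Sum>v\<in>S. scale (c v) v) \<Longrightarrow> x \<in> cone_hull S"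
  by (auto simp: cone_hull_def)

lemma cone_hullE:
  assumes "x \<in> cone_hull S"
  obtains c where "\<And>v. v \<in> S \<Longrightarrow> 0 \<le> c v" "x = (\<Sum>v\<in>S. scale (c v) v)"
  using assms by (auto simp: cone_hull_def)

lemma cone_hull_zero: "0 \<in> cone_hull S"
  by (rule cone_hullI[of _ "\<lambda>_. 0"]) auto

lemma cone_hull_add: "x \<in> cone_hull S \<Longrightarrow> y \<in> cone_hull S \<Longrightarrow> x + y \<in> cone_hull S"
proof (elim cone_hullE)
  fix c d
  assume "\<And>v. v \<in> S \<Longrightarrow> 0 \<le> c v" "\<And>v. v \<in> S \<Longrightarrow> 0 \<le> d v"
    "x = (\<Sum>v\<in>S. scale (c v) v)" "y = (\<Sum>v\<in>S. scale (d v) v)"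
  then show ?thesis
    by (intro cone_hullI[of _ "\<lambda>v. c v + d v"]) (auto simp: scale_left_distrib sum.distrib)
qed

lemma cone_hull_scale: "x \<in> cone_hull S \<Longrightarrow> 0 \<le> a \<Longrightarrow> scale a x \<in> cone_hull S"
proof (elim cone_hullE)
  fix c
  assume "0 \<le> a" "\<And>v. v \<in> S \<Longrightarrow> 0 \<le> c v" "x = (\<Sum>v\<in>S. scale (c v) v)"
  then show ?thesis
    by (intro cone_hullI[of _ "\<lambda>v. a * c v"]) (auto simp: scale_sum_right)
qed

lemma cone_hull_sum: "(\<And>i. i \<in> I \<Longrightarrow> f i \<in> cone_hull S) \<Longrightarrow> (\<Sum>i\<in>I. f i) \<in> cone_hull S"
  by (induction I rule: infinite_finite_induct) (auto simp: cone_hull_zero cone_hull_add)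

lemma cone_hull_gen: "finite S \<Longrightarrow> s \<in> S \<Longrightarrow> s \<in> cone_hull S"
  by (rule cone_hullI[of _ "\<lambda>v. if v = s then 1 else 0"])
     (auto simp: if_distrib[of "\<lambda>a. scale a _"] sum.delta cong: if_cong)

lemma cone_hull_least: "S \<subseteq> cone_hull T \<Longrightarrow> cone_hull S \<subseteq> cone_hull T"
  by (auto elim!: cone_hullE intro!: cone_hull_sum cone_hull_scale)

lemma cone_hull_single: "cone_hull {s} = {scale c s | c. 0 \<le> c}"
  by (auto simp: cone_hull_def)

lemma rational_cone_zero: "rational_cone \<sigma> \<Longrightarrow> 0 \<in> \<sigma>"
  and rational_cone_add: "rational_cone \<sigma> \<Longrightarrow> x \<in> \<sigma> \<Longrightarrow> y \<in> \<sigma> \<Longrightarrow> x + y \<in> \<sigma>"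
  and rational_cone_scale: "rational_cone \<sigma> \<Longrightarrow> x \<in> \<sigma> \<Longrightarrow> 0 \<le> a \<Longrightarrow> scale a x \<in> \<sigma>"
  by (auto simp: rational_cone_iff cone_hull_zero cone_hull_add cone_hull_scale)

lemma cone_hull_nonneg:
  assumes "lin m" "\<And>s. s \<in> S \<Longrightarrow> 0 \<le> m s" "v \<in> cone_hull S"
  shows "0 \<le> m v"
  using assms(3)
proof (rule cone_hullE)
  fix c assume c: "\<And>v. v \<in> S \<Longrightarrow> 0 \<le> c v" "v = (\<Sum>v\<in>S. scale (c v) v)"
  show ?thesis
    unfolding c(2) lin_comb[OF assms(1)] using c(1) assms(2) by (intro sum_nonneg) auto
qed

lemma cone_hull_face:
  assumes "finite S" "lin m" "\<And>s. s \<in> S \<Longrightarrow> 0 \<le> m s"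
  shows "{v \<in> cone_hull S. m v = 0} = cone_hull {s \<in> S. m s = 0}"
proof (intro subset_antisym subsetI)
  fix v assume v: "v \<in> {v \<in> cone_hull S. m v = 0}"
  then obtain c where c: "\<And>v. v \<in> S \<Longrightarrow> 0 \<le> c v" "v = (\<Sum>v\<in>S. scale (c v) v)"
    by (auto elim: cone_hullE)
  have "(\<Sum>s\<in>S. c s * m s) = 0"
    using v by (simp add: c(2) lin_comb[OF assms(2)])
  then have "\<forall>s\<in>S. c s * m s = 0"
    using sum_nonneg_eq_0_iff[OF assms(1), of "\<lambda>s. c s * m s"] c(1) assms(3) by auto
  then have "v = (\<Sum>s\<in>{s \<in> S. m s = 0}. scale (c s) s)"
    unfolding c(2) using assms(1) by (intro sum.mono_neutral_right) auto
  then show "v \<in> cone_hull {s \<in> S. m s = 0}"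
    using c(1) by (intro cone_hullI[of _ c]) auto
next
  fix v assume v: "v \<in> cone_hull {s \<in> S. m s = 0}"
  then have "v \<in> cone_hull S"
    using cone_hull_least[of "{s \<in> S. m s = 0}" S] cone_hull_gen[OF assms(1)] by blast
  moreover have "m v = 0"
    using v by (auto elim!: cone_hullE simp: lin_comb[OF assms(2)])
  ultimately show "v \<in> {v \<in> cone_hull S. m v = 0}" by simp
qed

text \<open>Bartl's induction: a form \<open>p\<close> separating \<open>v\<close> from the other generators must be negative on
  the new one, along which everything can then be projected to the kernel of \<open>p\<close>.\<close>

lemma farkas_family:
  fixes f :: "'i \<Rightarrow> 'v"
  assumes "finite I"
    and "\<And>m. lin m \<Longrightarrow> \<forall>i\<in>I. 0 \<le> m (f i) \<Longrightarrow> 0 \<le> m v"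
  shows "\<exists>c. (\<forall>i\<in>I. 0 \<le> c i) \<and> v = (\<Sum>i\<in>I. scale (c i) (f i))"
  using assms
proof (induction I arbitrary: f v)
  case empty
  have "m v = 0" if "lin m" for m
    using empty.prems[OF that] empty.prems[OF lin_uminus[OF that]] by simp
  then show ?case
    using form_nonzero[of v] by auto
next
  case (insert k I)
  show ?case
  proof (cases "\<forall>m. lin m \<longrightarrow> (\<forall>i\<in>I. 0 \<le> m (f i)) \<longrightarrow> 0 \<le> m v")
    case True
    then obtain c where c: "\<forall>i\<in>I. 0 \<le> c i" "v = (\<Sum>i\<in>I. scale (c i) (f i))"
      using insert.IH[of f v] by blast
    have "v = (\<Sum>i\<in>insert k I. scale ((c(k := 0)) i) (f i))"
      using insert.hyps c(2) by (simp add: sum.insert) (intro sum.cong, auto)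
    then show ?thesis
      using c(1) by (intro exI[of _ "c(k := 0)"]) auto
  next
    case False
    then obtain q where q: "lin q" "\<forall>i\<in>I. 0 \<le> q (f i)" "q v < 0"
      by force
    have qk: "q (f k) < 0"
      using insert.prems[OF q(1)] q(2,3) by force
    define p where "p = (\<lambda>x. (- 1 / q (f k)) * q x)"
    have p: "lin p" "\<forall>i\<in>I. 0 \<le> p (f i)" "p v < 0" "p (f k) = -1"
      using q qk lin_mult[OF q(1), of "- 1 / q (f k)"]
      by (auto simp: p_def divide_nonneg_neg divide_neg_neg)
    define f' where "f' = (\<lambda>i. f i + scale (p (f i)) (f k))"
    define v' where "v' = v + scale (p v) (f k)"
    have "0 \<le> m v'" if m: "lin m" "\<forall>i\<in>I. 0 \<le> m (f' i)" for m
    proof -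
      let ?y = "\<lambda>x. m x + m (f k) * p x"
      have "lin ?y"
        using m(1) p(1) by (intro lin_plus lin_mult)
      moreover have "0 \<le> ?y (f i)" if "i \<in> insert k I" for i
      proof (cases "i = k")
        case False
        then show ?thesis
          using m(2) that by (auto simp: f'_def lin_add[OF m(1)] lin_scale[OF m(1)] mult.commute)
      qed (simp add: p(4))
      ultimately have "0 \<le> ?y v"
        using insert.prems by blast
      then show ?thesis
        by (simp add: v'_def lin_add[OF m(1)] lin_scale[OF m(1)] mult.commute)
    qed
    then obtain c where c: "\<forall>i\<in>I. 0 \<le> c i" "v' = (\<Sum>i\<in>I. scale (c i) (f' i))"
      using insert.IH[of f' v'] by blast
    define a where "a = (\<Sum>i\<in>I. c i * p (f i)) - p v"
    have a: "0 \<le> a"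
      using c(1) p(2,3) sum_nonneg[of I "\<lambda>i. c i * p (f i)"] by (simp add: a_def)
    have "v = v' - scale (p v) (f k)"
      by (simp add: v'_def)
    also have "v' = (\<Sum>i\<in>I. scale (c i) (f i)) + scale (\<Sum>i\<in>I. c i * p (f i)) (f k)"
      by (simp add: c(2) f'_def scale_right_distrib sum.distrib scale_sum_left)
    finally have "v = (\<Sum>i\<in>I. scale (c i) (f i)) + scale a (f k)"
      by (simp add: a_def scale_left_diff_distrib add_diff_eq)
    also have "\<dots> = (\<Sum>i\<in>insert k I. scale ((c(k := a)) i) (f i))"
      using insert.hyps by (simp add: sum.insert add.commute) (intro sum.cong, auto)
    finally show ?thesis
      using c(1) a by (intro exI[of _ "c(k := a)"]) auto
  qed
qed

lemma farkas:
  assumes "finite S" "\<And>m. lin m \<Longrightarrow> \<forall>s\<in>S. 0 \<le> m s \<Longrightarrow> 0 \<le> m v"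
  shows "v \<in> cone_hull S"
  using farkas_family[OF assms(1), of "\<lambda>s. s" v] assms(2) by (auto simp: cone_hull_def)

lemma dual_monoid_cone_hull:
  assumes "finite S"
  shows "m \<in> dual_monoid (cone_hull S) \<longleftrightarrow> m \<in> dual_lattice \<and> (\<forall>s\<in>S. 0 \<le> m s)"
  using cone_hull_gen[OF assms] cone_hull_nonneg[OF dual_lattice_lin, of m S]
  unfolding dual_monoid_iff[of _ "cone_hull S"] by blast

text \<open>Biduality of cones. Farkas' lemma tests against all rational forms, and each of them has
  a positive multiple in the dual lattice.\<close>

lemma mem_cone_if_dual_nonneg:
  assumes "rational_cone \<sigma>" "\<And>m. m \<in> dual_monoid \<sigma> \<Longrightarrow> 0 \<le> m v"
  shows "v \<in> \<sigma>"
proof -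
  obtain S where S: "finite S" "\<sigma> = cone_hull S"
    using assms(1) by (auto simp: rational_cone_iff)
  have "0 \<le> m v" if m: "lin m" "\<forall>s\<in>S. 0 \<le> m s" for m
  proof -
    obtain k :: nat where k: "k > 0" "(\<lambda>v. of_nat k * m v) \<in> dual_lattice"
      using integral_multiple[OF m(1)] by blast
    then have "(\<lambda>v. of_nat k * m v) \<in> dual_monoid \<sigma>"
      using m(2) by (auto simp: S(2) dual_monoid_cone_hull[OF S(1)])
    then show ?thesis
      using assms(2) k(1) by (fastforce simp: zero_le_mult_iff)
  qed
  then show ?thesis
    using farkas[OF S(1)] S(2) by blast
qed

lemma face_by_dual_monoid:
  assumes "face_of \<tau> \<sigma>"
  shows "\<exists>u\<in>dual_monoid \<sigma>. \<tau> = {v \<in> \<sigma>. u v = 0}"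
proof -
  obtain m where m: "lin m" "\<forall>v\<in>\<sigma>. 0 \<le> m v" "\<tau> = {v \<in> \<sigma>. m v = 0}"
    using assms by (auto simp: face_of_def)
  obtain k :: nat where k: "k > 0" "(\<lambda>v. of_nat k * m v) \<in> dual_lattice"
    using integral_multiple[OF m(1)] by blast
  then show ?thesis
    using m by (intro bexI[of _ "\<lambda>v. of_nat k * m v"]) (auto simp: dual_monoid_iff[of _ \<sigma>])
qed

lemma face_ofI: "u \<in> dual_monoid \<sigma> \<Longrightarrow> \<tau> = {v \<in> \<sigma>. u v = 0} \<Longrightarrow> face_of \<tau> \<sigma>"
  by (auto simp: face_of_def dual_monoid_def)

lemma strongly_convexD:
  assumes "strongly_convex \<sigma>" "v \<in> \<sigma>" "- v \<in> \<sigma>"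
  shows "v = 0"
proof -
  have "v \<in> uminus ` \<sigma>"
    using imageI[OF assms(3), of uminus] by simp
  then show ?thesis
    using assms by (auto simp: strongly_convex_def)
qed

lemma minimal_generators:
  assumes "finite S"
  shows "\<exists>S'\<subseteq>S. cone_hull S' = cone_hull S \<and> (\<forall>s\<in>S'. s \<notin> cone_hull (S' - {s}))"
  using assms
proof (induction S rule: finite_psubset_induct)
  case (psubset S)
  show ?case
  proof (cases "\<exists>s\<in>S. s \<in> cone_hull (S - {s})")
    case True
    then obtain s where s: "s \<in> S" "s \<in> cone_hull (S - {s})" by blast
    have "S \<subseteq> cone_hull (S - {s})"
      using s(2) cone_hull_gen[of "S - {s}"] psubset.hyps by (cases) auto
    moreover have "S - {s} \<subseteq> cone_hull S"
      using cone_hull_gen[OF psubset.hyps] by auto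
    ultimately have "cone_hull (S - {s}) = cone_hull S"
      using cone_hull_least by blast
    then show ?thesis
      using psubset.IH[of "S - {s}"] s(1) by blast
  next
    case False
    then show ?thesis by blast
  qed
qed

text \<open>If no such form exists, every form that is nonnegative on \<open>S\<close> and on
  \<open>- s\<close> is nonpositive at \<open>t\<close>, so by Farkas \<open>- t\<close> lies in the
  cone over \<open>S\<close> and \<open>- s\<close>. Solving for \<open>s\<close> gives
  \<open>scale a s = t + ?w\<close>. A positive \<open>a\<close> contradicts the minimality of
  \<open>S\<close>, any other \<open>a\<close> contradicts strong convexity.\<close>

lemma extremal_form:
  assumes S: "finite S" "\<And>s. s \<in> S \<Longrightarrow> s \<notin> cone_hull (S - {s})"
    and convex: "strongly_convex (cone_hull S)" and s: "s \<in> S" and t: "t \<in> S" "t \<noteq> s"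
  shows "\<exists>m. lin m \<and> (\<forall>r\<in>S. 0 \<le> m r) \<and> m s = 0 \<and> 0 < m t"
proof (rule ccontr)
  assume no: "\<not> ?thesis"
  \<comment> \<open>Ensures that in the sum over \<open>insert (- s) S\<close> the coefficient of
    \<open>- s\<close> is separate from those of \<open>S\<close>.\<close>
  have notmem: "- s \<notin> S"
    using strongly_convexD[OF convex] cone_hull_gen[OF S(1)] s S(2)[OF s] cone_hull_zero by fastforce
  have "0 \<le> m (- t)" if m: "lin m" "\<forall>r\<in>insert (- s) S. 0 \<le> m r" for m
    using no m s by (auto simp: lin_neg[OF m(1)] not_less intro: antisym)
  then have "- t \<in> cone_hull (insert (- s) S)"
    using farkas[of "insert (- s) S" "- t"] S(1) by blast
  then obtain c where c: "\<And>r. r \<in> insert (- s) S \<Longrightarrow> 0 \<le> c r"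
      "- t = (\<Sum>r\<in>insert (- s) S. scale (c r) r)"
    by (rule cone_hullE) (rule that)
  define a where "a = c (- s) - c s"
  have "- t = scale (c s) s - scale (c (- s)) s + (\<Sum>r\<in>S - {s}. scale (c r) r)"
    using c(2) notmem S(1) s by (simp add: sum.remove[of S s] algebra_simps)
  then have eq: "scale a s = t + (\<Sum>r\<in>S - {s}. scale (c r) r)" (is "_ = t + ?w")
    by (simp add: a_def scale_left_diff_distrib algebra_simps)
  have w: "?w \<in> cone_hull (S - {s})"
    using c(1) by (intro cone_hullI[of _ c]) auto
  have tm: "t \<in> cone_hull (S - {s})"
    using t S(1) by (intro cone_hull_gen) auto
  have sub: "cone_hull (S - {s}) \<subseteq> cone_hull S"
    using cone_hull_gen[OF S(1)] by (intro cone_hull_least) auto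
  show False
  proof (cases "0 < a")
    case True
    then have "s = scale (1 / a) (t + ?w)"
      by (simp flip: eq)
    also have "\<dots> \<in> cone_hull (S - {s})"
      using True w tm by (intro cone_hull_scale cone_hull_add) auto
    finally show False
      using S(2)[OF s] by blast
  next
    case False
    have "- t = ?w + scale (- a) s"
      using eq by (simp add: algebra_simps)
    also have "\<dots> \<in> cone_hull S"
      using w sub False cone_hull_gen[OF S(1) s] by (intro cone_hull_add cone_hull_scale) auto
    finally have "t = 0"
      using strongly_convexD[OF convex] cone_hull_gen[OF S(1) t(1)] by blast
    then show False
      using S(2)[OF t(1)] cone_hull_zero by simp
  qed
qed

lemma dim_ray: "s \<noteq> 0 \<Longrightarrow> dim (cone_hull {s}) = 1"
proof -
  assume s: "s \<noteq> 0"
  have "span (cone_hull {s}) = span {s}"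
  proof (intro subset_antisym span_minimal subsetI)
    show "x \<in> span {s}" if "x \<in> cone_hull {s}" for x
      using that by (auto simp: cone_hull_single intro: span_scale span_base)
    show "x \<in> span (cone_hull {s})" if "x \<in> {s}" for x
      using that cone_hull_gen[of "{s}" s] by (auto intro: span_base)
  qed auto
  moreover have "independent {s}"
    using s by simp
  ultimately show ?thesis
    using dim_eq_card[of "{s}" "cone_hull {s}"] by simp
qed

text \<open>Every member \<open>s\<close> of a minimal generating set spans a ray: the extremal
  forms belonging to the other generators add up to a form that vanishes at \<open>s\<close> and is
  positive at all the others.\<close>

lemma cone_generated_by_rays:
  assumes "rational_cone \<sigma>" "strongly_convex \<sigma>"
  obtains S where "finite S" "S \<subseteq> N" "\<sigma> = cone_hull S"
    "\<And>s. s \<in> S \<Longrightarrow> s \<noteq> 0 \<and> cone_hull {s} \<in> cone_rays \<sigma>"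
proof -
  obtain S0 where S0: "finite S0" "S0 \<subseteq> N" "\<sigma> = cone_hull S0"
    using assms(1) by (auto simp: rational_cone_iff)
  obtain S where S: "S \<subseteq> S0" "cone_hull S = cone_hull S0"
      "\<And>s. s \<in> S \<Longrightarrow> s \<notin> cone_hull (S - {s})"
    using minimal_generators[OF S0(1)] by blast
  have fin: "finite S"
    using S(1) S0(1) finite_subset by blast
  have "s \<noteq> 0 \<and> cone_hull {s} \<in> cone_rays \<sigma>" if s: "s \<in> S" for s
  proof -
    have s0: "s \<noteq> 0"
      using S(3)[OF s] cone_hull_zero by metis
    have "\<forall>t\<in>S - {s}. \<exists>m. lin m \<and> (\<forall>r\<in>S. 0 \<le> m r) \<and> m s = 0 \<and> 0 < m t"
      using extremal_form[OF fin S(3) _ s] assms(2) S0(3) S(2) by auto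
    then obtain m where m: "\<And>t. t \<in> S - {s} \<Longrightarrow> lin (m t)"
        "\<And>t r. t \<in> S - {s} \<Longrightarrow> r \<in> S \<Longrightarrow> 0 \<le> m t r"
        "\<And>t. t \<in> S - {s} \<Longrightarrow> m t s = 0" "\<And>t. t \<in> S - {s} \<Longrightarrow> 0 < m t t"
      by metis
    define p where "p = (\<lambda>v. \<Sum>t\<in>S - {s}. m t v)"
    have p: "lin p"
      unfolding p_def using m(1) by blast
    have nonneg: "0 \<le> p r" if "r \<in> S" for r
      unfolding p_def using m(2) that by (intro sum_nonneg) auto
    have pos: "0 < p t" if "t \<in> S - {s}" for t
      unfolding p_def using m(2,4) that fin by (intro sum_pos2[of _ t]) auto
    have "{r \<in> S. p r = 0} = {s}"
    proof (intro subset_antisym subsetI)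
      show "r \<in> {s}" if "r \<in> {r \<in> S. p r = 0}" for r
        using pos[of r] that by (cases "r = s") auto
      show "r \<in> {r \<in> S. p r = 0}" if "r \<in> {s}" for r
        using s that m(3) by (simp add: p_def)
    qed
    then have "{v \<in> \<sigma>. p v = 0} = cone_hull {s}"
      using cone_hull_face[OF fin p nonneg] S(2) S0(3) by simp
    then have "face_of (cone_hull {s}) \<sigma>"
      unfolding face_of_def using p nonneg cone_hull_nonneg[OF p, of S] S(2) S0(3) by metis
    then show ?thesis
      using s0 dim_ray by (auto simp: cone_rays_def)
  qed
  then show thesis
    using that[of S] fin S S0 by auto
qed

lemma dim_one_subset_span:
  assumes "dim \<rho> = 1" "s \<in> \<rho>" "s \<noteq> 0"
  shows "\<rho> \<subseteq> span {s}"
proof -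
  obtain B where B: "int_basis scale B N"
    using free_of_rank by blast
  interpret fd: finite_dimensional_vector_space scale B
    by (rule finite_dimensional[OF B])
  show ?thesis
    using fd.card_ge_dim_independent[of "{s}" \<rho>] assms by simp
qed

text \<open>Among the lattice points of which \<open>s\<close> is a positive integral multiple, one
  is chosen of least height under an integral form positive at \<open>s\<close>. A proper divisor of
  it would be lower still.\<close>

lemma primitive_multiple:
  assumes "s \<in> N" "s \<noteq> 0"
  shows "\<exists>w k. primitive w \<and> 0 < (k::nat) \<and> s = scale (of_nat k) w"
proof -
  obtain m where m: "m \<in> dual_lattice" "0 < m s"
  proof -
    obtain m where m: "m \<in> dual_lattice" "m s \<noteq> 0"
      using lattice_of_integral
      by (metis assms(2) form_nonzero integral_multiple mult_eq_0_iff of_nat_0_eq_iff less_irrefl)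
    then show thesis
      using that[of m] that[of "\<lambda>v. - m v"] dual_lattice_uminus by (cases "0 < m s") auto
  qed
  define P where "P = (\<lambda>w. w \<in> N \<and> (\<exists>k::nat. 0 < k \<and> s = scale (of_nat k) w))"
  have Ps: "P s"
    using assms by (auto simp: P_def intro!: exI[of _ "1::nat"])
  define w where "w = arg_min (\<lambda>w. nat \<lfloor>m w\<rfloor>) P"
  have w: "P w" "\<And>x. P x \<Longrightarrow> nat \<lfloor>m w\<rfloor> \<le> nat \<lfloor>m x\<rfloor>"
    using arg_min_nat_lemma[of P s "\<lambda>w. nat \<lfloor>m w\<rfloor>", OF Ps] by (auto simp: w_def)
  have pos: "1 \<le> \<lfloor>m x\<rfloor>" "of_int \<lfloor>m x\<rfloor> = m x" if Px: "P x" for x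
  proof -
    obtain k :: nat where "0 < k" "s = scale (of_nat k) x"
      using Px by (auto simp: P_def)
    then have "0 < m x"
      using m by (auto simp: lin_scale[OF dual_lattice_lin[OF m(1)]] zero_less_mult_iff)
    moreover show "of_int \<lfloor>m x\<rfloor> = m x"
      using Px m(1) by (auto simp: P_def dual_lattice_floor)
    ultimately show "1 \<le> \<lfloor>m x\<rfloor>" by linarith
  qed
  obtain k :: nat where k: "0 < k" "s = scale (of_nat k) w"
    using w(1) by (auto simp: P_def)
  have "primitive w"
    unfolding primitive_def
  proof (intro conjI ballI allI impI)
    show "w \<in> N" "w \<noteq> 0"
      using w(1) k assms(2) by (auto simp: P_def)
    fix x :: 'v and j :: nat assume x: "x \<in> N" "w = scale (of_nat j) x"
    have j: "j \<noteq> 0"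
      using x(2) k assms(2) by auto
    then have Px: "P x"
      using x k by (auto simp: P_def intro!: exI[of _ "k * j"])
    have "m w = of_nat j * m x"
      using x(2) by (simp add: lin_scale[OF dual_lattice_lin[OF m(1)]])
    then have "\<lfloor>m w\<rfloor> = int j * \<lfloor>m x\<rfloor>"
      using pos(2)[OF Px] pos(2)[OF w(1)] by (metis of_int_eq_iff of_int_mult of_int_of_nat_eq)
    moreover have "\<lfloor>m w\<rfloor> \<le> \<lfloor>m x\<rfloor>"
      using w(2)[OF Px] pos(1)[OF Px] by linarith
    ultimately have "int j * \<lfloor>m x\<rfloor> \<le> 1 * \<lfloor>m x\<rfloor>" by simp
    then have "int j \<le> 1"
      using pos(1)[OF Px] by (subst (asm) mult_le_cancel_right) auto
    then show "j = 1"
      using j by simp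
  qed
  then show ?thesis
    using k by blast
qed

lemma ray_generator:
  assumes "rational_cone \<rho>" "strongly_convex \<rho>" "dim \<rho> = 1"
  obtains w where "primitive w" "\<rho> = cone_hull {w}"
proof -
  obtain S where S: "finite S" "S \<subseteq> N" "\<rho> = cone_hull S"
    using assms(1) by (auto simp: rational_cone_iff)
  have "\<exists>s\<in>S. s \<noteq> 0"
  proof (rule ccontr)
    assume no: "\<not> ?thesis"
    have "\<rho> \<subseteq> {0}"
      using no by (auto simp: S(3) elim!: cone_hullE intro!: sum.neutral)
    then have "span \<rho> = span {}"
      using span_mono[of \<rho> "{0}"] by (auto simp: span_zero)
    then show False
      using assms(3) dim_eq_card[of "{}" \<rho>] independent_empty by simp
  qed
  then obtain s where s: "s \<in> S" "s \<noteq> 0" by blast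
  obtain w k where w: "primitive w" "0 < (k::nat)" "s = scale (of_nat k) w"
    using primitive_multiple s S(2) by blast
  have "w = scale (1 / of_nat k) s"
    using w by simp
  then have wr: "w \<in> \<rho>"
    unfolding S(3) using cone_hull_gen[OF S(1) s(1)]
    by (metis cone_hull_scale divide_nonneg_nonneg of_nat_0_le_iff zero_le_one)
  have w0: "w \<noteq> 0"
    using w(1) by (simp add: primitive_def)
  have "x \<in> cone_hull {w}" if x: "x \<in> \<rho>" for x
  proof -
    have "x \<in> span {w}"
      using dim_one_subset_span[OF assms(3) wr w0] x by blast
    then obtain c where c: "x = scale c w"
      using span_breakdown[of w "{w}" x] by auto
    have "0 \<le> c"
    proof (rule ccontr)
      assume "\<not> 0 \<le> c"
      then have "scale (- 1 / c) x \<in> \<rho>"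
        using rational_cone_scale[OF assms(1) x, of "- 1 / c"] by (simp add: divide_nonpos_neg)
      then have "- w \<in> \<rho>"
        using c \<open>\<not> 0 \<le> c\<close> by simp
      then show False
        using strongly_convexD[OF assms(2) wr] w0 by blast
    qed
    then show ?thesis
      using c by (auto simp: cone_hull_single)
  qed
  moreover have "cone_hull {w} \<subseteq> \<rho>"
    using wr rational_cone_scale[OF assms(1) wr] by (auto simp: cone_hull_single)
  ultimately show thesis
    using that w(1) by blast
qed

text \<open>For each generator \<open>s\<close> some element of the dual monoid is positive at
  \<open>s\<close>, since otherwise biduality would put \<open>- s\<close> into the cone. The sum of
  these elements is positive at every generator.\<close>

lemma positive_form:
  assumes "rational_cone \<sigma>" "strongly_convex \<sigma>"
  shows "\<exists>m\<in>dual_monoid \<sigma>. \<forall>v\<in>\<sigma>. v \<noteq> 0 \<longrightarrow> 0 < m v"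
proof -
  obtain S where S: "finite S" "S \<subseteq> N" "\<sigma> = cone_hull S"
      "\<And>s. s \<in> S \<Longrightarrow> s \<noteq> 0 \<and> cone_hull {s} \<in> cone_rays \<sigma>"
    using cone_generated_by_rays[OF assms] by metis
  have "\<exists>m\<in>dual_monoid \<sigma>. 0 < m s" if s: "s \<in> S" for s
  proof (rule ccontr)
    assume "\<not> ?thesis"
    then have "0 \<le> m (- s)" if "m \<in> dual_monoid \<sigma>" for m
      using that by (simp add: lin_neg[OF dual_monoid_lin[OF that]] not_less)
    then have "- s \<in> \<sigma>"
      using mem_cone_if_dual_nonneg[OF assms(1)] by blast
    then show False
      using strongly_convexD[OF assms(2), of s] S(3,4) s cone_hull_gen[OF S(1) s] by blast
  qed
  then obtain m where m: "\<And>s. s \<in> S \<Longrightarrow> m s \<in> dual_monoid \<sigma>" "\<And>s. s \<in> S \<Longrightarrow> 0 < m s s"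
    by metis
  define p where "p = (\<lambda>v. \<Sum>s\<in>S. m s v)"
  have p: "p \<in> dual_monoid \<sigma>"
    unfolding p_def using m(1) by (rule dual_monoid_sum)
  have pos: "0 < p t" if "t \<in> S" for t
    unfolding p_def using m that S(1) cone_hull_gen[OF S(1) that]
    by (intro sum_pos2[of _ t]) (auto simp: dual_monoid_def S(3))
  have "v = 0" if v: "v \<in> \<sigma>" "p v \<le> 0" for v
  proof -
    obtain c where c: "\<And>v. v \<in> S \<Longrightarrow> 0 \<le> c v" "v = (\<Sum>v\<in>S. scale (c v) v)"
      using v(1) by (auto simp: S(3) elim: cone_hullE)
    have "(\<Sum>s\<in>S. c s * p s) = p v"
      by (simp add: c(2) lin_comb[OF dual_monoid_lin[OF p]])
    moreover have "0 \<le> (\<Sum>s\<in>S. c s * p s)"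
      using c(1) less_imp_le[OF pos] by (intro sum_nonneg) auto
    ultimately have "(\<Sum>s\<in>S. c s * p s) = 0"
      using v(2) by simp
    then have "\<forall>s\<in>S. c s * p s = 0"
      using sum_nonneg_eq_0_iff[OF S(1), of "\<lambda>s. c s * p s"] c(1) less_imp_le[OF pos]
      by auto
    then have "\<forall>s\<in>S. c s = 0"
      using pos by force
    then show ?thesis
      by (simp add: c(2))
  qed
  then show ?thesis
    using p by (intro bexI[of _ p]) (auto simp: not_le[symmetric])
qed

subsection \<open>Fans\<close>

lemma fan_rational: "fan \<Sigma> \<Longrightarrow> \<sigma> \<in> \<Sigma> \<Longrightarrow> rational_cone \<sigma>"
  and fan_convex: "fan \<Sigma> \<Longrightarrow> \<sigma> \<in> \<Sigma> \<Longrightarrow> strongly_convex \<sigma>"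
  and fan_face: "fan \<Sigma> \<Longrightarrow> \<sigma> \<in> \<Sigma> \<Longrightarrow> face_of \<tau> \<sigma> \<Longrightarrow> \<tau> \<in> \<Sigma>"
  and fan_Int_face: "fan \<Sigma> \<Longrightarrow> \<sigma> \<in> \<Sigma> \<Longrightarrow> \<tau> \<in> \<Sigma> \<Longrightarrow> face_of (\<sigma> \<inter> \<tau>) \<sigma>"
  by (simp_all add: fan_def)

lemma fan_Int: "fan \<Sigma> \<Longrightarrow> \<sigma> \<in> \<Sigma> \<Longrightarrow> \<tau> \<in> \<Sigma> \<Longrightarrow> \<sigma> \<inter> \<tau> \<in> \<Sigma>"
  using fan_face fan_Int_face by blast

lemma fan_zero: "fan \<Sigma> \<Longrightarrow> \<sigma> \<in> \<Sigma> \<Longrightarrow> 0 \<in> \<sigma>"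
  using fan_rational rational_cone_zero by blast

lemma zero_face:
  assumes "rational_cone \<sigma>" "strongly_convex \<sigma>"
  shows "face_of {0} \<sigma>"
proof -
  obtain m where m: "m \<in> dual_monoid \<sigma>" "\<forall>v\<in>\<sigma>. v \<noteq> 0 \<longrightarrow> 0 < m v"
    using positive_form[OF assms] by blast
  have "{0} = {v \<in> \<sigma>. m v = 0}"
    using m rational_cone_zero[OF assms(1)] lin_zero[OF dual_monoid_lin[OF m(1)]] by force
  then show ?thesis
    using face_ofI[OF m(1)] by blast
qed

lemma fan_zero_cone: "fan \<Sigma> \<Longrightarrow> {0} \<in> \<Sigma>"
  unfolding fan_def using zero_face by blast

lemma fan_ray_of_cone: "fan \<Sigma> \<Longrightarrow> \<sigma> \<in> \<Sigma> \<Longrightarrow> \<rho> \<in> cone_rays \<sigma> \<Longrightarrow> \<rho> \<in> fan_rays \<Sigma>"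
  using fan_face by (auto simp: cone_rays_def fan_rays_def)

text \<open>A point moving from the relative interior of \<open>\<tau>\<close> in direction \<open>e\<close> enters some cone of a
  complete fan at arbitrarily small times; that cone is closed, so it contains \<open>\<tau>\<close>.\<close>

lemma complete_fan_star:
  assumes "complete_fan \<Sigma>" "\<tau> \<in> \<Sigma>"
  shows "\<exists>\<omega>\<in>\<Sigma>. \<tau> \<subseteq> \<omega> \<and> (\<exists>v\<in>\<tau>. \<exists>a>0. v + scale a e \<in> \<omega>)"
proof -
  have fan: "fan \<Sigma>" and full: "\<Union>\<Sigma> = UNIV"
    using assms(1) by (auto simp: complete_fan_def)
  obtain S where S: "finite S" "\<tau> = cone_hull S"
    using fan_rational[OF fan assms(2)] by (auto simp: rational_cone_iff)
  \<comment> \<open>The sum of the generators lies in the relative interior: a form that is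
    nonnegative on \<open>\<tau>\<close> and vanishes at \<open>v\<close> vanishes on all of
    \<open>\<tau>\<close>.\<close>
  define v where "v = (\<Sum>s\<in>S. s)"
  have v: "v \<in> \<tau>"
    unfolding v_def S(2) using cone_hull_gen[OF S(1)] by (intro cone_hull_sum) auto
  have "\<forall>k::nat. \<exists>\<omega>\<in>\<Sigma>. v + scale (1 / of_nat (Suc k)) e \<in> \<omega>"
    using full by blast
  then obtain w where w: "\<And>k::nat. w k \<in> \<Sigma>" "\<And>k. v + scale (1 / of_nat (Suc k)) e \<in> w k"
    by metis
  have "finite (range w)"
    using w(1) fan finite_subset[of "range w" \<Sigma>] by (auto simp: fan_def)
  \<comment> \<open>There are infinitely many times \<open>1 / (k + 1)\<close> but finitely many
    cones, so one cone is met at arbitrarily small times.\<close>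
  then obtain k0 where inf: "infinite {k. w k = w k0}"
    using pigeonhole_infinite[of UNIV w] by auto
  define \<omega> where "\<omega> = w k0"
  have \<omega>: "\<omega> \<in> \<Sigma>"
    using w(1) by (simp add: \<omega>_def)
  have "0 \<le> m v" if m: "m \<in> dual_monoid \<omega>" for m
  proof (rule ccontr)
    assume neg: "\<not> 0 \<le> m v"
    obtain k1 :: nat where k1: "m e / (- m v) < of_nat k1"
      using reals_Archimedean2 by blast
    obtain k where k: "w k = \<omega>" "k1 < k"
      using inf unfolding infinite_nat_iff_unbounded \<omega>_def by blast
    have "0 \<le> m (v + scale (1 / of_nat (Suc k)) e)"
      using w(2)[of k] k(1) m by (auto simp: dual_monoid_def)
    then have "0 \<le> m v + m e / of_nat (Suc k)"
      by (simp add: lin_add[OF dual_monoid_lin[OF m]] lin_scale[OF dual_monoid_lin[OF m]])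
    then have "0 \<le> m v * of_nat (Suc k) + m e"
      by (simp add: field_simps del: of_nat_Suc)
    moreover have "m e < of_nat k1 * (- m v)"
      using pos_divide_less_eq[THEN iffD1, OF _ k1] neg by simp
    moreover have "of_nat k1 * (- m v) \<le> of_nat (Suc k) * (- m v)"
      using neg k(2) by (intro mult_right_mono) auto
    ultimately show False
      by (simp add: algebra_simps)
  qed
  then have v\<omega>: "v \<in> \<omega>"
    using mem_cone_if_dual_nonneg[OF fan_rational[OF fan \<omega>]] by blast
  obtain m where m: "m \<in> dual_monoid \<tau>" "\<tau> \<inter> \<omega> = {x \<in> \<tau>. m x = 0}"
    using face_by_dual_monoid[OF fan_Int_face[OF fan assms(2) \<omega>]] by blast
  have "m v = 0"
    using m(2) v v\<omega> by blast
  then have "(\<Sum>s\<in>S. m s) = 0"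
    by (simp add: v_def lin_sum[OF dual_monoid_lin[OF m(1)]])
  then have "\<forall>s\<in>S. m s = 0"
    using sum_nonneg_eq_0_iff[OF S(1), of m] m(1) cone_hull_gen[OF S(1)]
    by (auto simp: S(2) dual_monoid_def)
  then have "m x = 0" if "x \<in> \<tau>" for x
    using that by (auto simp: S(2) lin_comb[OF dual_monoid_lin[OF m(1)]] elim!: cone_hullE)
  then have "\<tau> \<subseteq> \<omega>"
    using m(2) by blast
  then show ?thesis
    using \<omega> v w(2)[of k0] by (intro bexI[of _ \<omega>] conjI bexI[of _ v] exI[of _ "1 / of_nat (Suc k0)"])
      (auto simp: \<omega>_def simp del: of_nat_Suc)
qed

subsection \<open>Points of charts\<close>

lemma chartI:
  assumes "x \<in> extensional (dual_monoid \<sigma>)" "x (\<lambda>_. 0) = 1"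
    "\<And>m m'. m \<in> dual_monoid \<sigma> \<Longrightarrow> m' \<in> dual_monoid \<sigma> \<Longrightarrow> x (\<lambda>v. m v + m' v) = x m * x m'"
  shows "x \<in> chart \<sigma>"
  using assms by (simp add: chart_def)

lemma chart_one: "x \<in> chart \<sigma> \<Longrightarrow> x (\<lambda>_. 0) = 1"
  by (simp add: chart_def)

lemma chart_mult:
  "x \<in> chart \<sigma> \<Longrightarrow> m \<in> dual_monoid \<sigma> \<Longrightarrow> m' \<in> dual_monoid \<sigma> \<Longrightarrow>
     x (\<lambda>v. m v + m' v) = x m * x m'"
  by (simp add: chart_def)

lemma chart_eqI:
  assumes "x \<in> chart \<sigma>" "y \<in> chart \<sigma>" "\<And>m. m \<in> dual_monoid \<sigma> \<Longrightarrow> x m = y m"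
  shows "x = y"
  using assms by (intro extensionalityI[of _ "dual_monoid \<sigma>"]) (auto simp: chart_def)

lemma chart_nat:
  assumes "x \<in> chart \<sigma>" "m \<in> dual_monoid \<sigma>"
  shows "x (\<lambda>v. of_nat k * m v) = x m ^ k"
proof (induction k)
  case (Suc k)
  have "(\<lambda>v. of_nat (Suc k) * m v) = (\<lambda>v. m v + of_nat k * m v)"
    by (simp add: distrib_right)
  then show ?case
    using Suc chart_mult[OF assms dual_monoid_nat[OF assms(2)]] by simp
qed (simp add: chart_one[OF assms(1)])

lemma chart_add_nat:
  assumes "x \<in> chart \<sigma>" "m \<in> dual_monoid \<sigma>" "u \<in> dual_monoid \<sigma>"
  shows "x (\<lambda>v. m v + of_nat k * u v) = x m * x u ^ k"
  using chart_mult[OF assms(1,2) dual_monoid_nat[OF assms(3)]] chart_nat[OF assms(1,3)] by simp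

lemma chart_sum:
  assumes "x \<in> chart \<sigma>" "\<And>i. i \<in> I \<Longrightarrow> f i \<in> dual_monoid \<sigma>"
  shows "x (\<lambda>v. \<Sum>i\<in>I. f i v) = (\<Prod>i\<in>I. x (f i))"
  using assms(2)
proof (induction I rule: infinite_finite_induct)
  case (insert i I)
  then have "x (\<lambda>v. f i v + (\<Sum>i\<in>I. f i v)) = x (f i) * x (\<lambda>v. \<Sum>i\<in>I. f i v)"
    by (intro chart_mult[OF assms(1)] dual_monoid_sum) auto
  then show ?case
    using insert by simp
qed (simp_all add: chart_one[OF assms(1)])

lemma chart_unit:
  assumes "x \<in> chart \<sigma>" "m \<in> dual_monoid \<sigma>" "(\<lambda>v. - m v) \<in> dual_monoid \<sigma>"
  shows "x m * x (\<lambda>v. - m v) = 1"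
  using chart_mult[OF assms] chart_one[OF assms(1)] by simp

lemma torus_nonzero: "x \<in> chart {0} \<Longrightarrow> m \<in> dual_lattice \<Longrightarrow> x m \<noteq> 0"
  using chart_unit[of x "{0}" m] dual_lattice_uminus by auto

lemma chart_restrict:
  assumes "\<tau> \<subseteq> \<sigma>" "z \<in> chart \<tau>"
  shows "restrict z (dual_monoid \<sigma>) \<in> chart \<sigma>"
  using dual_monoid_antimono[OF assms(1)] chart_one[OF assms(2)] chart_mult[OF assms(2)]
  by (intro chartI) (auto simp: zero_mem_dual_monoid add_mem_dual_monoid subset_iff)

text \<open>Passing to a face inverts the character \<open>u\<close> that cuts it out. A generator
  with \<open>u s = 0\<close> lies in the face, where \<open>m\<close> is already nonnegative; at
  the others a large multiple of \<open>u\<close> outweighs \<open>m\<close>. The claim for all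
  large \<open>j\<close> allows several forms to be shifted by one common multiple.\<close>

lemma dual_monoid_face_shift:
  assumes "rational_cone \<sigma>" "u \<in> dual_monoid \<sigma>" "m \<in> dual_monoid {v \<in> \<sigma>. u v = 0}"
  shows "\<exists>k::nat. \<forall>j\<ge>k. (\<lambda>v. m v + of_nat j * u v) \<in> dual_monoid \<sigma>"
proof -
  obtain S where S: "finite S" "S \<subseteq> N" "\<sigma> = cone_hull S"
    using assms(1) by (auto simp: rational_cone_iff)
  have "\<exists>k::nat. \<forall>j\<ge>k. 0 \<le> m s + of_nat j * u s" if "s \<in> S" for s
  proof (cases "u s = 0")
    case True
    then show ?thesis
      using assms(3) that cone_hull_gen[OF S(1)] S(3) by (auto simp: dual_monoid_def)
  next
    case False
    then have us: "0 < u s"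
      using assms(2) that cone_hull_gen[OF S(1)] S(3) by (force simp: dual_monoid_def)
    obtain k :: nat where k: "- m s / u s < of_nat k"
      using reals_Archimedean2 by blast
    have "0 \<le> m s + of_nat j * u s" if "k \<le> j" for j
    proof -
      have "- m s < of_nat k * u s"
        using pos_divide_less_eq[THEN iffD1, OF us k] .
      also have "\<dots> \<le> of_nat j * u s"
        using us that by (intro mult_right_mono) auto
      finally show ?thesis by simp
    qed
    then show ?thesis by blast
  qed
  then obtain k where k: "\<And>s j. s \<in> S \<Longrightarrow> k s \<le> j \<Longrightarrow> 0 \<le> m s + of_nat j * u s"
    by metis
  have "(\<lambda>v. m v + of_nat j * u v) \<in> dual_monoid \<sigma>" if "sum k S \<le> j" for j
  proof -
    have "k s \<le> j" if "s \<in> S" for s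
      using member_le_sum[OF that, of k] S(1) \<open>sum k S \<le> j\<close> by simp
    moreover have "(\<lambda>v. m v + of_nat j * u v) \<in> dual_lattice"
      using assms(2,3) dual_monoid_nat by (intro dual_lattice_add) (auto dest: dual_monoid_dual_lattice)
    ultimately show ?thesis
      using k by (simp add: S(3) dual_monoid_cone_hull[OF S(1)])
  qed
  then show ?thesis by blast
qed

lemma face_unit:
  assumes "u \<in> dual_monoid \<sigma>" "z \<in> chart {v \<in> \<sigma>. u v = 0}"
  shows "z u \<noteq> 0"
proof -
  have "u \<in> dual_monoid {v \<in> \<sigma>. u v = 0}" "(\<lambda>v. - u v) \<in> dual_monoid {v \<in> \<sigma>. u v = 0}"
    using assms(1) dual_lattice_uminus by (auto simp: dual_monoid_iff[of _ \<sigma>] dual_monoid_iff[of _ "{v \<in> \<sigma>. u v = 0}"])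
  then show ?thesis
    using chart_unit[OF assms(2)] by force
qed

lemma face_value:
  assumes "u \<in> dual_monoid \<sigma>" "z \<in> chart {v \<in> \<sigma>. u v = 0}" "m \<in> dual_monoid {v \<in> \<sigma>. u v = 0}"
  shows "z m = z (\<lambda>v. m v + of_nat k * u v) / z u ^ k"
proof -
  have "u \<in> dual_monoid {v \<in> \<sigma>. u v = 0}"
    using assms(1) dual_monoid_antimono[of "{v \<in> \<sigma>. u v = 0}" \<sigma>] by auto
  then show ?thesis
    using chart_add_nat[OF assms(2,3)] face_unit[OF assms(1,2)] by simp
qed

lemma face_point_unique:
  assumes "rational_cone \<sigma>" "u \<in> dual_monoid \<sigma>"
    and "z \<in> chart {v \<in> \<sigma>. u v = 0}" "z' \<in> chart {v \<in> \<sigma>. u v = 0}"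
    and "restrict z (dual_monoid \<sigma>) = restrict z' (dual_monoid \<sigma>)"
  shows "z = z'"
proof (rule chart_eqI[OF assms(3,4)])
  fix m assume m: "m \<in> dual_monoid {v \<in> \<sigma>. u v = 0}"
  obtain k :: nat where k: "(\<lambda>v. m v + of_nat k * u v) \<in> dual_monoid \<sigma>"
    using dual_monoid_face_shift[OF assms(1,2) m] by blast
  have "z y = z' y" if "y \<in> dual_monoid \<sigma>" for y
    using fun_cong[OF assms(5), of y] that by simp
  then show "z m = z' m"
    using face_value[OF assms(2,3) m, of k] face_value[OF assms(2,4) m, of k] k assms(2) by simp
qed

text \<open>The chart of the face is the principal open set \<open>x u \<noteq> 0\<close>. The
  extension of \<open>x\<close> sends \<open>m\<close> to \<open>x (m + k u) / x u ^ k\<close>, and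
  this does not depend on the exponent \<open>k\<close> as long as the shifted form lies in the dual
  monoid of \<open>\<sigma>\<close>.\<close>

lemma face_point_exists:
  assumes \<sigma>: "rational_cone \<sigma>" and u: "u \<in> dual_monoid \<sigma>" and x: "x \<in> chart \<sigma>" "x u \<noteq> 0"
  shows "\<exists>z\<in>chart {v \<in> \<sigma>. u v = 0}. restrict z (dual_monoid \<sigma>) = x"
proof -
  let ?\<tau> = "{v \<in> \<sigma>. u v = 0}"
  define s where "s = (\<lambda>m (k::nat) v. m v + of_nat k * u v)"
  define K where "K = (\<lambda>m. SOME k::nat. s m k \<in> dual_monoid \<sigma>)"
  have K: "s m (K m) \<in> dual_monoid \<sigma>" if "m \<in> dual_monoid ?\<tau>" for m
    unfolding K_def using dual_monoid_face_shift[OF \<sigma> u that] by (intro someI_ex[of "\<lambda>k. s m k \<in> _"]) (auto simp: s_def)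
  define z where "z = restrict (\<lambda>m. x (s m (K m)) / x u ^ K m) (dual_monoid ?\<tau>)"
  have z: "z m = x (s m k) / x u ^ k" if m: "m \<in> dual_monoid ?\<tau>" and k: "s m k \<in> dual_monoid \<sigma>" for m k
  proof -
    have "(\<lambda>v. s m k v + of_nat (K m) * u v) = (\<lambda>v. s m (K m) v + of_nat k * u v)"
      by (simp add: s_def algebra_simps)
    then have "x (s m k) * x u ^ K m = x (s m (K m)) * x u ^ k"
      using chart_add_nat[OF x(1) k u, of "K m"] chart_add_nat[OF x(1) K[OF m] u, of k] by simp
    then show ?thesis
      using m x(2) by (simp add: z_def frac_eq_eq)
  qed
  have sub: "dual_monoid \<sigma> \<subseteq> dual_monoid ?\<tau>"
    by (intro dual_monoid_antimono) auto
  have res: "z m = x m" if "m \<in> dual_monoid \<sigma>" for m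
    using z[of m 0] that sub by (auto simp: s_def)
  have "z \<in> chart ?\<tau>"
  proof (rule chartI)
    show "z \<in> extensional (dual_monoid ?\<tau>)"
      by (simp add: z_def)
    show "z (\<lambda>_. 0) = 1"
      using res[OF zero_mem_dual_monoid] chart_one[OF x(1)] by simp
    fix m m' assume m: "m \<in> dual_monoid ?\<tau>" "m' \<in> dual_monoid ?\<tau>"
    have eq: "s (\<lambda>v. m v + m' v) (K m + K m') = (\<lambda>v. s m (K m) v + s m' (K m') v)"
      by (simp add: s_def algebra_simps)
    then have "s (\<lambda>v. m v + m' v) (K m + K m') \<in> dual_monoid \<sigma>"
      using add_mem_dual_monoid[OF K[OF m(1)] K[OF m(2)]] by simp
    then have "z (\<lambda>v. m v + m' v) = x (\<lambda>v. s m (K m) v + s m' (K m') v) / x u ^ (K m + K m')"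
      using z[OF add_mem_dual_monoid[OF m]] eq by metis
    also have "\<dots> = z m * z m'"
      using m by (simp add: chart_mult[OF x(1) K K] z_def power_add)
    finally show "z (\<lambda>v. m v + m' v) = z m * z m'" .
  qed
  moreover have "restrict z (dual_monoid \<sigma>) = x"
    using x(1) res by (intro extensionalityI[of _ "dual_monoid \<sigma>"]) (auto simp: chart_def)
  ultimately show ?thesis by blast
qed

subsection \<open>Gluing\<close>

lemma gluing_iff:
  "((\<sigma>, x), (\<tau>, y)) \<in> gluing \<Sigma> \<longleftrightarrow> \<sigma> \<in> \<Sigma> \<and> \<tau> \<in> \<Sigma> \<and>
     (\<exists>z\<in>chart (\<sigma> \<inter> \<tau>). x = restrict z (dual_monoid \<sigma>) \<and> y = restrict z (dual_monoid \<tau>))"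
  unfolding gluing_def by blast

lemma restrict_chart: "x \<in> chart \<sigma> \<Longrightarrow> restrict x (dual_monoid \<sigma>) = x"
  by (simp add: chart_def extensional_restrict)

lemma gluing_refl: "\<sigma> \<in> \<Sigma> \<Longrightarrow> x \<in> chart \<sigma> \<Longrightarrow> ((\<sigma>, x), (\<sigma>, x)) \<in> gluing \<Sigma>"
  unfolding gluing_iff by (auto simp: restrict_chart intro!: bexI[of _ x])

lemma gluing_sym: "((\<sigma>, x), (\<tau>, y)) \<in> gluing \<Sigma> \<Longrightarrow> ((\<tau>, y), (\<sigma>, x)) \<in> gluing \<Sigma>"
  unfolding gluing_iff by (auto simp: Int_commute)

text \<open>The triple intersection is the face of \<open>\<tau>\<close> cut out by
  \<open>u + u'\<close>. The middle point \<open>y\<close> is nonzero at both \<open>u\<close> and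
  \<open>u'\<close>, hence extends to a point \<open>t\<close> of the triple intersection.
  Extensions being unique, \<open>t\<close> restricts to both given witnesses \<open>z\<close> and
  \<open>z'\<close>, and its restriction to \<open>\<sigma> \<inter> \<omega>\<close> is the witness
  wanted.\<close>

lemma gluing_trans:
  assumes fan: "fan \<Sigma>" and xy: "((\<sigma>, x), (\<tau>, y)) \<in> gluing \<Sigma>" and yw: "((\<tau>, y), (\<omega>, w)) \<in> gluing \<Sigma>"
  shows "((\<sigma>, x), (\<omega>, w :: ('v, 'k::field) chart_point)) \<in> gluing \<Sigma>"
proof -
  obtain z where z: "\<sigma> \<in> \<Sigma>" "\<tau> \<in> \<Sigma>" "z \<in> chart (\<sigma> \<inter> \<tau>)"
      "x = restrict z (dual_monoid \<sigma>)" "y = restrict z (dual_monoid \<tau>)"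
    using xy unfolding gluing_iff by blast
  obtain z' where z': "\<omega> \<in> \<Sigma>" "z' \<in> chart (\<tau> \<inter> \<omega>)"
      "y = restrict z' (dual_monoid \<tau>)" "w = restrict z' (dual_monoid \<omega>)"
    using yw unfolding gluing_iff by blast
  have rat: "rational_cone \<tau>"
    using fan_rational[OF fan z(2)] .
  obtain u where u: "u \<in> dual_monoid \<tau>" "\<sigma> \<inter> \<tau> = {v \<in> \<tau>. u v = 0}"
    using face_by_dual_monoid[OF fan_Int_face[OF fan z(2,1)]] by (auto simp: Int_commute)
  obtain u' where u': "u' \<in> dual_monoid \<tau>" "\<tau> \<inter> \<omega> = {v \<in> \<tau>. u' v = 0}"
    using face_by_dual_monoid[OF fan_Int_face[OF fan z(2) z'(1)]] by blast
  let ?u = "\<lambda>v. u v + u' v"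
  have face: "{v \<in> \<tau>. ?u v = 0} = \<sigma> \<inter> \<tau> \<inter> \<omega>"
  proof -
    have "?u v = 0 \<longleftrightarrow> u v = 0 \<and> u' v = 0" if "v \<in> \<tau>" for v
      using u(1) u'(1) that by (auto simp: dual_monoid_def add_nonneg_eq_0_iff)
    then show ?thesis
      using u(2) u'(2) by blast
  qed
  have y: "y \<in> chart \<tau>"
    unfolding z(5) using z(3) by (intro chart_restrict) auto
  have "y u \<noteq> 0"
    using face_unit[OF u(1), of z] u z(3) by (simp add: z(5))
  moreover have "y u' \<noteq> 0"
    using face_unit[OF u'(1), of z'] u' z'(2) by (simp add: z'(3))
  ultimately have "y ?u \<noteq> 0"
    by (simp add: chart_mult[OF y u(1) u'(1)])
  then obtain t where t: "t \<in> chart (\<sigma> \<inter> \<tau> \<inter> \<omega>)" "restrict t (dual_monoid \<tau>) = y"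
    using face_point_exists[OF rat add_mem_dual_monoid[OF u(1) u'(1)] y] face by auto
  have tz: "restrict t (dual_monoid (\<sigma> \<inter> \<tau>)) = z"
  proof (rule face_point_unique[OF rat u(1)])
    show "restrict t (dual_monoid (\<sigma> \<inter> \<tau>)) \<in> chart {v \<in> \<tau>. u v = 0}"
      unfolding u(2)[symmetric] using t(1) by (intro chart_restrict[of "\<sigma> \<inter> \<tau> \<inter> \<omega>"]) auto
    show "z \<in> chart {v \<in> \<tau>. u v = 0}"
      using z(3) u(2) by simp
    show "restrict (restrict t (dual_monoid (\<sigma> \<inter> \<tau>))) (dual_monoid \<tau>) = restrict z (dual_monoid \<tau>)"
      using t(2) z(5) dual_monoid_antimono[of "\<sigma> \<inter> \<tau>" \<tau>] by (simp add: Int_absorb1)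
  qed
  have tz': "restrict t (dual_monoid (\<tau> \<inter> \<omega>)) = z'"
  proof (rule face_point_unique[OF rat u'(1)])
    show "restrict t (dual_monoid (\<tau> \<inter> \<omega>)) \<in> chart {v \<in> \<tau>. u' v = 0}"
      unfolding u'(2)[symmetric] using t(1) by (intro chart_restrict[of "\<sigma> \<inter> \<tau> \<inter> \<omega>"]) auto
    show "z' \<in> chart {v \<in> \<tau>. u' v = 0}"
      using z'(2) u'(2) by simp
    show "restrict (restrict t (dual_monoid (\<tau> \<inter> \<omega>))) (dual_monoid \<tau>) = restrict z' (dual_monoid \<tau>)"
      using t(2) z'(3) dual_monoid_antimono[of "\<tau> \<inter> \<omega>" \<tau>] by (simp add: Int_absorb1)
  qed
  have "restrict t (dual_monoid (\<sigma> \<inter> \<omega>)) \<in> chart (\<sigma> \<inter> \<omega>)"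
    using t(1) by (intro chart_restrict[of "\<sigma> \<inter> \<tau> \<inter> \<omega>"]) auto
  moreover have "restrict (restrict t (dual_monoid (\<sigma> \<inter> \<omega>))) (dual_monoid \<sigma>) = x"
    using z(4) dual_monoid_antimono[of "\<sigma> \<inter> \<omega>" \<sigma>] dual_monoid_antimono[of "\<sigma> \<inter> \<tau>" \<sigma>]
    by (simp add: Int_absorb1 flip: tz)
  moreover have "restrict (restrict t (dual_monoid (\<sigma> \<inter> \<omega>))) (dual_monoid \<omega>) = w"
    using z'(4) dual_monoid_antimono[of "\<sigma> \<inter> \<omega>" \<omega>] dual_monoid_antimono[of "\<tau> \<inter> \<omega>" \<omega>]
    by (simp add: Int_absorb1 flip: tz')
  ultimately show ?thesis
    unfolding gluing_iff using z(1) z'(1) by blast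
qed

lemma chart_map_eq_iff:
  assumes "fan \<Sigma>" "\<sigma> \<in> \<Sigma>" "\<tau> \<in> \<Sigma>" "x \<in> chart \<sigma>" "y \<in> chart \<tau>"
  shows "chart_map \<Sigma> \<sigma> x = chart_map \<Sigma> \<tau> y \<longleftrightarrow>
    (\<exists>z\<in>chart (\<sigma> \<inter> \<tau>). x = restrict z (dual_monoid \<sigma>) \<and> y = restrict z (dual_monoid \<tau>))"
proof -
  have "chart_map \<Sigma> \<sigma> x = chart_map \<Sigma> \<tau> y \<longleftrightarrow> ((\<sigma>, x), (\<tau>, y)) \<in> gluing \<Sigma>"
  proof
    assume "chart_map \<Sigma> \<sigma> x = chart_map \<Sigma> \<tau> y"
    then show "((\<sigma>, x), (\<tau>, y)) \<in> gluing \<Sigma>"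
      using gluing_refl[OF assms(3,5)] by (auto simp: chart_map_def)
  next
    assume xy: "((\<sigma>, x), (\<tau>, y)) \<in> gluing \<Sigma>"
    have "((\<sigma>, x), q) \<in> gluing \<Sigma> \<longleftrightarrow> ((\<tau>, y), q) \<in> gluing \<Sigma>" for q
      using gluing_trans[OF assms(1) xy] gluing_trans[OF assms(1) gluing_sym[OF xy]]
      by (cases q) blast
    then show "chart_map \<Sigma> \<sigma> x = chart_map \<Sigma> \<tau> y"
      by (auto simp: chart_map_def)
  qed
  then show ?thesis
    using assms(2,3) by (simp add: gluing_iff)
qed

lemma chart_map_inj:
  assumes "fan \<Sigma>" "\<sigma> \<in> \<Sigma>" "x \<in> chart \<sigma>" "y \<in> chart \<sigma>" "chart_map \<Sigma> \<sigma> x = chart_map \<Sigma> \<sigma> y"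
  shows "x = y"
  using assms chart_map_eq_iff[OF assms(1,2,2,3,4)] by auto

lemma chart_map_restrict:
  assumes "fan \<Sigma>" "\<sigma> \<in> \<Sigma>" "\<tau> \<in> \<Sigma>" "\<tau> \<subseteq> \<sigma>" "z \<in> chart \<tau>"
  shows "chart_map \<Sigma> \<sigma> (restrict z (dual_monoid \<sigma>)) = chart_map \<Sigma> \<tau> z"
  using assms chart_map_eq_iff[OF assms(1-3) chart_restrict[OF assms(4,5)] assms(5)]
  by (auto simp: Int_absorb1 restrict_chart)

lemma toric_varietyE:
  assumes "p \<in> toric_variety \<Sigma>"
  obtains \<sigma> x where "\<sigma> \<in> \<Sigma>" "x \<in> chart \<sigma>" "p = chart_map \<Sigma> \<sigma> x"
  using assms unfolding toric_variety_def chart_map_def by (auto elim!: quotientE)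

subsection \<open>Coordinate rings\<close>

lemma coordinate_ringI:
  "finite F \<Longrightarrow> F \<subseteq> dual_monoid \<sigma> \<Longrightarrow> (\<lambda>x. \<Sum>m\<in>F. c m * x m) \<in> coordinate_ring \<sigma>"
  unfolding coordinate_ring_def by blast

lemma coordinate_ringE:
  assumes "g \<in> coordinate_ring \<sigma>"
  obtains F c where "finite F" "F \<subseteq> dual_monoid \<sigma>" "g = (\<lambda>x. \<Sum>m\<in>F. c m * x m)"
  using assms unfolding coordinate_ring_def by blast

lemma coordinate_ring_char: "m \<in> dual_monoid \<sigma> \<Longrightarrow> (\<lambda>x. x m) \<in> coordinate_ring \<sigma>"
  using coordinate_ringI[of "{m}" \<sigma> "\<lambda>_. 1"] by simp

lemma coordinate_ring_cmult:
  assumes "g \<in> coordinate_ring \<sigma>"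
  shows "(\<lambda>x. a * g x) \<in> coordinate_ring \<sigma>"
  using assms
proof (rule coordinate_ringE)
  fix F c assume "finite F" "F \<subseteq> dual_monoid \<sigma>" "g = (\<lambda>x. \<Sum>m\<in>F. c m * x m)"
  then show ?thesis
    using coordinate_ringI[of F \<sigma> "\<lambda>m. a * c m"] by (simp add: sum_distrib_left mult.assoc)
qed

lemma coordinate_ring_add:
  assumes "g \<in> coordinate_ring \<sigma>" "h \<in> coordinate_ring \<sigma>"
  shows "(\<lambda>x. g x + h x) \<in> coordinate_ring \<sigma>"
proof -
  obtain F c where F: "finite F" "F \<subseteq> dual_monoid \<sigma>" "g = (\<lambda>x. \<Sum>m\<in>F. c m * x m)"
    using assms(1) by (rule coordinate_ringE)
  obtain G d where G: "finite G" "G \<subseteq> dual_monoid \<sigma>" "h = (\<lambda>x. \<Sum>m\<in>G. d m * x m)"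
    using assms(2) by (rule coordinate_ringE)
  have "g x + h x = (\<Sum>m\<in>F \<union> G. ((if m \<in> F then c m else 0) + (if m \<in> G then d m else 0)) * x m)" for x
  proof -
    have "g x = (\<Sum>m\<in>F \<union> G. (if m \<in> F then c m else 0) * x m)"
      unfolding F(3) using F(1) G(1) by (intro sum.mono_neutral_cong_left) auto
    moreover have "h x = (\<Sum>m\<in>F \<union> G. (if m \<in> G then d m else 0) * x m)"
      unfolding G(3) using F(1) G(1) by (intro sum.mono_neutral_cong_left) auto
    ultimately show ?thesis
      by (simp only: distrib_right sum.distrib)
  qed
  then show ?thesis
    using coordinate_ringI[of "F \<union> G" \<sigma>] F G by auto
qed

lemma coordinate_ring_zero: "(\<lambda>x. 0) \<in> coordinate_ring \<sigma>"
  using coordinate_ringI[of "{}"] by simp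

lemma coordinate_ring_sum:
  "(\<And>i. i \<in> I \<Longrightarrow> g i \<in> coordinate_ring \<sigma>) \<Longrightarrow> (\<lambda>x. \<Sum>i\<in>I. g i x) \<in> coordinate_ring \<sigma>"
  by (induction I rule: infinite_finite_induct)
     (simp_all add: coordinate_ring_zero coordinate_ring_add)

lemma coordinate_ring_antimono: "\<tau> \<subseteq> \<sigma> \<Longrightarrow> coordinate_ring \<sigma> \<subseteq> coordinate_ring \<tau>"
  using dual_monoid_antimono[of \<tau> \<sigma>] by (auto elim!: coordinate_ringE intro!: coordinate_ringI)

lemma coordinate_ring_cong:
  assumes "g \<in> coordinate_ring \<sigma>" "\<And>m. m \<in> dual_monoid \<sigma> \<Longrightarrow> x m = y m"
  shows "g x = g y"
  using assms(1) by (rule coordinate_ringE) (auto intro!: sum.cong simp: assms(2) subset_iff)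

lemma coordinate_ring_restrict:
  "g \<in> coordinate_ring \<sigma> \<Longrightarrow> g (restrict z (dual_monoid \<sigma>)) = g z"
  by (rule coordinate_ring_cong) auto

text \<open>A tangent vector \<open>a\<close> at \<open>x\<close> makes \<open>x + \<epsilon> a\<close> a point over the dual numbers.  Since elements of
  the coordinate ring are linear in the characters, \<open>g a\<close> is the derivative of \<open>g\<close> along \<open>a\<close>.\<close>

definition tangent ::
    "'v set \<Rightarrow> ('v, 'k::field) chart_point \<Rightarrow> (('v \<Rightarrow> rat) \<Rightarrow> 'k) \<Rightarrow> bool" where
  "tangent \<sigma> x a \<longleftrightarrow> (\<forall>m\<in>dual_monoid \<sigma>. \<forall>m'\<in>dual_monoid \<sigma>.
     a (\<lambda>v. m v + m' v) = a m * x m' + x m * a m')"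

text \<open>Elements of the coordinate ring are also evaluated at tangent vectors, which are not
  points of the chart, so the pointwise product is not the right representative. The expression with
  the characters multiplied out agrees with it on the chart and satisfies the Leibniz rule at
  tangent vectors.\<close>

lemma coordinate_ring_mult:
  assumes "g \<in> coordinate_ring \<sigma>" "h \<in> coordinate_ring \<sigma>"
  obtains k where "k \<in> coordinate_ring \<sigma>" "\<And>x. x \<in> chart \<sigma> \<Longrightarrow> k x = g x * h x"
    "\<And>x a. tangent \<sigma> x a \<Longrightarrow> k a = g a * h x + g x * h a"
proof -
  obtain F c where F: "finite F" "F \<subseteq> dual_monoid \<sigma>" "g = (\<lambda>x. \<Sum>m\<in>F. c m * x m)"
    using assms(1) by (rule coordinate_ringE)
  obtain G d where G: "finite G" "G \<subseteq> dual_monoid \<sigma>" "h = (\<lambda>x. \<Sum>m\<in>G. d m * x m)"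
    using assms(2) by (rule coordinate_ringE)
  define k where "k = (\<lambda>x. \<Sum>m\<in>F. \<Sum>m'\<in>G. (c m * d m') * x (\<lambda>v. m v + m' v))"
  have "k \<in> coordinate_ring \<sigma>"
    unfolding k_def using F(2) G(2)
    by (intro coordinate_ring_sum coordinate_ring_cmult coordinate_ring_char add_mem_dual_monoid) auto
  moreover have "k x = g x * h x" if "x \<in> chart \<sigma>" for x
    unfolding k_def F(3) G(3) sum_product using F(2) G(2) that
    by (intro sum.cong refl) (simp add: chart_mult subset_iff)
  moreover have "k a = g a * h x + g x * h a" if "tangent \<sigma> x a" for x a
    unfolding k_def F(3) G(3) sum_product sum.distrib[symmetric] using F(2) G(2) that
    by (intro sum.cong refl) (simp add: tangent_def subset_iff algebra_simps)
  ultimately show thesis by (rule that)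
qed

definition ring_product ::
    "'v set \<Rightarrow> (('v, 'k::field) chart_point \<Rightarrow> 'k) \<Rightarrow> (('v, 'k) chart_point \<Rightarrow> 'k) \<Rightarrow>
      (('v, 'k) chart_point \<Rightarrow> 'k) \<Rightarrow> bool" where
  "ring_product \<sigma> g h k \<longleftrightarrow> k \<in> coordinate_ring \<sigma> \<and> (\<forall>x\<in>chart \<sigma>. k x = g x * h x) \<and>
     (\<forall>x a. tangent \<sigma> x a \<longrightarrow> k a = g a * h x + g x * h a)"

lemma ring_productE:
  assumes "g \<in> coordinate_ring \<sigma>" "h \<in> coordinate_ring \<sigma>"
  obtains k where "ring_product \<sigma> g h k"
proof (rule coordinate_ring_mult[OF assms])
  fix k assume "k \<in> coordinate_ring \<sigma>" "\<And>x. x \<in> chart \<sigma> \<Longrightarrow> k x = g x * h x"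
    "\<And>x a. tangent \<sigma> x a \<Longrightarrow> k a = g a * h x + g x * h a"
  then show thesis
    by (intro that[of k]) (simp add: ring_product_def)
qed

lemma ring_productD:
  assumes "ring_product \<sigma> g h k"
  shows "k \<in> coordinate_ring \<sigma>" "\<And>x. x \<in> chart \<sigma> \<Longrightarrow> k x = g x * h x"
    "\<And>x a. tangent \<sigma> x a \<Longrightarrow> k a = g a * h x + g x * h a"
  using assms by (auto simp: ring_product_def)

lemma coordinate_ring_power:
  assumes "g \<in> coordinate_ring \<sigma>"
  shows "\<exists>k\<in>coordinate_ring \<sigma>. \<forall>x\<in>chart \<sigma>. k x = g x ^ j"
proof (induction j)
  case 0
  then show ?case
    using coordinate_ring_char[OF zero_mem_dual_monoid, of \<sigma>] chart_one[of _ \<sigma>]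
    by (intro bexI[of _ "\<lambda>x. x (\<lambda>_. 0)"]) auto
next
  case (Suc j)
  then obtain k where k: "k \<in> coordinate_ring \<sigma>" "\<forall>x\<in>chart \<sigma>. k x = g x ^ j" by blast
  obtain l where "l \<in> coordinate_ring \<sigma>" "\<And>x. x \<in> chart \<sigma> \<Longrightarrow> l x = g x * k x"
    using coordinate_ring_mult[OF assms k(1)] by metis
  then show ?case
    using k(2) by (intro bexI[of _ l]) auto
qed

subsection \<open>Zariski topology and regular functions on charts\<close>

text \<open>Principal open sets are closed under intersection, by multiplying the functions, so they
  form a base and not only a subbase of the generated topology.\<close>

lemma openin_chart_topology:
  "openin (chart_topology \<sigma>) W \<longleftrightarrow> W \<subseteq> chart \<sigma> \<and>
     (\<forall>x\<in>W. \<exists>q\<in>coordinate_ring \<sigma>. q x \<noteq> (0::'k::field) \<and> {y \<in> chart \<sigma>. q y \<noteq> 0} \<subseteq> W)"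
proof safe
  fix x assume "openin (chart_topology \<sigma>) W" "x \<in> W"
  then show "x \<in> chart \<sigma>"
    using openin_subset topspace_chart_topology by blast
next
  fix x assume W: "openin (chart_topology \<sigma>) W" "x \<in> W"
  let ?P = "\<lambda>W. \<forall>x\<in>W. \<exists>q\<in>coordinate_ring \<sigma>. q x \<noteq> (0::'k) \<and> {y \<in> chart \<sigma>. q y \<noteq> 0} \<subseteq> W"
  have "generate_topology_on {{x \<in> chart \<sigma>. f x \<noteq> 0} | f. f \<in> coordinate_ring \<sigma>} W"
    using W(1) unfolding chart_topology_def openin_topology_generated_by_iff .
  then have "W \<subseteq> chart \<sigma> \<and> ?P W"
  proof induction
    case (Int a b)
    show ?case
    proof (intro conjI ballI)
      fix x assume x: "x \<in> a \<inter> b"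
      obtain q where q: "q \<in> coordinate_ring \<sigma>" "q x \<noteq> 0" "{y \<in> chart \<sigma>. q y \<noteq> 0} \<subseteq> a"
        using Int.IH(1) x by blast
      obtain r where r: "r \<in> coordinate_ring \<sigma>" "r x \<noteq> 0" "{y \<in> chart \<sigma>. r y \<noteq> 0} \<subseteq> b"
        using Int.IH(2) x by blast
      obtain k where k: "k \<in> coordinate_ring \<sigma>" "\<And>x. x \<in> chart \<sigma> \<Longrightarrow> k x = q x * r x"
        using coordinate_ring_mult[OF q(1) r(1)] by metis
      have "x \<in> chart \<sigma>"
        using Int.IH x by blast
      then show "\<exists>q\<in>coordinate_ring \<sigma>. q x \<noteq> 0 \<and> {y \<in> chart \<sigma>. q y \<noteq> 0} \<subseteq> a \<inter> b"
        using k q r by (intro bexI[of _ k]) auto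
    qed (use Int.IH in blast)
  next
    case (UN K)
    show ?case
    proof (intro conjI ballI)
      show "\<Union>K \<subseteq> chart \<sigma>"
        using UN.IH by blast
      fix x assume "x \<in> \<Union>K"
      then obtain k where k: "k \<in> K" "x \<in> k" by blast
      then obtain q where "q \<in> coordinate_ring \<sigma>" "q x \<noteq> 0" "{y \<in> chart \<sigma>. q y \<noteq> 0} \<subseteq> k"
        using UN.IH by blast
      then show "\<exists>q\<in>coordinate_ring \<sigma>. q x \<noteq> 0 \<and> {y \<in> chart \<sigma>. q y \<noteq> 0} \<subseteq> \<Union>K"
        using k(1) by (intro bexI[of _ q]) auto
    qed
  next
    case (Basis s)
    then obtain f where "f \<in> coordinate_ring \<sigma>" "s = {x \<in> chart \<sigma>. f x \<noteq> 0}" by blast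
    then show ?case by (intro conjI ballI bexI[of _ f]) auto
  qed simp
  then show "\<exists>q\<in>coordinate_ring \<sigma>. q x \<noteq> 0 \<and> {y \<in> chart \<sigma>. q y \<noteq> 0} \<subseteq> W"
    using W(2) by blast
next
  assume W: "W \<subseteq> chart \<sigma>" "\<forall>x\<in>W. \<exists>q\<in>coordinate_ring \<sigma>. q x \<noteq> 0 \<and> {y \<in> chart \<sigma>. q y \<noteq> 0} \<subseteq> W"
  have "openin (chart_topology \<sigma>) {y \<in> chart \<sigma>. q y \<noteq> 0}" if "q \<in> coordinate_ring \<sigma>" for q
    unfolding chart_topology_def using that by (intro topology_generated_by_Basis) blast
  note principal = this
  have "\<exists>T. openin (chart_topology \<sigma>) T \<and> x \<in> T \<and> T \<subseteq> W" if x: "x \<in> W" for x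
  proof -
    obtain q where "q \<in> coordinate_ring \<sigma>" "q x \<noteq> 0" "{y \<in> chart \<sigma>. q y \<noteq> 0} \<subseteq> W"
      using W(2) x by blast
    then show ?thesis
      using principal[of q] W(1) x by (intro exI[of _ "{y \<in> chart \<sigma>. q y \<noteq> 0}"]) auto
  qed
  then show "openin (chart_topology \<sigma>) W"
    by (subst openin_subopen) blast
qed

lemma openin_principal:
  "q \<in> coordinate_ring \<sigma> \<Longrightarrow> openin (chart_topology \<sigma>) {y \<in> chart \<sigma>. q y \<noteq> (0::'k::field)}"
  unfolding openin_chart_topology by blast

text \<open>A normal form for regular germs: the fraction is valid wherever its denominator is
  nonzero, so no neighbourhood has to be carried along.\<close>

definition local_fraction ::
    "'v set \<Rightarrow> ('v, 'k::field) chart_point \<Rightarrow> (('v, 'k) chart_point \<Rightarrow> 'k) \<Rightarrow>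
      (('v, 'k) chart_point \<Rightarrow> 'k) \<Rightarrow> (('v, 'k) chart_point \<Rightarrow> 'k) \<Rightarrow> bool" where
  "local_fraction \<sigma> x f g h \<longleftrightarrow> g \<in> coordinate_ring \<sigma> \<and> h \<in> coordinate_ring \<sigma> \<and> h x \<noteq> 0 \<and>
     (\<forall>y\<in>chart \<sigma>. h y \<noteq> 0 \<longrightarrow> f y = g y / h y)"

text \<open>Numerator and denominator are multiplied by a function \<open>q\<close> whose principal
  open set lies in the given neighbourhood; where the new denominator is nonzero, the old fraction
  applies.\<close>

lemma chart_regularD:
  assumes "chart_regular \<sigma> W f" "x \<in> W" "W \<subseteq> chart \<sigma>"
  shows "\<exists>g h. local_fraction \<sigma> x f g h \<and> {y \<in> chart \<sigma>. h y \<noteq> 0} \<subseteq> W"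
proof -
  obtain W' g h where W': "openin (chart_topology \<sigma>) W'" "x \<in> W'" "W' \<subseteq> W"
    and gh: "g \<in> coordinate_ring \<sigma>" "h \<in> coordinate_ring \<sigma>" "\<forall>y\<in>W'. h y \<noteq> 0 \<and> f y = g y / h y"
    using bspec[OF assms(1)[unfolded chart_regular_def] assms(2)]
    by (elim exE conjE bexE) (rule that)
  obtain q where q: "q \<in> coordinate_ring \<sigma>" "q x \<noteq> 0" "{y \<in> chart \<sigma>. q y \<noteq> 0} \<subseteq> W'"
    using W'(1,2) unfolding openin_chart_topology by blast
  obtain g' where g': "g' \<in> coordinate_ring \<sigma>" "\<And>x. x \<in> chart \<sigma> \<Longrightarrow> g' x = g x * q x"
    using coordinate_ring_mult[OF gh(1) q(1)] by metis
  obtain h' where h': "h' \<in> coordinate_ring \<sigma>" "\<And>x. x \<in> chart \<sigma> \<Longrightarrow> h' x = h x * q x"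
    using coordinate_ring_mult[OF gh(2) q(1)] by metis
  have x: "x \<in> chart \<sigma>"
    using assms by blast
  have W'y: "y \<in> W'" if "y \<in> chart \<sigma>" "h' y \<noteq> 0" for y
    using that h'(2) q(3) by auto
  have "local_fraction \<sigma> x f g' h'"
    unfolding local_fraction_def
    using g' h' gh(3) W'(2) q(2) x W'y by (auto simp: divide_simps)
  then show ?thesis
    using W'y W'(3) by blast
qed

lemma chart_regularI:
  assumes "\<And>x. x \<in> W \<Longrightarrow> \<exists>g h. local_fraction \<sigma> x f g h \<and> {y \<in> chart \<sigma>. h y \<noteq> 0} \<subseteq> W"
    and "W \<subseteq> chart \<sigma>"
  shows "chart_regular \<sigma> W f"
  unfolding chart_regular_def
proof
  fix x assume x: "x \<in> W"
  then obtain g h where gh: "local_fraction \<sigma> x f g h" "{y \<in> chart \<sigma>. h y \<noteq> 0} \<subseteq> W"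
    using assms(1) by blast
  then show "\<exists>W'. openin (chart_topology \<sigma>) W' \<and> x \<in> W' \<and> W' \<subseteq> W \<and>
      (\<exists>g\<in>coordinate_ring \<sigma>. \<exists>h\<in>coordinate_ring \<sigma>. \<forall>y\<in>W'. h y \<noteq> 0 \<and> f y = g y / h y)"
    using x assms(2) openin_principal[of h \<sigma>]
    by (intro exI[of _ "{y \<in> chart \<sigma>. h y \<noteq> 0}"]) (auto simp: local_fraction_def)
qed

subsection \<open>Regular germs on the variety\<close>

lemma local_fraction_shrink:
  assumes "local_fraction \<sigma> x f g h" "q \<in> coordinate_ring \<sigma>" "q x \<noteq> 0" "x \<in> chart \<sigma>"
  shows "\<exists>g' h'. local_fraction \<sigma> x f g' h' \<and> {y \<in> chart \<sigma>. h' y \<noteq> 0} \<subseteq> {y \<in> chart \<sigma>. q y \<noteq> 0}"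
proof -
  have gh: "g \<in> coordinate_ring \<sigma>" "h \<in> coordinate_ring \<sigma>" "h x \<noteq> 0"
      "\<And>y. y \<in> chart \<sigma> \<Longrightarrow> h y \<noteq> 0 \<Longrightarrow> f y = g y / h y"
    using assms(1) by (auto simp: local_fraction_def)
  obtain g' where g': "g' \<in> coordinate_ring \<sigma>" "\<And>x. x \<in> chart \<sigma> \<Longrightarrow> g' x = g x * q x"
    using coordinate_ring_mult[OF gh(1) assms(2)] by metis
  obtain h' where h': "h' \<in> coordinate_ring \<sigma>" "\<And>x. x \<in> chart \<sigma> \<Longrightarrow> h' x = h x * q x"
    using coordinate_ring_mult[OF gh(2) assms(2)] by metis
  have "local_fraction \<sigma> x f g' h'"
    unfolding local_fraction_def using g' h' gh assms(3,4) by auto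
  then show ?thesis
    using h'(2) by (intro exI[of _ g'] exI[of _ h']) auto
qed

lemma local_fraction_down:
  assumes fan: "fan \<Sigma>" and "\<tau> \<in> \<Sigma>" "\<omega> \<in> \<Sigma>" "\<omega> \<subseteq> \<tau>" "z \<in> chart \<omega>"
    and "local_fraction \<tau> (restrict z (dual_monoid \<tau>)) (F \<circ> chart_map \<Sigma> \<tau>) g h"
  shows "local_fraction \<omega> z (F \<circ> chart_map \<Sigma> \<omega>) g h"
proof -
  have gh: "g \<in> coordinate_ring \<tau>" "h \<in> coordinate_ring \<tau>" "h (restrict z (dual_monoid \<tau>)) \<noteq> 0"
      "\<And>y. y \<in> chart \<tau> \<Longrightarrow> h y \<noteq> 0 \<Longrightarrow> F (chart_map \<Sigma> \<tau> y) = g y / h y"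
    using assms(6) by (auto simp: local_fraction_def)
  have "F (chart_map \<Sigma> \<omega> y) = g y / h y" if "y \<in> chart \<omega>" "h y \<noteq> 0" for y
    using gh(4)[OF chart_restrict[OF assms(4) that(1)]] that(2) chart_map_restrict[OF fan assms(2,3,4) that(1)]
    by (simp add: coordinate_ring_restrict[OF gh(1)] coordinate_ring_restrict[OF gh(2)])
  then show ?thesis
    using gh(1-3) coordinate_ring_antimono[OF assms(4)]
    by (auto simp: local_fraction_def coordinate_ring_restrict[OF gh(2)])
qed

lemma eventually_uniform:
  fixes P :: "'i \<Rightarrow> nat \<Rightarrow> bool"
  assumes "finite F" "\<And>m. m \<in> F \<Longrightarrow> \<exists>k. \<forall>j\<ge>k. P m j"
  shows "\<exists>k. \<forall>m\<in>F. P m k"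
proof -
  obtain K where K: "\<And>m j. m \<in> F \<Longrightarrow> K m \<le> j \<Longrightarrow> P m j"
    using assms(2) by metis
  have "P m (sum K F)" if "m \<in> F" for m
    using K[OF that member_le_sum[OF that _ assms(1), of K]] by simp
  then show ?thesis by blast
qed

text \<open>A function on the chart of a face has only powers of \<open>u\<close> as denominators;
  one exponent serves the finitely many characters that occur in it.\<close>

lemma coordinate_ring_face:
  assumes "rational_cone \<sigma>" "u \<in> dual_monoid \<sigma>" "\<tau> = {v \<in> \<sigma>. u v = 0}" "g \<in> coordinate_ring \<tau>"
  obtains g' k where "g' \<in> coordinate_ring \<sigma>" "\<forall>z\<in>chart \<tau>. g z * z u ^ k = g' z"
proof -
  obtain F c where F: "finite F" "F \<subseteq> dual_monoid \<tau>" "g = (\<lambda>x. \<Sum>m\<in>F. c m * x m)"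
    using assms(4) by (rule coordinate_ringE)
  obtain k where k: "\<forall>m\<in>F. (\<lambda>v. m v + of_nat k * u v) \<in> dual_monoid \<sigma>"
    using eventually_uniform[OF F(1), of "\<lambda>m j. (\<lambda>v. m v + of_nat j * u v) \<in> dual_monoid \<sigma>"]
      dual_monoid_face_shift[OF assms(1,2), folded assms(3)] F(2) by blast
  define g' where "g' = (\<lambda>x. \<Sum>m\<in>F. c m * x (\<lambda>v. m v + of_nat k * u v))"
  have "g' \<in> coordinate_ring \<sigma>"
    unfolding g'_def using k by (intro coordinate_ring_sum coordinate_ring_cmult coordinate_ring_char) auto
  moreover have "g z * z u ^ k = g' z" if "z \<in> chart \<tau>" for z
    unfolding F(3) g'_def sum_distrib_right
    using F(2) dual_monoid_antimono[of \<tau> \<sigma>] assms(2,3)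
    by (intro sum.cong refl) (auto simp: chart_add_nat[OF that] subset_iff)
  ultimately show thesis using that by blast
qed

lemma local_fraction_up:
  assumes fan: "fan \<Sigma>" and \<sigma>: "\<sigma> \<in> \<Sigma>" and \<tau>: "\<tau> \<in> \<Sigma>" "face_of \<tau> \<sigma>" and z: "z \<in> chart \<tau>"
    and frac: "local_fraction \<tau> z (F \<circ> chart_map \<Sigma> \<tau>) g h"
  shows "\<exists>g' h'. local_fraction \<sigma> (restrict z (dual_monoid \<sigma>)) (F \<circ> chart_map \<Sigma> \<sigma>) g' h'"
proof -
  obtain u where u: "u \<in> dual_monoid \<sigma>" "\<tau> = {v \<in> \<sigma>. u v = 0}"
    using face_by_dual_monoid[OF \<tau>(2)] by blast
  have sub: "\<tau> \<subseteq> \<sigma>"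
    using u(2) by blast
  have gh: "g \<in> coordinate_ring \<tau>" "h \<in> coordinate_ring \<tau>" "h z \<noteq> 0"
      "\<And>y. y \<in> chart \<tau> \<Longrightarrow> h y \<noteq> 0 \<Longrightarrow> F (chart_map \<Sigma> \<tau> y) = g y / h y"
    using frac by (auto simp: local_fraction_def)
  obtain g1 k where g1: "g1 \<in> coordinate_ring \<sigma>" "\<forall>z\<in>chart \<tau>. g z * z u ^ k = g1 z"
    using coordinate_ring_face[OF fan_rational[OF fan \<sigma>] u gh(1)] .
  obtain h1 l where h1: "h1 \<in> coordinate_ring \<sigma>" "\<forall>z\<in>chart \<tau>. h z * z u ^ l = h1 z"
    using coordinate_ring_face[OF fan_rational[OF fan \<sigma>] u gh(2)] .
  \<comment> \<open>Both \<open>g\<close> and \<open>h\<close> end up multiplied by \<open>u\<close>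
    to the power \<open>k + l + 1\<close>. The additional factor, present even if
    \<open>k = l = 0\<close>, makes \<open>h'\<close> vanish off the chart of the face, where
    nothing is known about \<open>F\<close>.\<close>
  obtain g' where g': "g' \<in> coordinate_ring \<sigma>" "\<And>x. x \<in> chart \<sigma> \<Longrightarrow> g' x = g1 x * x (\<lambda>v. of_nat (Suc l) * u v)"
    using coordinate_ring_mult[OF g1(1) coordinate_ring_char[OF dual_monoid_nat[OF u(1)]]] by metis
  obtain h' where h': "h' \<in> coordinate_ring \<sigma>" "\<And>x. x \<in> chart \<sigma> \<Longrightarrow> h' x = h1 x * x (\<lambda>v. of_nat (Suc k) * u v)"
    using coordinate_ring_mult[OF h1(1) coordinate_ring_char[OF dual_monoid_nat[OF u(1)]]] by metis
  have zu: "z u \<noteq> 0" if "z \<in> chart \<tau>" for z :: "('v, 'a) chart_point"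
    using face_unit[OF u(1)] that u(2) by blast
  have val: "g' (restrict z (dual_monoid \<sigma>)) = g z * z u ^ (k + Suc l)"
      "h' (restrict z (dual_monoid \<sigma>)) = h z * z u ^ (l + Suc k)" if z: "z \<in> chart \<tau>" for z
    using g'(2)[OF chart_restrict[OF sub z]] h'(2)[OF chart_restrict[OF sub z]]
      bspec[OF g1(2) z, symmetric] bspec[OF h1(2) z, symmetric] chart_nat[OF chart_restrict[OF sub z] u(1)] u(1)
      coordinate_ring_restrict[OF g1(1), of z] coordinate_ring_restrict[OF h1(1), of z]
    by (simp_all add: power_add del: of_nat_Suc)
  have "(F \<circ> chart_map \<Sigma> \<sigma>) y = g' y / h' y" if y: "y \<in> chart \<sigma>" "h' y \<noteq> 0" for y
  proof -
    have "y u \<noteq> 0"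
      using y h'(2)[OF y(1)] chart_nat[OF y(1) u(1), of "Suc k"] by (auto simp del: of_nat_Suc)
    then obtain w where w: "w \<in> chart \<tau>" "restrict w (dual_monoid \<sigma>) = y"
      using face_point_exists[OF fan_rational[OF fan \<sigma>] u(1) y(1)] u(2) by blast
    have "h w \<noteq> 0"
      using val(2)[OF w(1)] w(2) y(2) by auto
    then have "F (chart_map \<Sigma> \<sigma> y) = g w / h w"
      using gh(4)[OF w(1)] chart_map_restrict[OF fan \<sigma> \<tau>(1) sub w(1)] w(2) by simp
    also have "\<dots> = g' y / h' y"
      using val[OF w(1)] w(2) zu[OF w(1)] by (simp add: add.commute)
    finally show ?thesis by simp
  qed
  then have "local_fraction \<sigma> (restrict z (dual_monoid \<sigma>)) (F \<circ> chart_map \<Sigma> \<sigma>) g' h'"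
    using g'(1) h'(1) val(2)[OF z] gh(3) zu[OF z] by (auto simp: local_fraction_def)
  then show ?thesis by blast
qed

text \<open>Regularity of a germ, required in a single chart through the point;
  \<open>regular_at_iff\<close> shows that the choice of the chart does not matter.\<close>

definition regular_at ::
    "'v set set \<Rightarrow> ('v, 'k::field) toric_point \<Rightarrow> (('v, 'k) toric_point \<Rightarrow> 'k) \<Rightarrow> bool" where
  "regular_at \<Sigma> p F \<longleftrightarrow> (\<exists>\<sigma>\<in>\<Sigma>. \<exists>x\<in>chart \<sigma>. p = chart_map \<Sigma> \<sigma> x \<and>
     (\<exists>g h. local_fraction \<sigma> x (F \<circ> chart_map \<Sigma> \<sigma>) g h))"

text \<open>Two charts through the point are compared on the chart of the common face: a fraction
  restricts to it from one side and extends from it on the other.\<close>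

lemma regular_at_iff:
  assumes fan: "fan \<Sigma>" and \<sigma>: "\<sigma> \<in> \<Sigma>" "x \<in> chart \<sigma>"
  shows "regular_at \<Sigma> (chart_map \<Sigma> \<sigma> x) F \<longleftrightarrow> (\<exists>g h. local_fraction \<sigma> x (F \<circ> chart_map \<Sigma> \<sigma>) g h)"
proof
  assume "regular_at \<Sigma> (chart_map \<Sigma> \<sigma> x) F"
  then obtain \<tau> y g h where \<tau>: "\<tau> \<in> \<Sigma>" "y \<in> chart \<tau>" "chart_map \<Sigma> \<sigma> x = chart_map \<Sigma> \<tau> y"
      and gh: "local_fraction \<tau> y (F \<circ> chart_map \<Sigma> \<tau>) g h"
    unfolding regular_at_def by blast
  obtain z where z: "z \<in> chart (\<sigma> \<inter> \<tau>)" "x = restrict z (dual_monoid \<sigma>)" "y = restrict z (dual_monoid \<tau>)"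
    using \<tau>(3) chart_map_eq_iff[OF fan \<sigma>(1) \<tau>(1) \<sigma>(2) \<tau>(2)] by blast
  have \<omega>: "\<sigma> \<inter> \<tau> \<in> \<Sigma>"
    using fan_Int[OF fan \<sigma>(1) \<tau>(1)] .
  have "local_fraction (\<sigma> \<inter> \<tau>) z (F \<circ> chart_map \<Sigma> (\<sigma> \<inter> \<tau>)) g h"
    using local_fraction_down[OF fan \<tau>(1) \<omega> _ z(1)] gh z(3) by simp
  then show "\<exists>g h. local_fraction \<sigma> x (F \<circ> chart_map \<Sigma> \<sigma>) g h"
    using local_fraction_up[OF fan \<sigma>(1) \<omega> fan_Int_face[OF fan \<sigma>(1) \<tau>(1)] z(1)] z(2) by simp
qed (use \<sigma> in \<open>auto simp: regular_at_def\<close>)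

lemma regular_atE:
  assumes "fan \<Sigma>" "\<sigma> \<in> \<Sigma>" "x \<in> chart \<sigma>" "regular_at \<Sigma> (chart_map \<Sigma> \<sigma> x) F"
  obtains g h where "local_fraction \<sigma> x (F \<circ> chart_map \<Sigma> \<sigma>) g h"
  using assms(4) unfolding regular_at_iff[OF assms(1-3)] by blast

lemma regular_atI:
  assumes "fan \<Sigma>" "\<sigma> \<in> \<Sigma>" "x \<in> chart \<sigma>" "local_fraction \<sigma> x (F \<circ> chart_map \<Sigma> \<sigma>) g h"
  shows "regular_at \<Sigma> (chart_map \<Sigma> \<sigma> x) F"
  using assms(4) unfolding regular_at_iff[OF assms(1-3)] by blast

lemma regular_atD:
  assumes "fan \<Sigma>" "openin (toric_topology \<Sigma>) U" "regular_on \<Sigma> U F" "p \<in> U"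
  shows "regular_at \<Sigma> p F"
proof -
  have "p \<in> toric_variety \<Sigma>"
    using assms(2,4) openin_toric_topology by blast
  then obtain \<sigma> x where x: "\<sigma> \<in> \<Sigma>" "x \<in> chart \<sigma>" "p = chart_map \<Sigma> \<sigma> x"
    by (rule toric_varietyE)
  have "chart_regular \<sigma> {x \<in> chart \<sigma>. chart_map \<Sigma> \<sigma> x \<in> U} (F \<circ> chart_map \<Sigma> \<sigma>)"
    using assms(3) x(1) by (simp add: regular_on_def)
  from chart_regularD[OF this, of x] show ?thesis
    unfolding x(3) regular_at_iff[OF assms(1) x(1,2)] using x(2,3) assms(4) by auto
qed

lemma regular_onI:
  assumes "fan \<Sigma>" "openin (toric_topology \<Sigma>) U" "\<And>p. p \<in> U \<Longrightarrow> regular_at \<Sigma> p F"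
  shows "regular_on \<Sigma> U F"
  unfolding regular_on_def
proof
  fix \<sigma> assume \<sigma>: "\<sigma> \<in> \<Sigma>"
  show "chart_regular \<sigma> {x \<in> chart \<sigma>. chart_map \<Sigma> \<sigma> x \<in> U} (F \<circ> chart_map \<Sigma> \<sigma>)"
  proof (rule chart_regularI)
    fix x assume x: "x \<in> {x \<in> chart \<sigma>. chart_map \<Sigma> \<sigma> x \<in> U}"
    then have xc: "x \<in> chart \<sigma>" and xr: "regular_at \<Sigma> (chart_map \<Sigma> \<sigma> x) F"
      using assms(3) by auto
    obtain g h where gh: "local_fraction \<sigma> x (F \<circ> chart_map \<Sigma> \<sigma>) g h"
      using regular_atE[OF assms(1) \<sigma> xc xr] .
    have "openin (chart_topology \<sigma>) {x \<in> chart \<sigma>. chart_map \<Sigma> \<sigma> x \<in> U}"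
      using assms(2) \<sigma> by (simp add: openin_toric_topology)
    then obtain q where q: "q \<in> coordinate_ring \<sigma>" "q x \<noteq> 0"
        "{y \<in> chart \<sigma>. q y \<noteq> 0} \<subseteq> {x \<in> chart \<sigma>. chart_map \<Sigma> \<sigma> x \<in> U}"
      using x unfolding openin_chart_topology by blast
    obtain g' h' where "local_fraction \<sigma> x (F \<circ> chart_map \<Sigma> \<sigma>) g' h'"
        "{y \<in> chart \<sigma>. h' y \<noteq> 0} \<subseteq> {y \<in> chart \<sigma>. q y \<noteq> 0}"
      using local_fraction_shrink[OF gh q(1,2) xc] by blast
    then show "\<exists>g h. local_fraction \<sigma> x (F \<circ> chart_map \<Sigma> \<sigma>) g h \<and>
        {y \<in> chart \<sigma>. h y \<noteq> 0} \<subseteq> {x \<in> chart \<sigma>. chart_map \<Sigma> \<sigma> x \<in> U}"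
      using q(3) by (intro exI[of _ g'] exI[of _ h']) auto
  qed auto
qed

text \<open>The definition of an endomorphism speaks of functions regular on open sets. Applied to
  the open set where \<open>F\<close> is regular, it yields a statement about single germs.\<close>

lemma openin_regular_locus:
  assumes "fan \<Sigma>"
  shows "openin (toric_topology \<Sigma>) {p \<in> toric_variety \<Sigma>. regular_at \<Sigma> p F}"
  unfolding openin_toric_topology
proof (intro conjI ballI)
  fix \<sigma> assume \<sigma>: "\<sigma> \<in> \<Sigma>"
  show "openin (chart_topology \<sigma>)
      {x \<in> chart \<sigma>. chart_map \<Sigma> \<sigma> x \<in> {p \<in> toric_variety \<Sigma>. regular_at \<Sigma> p F}}"
    unfolding openin_chart_topology
  proof (intro conjI ballI)
    fix x assume x: "x \<in> {x \<in> chart \<sigma>. chart_map \<Sigma> \<sigma> x \<in> {p \<in> toric_variety \<Sigma>. regular_at \<Sigma> p F}}"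
    then have xc: "x \<in> chart \<sigma>" and xr: "regular_at \<Sigma> (chart_map \<Sigma> \<sigma> x) F"
      by auto
    obtain g h where gh: "local_fraction \<sigma> x (F \<circ> chart_map \<Sigma> \<sigma>) g h"
      using regular_atE[OF assms \<sigma> xc xr] .
    have "regular_at \<Sigma> (chart_map \<Sigma> \<sigma> y) F" if "y \<in> chart \<sigma>" "h y \<noteq> 0" for y
    proof -
      have "local_fraction \<sigma> y (F \<circ> chart_map \<Sigma> \<sigma>) g h"
        using gh that(2) by (simp add: local_fraction_def)
      then show ?thesis
        by (rule regular_atI[OF assms \<sigma> that(1)])
    qed
    then show "\<exists>q\<in>coordinate_ring \<sigma>. q x \<noteq> 0 \<and> {y \<in> chart \<sigma>. q y \<noteq> 0} \<subseteq>
        {x \<in> chart \<sigma>. chart_map \<Sigma> \<sigma> x \<in> {p \<in> toric_variety \<Sigma>. regular_at \<Sigma> p F}}"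
      using gh chart_map_mem[OF \<sigma>] by (intro bexI[of _ h]) (auto simp: local_fraction_def)
  qed auto
qed auto

subsection \<open>Endomorphisms\<close>

lemma endomorphism_mem: "endomorphism \<Sigma> \<phi> \<Longrightarrow> p \<in> toric_variety \<Sigma> \<Longrightarrow> \<phi> p \<in> toric_variety \<Sigma>"
  unfolding endomorphism_def continuous_map_def topspace_toric_topology by auto

lemma endomorphism_regular_at:
  assumes "fan \<Sigma>" "endomorphism \<Sigma> \<phi>" "p \<in> toric_variety \<Sigma>" "regular_at \<Sigma> (\<phi> p) F"
  shows "regular_at \<Sigma> p (F \<circ> \<phi>)"
proof -
  let ?U = "{p \<in> toric_variety \<Sigma>. regular_at \<Sigma> p F}"
  have U: "openin (toric_topology \<Sigma>) ?U" "\<phi> p \<in> ?U"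
    using openin_regular_locus[OF assms(1)] endomorphism_mem[OF assms(2,3)] assms(4) by auto
  have "regular_on \<Sigma> ?U F"
    using U(1) by (intro regular_onI[OF assms(1)]) auto
  then have "regular_on \<Sigma> {p \<in> toric_variety \<Sigma>. \<phi> p \<in> ?U} (F \<circ> \<phi>)"
    using assms(2) U(1) unfolding endomorphism_def by blast
  moreover have "openin (toric_topology \<Sigma>) {p \<in> toric_variety \<Sigma>. \<phi> p \<in> ?U}"
    using assms(2) U(1) unfolding endomorphism_def continuous_map_def topspace_toric_topology by blast
  ultimately show ?thesis
    using regular_atD[OF assms(1)] assms(3) U(2) by blast
qed

lemma coordinate_ring_pullback:
  assumes h: "h \<in> coordinate_ring \<sigma>"
    and pull: "\<And>m. m \<in> dual_monoid \<tau> \<Longrightarrow>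
      \<exists>g\<in>coordinate_ring \<sigma>. \<exists>k. \<forall>y\<in>chart \<sigma>. h y \<noteq> 0 \<longrightarrow> \<Phi> y m * h y ^ k = g y"
    and "G \<in> coordinate_ring \<tau>"
  shows "\<exists>g\<in>coordinate_ring \<sigma>. \<exists>k. \<forall>y\<in>chart \<sigma>. h y \<noteq> 0 \<longrightarrow> G (\<Phi> y) * h y ^ k = g y"
proof -
  obtain F c where F: "finite F" "F \<subseteq> dual_monoid \<tau>" "G = (\<lambda>x. \<Sum>m\<in>F. c m * x m)"
    using assms(3) by (rule coordinate_ringE)
  show ?thesis
    unfolding F(3) using F(1,2)
  proof (induction F)
    case empty
    then show ?case
      using coordinate_ring_zero by (intro bexI[of _ "\<lambda>_. 0"]) auto
  next
    case (insert m F)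
    then obtain g k where g: "g \<in> coordinate_ring \<sigma>"
        "\<And>y. y \<in> chart \<sigma> \<Longrightarrow> h y \<noteq> 0 \<Longrightarrow> (\<Sum>m\<in>F. c m * \<Phi> y m) * h y ^ k = g y"
      by auto
    obtain g1 l where g1: "g1 \<in> coordinate_ring \<sigma>"
        "\<And>y. y \<in> chart \<sigma> \<Longrightarrow> h y \<noteq> 0 \<Longrightarrow> \<Phi> y m * h y ^ l = g1 y"
      using pull[of m] insert.prems by auto
    obtain hk where hk: "hk \<in> coordinate_ring \<sigma>" "\<And>y. y \<in> chart \<sigma> \<Longrightarrow> hk y = h y ^ k"
      using coordinate_ring_power[OF h, of k] by auto
    obtain hl where hl: "hl \<in> coordinate_ring \<sigma>" "\<And>y. y \<in> chart \<sigma> \<Longrightarrow> hl y = h y ^ l"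
      using coordinate_ring_power[OF h, of l] by auto
    obtain a where a: "a \<in> coordinate_ring \<sigma>" "\<And>y. y \<in> chart \<sigma> \<Longrightarrow> a y = g y * hl y"
      using coordinate_ring_mult[OF g(1) hl(1)] by metis
    obtain b where b: "b \<in> coordinate_ring \<sigma>" "\<And>y. y \<in> chart \<sigma> \<Longrightarrow> b y = g1 y * hk y"
      using coordinate_ring_mult[OF g1(1) hk(1)] by metis
    have "(\<Sum>m\<in>insert m F. c m * \<Phi> y m) * h y ^ (k + l) = c m * b y + a y"
      if y: "y \<in> chart \<sigma>" "h y \<noteq> 0" for y
      using insert.hyps g(2)[OF y, symmetric] g1(2)[OF y, symmetric] a(2)[OF y(1)] b(2)[OF y(1)]
        hk(2)[OF y(1)] hl(2)[OF y(1)] by (simp add: power_add algebra_simps)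
    moreover have "(\<lambda>y. c m * b y + a y) \<in> coordinate_ring \<sigma>"
      using a(1) b(1) by (intro coordinate_ring_add coordinate_ring_cmult)
    ultimately show ?case
      by (intro bexI[of _ "\<lambda>y. c m * b y + a y"] exI[of _ "k + l"]) auto
  qed
qed

text \<open>A morphism in coordinates: on the principal open set of \<open>h\<close> in the chart of
  \<open>\<sigma>\<close>, the map \<open>\<phi>\<close> is given by \<open>\<Phi>\<close> with
  values in one chart, and the coordinates of \<open>\<Phi>\<close> are regular there, that is,
  fractions with powers of \<open>h\<close> as denominators.\<close>

definition local_lift ::
    "'v set set \<Rightarrow> (('v, 'k::field) toric_point \<Rightarrow> ('v, 'k) toric_point) \<Rightarrow> 'v set \<Rightarrow> 'v set \<Rightarrow>
      (('v, 'k) chart_point \<Rightarrow> 'k) \<Rightarrow> (('v, 'k) chart_point \<Rightarrow> ('v, 'k) chart_point) \<Rightarrow> bool" where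
  "local_lift \<Sigma> \<phi> \<sigma> \<tau> h \<Phi> \<longleftrightarrow> \<tau> \<in> \<Sigma> \<and> h \<in> coordinate_ring \<sigma> \<and>
     (\<forall>y\<in>chart \<sigma>. h y \<noteq> 0 \<longrightarrow> \<Phi> y \<in> chart \<tau> \<and> \<phi> (chart_map \<Sigma> \<sigma> y) = chart_map \<Sigma> \<tau> (\<Phi> y)) \<and>
     (\<forall>m\<in>dual_monoid \<tau>. \<exists>g\<in>coordinate_ring \<sigma>. \<exists>k. \<forall>y\<in>chart \<sigma>. h y \<noteq> 0 \<longrightarrow> \<Phi> y m * h y ^ k = g y)"

lemma local_liftI:
  assumes "\<tau> \<in> \<Sigma>" "h \<in> coordinate_ring \<sigma>"
    and "\<And>y. y \<in> chart \<sigma> \<Longrightarrow> h y \<noteq> 0 \<Longrightarrow> \<Phi> y \<in> chart \<tau>"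
    and "\<And>y. y \<in> chart \<sigma> \<Longrightarrow> h y \<noteq> 0 \<Longrightarrow> \<phi> (chart_map \<Sigma> \<sigma> y) = chart_map \<Sigma> \<tau> (\<Phi> y)"
    and "\<And>m. m \<in> dual_monoid \<tau> \<Longrightarrow>
      \<exists>g\<in>coordinate_ring \<sigma>. \<exists>k. \<forall>y\<in>chart \<sigma>. h y \<noteq> 0 \<longrightarrow> \<Phi> y m * h y ^ k = g y"
  shows "local_lift \<Sigma> \<phi> \<sigma> \<tau> h \<Phi>"
  using assms by (simp add: local_lift_def)

lemma local_liftD:
  assumes "local_lift \<Sigma> \<phi> \<sigma> \<tau> h \<Phi>"
  shows "\<tau> \<in> \<Sigma>" "h \<in> coordinate_ring \<sigma>"
    "\<And>y. y \<in> chart \<sigma> \<Longrightarrow> h y \<noteq> 0 \<Longrightarrow> \<Phi> y \<in> chart \<tau>"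
    "\<And>y. y \<in> chart \<sigma> \<Longrightarrow> h y \<noteq> 0 \<Longrightarrow> \<phi> (chart_map \<Sigma> \<sigma> y) = chart_map \<Sigma> \<tau> (\<Phi> y)"
    "\<And>G. G \<in> coordinate_ring \<tau> \<Longrightarrow>
      \<exists>g\<in>coordinate_ring \<sigma>. \<exists>k. \<forall>y\<in>chart \<sigma>. h y \<noteq> 0 \<longrightarrow> G (\<Phi> y) * h y ^ k = g y"
  using assms coordinate_ring_pullback[of h \<sigma> \<tau> \<Phi>] by (auto simp: local_lift_def)

text \<open>Continuity and the pullback of regular functions are both local, and a fraction on the
  target pulls back to a fraction once the powers of \<open>h\<close> are cleared.\<close>

lemma endomorphismI:
  fixes \<phi> :: "('v, 'k::field) toric_point \<Rightarrow> ('v, 'k) toric_point"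
  assumes fan: "fan \<Sigma>"
    and loc: "\<And>\<sigma> x. \<sigma> \<in> \<Sigma> \<Longrightarrow> x \<in> chart \<sigma> \<Longrightarrow> \<exists>\<tau> h \<Phi>. local_lift \<Sigma> \<phi> \<sigma> \<tau> h \<Phi> \<and> h x \<noteq> 0"
  shows "endomorphism \<Sigma> \<phi>"
proof -
  have mem: "\<phi> p \<in> toric_variety \<Sigma>" if "p \<in> toric_variety \<Sigma>" for p
    using that
  proof (rule toric_varietyE)
    fix \<sigma> x assume x: "\<sigma> \<in> \<Sigma>" "x \<in> chart \<sigma>" "p = chart_map \<Sigma> \<sigma> x"
    obtain \<tau> h \<Phi> where lift: "local_lift \<Sigma> \<phi> \<sigma> \<tau> h \<Phi>" "h x \<noteq> 0"
      using loc[OF x(1,2)] by blast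
    show ?thesis
      unfolding x(3) local_liftD(4)[OF lift(1) x(2) lift(2)]
      using chart_map_mem[OF local_liftD(1,3)[OF lift(1)]] x(2) lift(2) by blast
  qed
  have cont: "openin (toric_topology \<Sigma>) {p \<in> toric_variety \<Sigma>. \<phi> p \<in> U}"
    if U: "openin (toric_topology \<Sigma>) U" for U :: "('v, 'k) toric_point set"
    unfolding openin_toric_topology
  proof (intro conjI ballI)
    fix \<sigma> assume \<sigma>: "\<sigma> \<in> \<Sigma>"
    show "openin (chart_topology \<sigma>) {x \<in> chart \<sigma>. chart_map \<Sigma> \<sigma> x \<in> {p \<in> toric_variety \<Sigma>. \<phi> p \<in> U}}"
      unfolding openin_chart_topology
    proof (intro conjI ballI)
      fix x assume x: "x \<in> {x \<in> chart \<sigma>. chart_map \<Sigma> \<sigma> x \<in> {p \<in> toric_variety \<Sigma>. \<phi> p \<in> U}}"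
      then have xc: "x \<in> chart \<sigma>" by simp
      show "\<exists>q\<in>coordinate_ring \<sigma>. q x \<noteq> 0 \<and>
          {y \<in> chart \<sigma>. q y \<noteq> 0} \<subseteq> {x \<in> chart \<sigma>. chart_map \<Sigma> \<sigma> x \<in> {p \<in> toric_variety \<Sigma>. \<phi> p \<in> U}}"
      proof -
        obtain \<tau> h \<Phi> where lift: "local_lift \<Sigma> \<phi> \<sigma> \<tau> h \<Phi>" and hx: "h x \<noteq> 0"
          using loc[OF \<sigma> xc] by blast
        note \<tau> = local_liftD(1)[OF lift] and h = local_liftD(2)[OF lift] hx
          and \<Phi> = local_liftD(3,4)[OF lift] and pull = local_liftD(5)[OF lift]
        have "openin (chart_topology \<tau>) {y \<in> chart \<tau>. chart_map \<Sigma> \<tau> y \<in> U}"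
          using U \<tau> by (simp add: openin_toric_topology)
        then obtain q where q: "q \<in> coordinate_ring \<tau>" "q (\<Phi> x) \<noteq> 0"
            "{y \<in> chart \<tau>. q y \<noteq> 0} \<subseteq> {y \<in> chart \<tau>. chart_map \<Sigma> \<tau> y \<in> U}"
          using x \<Phi>[OF xc h(2)] unfolding openin_chart_topology by force
        obtain g k where g: "g \<in> coordinate_ring \<sigma>"
            "\<And>y. y \<in> chart \<sigma> \<Longrightarrow> h y \<noteq> 0 \<Longrightarrow> q (\<Phi> y) * h y ^ k = g y"
          using pull[OF q(1)] by auto
        \<comment> \<open>The factor \<open>h\<close> keeps the principal open set of
          \<open>r\<close> inside the domain of the lift.\<close>
        obtain r where r: "r \<in> coordinate_ring \<sigma>" "\<And>y. y \<in> chart \<sigma> \<Longrightarrow> r y = g y * h y"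
          using coordinate_ring_mult[OF g(1) h(1)] by metis
        have "r x \<noteq> 0"
          using r(2)[OF xc] g(2)[OF xc h(2), symmetric] q(2) h(2) by simp
        moreover have "\<phi> (chart_map \<Sigma> \<sigma> y) \<in> U" if y: "y \<in> chart \<sigma>" "r y \<noteq> 0" for y
        proof -
          have hy: "h y \<noteq> 0" and gy: "g y \<noteq> 0"
            using r(2)[OF y(1)] y(2) by auto
          then have "q (\<Phi> y) \<noteq> 0"
            using g(2)[OF y(1) hy] by auto
          then show ?thesis
            using q(3) \<Phi>[OF y(1) hy] by auto
        qed
        ultimately show ?thesis
          using r(1) chart_map_mem[OF \<sigma>] by (intro bexI[of _ r]) auto
      qed
    qed auto
  qed auto
  have reg: "regular_at \<Sigma> p (F \<circ> \<phi>)" if p: "p \<in> toric_variety \<Sigma>" and F: "regular_at \<Sigma> (\<phi> p) F"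
    for p and F :: "('v, 'k) toric_point \<Rightarrow> 'k"
    using p
  proof (rule toric_varietyE)
    fix \<sigma> x assume x: "\<sigma> \<in> \<Sigma>" "x \<in> chart \<sigma>" "p = chart_map \<Sigma> \<sigma> x"
    show ?thesis
    proof -
      obtain \<tau> h \<Phi> where lift: "local_lift \<Sigma> \<phi> \<sigma> \<tau> h \<Phi>" and hx: "h x \<noteq> 0"
        using loc[OF x(1,2)] by blast
      note \<tau> = local_liftD(1)[OF lift] and h = local_liftD(2)[OF lift] hx
        and \<Phi> = local_liftD(3,4)[OF lift] and pull = local_liftD(5)[OF lift]
      obtain a b where ab: "local_fraction \<tau> (\<Phi> x) (F \<circ> chart_map \<Sigma> \<tau>) a b"
        using regular_atE[OF fan \<tau> \<Phi>(1)[OF x(2) h(2)] F[unfolded x(3) \<Phi>(2)[OF x(2) h(2)]]] .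
      then have ab': "a \<in> coordinate_ring \<tau>" "b \<in> coordinate_ring \<tau>" "b (\<Phi> x) \<noteq> 0"
          "\<And>y. y \<in> chart \<tau> \<Longrightarrow> b y \<noteq> 0 \<Longrightarrow> F (chart_map \<Sigma> \<tau> y) = a y / b y"
        by (auto simp: local_fraction_def)
      obtain a1 k where a1: "a1 \<in> coordinate_ring \<sigma>"
          "\<And>y. y \<in> chart \<sigma> \<Longrightarrow> h y \<noteq> 0 \<Longrightarrow> a (\<Phi> y) * h y ^ k = a1 y"
        using pull[OF ab'(1)] by auto
      obtain b1 l where b1: "b1 \<in> coordinate_ring \<sigma>"
          "\<And>y. y \<in> chart \<sigma> \<Longrightarrow> h y \<noteq> 0 \<Longrightarrow> b (\<Phi> y) * h y ^ l = b1 y"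
        using pull[OF ab'(2)] by auto
      \<comment> \<open>The exponents are raised by one so that \<open>b2\<close> vanishes wherever
        \<open>h\<close> does, even for \<open>k = 0\<close>; numerator and denominator are
        multiplied by the same power in total.\<close>
      obtain hk where hk: "hk \<in> coordinate_ring \<sigma>" "\<And>y. y \<in> chart \<sigma> \<Longrightarrow> hk y = h y ^ Suc k"
        using coordinate_ring_power[OF h(1), of "Suc k"] by auto
      obtain hl where hl: "hl \<in> coordinate_ring \<sigma>" "\<And>y. y \<in> chart \<sigma> \<Longrightarrow> hl y = h y ^ Suc l"
        using coordinate_ring_power[OF h(1), of "Suc l"] by auto
      obtain a2 where a2: "a2 \<in> coordinate_ring \<sigma>" "\<And>y. y \<in> chart \<sigma> \<Longrightarrow> a2 y = a1 y * hl y"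
        using coordinate_ring_mult[OF a1(1) hl(1)] by metis
      obtain b2 where b2: "b2 \<in> coordinate_ring \<sigma>" "\<And>y. y \<in> chart \<sigma> \<Longrightarrow> b2 y = b1 y * hk y"
        using coordinate_ring_mult[OF b1(1) hk(1)] by metis
      have "b2 x \<noteq> 0"
        using b2(2)[OF x(2)] b1(2)[OF x(2) h(2), symmetric] hk(2)[OF x(2)] h(2) ab'(3) by simp
      moreover have "F (\<phi> (chart_map \<Sigma> \<sigma> y)) = a2 y / b2 y" if y: "y \<in> chart \<sigma>" "b2 y \<noteq> 0" for y
      proof -
        have hy: "h y \<noteq> 0"
          using y(2) b2(2)[OF y(1)] hk(2)[OF y(1)] by auto
        have "b (\<Phi> y) \<noteq> 0"
          using y(2) b2(2)[OF y(1)] b1(2)[OF y(1) hy, symmetric] by auto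
        then have "F (\<phi> (chart_map \<Sigma> \<sigma> y)) = a (\<Phi> y) / b (\<Phi> y)"
          using ab'(4) \<Phi>[OF y(1) hy] by simp
        also have "\<dots> = a2 y / b2 y"
          using hy by (simp add: a2(2)[OF y(1)] b2(2)[OF y(1)] a1(2)[OF y(1) hy, symmetric]
              b1(2)[OF y(1) hy, symmetric] hk(2)[OF y(1)] hl(2)[OF y(1)])
        finally show ?thesis .
      qed
      ultimately have "local_fraction \<sigma> x (F \<circ> \<phi> \<circ> chart_map \<Sigma> \<sigma>) a2 b2"
        using a2(1) b2(1) by (simp add: local_fraction_def)
      then show ?thesis
        unfolding x(3) by (rule regular_atI[OF fan x(1,2)])
    qed
  qed
  show ?thesis
    unfolding endomorphism_def
  proof (intro conjI allI impI)
    show "continuous_map (toric_topology \<Sigma>) (toric_topology \<Sigma>) \<phi>"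
      unfolding continuous_map_def topspace_toric_topology using mem cont by auto
    fix U and F :: "('v, 'k) toric_point \<Rightarrow> 'k"
    assume U: "openin (toric_topology \<Sigma>) U \<and> regular_on \<Sigma> U F"
    then show "regular_on \<Sigma> {p \<in> toric_variety \<Sigma>. \<phi> p \<in> U} (F \<circ> \<phi>)"
      using cont reg regular_atD[OF fan, of U F] by (intro regular_onI[OF fan]) auto
  qed
qed

lemma endomorphism_comp:
  fixes \<phi> \<psi> :: "('v, 'k::field) toric_point \<Rightarrow> ('v, 'k) toric_point"
  assumes "endomorphism \<Sigma> \<phi>" "endomorphism \<Sigma> \<psi>"
  shows "endomorphism \<Sigma> (\<phi> \<circ> \<psi>)"
  unfolding endomorphism_def
proof (intro conjI allI impI)
  show "continuous_map (toric_topology \<Sigma>) (toric_topology \<Sigma>) (\<phi> \<circ> \<psi>)"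
    using assms by (intro continuous_map_compose[of _ "toric_topology \<Sigma>"]) (simp_all add: endomorphism_def)
  fix U and F :: "('v, 'k) toric_point \<Rightarrow> 'k"
  assume U: "openin (toric_topology \<Sigma>) U \<and> regular_on \<Sigma> U F"
  let ?V = "{p \<in> toric_variety \<Sigma>. \<phi> p \<in> U}"
  have "openin (toric_topology \<Sigma>) ?V \<and> regular_on \<Sigma> ?V (F \<circ> \<phi>)"
    using assms(1) U openin_continuous_map_preimage[of "toric_topology \<Sigma>" "toric_topology \<Sigma>" \<phi> U]
    by (simp add: endomorphism_def topspace_toric_topology)
  then have "regular_on \<Sigma> {p \<in> toric_variety \<Sigma>. \<psi> p \<in> ?V} ((F \<circ> \<phi>) \<circ> \<psi>)"
    by (rule assms(2)[unfolded endomorphism_def, THEN conjunct2, THEN spec, THEN spec, THEN mp])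
  moreover have "{p \<in> toric_variety \<Sigma>. \<psi> p \<in> ?V} = {p \<in> toric_variety \<Sigma>. (\<phi> \<circ> \<psi>) p \<in> U}"
    using endomorphism_mem[OF assms(2)] by auto
  ultimately show "regular_on \<Sigma> {p \<in> toric_variety \<Sigma>. (\<phi> \<circ> \<psi>) p \<in> U} (F \<circ> (\<phi> \<circ> \<psi>))"
    by (simp add: comp_assoc)
qed

lemma automorphism_comp:
  assumes "automorphism \<Sigma> \<phi>" "automorphism \<Sigma> \<psi>"
  shows "automorphism \<Sigma> (\<phi> \<circ> \<psi>)"
proof -
  obtain \<phi>' where \<phi>': "endomorphism \<Sigma> \<phi>'" "\<forall>p\<in>toric_variety \<Sigma>. \<phi>' (\<phi> p) = p \<and> \<phi> (\<phi>' p) = p"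
    using assms(1) unfolding automorphism_def by blast
  obtain \<psi>' where \<psi>': "endomorphism \<Sigma> \<psi>'" "\<forall>p\<in>toric_variety \<Sigma>. \<psi>' (\<psi> p) = p \<and> \<psi> (\<psi>' p) = p"
    using assms(2) unfolding automorphism_def by blast
  have "endomorphism \<Sigma> \<phi>" "endomorphism \<Sigma> \<psi>"
    using assms by (simp_all add: automorphism_def)
  then show ?thesis
    unfolding automorphism_def using \<phi>' \<psi>' endomorphism_mem[of \<Sigma> \<psi>] endomorphism_mem[of \<Sigma> \<phi>']
    by (intro conjI endomorphism_comp exI[of _ "\<psi>' \<circ> \<phi>'"]) auto
qed

lemma automorphism_id: "automorphism \<Sigma> (\<lambda>p. p)"
proof -
  have "endomorphism \<Sigma> (\<lambda>p :: ('v, 'a::field) toric_point. p)"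
    unfolding endomorphism_def
  proof (intro conjI allI impI)
    fix U F assume U: "openin (toric_topology \<Sigma>) U \<and> regular_on \<Sigma> U (F :: ('v, 'a) toric_point \<Rightarrow> 'a)"
    then have "{p \<in> toric_variety \<Sigma>. p \<in> U} = U"
      using openin_subset[of "toric_topology \<Sigma>" U] by (auto simp: topspace_toric_topology)
    then show "regular_on \<Sigma> {p \<in> toric_variety \<Sigma>. p \<in> U} (F \<circ> (\<lambda>p. p))"
      using U by (simp add: comp_def)
  qed (simp add: continuous_map_id[unfolded id_def])
  then show ?thesis
    unfolding automorphism_def by (intro conjI exI[of _ "\<lambda>p. p"]) auto
qed

subsection \<open>Characters as rational functions\<close>

text \<open>A rational function on the variety: its value is meaningful at points of charts whose
  dual monoid contains \<open>m\<close>, and arbitrary elsewhere.\<close>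

definition character :: "'v set set \<Rightarrow> ('v \<Rightarrow> rat) \<Rightarrow> ('v, 'k::field) toric_point \<Rightarrow> 'k" where
  "character \<Sigma> m p =
     (SOME c. \<exists>\<tau>\<in>\<Sigma>. \<exists>y\<in>chart \<tau>. m \<in> dual_monoid \<tau> \<and> p = chart_map \<Sigma> \<tau> y \<and> c = y m)"

lemma character_eq:
  assumes fan: "fan \<Sigma>" and "\<tau> \<in> \<Sigma>" "y \<in> chart \<tau>" "m \<in> dual_monoid \<tau>"
  shows "character \<Sigma> m (chart_map \<Sigma> \<tau> y) = y m"
  unfolding character_def
proof (rule some_equality)
  fix c assume "\<exists>\<sigma>\<in>\<Sigma>. \<exists>x\<in>chart \<sigma>. m \<in> dual_monoid \<sigma> \<and> chart_map \<Sigma> \<tau> y = chart_map \<Sigma> \<sigma> x \<and> c = x m"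
  then obtain \<sigma> x where x: "\<sigma> \<in> \<Sigma>" "x \<in> chart \<sigma>" "m \<in> dual_monoid \<sigma>"
      "chart_map \<Sigma> \<tau> y = chart_map \<Sigma> \<sigma> x" "c = x m" by blast
  then obtain z where "y = restrict z (dual_monoid \<tau>)" "x = restrict z (dual_monoid \<sigma>)"
    using chart_map_eq_iff[OF fan assms(2) x(1) assms(3) x(2)] by blast
  then show "c = y m"
    using x(3,5) assms(4) by simp
qed (use assms in blast)

lemma character_regular_at:
  assumes fan: "fan \<Sigma>" and "\<tau> \<in> \<Sigma>" "y \<in> chart \<tau>" "m \<in> dual_monoid \<tau>"
  shows "regular_at \<Sigma> (chart_map \<Sigma> \<tau> y) (character \<Sigma> m)"
proof -
  have "local_fraction \<tau> y (character \<Sigma> m \<circ> chart_map \<Sigma> \<tau>) (\<lambda>x. x m) (\<lambda>x. x (\<lambda>_. 0))"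
    using assms character_eq[OF fan assms(2) _ assms(4)]
    by (auto simp: local_fraction_def coordinate_ring_char zero_mem_dual_monoid chart_one)
  then show ?thesis
    by (rule regular_atI[OF fan assms(2,3)])
qed

end

subsection \<open>Root automorphisms\<close>

text \<open>\<open>u\<close> is a Demazure root: it is \<open>-1\<close> on \<open>e\<close> and nonnegative on all rays except that of \<open>e\<close>.  The
  corresponding one-parameter group acts by \<open>\<chi>\<^sup>m \<mapsto> \<chi>\<^sup>m (1 + s \<chi>\<^sup>u)\<^bsup>m(e)\<^esup>\<close>.\<close>

locale demazure_root = toric_lattice scale N n
  for scale :: "rat \<Rightarrow> 'v::ab_group_add \<Rightarrow> 'v" and N n +
  fixes \<Sigma> :: "'v set set" and e :: 'v and u :: "'v \<Rightarrow> rat"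
  assumes complete: "complete_fan \<Sigma>"
    and e_lattice: "e \<in> N" and u_lattice: "u \<in> dual_lattice" and u_e: "u e = - 1"
    and other_rays: "\<And>\<rho> v. \<rho> \<in> fan_rays \<Sigma> \<Longrightarrow> \<rho> \<noteq> cone_hull {e} \<Longrightarrow> v \<in> \<rho> \<Longrightarrow> 0 \<le> u v"
begin

lemma fan: "fan \<Sigma>"
  using complete by (simp add: complete_fan_def)

lemma shift_add:
  "(\<lambda>v. (m v + of_nat i * u v) + (m' v + of_nat j * u v)) = (\<lambda>v. (m v + m' v) + of_nat (i + j) * u v)"
  by (simp add: algebra_simps)

text \<open>If \<open>e\<close> is not in \<open>\<tau>\<close>, the ray of \<open>e\<close> is not
  among the rays of \<open>\<tau>\<close>, and \<open>u\<close> is nonnegative on all other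
  rays.\<close>

lemma u_dual:
  assumes "\<tau> \<in> \<Sigma>" "e \<notin> \<tau>"
  shows "u \<in> dual_monoid \<tau>"
proof -
  obtain S where S: "finite S" "S \<subseteq> N" "\<tau> = cone_hull S"
      "\<And>s. s \<in> S \<Longrightarrow> s \<noteq> 0 \<and> cone_hull {s} \<in> cone_rays \<tau>"
    using cone_generated_by_rays[OF fan_rational[OF fan assms(1)] fan_convex[OF fan assms(1)]] by metis
  have "0 \<le> u s" if s: "s \<in> S" for s
  proof (rule other_rays[of "cone_hull {s}"])
    show "cone_hull {s} \<in> fan_rays \<Sigma>"
      using S(4)[OF s] fan_ray_of_cone[OF fan assms(1)] by blast
    show "cone_hull {s} \<noteq> cone_hull {e}"
    proof
      assume "cone_hull {s} = cone_hull {e}"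
      then have "e \<in> cone_hull {s}"
        using cone_hull_gen[of "{e}" e] by simp
      then show False
        using assms(2) cone_hull_least[of "{s}" S] cone_hull_gen[OF S(1) s] S(3) by blast
    qed
    show "s \<in> cone_hull {s}"
      by (rule cone_hull_gen) auto
  qed
  then show ?thesis
    using u_lattice by (simp add: S(3) dual_monoid_cone_hull[OF S(1)])
qed

text \<open>Adding \<open>u\<close> lowers \<open>m\<close> only on the ray of \<open>e\<close>, by
  1 at \<open>e\<close> in each step, so \<open>m e\<close> steps can be afforded.\<close>

lemma shift_dual:
  assumes "\<tau> \<in> \<Sigma>" "e \<in> \<tau>" "m \<in> dual_monoid \<tau>" "of_nat k \<le> m e"
  shows "(\<lambda>v. m v + of_nat k * u v) \<in> dual_monoid \<tau>"
proof -
  have m: "lin m"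
    using assms(3) by (rule dual_monoid_lin)
  obtain S where S: "finite S" "S \<subseteq> N" "\<tau> = cone_hull S"
      "\<And>s. s \<in> S \<Longrightarrow> s \<noteq> 0 \<and> cone_hull {s} \<in> cone_rays \<tau>"
    using cone_generated_by_rays[OF fan_rational[OF fan assms(1)] fan_convex[OF fan assms(1)]] by metis
  have "0 \<le> m s + of_nat k * u s" if s: "s \<in> S" for s
  proof (cases "cone_hull {s} = cone_hull {e}")
    case True
    then have "s \<in> cone_hull {e}"
      using cone_hull_gen[of "{s}" s] by simp
    then obtain c where c: "0 \<le> c" "s = scale c e"
      by (auto simp: cone_hull_single)
    have "m s + of_nat k * u s = c * (m e - of_nat k)"
      by (simp add: c(2) lin_scale[OF m] lin_scale[OF dual_lattice_lin[OF u_lattice]] u_e algebra_simps)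
    then show ?thesis
      using c(1) assms(4) by simp
  next
    case False
    then have "0 \<le> u s"
      using other_rays S(4)[OF s] fan_ray_of_cone[OF fan assms(1)] cone_hull_gen[of "{s}" s] by blast
    moreover have "0 \<le> m s"
      using assms(3) cone_hull_gen[OF S(1) s] S(3) by (simp add: dual_monoid_def)
    ultimately show ?thesis by simp
  qed
  moreover have "(\<lambda>v. m v + of_nat k * u v) \<in> dual_lattice"
    using dual_lattice_add[OF dual_monoid_dual_lattice[OF assms(3)] dual_lattice_int[OF u_lattice, of "int k"]]
    by simp
  ultimately show ?thesis
    by (simp add: S(3) dual_monoid_cone_hull[OF S(1)])
qed

abbreviation height :: "('v \<Rightarrow> rat) \<Rightarrow> nat" where
  "height m \<equiv> nat \<lfloor>m e\<rfloor>"

lemma of_nat_height: "e \<in> \<tau> \<Longrightarrow> m \<in> dual_monoid \<tau> \<Longrightarrow> of_nat (height m) = m e"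
  using dual_lattice_floor[OF dual_monoid_dual_lattice e_lattice, of m \<tau>]
  by (auto simp: dual_monoid_def of_nat_nat)

lemma shift_dual_height:
  assumes "\<tau> \<in> \<Sigma>" "e \<in> \<tau>" "m \<in> dual_monoid \<tau>" "k \<le> height m"
  shows "(\<lambda>v. m v + of_nat k * u v) \<in> dual_monoid \<tau>"
proof (rule shift_dual[OF assms(1-3)])
  have "rat_of_nat k \<le> of_nat (height m)"
    using assms(4) by (simp only: of_nat_le_iff)
  then show "of_nat k \<le> m e"
    unfolding of_nat_height[OF assms(2,3)] .
qed

lemma height_add:
  assumes "e \<in> \<tau>" "m \<in> dual_monoid \<tau>" "m' \<in> dual_monoid \<tau>"
  shows "height (\<lambda>v. m v + m' v) = height m + height m'"
proof -
  have "rat_of_nat (height (\<lambda>v. m v + m' v)) = of_nat (height m + height m')"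
    unfolding of_nat_add of_nat_height[OF assms(1,2)] of_nat_height[OF assms(1,3)]
    by (rule of_nat_height[OF assms(1) add_mem_dual_monoid[OF assms(2,3)]])
  then show ?thesis
    by (simp only: of_nat_eq_iff)
qed

lemma height_shift:
  assumes "\<tau> \<in> \<Sigma>" "e \<in> \<tau>" "m \<in> dual_monoid \<tau>" "k \<le> height m"
  shows "height (\<lambda>v. m v + of_nat k * u v) = height m - k"
proof -
  have "rat_of_nat (height (\<lambda>v. m v + of_nat k * u v)) = m e + of_nat k * u e"
    by (rule of_nat_height[OF assms(2) shift_dual_height[OF assms]])
  also have "\<dots> = of_nat (height m) - of_nat k"
    unfolding of_nat_height[OF assms(2,3)] by (simp add: u_e)
  also have "\<dots> = of_nat (height m - k)"
    by (rule of_nat_diff[OF assms(4), symmetric])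
  finally show ?thesis
    by (simp only: of_nat_eq_iff)
qed

text \<open>\<open>shift_eval x m P\<close> is the value at \<open>x\<close> of \<open>\<chi>\<^sup>m P(\<chi>\<^sup>u)\<close>.\<close>

definition shift_eval :: "('v, 'k::field) chart_point \<Rightarrow> ('v \<Rightarrow> rat) \<Rightarrow> 'k poly \<Rightarrow> 'k" where
  "shift_eval x m P = (\<Sum>k\<le>degree P. coeff P k * x (\<lambda>v. m v + of_nat k * u v))"

lemma shift_eval_bound:
  "degree P \<le> d \<Longrightarrow> shift_eval x m P = (\<Sum>k\<le>d. coeff P k * x (\<lambda>v. m v + of_nat k * u v))"
  unfolding shift_eval_def by (intro sum.mono_neutral_left) (auto simp: coeff_eq_0)

lemma shift_eval_add: "shift_eval x m (P + Q) = shift_eval x m P + shift_eval x m Q"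
  by (subst (1 2 3) shift_eval_bound[of _ "max (degree P) (degree Q)"])
     (auto simp: degree_add_le sum.distrib distrib_right)

lemma shift_eval_zero: "shift_eval x m 0 = 0"
  by (simp add: shift_eval_def)

lemma shift_eval_sum: "shift_eval x m (\<Sum>i\<in>I. P i) = (\<Sum>i\<in>I. shift_eval x m (P i))"
  by (induction I rule: infinite_finite_induct) (simp_all add: shift_eval_zero shift_eval_add)

lemma shift_eval_smult: "shift_eval x m (smult c P) = c * shift_eval x m P"
  by (subst (1 2) shift_eval_bound[of _ "degree P"]) (auto simp: degree_smult_le sum_distrib_left mult.assoc)

lemma shift_eval_monom: "shift_eval x m (monom c k) = c * x (\<lambda>v. m v + of_nat k * u v)"
  by (subst shift_eval_bound[of _ k]) (auto simp: degree_monom_le if_distrib[of "\<lambda>a. a * _"] cong: if_cong)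

lemma shift_eval_one: "shift_eval x m 1 = x m"
  using shift_eval_monom[of x m 1 0] unfolding one_pCons monom_0 by simp

lemma monom_1_pCons: "monom s 1 = [:0, s:]"
  by (simp add: One_nat_def monom_Suc monom_0)

lemma shift_eval_linear: "shift_eval x m [:1, s:] = x m + s * x (\<lambda>v. m v + u v)"
proof -
  have "[:1, s:] = monom 1 0 + monom s 1"
    unfolding monom_1_pCons monom_0 by simp
  then show ?thesis
    by (simp only: shift_eval_add shift_eval_monom) simp
qed

text \<open>The degree bounds keep every shifted form in the dual monoid, so that \<open>x\<close>
  is multiplicative on each pair of terms even where \<open>u\<close> itself is not regular.\<close>

lemma shift_eval_mult:
  assumes \<tau>: "\<tau> \<in> \<Sigma>" "e \<in> \<tau>" and x: "x \<in> chart \<tau>" and m: "m \<in> dual_monoid \<tau>" "m' \<in> dual_monoid \<tau>"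
    and deg: "degree P \<le> height m" "degree Q \<le> height m'"
  shows "shift_eval x (\<lambda>v. m v + m' v) (P * Q) = shift_eval x m P * shift_eval x m' Q"
proof -
  have PQ: "P = (\<Sum>i\<le>height m. monom (coeff P i) i)" "Q = (\<Sum>i\<le>height m'. monom (coeff Q i) i)"
    by (rule poly_as_sum_of_monoms'[symmetric], fact)+
  have "P * Q = (\<Sum>i\<le>height m. monom (coeff P i) i) * (\<Sum>i\<le>height m'. monom (coeff Q i) i)"
    by (rule arg_cong2[OF PQ])
  also have "\<dots> = (\<Sum>i\<le>height m. \<Sum>j\<le>height m'. monom (coeff P i * coeff Q j) (i + j))"
    by (simp only: sum_product mult_monom)
  finally have "shift_eval x (\<lambda>v. m v + m' v) (P * Q) =
      (\<Sum>i\<le>height m. \<Sum>j\<le>height m'. (coeff P i * coeff Q j) *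
        x (\<lambda>v. (m v + of_nat i * u v) + (m' v + of_nat j * u v)))"
    unfolding shift_add by (simp only: shift_eval_sum shift_eval_monom)
  also have "\<dots> = (\<Sum>i\<le>height m. \<Sum>j\<le>height m'. (coeff P i * x (\<lambda>v. m v + of_nat i * u v)) *
        (coeff Q j * x (\<lambda>v. m' v + of_nat j * u v)))"
    using chart_mult[OF x shift_dual_height[OF \<tau> m(1)] shift_dual_height[OF \<tau> m(2)]]
    by (intro sum.cong refl) (simp add: algebra_simps)
  also have "\<dots> = shift_eval x m P * shift_eval x m' Q"
    unfolding shift_eval_bound[OF deg(1)] shift_eval_bound[OF deg(2)] by (simp only: sum_product)
  finally show ?thesis .
qed

lemma shift_eval_cong:
  assumes "\<tau> \<in> \<Sigma>" "e \<in> \<tau>" "m \<in> dual_monoid \<tau>" "degree P \<le> height m"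
    and "\<And>m. m \<in> dual_monoid \<tau> \<Longrightarrow> x m = y m"
  shows "shift_eval x m P = shift_eval y m P"
  unfolding shift_eval_def using assms(4) by (intro sum.cong refl) (auto intro!: assms(5) shift_dual_height assms(1-3))

lemma shift_eval_dual:
  assumes "z \<in> chart \<omega>" "u \<in> dual_monoid \<omega>" "m \<in> dual_monoid \<omega>"
  shows "shift_eval z m P = z m * poly P (z u)"
  by (simp add: shift_eval_def poly_altdef chart_add_nat[OF assms(1,3,2)] sum_distrib_left algebra_simps)

definition root_act :: "'k::field \<Rightarrow> 'v set \<Rightarrow> ('v, 'k) chart_point \<Rightarrow> ('v, 'k) chart_point" where
  "root_act s \<tau> x = restrict (\<lambda>m. shift_eval x m ([:1, s:] ^ height m)) (dual_monoid \<tau>)"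

lemma degree_linear_power: "degree ([:1, s:] ^ k) \<le> k"
  using degree_power_le[of "[:1, s:]" k] by (cases "s = 0") auto

lemma root_act_mem:
  assumes "\<tau> \<in> \<Sigma>" "e \<in> \<tau>" "x \<in> chart \<tau>"
  shows "root_act s \<tau> x \<in> chart \<tau>"
proof (rule chartI)
  have "root_act s \<tau> x (\<lambda>_. 0) = shift_eval x (\<lambda>_. 0) ([:1, s:] ^ height (\<lambda>_. 0))"
    by (simp only: root_act_def restrict_apply' zero_mem_dual_monoid)
  also have "\<dots> = shift_eval x (\<lambda>_. 0) 1"
    by (simp only: floor_zero nat_zero_as_int[symmetric] power_0)
  finally show "root_act s \<tau> x (\<lambda>_. 0) = 1"
    by (simp only: shift_eval_one chart_one[OF assms(3)])
  fix m m' assume m: "m \<in> dual_monoid \<tau>" "m' \<in> dual_monoid \<tau>"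
  show "root_act s \<tau> x (\<lambda>v. m v + m' v) = root_act s \<tau> x m * root_act s \<tau> x m'"
    using shift_eval_mult[OF assms m degree_linear_power degree_linear_power, of s s]
    unfolding root_act_def restrict_apply'[OF m(1)] restrict_apply'[OF m(2)]
      restrict_apply'[OF add_mem_dual_monoid[OF m]] height_add[OF assms(2) m] power_add .
qed (simp add: root_act_def)

text \<open>The form \<open>m + k u\<close> has height \<open>height m - k\<close>, so the first
  action turns its character into the \<open>m\<close>-th character times
  \<open>X ^ k * (1 + s X) ^ (height m - k)\<close>, where \<open>X\<close> is the character of
  \<open>u\<close>. The binomial theorem reassembles these terms to a power of
  \<open>(1 + s X) + t X\<close>.\<close>

lemma root_act_add:
  assumes \<tau>: "\<tau> \<in> \<Sigma>" "e \<in> \<tau>" and x: "x \<in> chart \<tau>"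
  shows "root_act t \<tau> (root_act s \<tau> x) = root_act (s + t) \<tau> x"
proof (rule extensionalityI[of _ "dual_monoid \<tau>"])
  fix m assume m: "m \<in> dual_monoid \<tau>"
  let ?a = "height m" and ?y = "root_act s \<tau> x"
  have y: "?y (\<lambda>v. m v + of_nat k * u v) = shift_eval x m (monom 1 k * [:1, s:] ^ (?a - k))"
    if k: "k \<le> ?a" for k
  proof -
    let ?m = "\<lambda>v. m v + of_nat k * u v"
    have "?y ?m = shift_eval x ?m ([:1, s:] ^ (?a - k))"
      using shift_dual_height[OF \<tau> m k] height_shift[OF \<tau> m k] by (simp add: root_act_def)
    also have "\<dots> = shift_eval x m (monom 1 k * [:1, s:] ^ (?a - k))"
    proof -
      have d: "degree ([:1, s:] ^ (?a - k)) \<le> ?a - k"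
        by (rule degree_linear_power)
      have "monom 1 k * [:1, s:] ^ (?a - k) = (\<Sum>i\<le>?a - k. monom (coeff ([:1, s:] ^ (?a - k)) i) (k + i))"
        by (subst poly_as_sum_of_monoms'[OF d, symmetric]) (simp add: sum_distrib_left mult_monom)
      then show ?thesis
        unfolding shift_eval_bound[OF d]
        by (simp add: shift_eval_sum shift_eval_monom algebra_simps)
    qed
    finally show ?thesis .
  qed
  have exp: "[:1, t:] ^ ?a = (\<Sum>k\<le>?a. smult (of_nat (?a choose k) * t ^ k) (monom 1 k))"
  proof -
    have "[:1, t:] = monom t 1 + 1"
      unfolding monom_1_pCons one_pCons by simp
    then have "[:1, t:] ^ ?a = (monom t 1 + 1) ^ ?a"
      by (rule arg_cong)
    also have "\<dots> = (\<Sum>k\<le>?a. of_nat (?a choose k) * monom t 1 ^ k * 1 ^ (?a - k))"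
      by (rule binomial_ring)
    also have "\<dots> = (\<Sum>k\<le>?a. smult (of_nat (?a choose k) * t ^ k) (monom 1 k))"
      by (intro sum.cong refl) (simp add: monom_power of_nat_poly smult_monom)
    finally show ?thesis .
  qed
  have exp': "[:1, s + t:] ^ ?a =
      (\<Sum>k\<le>?a. smult (of_nat (?a choose k) * t ^ k) (monom 1 k * [:1, s:] ^ (?a - k)))"
  proof -
    have "[:1, s + t:] = monom t 1 + [:1, s:]"
      unfolding monom_1_pCons by simp
    then have "[:1, s + t:] ^ ?a = (monom t 1 + [:1, s:]) ^ ?a"
      by (rule arg_cong)
    also have "\<dots> = (\<Sum>k\<le>?a. of_nat (?a choose k) * monom t 1 ^ k * [:1, s:] ^ (?a - k))"
      by (rule binomial_ring)
    also have "\<dots> = (\<Sum>k\<le>?a. smult (of_nat (?a choose k) * t ^ k) (monom 1 k * [:1, s:] ^ (?a - k)))"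
    proof (intro sum.cong refl)
      fix k
      have "of_nat (?a choose k) * monom t 1 ^ k = smult (of_nat (?a choose k) * t ^ k) (monom 1 k)"
        by (simp add: monom_power of_nat_poly smult_monom)
      then show "of_nat (?a choose k) * monom t 1 ^ k * [:1, s:] ^ (?a - k) =
          smult (of_nat (?a choose k) * t ^ k) (monom 1 k * [:1, s:] ^ (?a - k))"
        by simp
    qed
    finally show ?thesis .
  qed
  have "shift_eval ?y m ([:1, t:] ^ ?a) =
      (\<Sum>k\<le>?a. (of_nat (?a choose k) * t ^ k) * ?y (\<lambda>v. m v + of_nat k * u v))"
    unfolding exp by (simp add: shift_eval_sum shift_eval_smult shift_eval_monom)
  also have "\<dots> = (\<Sum>k\<le>?a. (of_nat (?a choose k) * t ^ k) * shift_eval x m (monom 1 k * [:1, s:] ^ (?a - k)))"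
    by (intro sum.cong refl) (simp add: y)
  also have "\<dots> = shift_eval x m ([:1, s + t:] ^ ?a)"
    unfolding exp' by (simp add: shift_eval_sum shift_eval_smult)
  finally show "root_act t \<tau> ?y m = root_act (s + t) \<tau> x m"
    using m by (simp add: root_act_def[of t] root_act_def[of "s + t"])
qed (auto simp: root_act_def)

lemma root_act_zero: "x \<in> chart \<tau> \<Longrightarrow> root_act 0 \<tau> x = x"
  by (rule extensionalityI[of _ "dual_monoid \<tau>"])
     (auto simp: root_act_def chart_def shift_eval_one simp flip: one_pCons)

lemma root_act_restrict:
  assumes "\<tau> \<in> \<Sigma>" "e \<in> \<tau>" "\<omega> \<subseteq> \<tau>"
  shows "root_act s \<tau> (restrict z (dual_monoid \<tau>)) = restrict (root_act s \<omega> z) (dual_monoid \<tau>)"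
proof (rule extensionalityI[of _ "dual_monoid \<tau>"])
  fix m assume m: "m \<in> dual_monoid \<tau>"
  have "shift_eval (restrict z (dual_monoid \<tau>)) m ([:1, s:] ^ height m) = shift_eval z m ([:1, s:] ^ height m)"
    by (rule shift_eval_cong[OF assms(1,2) m degree_linear_power]) simp
  then show "root_act s \<tau> (restrict z (dual_monoid \<tau>)) m = restrict (root_act s \<omega> z) (dual_monoid \<tau>) m"
    using m dual_monoid_antimono[OF assms(3)] by (auto simp: root_act_def)
qed (auto simp: root_act_def)

text \<open>Leaving the remaining points fixed agrees with the scaling formula: at a point outside
  the charts of cones containing \<open>e\<close>, the character of \<open>u\<close> takes the value
  0, so its scaling factor is 1.\<close>

definition root_map :: "'k::field \<Rightarrow> ('v, 'k) toric_point \<Rightarrow> ('v, 'k) toric_point" where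
  "root_map s p = (if \<exists>\<tau>\<in>\<Sigma>. e \<in> \<tau> \<and> p \<in> chart_map \<Sigma> \<tau> ` chart \<tau>
     then SOME q. \<exists>\<tau>\<in>\<Sigma>. e \<in> \<tau> \<and> (\<exists>x\<in>chart \<tau>. p = chart_map \<Sigma> \<tau> x \<and> q = chart_map \<Sigma> \<tau> (root_act s \<tau> x))
     else p)"

text \<open>Independence of the chosen chart: two charts of cones containing \<open>e\<close> meet
  in a third such chart, and the action commutes with restriction.\<close>

lemma root_map_eq:
  assumes \<tau>: "\<tau> \<in> \<Sigma>" "e \<in> \<tau>" and x: "x \<in> chart \<tau>"
  shows "root_map s (chart_map \<Sigma> \<tau> x) = chart_map \<Sigma> \<tau> (root_act s \<tau> x)"
proof -
  have ex: "\<exists>\<tau>'\<in>\<Sigma>. e \<in> \<tau>' \<and> chart_map \<Sigma> \<tau> x \<in> chart_map \<Sigma> \<tau>' ` chart \<tau>'"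
    using assms by blast
  show ?thesis
    unfolding root_map_def if_P[OF ex]
  proof (rule some_equality)
    fix q
    assume "\<exists>\<tau>'\<in>\<Sigma>. e \<in> \<tau>' \<and> (\<exists>x'\<in>chart \<tau>'. chart_map \<Sigma> \<tau> x = chart_map \<Sigma> \<tau>' x' \<and>
        q = chart_map \<Sigma> \<tau>' (root_act s \<tau>' x'))"
    then obtain \<tau>' x' where \<tau>': "\<tau>' \<in> \<Sigma>" "e \<in> \<tau>'" "x' \<in> chart \<tau>'"
        "chart_map \<Sigma> \<tau> x = chart_map \<Sigma> \<tau>' x'" and q: "q = chart_map \<Sigma> \<tau>' (root_act s \<tau>' x')"
      by blast
    obtain z where z: "z \<in> chart (\<tau> \<inter> \<tau>')" "x = restrict z (dual_monoid \<tau>)" "x' = restrict z (dual_monoid \<tau>')"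
      using \<tau>'(4) unfolding chart_map_eq_iff[OF fan \<tau>(1) \<tau>'(1) x \<tau>'(3)] by blast
    have \<omega>: "\<tau> \<inter> \<tau>' \<in> \<Sigma>" "e \<in> \<tau> \<inter> \<tau>'"
      using fan_Int[OF fan \<tau>(1) \<tau>'(1)] \<tau>(2) \<tau>'(2) by auto
    note mem = root_act_mem[OF \<omega> z(1), of s]
    show "q = chart_map \<Sigma> \<tau> (root_act s \<tau> x)"
      unfolding q z(2,3) root_act_restrict[OF \<tau> Int_lower1[of \<tau> \<tau>']] root_act_restrict[OF \<tau>'(1,2) Int_lower2[of \<tau> \<tau>']]
      using chart_map_restrict[OF fan \<tau>(1) \<omega>(1) _ mem] chart_map_restrict[OF fan \<tau>'(1) \<omega>(1) _ mem] by simp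
  qed (use assms in blast)
qed

lemma root_map_fixed:
  "\<not> (\<exists>\<tau>\<in>\<Sigma>. e \<in> \<tau> \<and> p \<in> chart_map \<Sigma> \<tau> ` chart \<tau>) \<Longrightarrow> root_map s p = p"
  unfolding root_map_def by (rule if_not_P)

lemma root_map_inverse: "root_map (- s) (root_map s p) = p"
proof (cases "\<exists>\<tau>\<in>\<Sigma>. e \<in> \<tau> \<and> p \<in> chart_map \<Sigma> \<tau> ` chart \<tau>")
  case True
  then obtain \<tau> x where x: "\<tau> \<in> \<Sigma>" "e \<in> \<tau>" "x \<in> chart \<tau>" "p = chart_map \<Sigma> \<tau> x" by blast
  show ?thesis
    unfolding x(4) root_map_eq[OF x(1-3)] root_map_eq[OF x(1,2) root_act_mem[OF x(1-3)]]
      root_act_add[OF x(1-3)] using root_act_zero[OF x(3)] by simp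
qed (simp add: root_map_fixed)

text \<open>The form which the action takes on charts of cones without \<open>e\<close>. There
  \<open>u\<close> is regular but \<open>m e\<close> may be negative, whence the integral
  power.\<close>

definition root_scale :: "'k::field \<Rightarrow> 'v set \<Rightarrow> ('v, 'k) chart_point \<Rightarrow> ('v, 'k) chart_point" where
  "root_scale s \<tau> y = restrict (\<lambda>m. y m * (1 + s * y u) powi \<lfloor>m e\<rfloor>) (dual_monoid \<tau>)"

lemma root_scale_mem:
  assumes "y \<in> chart \<tau>" "1 + s * y u \<noteq> 0"
  shows "root_scale s \<tau> y \<in> chart \<tau>"
proof (rule chartI)
  show "root_scale s \<tau> y (\<lambda>_. 0) = 1"
    using chart_one[OF assms(1)] by (simp add: root_scale_def zero_mem_dual_monoid)
  fix m m' assume m: "m \<in> dual_monoid \<tau>" "m' \<in> dual_monoid \<tau>"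
  have "rat_of_int \<lfloor>m e + m' e\<rfloor> = rat_of_int (\<lfloor>m e\<rfloor> + \<lfloor>m' e\<rfloor>)"
    unfolding of_int_add dual_lattice_floor[OF dual_monoid_dual_lattice[OF m(1)] e_lattice]
      dual_lattice_floor[OF dual_monoid_dual_lattice[OF m(2)] e_lattice]
    by (rule dual_lattice_floor[OF dual_monoid_dual_lattice[OF add_mem_dual_monoid[OF m]] e_lattice])
  then have "\<lfloor>m e + m' e\<rfloor> = \<lfloor>m e\<rfloor> + \<lfloor>m' e\<rfloor>"
    by (simp only: of_int_eq_iff)
  then show "root_scale s \<tau> y (\<lambda>v. m v + m' v) = root_scale s \<tau> y m * root_scale s \<tau> y m'"
    using m add_mem_dual_monoid[OF m] assms(2)
    by (simp add: root_scale_def chart_mult[OF assms(1)] power_int_add)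
qed (simp add: root_scale_def)

text \<open>On the smaller chart the character of \<open>u\<close> is regular, so the shifted
  expression factors as the character of \<open>m\<close> times a polynomial in the value at
  \<open>u\<close>.\<close>

lemma root_act_eq_scale:
  assumes \<tau>: "\<tau> \<in> \<Sigma>" "e \<in> \<tau>" and \<omega>: "\<omega> \<in> \<Sigma>" "e \<notin> \<omega>" "\<omega> \<subseteq> \<tau>" and z: "z \<in> chart \<omega>"
  shows "root_act s \<tau> (restrict z (dual_monoid \<tau>)) = restrict (root_scale s \<omega> z) (dual_monoid \<tau>)"
  unfolding root_act_restrict[OF \<tau> \<omega>(3)]
proof (rule extensionalityI[of _ "dual_monoid \<tau>"])
  fix m assume m: "m \<in> dual_monoid \<tau>"
  then have m\<omega>: "m \<in> dual_monoid \<omega>"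
    using dual_monoid_antimono[OF \<omega>(3)] by blast
  have "int (height m) = \<lfloor>m e\<rfloor>"
    using m \<tau>(2) by (simp add: dual_monoid_def)
  then have "(1 + s * z u) ^ height m = (1 + s * z u) powi \<lfloor>m e\<rfloor>"
    by (metis power_int_of_nat)
  then show "restrict (root_act s \<omega> z) (dual_monoid \<tau>) m = restrict (root_scale s \<omega> z) (dual_monoid \<tau>) m"
    using m m\<omega> by (simp add: root_act_def root_scale_def shift_eval_dual[OF z u_dual[OF \<omega>(1,2)] m\<omega>]
        poly_power mult.commute[of s])
qed auto

text \<open>Completeness enters here. Moving from the face \<open>u = 0\<close> in direction
  \<open>e\<close> leads to points with negative \<open>u\<close>, and a cone with such points must
  contain \<open>e\<close> because \<open>u\<close> is nonnegative on all other cones.\<close>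

lemma face_in_star:
  assumes "\<sigma> \<in> \<Sigma>" "e \<notin> \<sigma>"
  obtains \<omega> where "\<omega> \<in> \<Sigma>" "e \<in> \<omega>" "{v \<in> \<sigma>. u v = 0} \<subseteq> \<omega>" "{v \<in> \<sigma>. u v = 0} \<in> \<Sigma>"
proof -
  have face: "{v \<in> \<sigma>. u v = 0} \<in> \<Sigma>"
    using fan_face[OF fan assms(1) face_ofI[OF u_dual[OF assms] refl]] .
  obtain \<omega> v a where \<omega>: "\<omega> \<in> \<Sigma>" "{v \<in> \<sigma>. u v = 0} \<subseteq> \<omega>" "v \<in> {v \<in> \<sigma>. u v = 0}" "0 < a" "v + scale a e \<in> \<omega>"
    using complete_fan_star[OF complete face, of e] by blast
  have lin: "lin u"
    using u_lattice by (rule dual_lattice_lin)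
  have "u (v + scale a e) < 0"
    using \<omega>(3,4) by (simp add: lin_add[OF lin] lin_scale[OF lin] u_e)
  then have "e \<in> \<omega>"
    using u_dual[OF \<omega>(1)] \<omega>(5) by (force simp: dual_monoid_def)
  then show thesis
    using that \<omega>(1,2) face by blast
qed

text \<open>A point that also lies in the chart of a cone containing \<open>e\<close> is treated on
  the intersection of the two charts. For any other point \<open>y u = 0\<close>, since otherwise
  \<open>face_in_star\<close> would place it in such a chart; then both sides leave it
  fixed.\<close>

lemma root_map_scale:
  assumes \<sigma>: "\<sigma> \<in> \<Sigma>" "e \<notin> \<sigma>" and y: "y \<in> chart \<sigma>" "1 + s * y u \<noteq> 0"
  shows "root_map s (chart_map \<Sigma> \<sigma> y) = chart_map \<Sigma> \<sigma> (root_scale s \<sigma> y)"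
proof (cases "\<exists>\<tau>\<in>\<Sigma>. e \<in> \<tau> \<and> chart_map \<Sigma> \<sigma> y \<in> chart_map \<Sigma> \<tau> ` chart \<tau>")
  case True
  then obtain \<tau> x where x: "\<tau> \<in> \<Sigma>" "e \<in> \<tau>" "x \<in> chart \<tau>" "chart_map \<Sigma> \<sigma> y = chart_map \<Sigma> \<tau> x" by blast
  obtain z where z: "z \<in> chart (\<sigma> \<inter> \<tau>)" "y = restrict z (dual_monoid \<sigma>)" "x = restrict z (dual_monoid \<tau>)"
    using x(4) unfolding chart_map_eq_iff[OF fan \<sigma>(1) x(1) y(1) x(3)] by blast
  have \<omega>: "\<sigma> \<inter> \<tau> \<in> \<Sigma>" "e \<notin> \<sigma> \<inter> \<tau>"
    using fan_Int[OF fan \<sigma>(1) x(1)] \<sigma>(2) by auto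
  have u\<sigma>: "u \<in> dual_monoid \<sigma>"
    by (rule u_dual[OF \<sigma>])
  have mem: "root_scale s (\<sigma> \<inter> \<tau>) z \<in> chart (\<sigma> \<inter> \<tau>)"
    using y(2) u\<sigma> by (intro root_scale_mem z(1)) (simp add: z(2))
  have "root_scale s \<sigma> y = restrict (root_scale s (\<sigma> \<inter> \<tau>) z) (dual_monoid \<sigma>)"
    using u\<sigma> dual_monoid_antimono[of "\<sigma> \<inter> \<tau>" \<sigma>] by (auto simp: root_scale_def z(2) fun_eq_iff)
  moreover have "root_act s \<tau> x = restrict (root_scale s (\<sigma> \<inter> \<tau>) z) (dual_monoid \<tau>)"
    unfolding z(3) by (rule root_act_eq_scale[OF x(1,2) \<omega> Int_lower2 z(1)])
  moreover have "root_map s (chart_map \<Sigma> \<sigma> y) = chart_map \<Sigma> \<tau> (root_act s \<tau> x)"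
    unfolding x(4) by (rule root_map_eq[OF x(1-3)])
  ultimately show ?thesis
    using chart_map_restrict[OF fan \<sigma>(1) \<omega>(1) _ mem] chart_map_restrict[OF fan x(1) \<omega>(1) _ mem] by simp
next
  case False
  have "y u = 0"
  proof (rule ccontr)
    assume "y u \<noteq> 0"
    then obtain z where z: "z \<in> chart {v \<in> \<sigma>. u v = 0}" "restrict z (dual_monoid \<sigma>) = y"
      using face_point_exists[OF fan_rational[OF fan \<sigma>(1)] u_dual[OF \<sigma>] y(1)] by blast
    obtain \<omega> where \<omega>: "\<omega> \<in> \<Sigma>" "e \<in> \<omega>" "{v \<in> \<sigma>. u v = 0} \<subseteq> \<omega>" "{v \<in> \<sigma>. u v = 0} \<in> \<Sigma>"
      using face_in_star[OF \<sigma>] .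
    have "chart_map \<Sigma> \<sigma> y = chart_map \<Sigma> {v \<in> \<sigma>. u v = 0} z"
      unfolding z(2)[symmetric] by (rule chart_map_restrict[OF fan \<sigma>(1) \<omega>(4) _ z(1)]) blast
    also have "\<dots> = chart_map \<Sigma> \<omega> (restrict z (dual_monoid \<omega>))"
      by (rule chart_map_restrict[OF fan \<omega>(1,4,3) z(1), symmetric])
    finally show False
      using False \<omega>(1,2) chart_restrict[OF \<omega>(3) z(1)] by blast
  qed
  then have "root_scale s \<sigma> y = y"
    using y(1) by (intro extensionalityI[of _ "dual_monoid \<sigma>"]) (auto simp: root_scale_def chart_def)
  then show ?thesis
    using False by (simp add: root_map_fixed)
qed

lemma root_map_local_lift:
  fixes s :: "'k::field"
  assumes \<sigma>: "\<sigma> \<in> \<Sigma>" and x: "x \<in> chart \<sigma>"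
  shows "\<exists>\<tau> h \<Phi>. local_lift \<Sigma> (root_map s) \<sigma> \<tau> h \<Phi> \<and> h x \<noteq> 0"
proof -
  \<comment> \<open>Where the scaling factor vanishes, \<open>x u\<close> is nonzero. This third
    case passes through the face \<open>u = 0\<close> to the chart of a cone containing
    \<open>e\<close>, where the action is polynomial.\<close>
  consider "e \<in> \<sigma>" | "e \<notin> \<sigma>" "1 + s * x u \<noteq> 0" | "e \<notin> \<sigma>" "x u \<noteq> 0"
    by fastforce
  then show ?thesis
  proof cases
    case 1
    have "\<exists>g\<in>coordinate_ring \<sigma>. \<exists>k. \<forall>y\<in>chart \<sigma>. y (\<lambda>_. 0) \<noteq> 0 \<longrightarrow> root_act s \<sigma> y m * y (\<lambda>_. 0) ^ k = g y"
      if m: "m \<in> dual_monoid \<sigma>" for m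
    proof (intro bexI exI ballI impI)
      have le: "k \<le> height m" if "k \<le> degree ([:1, s:] ^ height m)" for k
        using degree_linear_power[of s "height m"] that by simp
      show "(\<lambda>y. shift_eval y m ([:1, s:] ^ height m)) \<in> coordinate_ring \<sigma>"
        unfolding shift_eval_def
        using shift_dual_height[OF \<sigma> 1 m] le
        by (intro coordinate_ring_sum coordinate_ring_cmult coordinate_ring_char) auto
      show "root_act s \<sigma> y m * y (\<lambda>_. 0) ^ 0 = shift_eval y m ([:1, s:] ^ height m)" for y
        using m by (simp add: root_act_def)
    qed
    then have "local_lift \<Sigma> (root_map s) \<sigma> \<sigma> (\<lambda>y. y (\<lambda>_. 0)) (root_act s \<sigma>)"
      using root_act_mem[OF \<sigma> 1] root_map_eq[OF \<sigma> 1] coordinate_ring_char[OF zero_mem_dual_monoid]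
      by (intro local_liftI \<sigma>)
    then show ?thesis
      using chart_one[OF x]
      by (intro exI[of _ \<sigma>] exI[of _ "\<lambda>y. y (\<lambda>_. 0)"] exI[of _ "root_act s \<sigma>"]) simp
  next
    case 2
    note u = u_dual[OF \<sigma> 2(1)]
    let ?h = "\<lambda>y. y (\<lambda>_. 0) + s * y u"
    have h: "?h \<in> coordinate_ring \<sigma>"
      using u by (intro coordinate_ring_add coordinate_ring_cmult coordinate_ring_char zero_mem_dual_monoid)
    have "\<exists>g\<in>coordinate_ring \<sigma>. \<exists>k. \<forall>y\<in>chart \<sigma>. ?h y \<noteq> 0 \<longrightarrow> root_scale s \<sigma> y m * ?h y ^ k = g y"
      if m: "m \<in> dual_monoid \<sigma>" for m
    proof (cases "0 \<le> \<lfloor>m e\<rfloor>")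
      case True
      obtain k where k: "k \<in> coordinate_ring \<sigma>" "\<forall>y\<in>chart \<sigma>. k y = ?h y ^ nat \<lfloor>m e\<rfloor>"
        using coordinate_ring_power[OF h] by blast
      obtain g where g: "g \<in> coordinate_ring \<sigma>" "\<And>y. y \<in> chart \<sigma> \<Longrightarrow> g y = y m * k y"
        using coordinate_ring_mult[OF coordinate_ring_char[OF m] k(1)] by metis
      have "(1 + s * y u) powi \<lfloor>m e\<rfloor> = (1 + s * y u) ^ nat \<lfloor>m e\<rfloor>" for y
        using True by (simp add: power_int_def)
      then show ?thesis
        using g k(2) m by (intro bexI[of _ g] exI[of _ 0]) (auto simp: root_scale_def chart_one[of _ \<sigma>])
    next
      case False
      have "(1 + s * y u) powi \<lfloor>m e\<rfloor> * (1 + s * y u) ^ nat (- \<lfloor>m e\<rfloor>) = 1" if "1 + s * y u \<noteq> 0" for y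
        using False that by (simp add: power_int_def power_inverse)
      then show ?thesis
        using m
        by (intro bexI[of _ "\<lambda>y. y m"] exI[of _ "nat (- \<lfloor>m e\<rfloor>)"] coordinate_ring_char)
          (auto simp: root_scale_def mult.assoc chart_one[of _ \<sigma>])
    qed
    moreover have "1 + s * y u \<noteq> 0" if "y \<in> chart \<sigma>" "?h y \<noteq> 0" for y
      using that chart_one[OF that(1)] by simp
    ultimately have "local_lift \<Sigma> (root_map s) \<sigma> \<sigma> ?h (root_scale s \<sigma>)"
      by (intro local_liftI \<sigma> h root_scale_mem root_map_scale[OF \<sigma> 2(1)])
    then show ?thesis
      using 2(2) chart_one[OF x] by (intro exI[of _ \<sigma>] exI[of _ ?h] exI[of _ "root_scale s \<sigma>"]) auto
  next
    case 3
    note u = u_dual[OF \<sigma> 3(1)]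
    let ?\<tau> = "{v \<in> \<sigma>. u v = 0}"
    obtain \<omega> where \<omega>: "\<omega> \<in> \<Sigma>" "e \<in> \<omega>" "?\<tau> \<subseteq> \<omega>" "?\<tau> \<in> \<Sigma>"
      using face_in_star[OF \<sigma> 3(1)] .
    have "\<exists>z\<in>chart ?\<tau>. restrict z (dual_monoid \<sigma>) = y" if "y \<in> chart \<sigma>" "y u \<noteq> 0" for y :: "('v, 'k) chart_point"
      using face_point_exists[OF fan_rational[OF fan \<sigma>] u that] .
    then obtain ext where ext: "\<And>y :: ('v, 'k) chart_point. y \<in> chart \<sigma> \<Longrightarrow> y u \<noteq> 0 \<Longrightarrow> ext y \<in> chart ?\<tau>"
        "\<And>y. y \<in> chart \<sigma> \<Longrightarrow> y u \<noteq> 0 \<Longrightarrow> restrict (ext y) (dual_monoid \<sigma>) = y"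
      by metis
    define \<Phi> where "\<Phi> = (\<lambda>y. root_act s \<omega> (restrict (ext y) (dual_monoid \<omega>)))"
    have mem: "\<Phi> y \<in> chart \<omega>" and eq: "root_map s (chart_map \<Sigma> \<sigma> y) = chart_map \<Sigma> \<omega> (\<Phi> y)"
      if y: "y \<in> chart \<sigma>" "y u \<noteq> 0" for y
    proof -
      note r = chart_restrict[OF \<omega>(3) ext(1)[OF y]]
      show "\<Phi> y \<in> chart \<omega>"
        unfolding \<Phi>_def by (rule root_act_mem[OF \<omega>(1,2) r])
      have "chart_map \<Sigma> \<sigma> y = chart_map \<Sigma> ?\<tau> (ext y)"
        using chart_map_restrict[OF fan \<sigma> \<omega>(4) _ ext(1)[OF y]] ext(2)[OF y] by auto
      also have "\<dots> = chart_map \<Sigma> \<omega> (restrict (ext y) (dual_monoid \<omega>))"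
        by (rule chart_map_restrict[OF fan \<omega>(1,4,3) ext(1)[OF y], symmetric])
      finally show "root_map s (chart_map \<Sigma> \<sigma> y) = chart_map \<Sigma> \<omega> (\<Phi> y)"
        using root_map_eq[OF \<omega>(1,2) r] by (simp add: \<Phi>_def)
    qed
    have "\<exists>g\<in>coordinate_ring \<sigma>. \<exists>k. \<forall>y\<in>chart \<sigma>. y u \<noteq> 0 \<longrightarrow> \<Phi> y m * y u ^ k = g y"
      if m: "m \<in> dual_monoid \<omega>" for m
    proof -
      let ?G = "\<lambda>y. shift_eval y m ([:1, s:] ^ height m)"
      have le: "k \<le> height m" if "k \<le> degree ([:1, s:] ^ height m)" for k
        using degree_linear_power[of s "height m"] that by simp
      have "?G \<in> coordinate_ring \<omega>"
        unfolding shift_eval_def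
        using shift_dual_height[OF \<omega>(1,2) m] le
        by (intro coordinate_ring_sum coordinate_ring_cmult coordinate_ring_char) auto
      then have G: "?G \<in> coordinate_ring ?\<tau>"
        using coordinate_ring_antimono[OF \<omega>(3)] by blast
      obtain g k where g: "g \<in> coordinate_ring \<sigma>" "\<forall>z\<in>chart ?\<tau>. ?G z * z u ^ k = g z"
        using coordinate_ring_face[OF fan_rational[OF fan \<sigma>] u refl G] .
      have "\<Phi> y m * y u ^ k = g y" if y: "y \<in> chart \<sigma>" "y u \<noteq> 0" for y
      proof -
        have "\<Phi> y m = ?G (ext y)"
          using m shift_eval_cong[OF \<omega>(1,2) m degree_linear_power[of s], of "restrict (ext y) (dual_monoid \<omega>)" "ext y"]
          by (simp add: \<Phi>_def root_act_def)
        moreover have "y u = ext y u"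
          using fun_cong[OF ext(2)[OF y], of u] u by simp
        moreover have "g y = g (ext y)"
          using coordinate_ring_restrict[OF g(1), of "ext y"] ext(2)[OF y] by simp
        ultimately show ?thesis
          using g(2) ext(1)[OF y] by simp
      qed
      then show ?thesis
        using g(1) by blast
    qed
    then have "local_lift \<Sigma> (root_map s) \<sigma> \<omega> (\<lambda>y. y u) \<Phi>"
      using mem eq by (intro local_liftI \<omega>(1) coordinate_ring_char[OF u])
    then show ?thesis
      using 3(2) by (intro exI[of _ \<omega>] exI[of _ "\<lambda>y. y u"] exI[of _ \<Phi>]) auto
  qed
qed

lemma root_map_automorphism: "automorphism \<Sigma> (root_map s)"
  unfolding automorphism_def
proof (intro conjI exI[of _ "root_map (- s)"] ballI)
  show "endomorphism \<Sigma> (root_map s)" "endomorphism \<Sigma> (root_map (- s))"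
    by (rule endomorphismI[OF fan root_map_local_lift]; assumption)+
  show "root_map (- s) (root_map s p) = p" "root_map s (root_map (- s) p) = p" for p
    using root_map_inverse[of s p] root_map_inverse[of "- s" p] by simp_all
qed

end

section \<open>Moving the fixed point of a smooth cone by root automorphisms\<close>

context toric_lattice
begin

lemma distinguished_chart_point:
  "restrict (\<lambda>m. if \<forall>v\<in>\<sigma>. m v = 0 then 1 else 0) (dual_monoid \<sigma>) \<in> (chart \<sigma> :: ('v, 'k::field) chart_point set)"
proof (rule chartI)
  fix m m' assume m: "m \<in> dual_monoid \<sigma>" "m' \<in> dual_monoid \<sigma>"
  have "m v + m' v = 0 \<longleftrightarrow> m v = 0 \<and> m' v = 0" if "v \<in> \<sigma>" for v
    using m that by (auto simp: dual_monoid_def add_nonneg_eq_0_iff)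
  then show "restrict (\<lambda>m. if \<forall>v\<in>\<sigma>. m v = 0 then 1 else 0) (dual_monoid \<sigma>) (\<lambda>v. m v + m' v) =
      restrict (\<lambda>m. if \<forall>v\<in>\<sigma>. m v = 0 then 1 else 0) (dual_monoid \<sigma>) m *
      (restrict (\<lambda>m. if \<forall>v\<in>\<sigma>. m v = 0 then 1 else 0) (dual_monoid \<sigma>) m' :: 'k)"
    using m by (auto simp: add_mem_dual_monoid)
qed (auto simp: zero_mem_dual_monoid)

text \<open>The cone is generated by vectors spanning its rays, which are positive multiples of
  primitive generators; on the latter \<open>d b\<close> takes only the values 0 and 1.\<close>

lemma smooth_cone_dual_basis:
  assumes fan: "fan \<Sigma>" and \<sigma>: "\<sigma> \<in> \<Sigma>" and B: "int_basis scale (primitive_generators \<sigma>) N"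
    and d: "\<forall>b\<in>primitive_generators \<sigma>. d b \<in> dual_lattice \<and>
      (\<forall>b'\<in>primitive_generators \<sigma>. d b b' = (if b' = b then 1 else 0))"
    and b: "b \<in> primitive_generators \<sigma>"
  shows "d b \<in> dual_monoid \<sigma>"
proof -
  obtain S where S: "finite S" "S \<subseteq> N" "\<sigma> = cone_hull S"
      "\<And>s. s \<in> S \<Longrightarrow> s \<noteq> 0 \<and> cone_hull {s} \<in> cone_rays \<sigma>"
    using cone_generated_by_rays[OF fan_rational[OF fan \<sigma>] fan_convex[OF fan \<sigma>]] by metis
  have "0 \<le> d b s" if s: "s \<in> S" for s
  proof -
    obtain w k where w: "primitive w" "0 < (k::nat)" "s = scale (of_nat k) w"
      using primitive_multiple[of s] S(2,4) s by blast
    have "w = scale (1 / of_nat k) s"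
      using w(2,3) by simp
    then have "w \<in> cone_hull {s}"
      using cone_hull_single by auto
    then have "w \<in> primitive_generators \<sigma>"
      using w(1) S(4)[OF s] by (auto simp: primitive_generators_def)
    then have "0 \<le> d b w"
      using d b by auto
    then show ?thesis
      unfolding w(3) using d b by (simp add: lin_scale[OF dual_lattice_lin])
  qed
  then show ?thesis
    using d b by (simp add: S(3) dual_monoid_cone_hull[OF S(1)])
qed

lemma smooth_cone_moves_into_torus:
  fixes \<Sigma> :: "'v set set"
  assumes complete: "complete_fan \<Sigma>" and \<sigma>: "\<sigma> \<in> \<Sigma>" and smooth: "smooth_cone \<sigma>"
    and rays: "\<forall>\<rho>\<in>fan_rays \<Sigma> - cone_rays \<sigma>. \<rho> \<subseteq> uminus ` \<sigma>"
  shows "\<exists>\<phi> :: ('v, 'k::field) toric_point \<Rightarrow> ('v, 'k) toric_point.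
    automorphism \<Sigma> \<phi> \<and> \<phi> (distinguished_point \<Sigma> \<sigma>) \<in> dense_torus \<Sigma>"
proof -
  have fan: "fan \<Sigma>"
    using complete by (simp add: complete_fan_def)
  define B where "B = primitive_generators \<sigma>"
  have B: "int_basis scale B N"
    using smooth by (simp add: smooth_cone_def B_def)
  have fin: "finite B"
    using B by (simp add: int_basis_def)
  obtain d where d: "\<forall>b\<in>B. d b \<in> dual_lattice \<and> (\<forall>b'\<in>B. d b b' = (if b' = b then 1 else 0))"
    using dual_basis[OF B] by blast
  have d_dual: "d b \<in> dual_monoid \<sigma>" if "b \<in> B" for b
    using smooth_cone_dual_basis[OF fan \<sigma> B[unfolded B_def] d[unfolded B_def]] that by (simp add: B_def)
  have b_cone: "b \<in> \<sigma>" if "b \<in> B" for b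
    using that by (auto simp: B_def primitive_generators_def cone_rays_def face_of_def)
  have root: "demazure_root scale N n \<Sigma> b (\<lambda>v. - d b v)" if b: "b \<in> B" for b
  proof (intro demazure_root.intro toric_lattice_axioms demazure_root_axioms.intro complete)
    show "b \<in> N"
      by (rule int_basis_mem[OF B b])
    show "(\<lambda>v. - d b v) \<in> dual_lattice"
      using d b dual_lattice_uminus by blast
    show "- d b b = - 1"
      using d b by simp
    fix \<rho> v assume \<rho>: "\<rho> \<in> fan_rays \<Sigma>" "\<rho> \<noteq> cone_hull {b}" "v \<in> \<rho>"
    \<comment> \<open>Another ray of the cone is spanned by another basis vector, where
      \<open>d b\<close> vanishes. A ray outside lies in the negative of the cone, where
      \<open>d b\<close> is nonpositive.\<close>
    show "0 \<le> - d b v"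
    proof (cases "\<rho> \<in> cone_rays \<sigma>")
      case True
      then have "\<rho> \<in> \<Sigma>" "dim \<rho> = 1"
        using \<rho>(1) by (auto simp: fan_rays_def)
      then obtain w where w: "primitive w" "\<rho> = cone_hull {w}"
        using ray_generator[OF fan_rational[OF fan] fan_convex[OF fan]] by blast
      have "w \<in> \<rho>"
        unfolding w(2) by (rule cone_hull_gen) auto
      then have "w \<in> B"
        using w(1) True by (auto simp: B_def primitive_generators_def)
      moreover have "w \<noteq> b"
        using \<rho>(2) w(2) by blast
      ultimately have "d b w = 0"
        using d b by simp
      then show ?thesis
        using \<rho>(3) d b by (auto simp: w(2) cone_hull_single lin_scale[OF dual_lattice_lin])
    next
      case False
      then obtain w where w: "w \<in> \<sigma>" "v = - w"
        using rays \<rho>(1,3) by blast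
      then show ?thesis
        using d_dual[OF b] by (simp add: dual_monoid_def lin_neg)
    qed
  qed
  \<comment> \<open>\<open>J\<close> is the set of coordinates already made nonzero. The root map of
    \<open>b\<close> does not disturb them, because their characters have height 0 at
    \<open>b\<close>. It is applied only if the coordinate of \<open>b\<close> is zero, so that the
    new value is exactly 1.\<close>
  have "\<exists>\<phi> :: ('v, 'k) toric_point \<Rightarrow> ('v, 'k) toric_point. \<exists>x\<in>chart \<sigma>. automorphism \<Sigma> \<phi> \<and>
      \<phi> (distinguished_point \<Sigma> \<sigma>) = chart_map \<Sigma> \<sigma> x \<and> (\<forall>b\<in>J. x (d b) \<noteq> 0)" if "J \<subseteq> B" for J
    using finite_subset[OF that fin] that
  proof (induction J)
    case empty
    then show ?case
      using automorphism_id distinguished_chart_point[of \<sigma>] by (auto simp: distinguished_point_def)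
  next
    case (insert b J)
    then obtain \<phi> :: "('v, 'k) toric_point \<Rightarrow> ('v, 'k) toric_point" and x where
        \<phi>: "x \<in> chart \<sigma>" "automorphism \<Sigma> \<phi>" "\<phi> (distinguished_point \<Sigma> \<sigma>) = chart_map \<Sigma> \<sigma> x"
        "\<forall>b\<in>J. x (d b) \<noteq> 0"
      by auto
    have b: "b \<in> B"
      using insert.prems by simp
    show ?case
    proof (cases "x (d b) = 0")
      case False
      then show ?thesis
        using \<phi> by (intro exI[of _ \<phi>] bexI[of _ x]) auto
    next
      case True
      interpret root: demazure_root scale N n \<Sigma> b "\<lambda>v. - d b v"
        by (rule root[OF b])
      let ?x = "root.root_act 1 \<sigma> x"
      have "?x (d b) = root.shift_eval x (d b) [:1, 1:]"
        using d_dual[OF b] d b by (simp add: root.root_act_def)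
      also have "\<dots> = 1"
        using True chart_one[OF \<phi>(1)] by (simp add: root.shift_eval_linear)
      finally have xb: "?x (d b) = 1" .
      have xb': "?x (d b') = x (d b')" if "b' \<in> J" for b'
      proof -
        have "b' \<in> B" "b' \<noteq> b"
          using that insert by auto
        then show ?thesis
          using d_dual[of b'] d b by (simp add: root.root_act_def root.shift_eval_one)
      qed
      have "automorphism \<Sigma> (root.root_map 1 \<circ> \<phi>)"
        by (rule automorphism_comp[OF root.root_map_automorphism \<phi>(2)])
      moreover have "(root.root_map 1 \<circ> \<phi>) (distinguished_point \<Sigma> \<sigma>) = chart_map \<Sigma> \<sigma> ?x"
        using root.root_map_eq[OF \<sigma> b_cone[OF b] \<phi>(1)] by (simp add: \<phi>(3))
      ultimately show ?thesis
        using root.root_act_mem[OF \<sigma> b_cone[OF b] \<phi>(1), of 1] xb xb' \<phi>(4)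
        by (intro exI[of _ "root.root_map 1 \<circ> \<phi>"] bexI[of _ ?x]) (auto simp del: comp_apply)
    qed
  qed
  from this[OF subset_refl] obtain \<phi> :: "('v, 'k) toric_point \<Rightarrow> ('v, 'k) toric_point" and x where
      \<phi>: "x \<in> chart \<sigma>" "automorphism \<Sigma> \<phi>" "\<phi> (distinguished_point \<Sigma> \<sigma>) = chart_map \<Sigma> \<sigma> x"
      "\<forall>b\<in>B. x (d b) \<noteq> 0"
    by auto
  \<comment> \<open>The character of \<open>?u\<close> is the product of all coordinates. It is
    nonzero at \<open>x\<close>, and \<open>?u\<close> vanishes on the cone only at 0, so
    \<open>x\<close> extends to the chart of the zero cone, which is the torus.\<close>
  let ?u = "\<lambda>v. \<Sum>b\<in>B. d b v"
  have u: "?u \<in> dual_monoid \<sigma>"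
    using d_dual by (rule dual_monoid_sum)
  have "x ?u \<noteq> 0"
    using chart_sum[OF \<phi>(1), of B d] d_dual \<phi>(4) fin by simp
  moreover have "{v \<in> \<sigma>. ?u v = 0} = {0}"
  proof (intro subset_antisym subsetI)
    fix v assume v: "v \<in> {v \<in> \<sigma>. ?u v = 0}"
    have "\<forall>b\<in>B. d b v = 0"
      using sum_nonneg_eq_0_iff[OF fin, of "\<lambda>b. d b v"] v d_dual by (auto simp: dual_monoid_def)
    then show "v \<in> {0}"
      using dual_basis_expand[OF B d, of v] by simp
  next
    fix v assume "v \<in> {0 :: 'v}"
    then show "v \<in> {v \<in> \<sigma>. ?u v = 0}"
      using fan_zero[OF fan \<sigma>] lin_zero[OF dual_monoid_lin[OF u]] by simp
  qed
  ultimately obtain z where z: "z \<in> chart {0}" "restrict z (dual_monoid \<sigma>) = x"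
    using face_point_exists[OF fan_rational[OF fan \<sigma>] u \<phi>(1)] by auto
  have "chart_map \<Sigma> \<sigma> x = chart_map \<Sigma> {0} z"
    unfolding z(2)[symmetric] using fan_zero[OF fan \<sigma>]
    by (intro chart_map_restrict[OF fan \<sigma> fan_zero_cone[OF fan] _ z(1)]) simp
  then show ?thesis
    using \<phi>(2,3) z(1) by (auto simp: dense_torus_def)
qed

end

section \<open>Algebraic identities behind the quotient rule\<close>

lemma quotient_rule_unique:
  fixes g h g' h' :: "'k::field"
  assumes "h \<noteq> 0" "h' \<noteq> 0" and eq: "g * h' = g' * h" and deriv: "dg * h' + g * dh' = dg' * h + g' * dh"
  shows "(dg * h - g * dh) / h\<^sup>2 = (dg' * h' - g' * dh') / h'\<^sup>2"
proof -
  have "(dg * h - g * dh) * h'\<^sup>2 - (dg' * h' - g' * dh') * h\<^sup>2 =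
      (dg * h' + g * dh' - (dg' * h + g' * dh)) * (h * h') - (dh * h' + dh' * h) * (g * h' - g' * h)"
    by (simp add: power2_eq_square algebra_simps)
  also have "\<dots> = 0"
    unfolding eq deriv by simp
  finally have *: "(dg * h - g * dh) * h'\<^sup>2 = (dg' * h' - g' * dh') * h\<^sup>2"
    by (simp only: right_minus_eq)
  have "h\<^sup>2 \<noteq> 0" "h'\<^sup>2 \<noteq> 0" using assms(1,2) by simp_all
  then show ?thesis
    using * by (rule frac_eq_eq[THEN iffD2])
qed

lemma quotient_rule_inverse:
  fixes g h :: "'k::field"
  assumes "h \<noteq> 0" "g \<noteq> 0"
  shows "- ((dg * h - g * dh) / h\<^sup>2) / (g / h)\<^sup>2 =
    ((dh * h + h * dh) * (g * h) - (h * h) * (dg * h + g * dh)) / (g * h)\<^sup>2"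
proof -
  have *: "((dh * h + h * dh) * (g * h) - (h * h) * (dg * h + g * dh)) = (- (dg * h - g * dh)) * h\<^sup>2"
    by (simp add: power2_eq_square algebra_simps)
  show ?thesis
    unfolding * power_divide power_mult_distrib using assms by simp
qed

lemma quotient_rule_cancel:
  fixes g h q :: "'k::field"
  assumes "q \<noteq> 0"
  shows "(dg * h - g * dh) / h\<^sup>2 =
    ((dg * q + g * dq) * (h * q) - (g * q) * (dh * q + h * dq)) / (h * q)\<^sup>2"
proof -
  have *: "((dg * q + g * dq) * (h * q) - (g * q) * (dh * q + h * dq)) = (dg * h - g * dh) * q\<^sup>2"
    by (simp add: power2_eq_square algebra_simps)
  show ?thesis
    unfolding * power_mult_distrib using assms by simp
qed

context toric_lattice
begin

subsection \<open>Linear independence of characters\<close>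

text \<open>The value at \<open>c\<close> of the one-parameter subgroup of \<open>v\<close>; the
  floor only converts the integral rational number \<open>m v\<close> into an exponent.\<close>

definition cocharacter :: "'v \<Rightarrow> 'k::field \<Rightarrow> ('v, 'k) chart_point" where
  "cocharacter v c = restrict (\<lambda>m. c powi \<lfloor>m v\<rfloor>) dual_lattice"

lemma floor_add_lattice:
  assumes "m \<in> dual_lattice" "m' \<in> dual_lattice" "v \<in> N"
  shows "\<lfloor>m v + m' v\<rfloor> = \<lfloor>m v\<rfloor> + \<lfloor>m' v\<rfloor>"
proof -
  have "rat_of_int \<lfloor>m v + m' v\<rfloor> = rat_of_int (\<lfloor>m v\<rfloor> + \<lfloor>m' v\<rfloor>)"
    unfolding of_int_add dual_lattice_floor[OF assms(1,3)] dual_lattice_floor[OF assms(2,3)]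
    by (rule dual_lattice_floor[OF dual_lattice_add[OF assms(1,2)] assms(3)])
  then show ?thesis
    by (simp only: of_int_eq_iff)
qed

lemma cocharacter_mem:
  assumes "v \<in> N" "c \<noteq> 0"
  shows "cocharacter v c \<in> chart {0}"
proof (rule chartI)
  show "cocharacter v c (\<lambda>v. m v + m' v) = cocharacter v c m * cocharacter v c m'"
    if "m \<in> dual_lattice" "m' \<in> dual_lattice" for m m'
    using that dual_lattice_add[OF that] assms(2)
    by (simp add: cocharacter_def floor_add_lattice[OF that assms(1)] power_int_add)
qed (simp_all add: cocharacter_def zero_mem_dual_monoid)

lemma chart_times:
  assumes "x \<in> chart \<sigma>" "y \<in> chart \<sigma>"
  shows "restrict (\<lambda>m. x m * y m) (dual_monoid \<sigma>) \<in> chart \<sigma>"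
  using chart_mult[OF assms(1)] chart_mult[OF assms(2)]
  by (intro chartI) (auto simp: zero_mem_dual_monoid add_mem_dual_monoid
      chart_one[OF assms(1)] chart_one[OF assms(2)])

text \<open>In characteristic zero, 2 has infinite multiplicative order. This makes the
  one-parameter subgroups at the parameter 2 separate the characters.\<close>

lemma two_powi_eq_1:
  assumes "(2 :: 'k::field_char_0) powi k = 1"
  shows "k = 0"
proof -
  have pos: "j = 0" if "(2 :: 'k) ^ j = 1" for j
  proof -
    have "of_nat (2 ^ j) = (of_nat 1 :: 'k)"
      using that by simp
    then show ?thesis
      by (simp only: of_nat_eq_iff) simp
  qed
  show ?thesis
  proof (cases "0 \<le> k")
    case True
    then show ?thesis
      using assms pos[of "nat k"] by (simp add: power_int_def)
  next
    case False
    then have "(2 :: 'k) ^ nat (- k) = 1"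
      using assms by (simp add: power_int_def inverse_eq_divide power_divide)
    then have "nat (- k) = 0"
      by (rule pos)
    then show ?thesis
      using False by simp
  qed
qed

lemma two_powi_inj:
  assumes "(2 :: 'k::field_char_0) powi j = 2 powi k"
  shows "j = k"
proof -
  have "(2 :: 'k) powi (j - k) = 1"
    using assms by (simp add: power_int_diff)
  then show ?thesis
    using two_powi_eq_1 by force
qed

lemma torus_separates:
  assumes "m \<in> dual_lattice" "m' \<in> dual_lattice" "m \<noteq> m'"
  shows "\<exists>t\<in>chart {0}. t m \<noteq> (t m' :: 'k::field_char_0)"
proof -
  obtain v where v: "v \<in> N" "m v \<noteq> m' v"
    using dual_lattice_separates[OF assms] by blast
  have "\<lfloor>m v\<rfloor> \<noteq> \<lfloor>m' v\<rfloor>"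
    using v dual_lattice_floor[OF assms(1) v(1)] dual_lattice_floor[OF assms(2) v(1)] by metis
  then have "cocharacter v 2 m \<noteq> (cocharacter v 2 m' :: 'k)"
    using two_powi_inj[where 'k = 'k] assms by (auto simp: cocharacter_def)
  then show ?thesis
    using cocharacter_mem[OF v(1), of "2 :: 'k"] by auto
qed

text \<open>Artin's argument: a relation translated by a torus point \<open>t\<close>, minus
  \<open>t k\<close> times the relation itself, no longer involves \<open>k\<close>; choosing
  \<open>t\<close> to separate \<open>m\<close> from \<open>k\<close> shows that the coefficient of
  \<open>m\<close> is zero.\<close>

lemma characters_independent:
  fixes c :: "('v \<Rightarrow> rat) \<Rightarrow> 'k::field_char_0"
  assumes "finite F" "F \<subseteq> dual_lattice" "\<And>x. x \<in> chart {0} \<Longrightarrow> (\<Sum>m\<in>F. c m * x m) = 0"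
  shows "\<forall>m\<in>F. c m = 0"
  using assms
proof (induction F arbitrary: c)
  case (insert k F)
  have F: "F \<subseteq> dual_lattice" and k: "k \<in> dual_lattice"
    using insert.prems by auto
  have "c m = 0" if m: "m \<in> F" for m
  proof -
    obtain t :: "('v, 'k) chart_point" where t: "t \<in> chart {0}" "t m \<noteq> t k"
      using torus_separates[of m k] F k m insert.hyps(2) by blast
    have "(\<Sum>m\<in>F. (c m * (t m - t k)) * x m) = 0" if x: "x \<in> chart {0}" for x
    proof -
      have "(\<Sum>m\<in>insert k F. c m * (t m * x m)) = 0"
      proof -
        have "(\<Sum>m\<in>insert k F. c m * (t m * x m)) =
            (\<Sum>m\<in>insert k F. c m * restrict (\<lambda>m. t m * x m) dual_lattice m)"
          using insert.prems(1) by (intro sum.cong) auto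
        then show ?thesis
          using insert.prems(2)[OF chart_times[OF t(1) x]] by simp
      qed
      moreover have "t k * (\<Sum>m\<in>insert k F. c m * x m) = 0"
        using insert.prems(2)[OF x] by simp
      ultimately have "(\<Sum>m\<in>insert k F. c m * (t m * x m)) - (\<Sum>m\<in>insert k F. t k * (c m * x m)) = 0"
        by (simp add: sum_distrib_left)
      then have "(\<Sum>m\<in>insert k F. (c m * (t m - t k)) * x m) = 0"
        unfolding sum_subtractf[symmetric] by (simp add: algebra_simps)
      then show ?thesis
        using insert.hyps by simp
    qed
    then have "\<forall>m\<in>F. c m * (t m - t k) = 0"
      by (rule insert.IH[OF F])
    then show ?thesis
      using m t(2) by auto
  qed
  moreover obtain x :: "('v, 'k) chart_point" where x: "x \<in> chart {0}"
    using cocharacter_mem[OF lattice_zero, of "1 :: 'k"] by auto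
  ultimately have "c k * x k = 0"
    using insert.prems(2)[OF x] insert.hyps by simp
  then show ?case
    using \<open>\<And>m. m \<in> F \<Longrightarrow> c m = 0\<close> torus_nonzero[OF x k] by auto
qed simp

text \<open>The argument \<open>a\<close> need not be a point of the chart. Vanishing on the chart
  forces all coefficients to be zero, so an identity checked on points may be evaluated at tangent
  vectors.\<close>

lemma coordinate_ring_eq_0:
  fixes g :: "('v, 'k::field_char_0) chart_point \<Rightarrow> 'k"
  assumes "g \<in> coordinate_ring \<sigma>" "0 \<in> \<sigma>" "\<And>x. x \<in> chart \<sigma> \<Longrightarrow> g x = 0"
  shows "g a = 0"
proof -
  obtain F c where F: "finite F" "F \<subseteq> dual_monoid \<sigma>" "g = (\<lambda>x. \<Sum>m\<in>F. c m * x m)"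
    using assms(1) by (rule coordinate_ringE)
  have sub: "F \<subseteq> dual_lattice"
    using F(2) dual_monoid_dual_lattice by blast
  have "(\<Sum>m\<in>F. c m * x m) = 0" if x: "x \<in> chart {0}" for x
    using assms(3)[OF chart_restrict[OF _ x]] assms(2) coordinate_ring_restrict[OF assms(1), of x] F(3) by simp
  then have "\<forall>m\<in>F. c m = 0"
    by (rule characters_independent[OF F(1) sub])
  then show ?thesis
    by (simp add: F(3))
qed

subsection \<open>Derivatives of germs\<close>

lemma tangent_zero:
  assumes "tangent \<sigma> x a" "x \<in> chart \<sigma>"
  shows "a (\<lambda>_. 0) = 0"
proof -
  have "a (\<lambda>v. (\<lambda>_. 0) v + (\<lambda>_. 0) v) = a (\<lambda>_. 0) * x (\<lambda>_. 0) + x (\<lambda>_. 0) * a (\<lambda>_. 0)"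
    by (rule bspec[OF bspec[OF assms(1)[unfolded tangent_def] zero_mem_dual_monoid] zero_mem_dual_monoid])
  then have "a (\<lambda>_. 0) = a (\<lambda>_. 0) + a (\<lambda>_. 0)"
    by (simp only: chart_one[OF assms(2)] add_0 mult_1 mult_1_right)
  then show ?thesis
    unfolding add_cancel_right_right .
qed

text \<open>A relation and not a function, since the quotient rule is applied to some fraction
  representing the germ; \<open>germ_deriv_unique\<close> removes the dependence for tangent
  vectors.\<close>

definition germ_deriv ::
    "'v set \<Rightarrow> ('v, 'k::field) chart_point \<Rightarrow> (('v \<Rightarrow> rat) \<Rightarrow> 'k) \<Rightarrow>
      (('v, 'k) chart_point \<Rightarrow> 'k) \<Rightarrow> 'k \<Rightarrow> bool" where
  "germ_deriv \<sigma> x a f d \<longleftrightarrow>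
     (\<exists>g h. local_fraction \<sigma> x f g h \<and> d = (g a * h x - g x * h a) / (h x)\<^sup>2)"

lemma germ_derivE:
  assumes "germ_deriv \<sigma> x a f d"
  obtains g h where "local_fraction \<sigma> x f g h" "d = (g a * h x - g x * h a) / (h x)\<^sup>2"
  using assms unfolding germ_deriv_def by blast

lemma local_fractionD:
  assumes "local_fraction \<sigma> x f g h"
  shows "g \<in> coordinate_ring \<sigma>" "h \<in> coordinate_ring \<sigma>" "h x \<noteq> 0"
    "\<And>y. y \<in> chart \<sigma> \<Longrightarrow> h y \<noteq> 0 \<Longrightarrow> f y = g y / h y"
  using assms by (auto simp: local_fraction_def)

lemma germ_derivI:
  assumes "g \<in> coordinate_ring \<sigma>" "h \<in> coordinate_ring \<sigma>" "h x \<noteq> 0"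
    "\<And>y. y \<in> chart \<sigma> \<Longrightarrow> h y \<noteq> 0 \<Longrightarrow> f y = g y / h y" "d = (g a * h x - g x * h a) / (h x)\<^sup>2"
  shows "germ_deriv \<sigma> x a f d"
  using assms unfolding germ_deriv_def local_fraction_def by blast

lemma germ_deriv_exists: "local_fraction \<sigma> x f g h \<Longrightarrow> \<exists>d. germ_deriv \<sigma> x a f d"
  unfolding germ_deriv_def by blast

text \<open>Two fractions for one germ agree only where both denominators are nonzero, so
  \<open>g h' - g' h\<close> is multiplied by \<open>h h'\<close> to vanish on the whole chart and
  thus also at \<open>a\<close>. As its first factor vanishes at \<open>x\<close>, the Leibniz rule
  leaves only the derivative of that factor, which is therefore zero.\<close>

lemma germ_deriv_unique:
  fixes x :: "('v, 'k::field_char_0) chart_point"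
  assumes a: "tangent \<sigma> x a" and x: "x \<in> chart \<sigma>" "0 \<in> \<sigma>"
    and "germ_deriv \<sigma> x a f d" "germ_deriv \<sigma> x a f d'"
  shows "d = d'"
proof -
  obtain g h where gh0: "local_fraction \<sigma> x f g h" and gh1: "d = (g a * h x - g x * h a) / (h x)\<^sup>2"
    using assms(4) by (rule germ_derivE)
  note gh = local_fractionD[OF gh0] gh1
  obtain g' h' where gh'0: "local_fraction \<sigma> x f g' h'" and gh'1: "d' = (g' a * h' x - g' x * h' a) / (h' x)\<^sup>2"
    using assms(5) by (rule germ_derivE)
  note gh' = local_fractionD[OF gh'0] gh'1
  obtain p where p0: "ring_product \<sigma> g h' p"
    using ring_productE[OF gh(1) gh'(2)] .
  note p = ring_productD[OF p0]
  obtain q where q0: "ring_product \<sigma> g' h q"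
    using ring_productE[OF gh'(1) gh(2)] .
  note q = ring_productD[OF q0]
  obtain r where r0: "ring_product \<sigma> h h' r"
    using ring_productE[OF gh(2) gh'(2)] .
  note r = ring_productD[OF r0]
  have k: "(\<lambda>y. p y + (- 1) * q y) \<in> coordinate_ring \<sigma>"
    by (intro coordinate_ring_add coordinate_ring_cmult p q)
  obtain s where s0: "ring_product \<sigma> (\<lambda>y. p y + (- 1) * q y) r s"
    using ring_productE[OF k r(1)] .
  note s = ring_productD[OF s0]
  have "s y = 0" if y: "y \<in> chart \<sigma>" for y
  proof (cases "h y = 0 \<or> h' y = 0")
    case False
    then have "g y / h y = g' y / h' y"
      using gh(4)[OF y] gh'(4)[OF y] by simp
    then show ?thesis
      using False by (simp add: s(2)[OF y] p(2)[OF y] q(2)[OF y] frac_eq_eq)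
  qed (auto simp: s(2)[OF y] r(2)[OF y])
  then have "s a = 0"
    by (rule coordinate_ring_eq_0[OF s(1) x(2)])
  moreover have eq: "g x * h' x = g' x * h x"
    using gh(3,4) gh'(3,4) x(1) by (metis frac_eq_eq)
  ultimately have "(p a - q a) * (h x * h' x) = 0"
    using s(3)[OF a] p(2)[OF x(1)] q(2)[OF x(1)] r(2)[OF x(1)] by simp
  then have "g a * h' x + g x * h' a = g' a * h x + g' x * h a"
    using gh(3) gh'(3) p(3)[OF a] q(3)[OF a] by simp
  then show ?thesis
    unfolding gh(5) gh'(5) using gh(3) gh'(3) eq by (intro quotient_rule_unique)
qed

lemma germ_deriv_mult:
  assumes a: "tangent \<sigma> x a" and x: "x \<in> chart \<sigma>"
    and "germ_deriv \<sigma> x a f d" "germ_deriv \<sigma> x a f' d'"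
  shows "germ_deriv \<sigma> x a (\<lambda>y. f y * f' y) (d * f' x + f x * d')"
proof -
  obtain g h where gh0: "local_fraction \<sigma> x f g h" and gh1: "d = (g a * h x - g x * h a) / (h x)\<^sup>2"
    using assms(3) by (rule germ_derivE)
  note gh = local_fractionD[OF gh0] gh1
  obtain g' h' where gh'0: "local_fraction \<sigma> x f' g' h'" and gh'1: "d' = (g' a * h' x - g' x * h' a) / (h' x)\<^sup>2"
    using assms(4) by (rule germ_derivE)
  note gh' = local_fractionD[OF gh'0] gh'1
  obtain p where p0: "ring_product \<sigma> g g' p"
    using ring_productE[OF gh(1) gh'(1)] .
  note p = ring_productD[OF p0]
  obtain q where q0: "ring_product \<sigma> h h' q"
    using ring_productE[OF gh(2) gh'(2)] .
  note q = ring_productD[OF q0]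
  have "d * f' x + f x * d' = (p a * q x - p x * q a) / (q x)\<^sup>2"
    using gh(3) gh'(3)
    by (simp add: gh(4)[OF x gh(3)] gh'(4)[OF x gh'(3)] gh(5) gh'(5) p(2)[OF x] q(2)[OF x] p(3)[OF a] q(3)[OF a]
        divide_simps power2_eq_square algebra_simps)
  then show ?thesis
    using p q gh gh' x by (intro germ_derivI[of p \<sigma> q]) auto
qed

lemma germ_deriv_add:
  assumes a: "tangent \<sigma> x a" and x: "x \<in> chart \<sigma>"
    and "germ_deriv \<sigma> x a f d" "germ_deriv \<sigma> x a f' d'"
  shows "germ_deriv \<sigma> x a (\<lambda>y. f y + f' y) (d + d')"
proof -
  obtain g h where gh0: "local_fraction \<sigma> x f g h" and gh1: "d = (g a * h x - g x * h a) / (h x)\<^sup>2"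
    using assms(3) by (rule germ_derivE)
  note gh = local_fractionD[OF gh0] gh1
  obtain g' h' where gh'0: "local_fraction \<sigma> x f' g' h'" and gh'1: "d' = (g' a * h' x - g' x * h' a) / (h' x)\<^sup>2"
    using assms(4) by (rule germ_derivE)
  note gh' = local_fractionD[OF gh'0] gh'1
  obtain p where p0: "ring_product \<sigma> g h' p"
    using ring_productE[OF gh(1) gh'(2)] .
  note p = ring_productD[OF p0]
  obtain p' where p'0: "ring_product \<sigma> g' h p'"
    using ring_productE[OF gh'(1) gh(2)] .
  note p' = ring_productD[OF p'0]
  obtain q where q0: "ring_product \<sigma> h h' q"
    using ring_productE[OF gh(2) gh'(2)] .
  note q = ring_productD[OF q0]
  have "d + d' = ((p a + p' a) * q x - (p x + p' x) * q a) / (q x)\<^sup>2"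
    using gh(3) gh'(3)
    by (simp add: gh(5) gh'(5) p(2)[OF x] p'(2)[OF x] q(2)[OF x] p(3)[OF a] p'(3)[OF a] q(3)[OF a]
        divide_simps power2_eq_square algebra_simps)
  moreover have "f y + f' y = (p y + p' y) / q y" if "y \<in> chart \<sigma>" "q y \<noteq> 0" for y
  proof -
    have h0: "h y \<noteq> 0" "h' y \<noteq> 0"
      using that q(2) by auto
    show ?thesis
      unfolding gh(4)[OF that(1) h0(1)] gh'(4)[OF that(1) h0(2)] p(2)[OF that(1)] p'(2)[OF that(1)] q(2)[OF that(1)]
      using h0 by (rule add_frac_eq)
  qed
  ultimately show ?thesis
    using q(2)[OF x] gh(3) gh'(3)
    by (intro germ_derivI[of "\<lambda>y. p y + p' y" \<sigma> q] coordinate_ring_add p p' q) auto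
qed

lemma germ_deriv_cmult:
  assumes "germ_deriv \<sigma> x a f d"
  shows "germ_deriv \<sigma> x a (\<lambda>y. c * f y) (c * d)"
proof -
  obtain g h where gh0: "local_fraction \<sigma> x f g h" and gh1: "d = (g a * h x - g x * h a) / (h x)\<^sup>2"
    using assms by (rule germ_derivE)
  note gh = local_fractionD[OF gh0] gh1
  have "c * d = (c * g a * h x - c * g x * h a) / (h x)\<^sup>2"
    unfolding gh(5) times_divide_eq_right right_diff_distrib mult.assoc ..
  then show ?thesis
    using gh(3,4) by (intro germ_derivI[of "\<lambda>y. c * g y" \<sigma> h] coordinate_ring_cmult gh(1,2)) auto
qed

lemma germ_deriv_character:
  assumes a: "tangent \<sigma> x a" and x: "x \<in> chart \<sigma>" and m: "m \<in> dual_monoid \<sigma>"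
  shows "germ_deriv \<sigma> x a (\<lambda>y. y m) (a m)"
proof (rule germ_derivI[of "\<lambda>y. y m" \<sigma> "\<lambda>y. y (\<lambda>_. 0)"])
  show "a m = (a m * x (\<lambda>_. 0) - x m * a (\<lambda>_. 0)) / (x (\<lambda>_. 0))\<^sup>2"
    by (simp add: tangent_zero[OF a x] chart_one[OF x])
qed (simp_all add: coordinate_ring_char m zero_mem_dual_monoid chart_one chart_one[OF x])

lemma germ_deriv_zero:
  assumes "x \<in> chart \<sigma>"
  shows "germ_deriv \<sigma> x a (\<lambda>y. 0) 0"
  using chart_one[OF assms]
  by (intro germ_derivI[of "\<lambda>y. 0" \<sigma> "\<lambda>y. y (\<lambda>_. 0)"] coordinate_ring_char coordinate_ring_zero zero_mem_dual_monoid) auto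

lemma germ_deriv_sum:
  assumes a: "tangent \<sigma> x a" and x: "x \<in> chart \<sigma>"
    and "\<And>i. i \<in> I \<Longrightarrow> germ_deriv \<sigma> x a (f i) (d i)"
  shows "germ_deriv \<sigma> x a (\<lambda>y. \<Sum>i\<in>I. f i y) (\<Sum>i\<in>I. d i)"
  using assms(3)
proof (induction I rule: infinite_finite_induct)
  case (insert i I)
  have "germ_deriv \<sigma> x a (\<lambda>y. f i y + (\<Sum>i\<in>I. f i y)) (d i + (\<Sum>i\<in>I. d i))"
    using insert by (intro germ_deriv_add[OF a x]) auto
  then show ?case
    using insert.hyps by simp
qed (simp_all add: germ_deriv_zero[OF x])

lemma germ_deriv_inverse:
  assumes a: "tangent \<sigma> x a" and x: "x \<in> chart \<sigma>"
    and "germ_deriv \<sigma> x a f d" "f x \<noteq> 0"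
  shows "germ_deriv \<sigma> x a (\<lambda>y. inverse (f y)) (- d / (f x)\<^sup>2)"
proof -
  obtain g h where gh0: "local_fraction \<sigma> x f g h" and gh1: "d = (g a * h x - g x * h a) / (h x)\<^sup>2"
    using assms(3) by (rule germ_derivE)
  note gh = local_fractionD[OF gh0] gh1
  obtain p where p0: "ring_product \<sigma> h h p"
    using ring_productE[OF gh(2) gh(2)] .
  note p = ring_productD[OF p0]
  obtain q where q0: "ring_product \<sigma> g h q"
    using ring_productE[OF gh(1) gh(2)] .
  note q = ring_productD[OF q0]
  have fx: "f x = g x / h x"
    by (rule gh(4)[OF x gh(3)])
  then have gx: "g x \<noteq> 0"
    using assms(4) by auto
  have "- d / (f x)\<^sup>2 = (p a * q x - p x * q a) / (q x)\<^sup>2"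
    unfolding fx gh(5) p(2)[OF x] q(2)[OF x] p(3)[OF a] q(3)[OF a] by (rule quotient_rule_inverse[OF gh(3) gx])
  moreover have "inverse (f y) = p y / q y" if "y \<in> chart \<sigma>" "q y \<noteq> 0" for y
    using that p(2) q(2) gh(4)[of y] by auto
  ultimately show ?thesis
    using q(2)[OF x] gx gh(3) by (intro germ_derivI[of p \<sigma> q] p q) auto
qed

text \<open>Derivatives are local: extending the fraction by \<open>q\<close> confines its domain to
  the region where the two functions agree, and does not change the quotient rule.\<close>

lemma germ_deriv_cong:
  assumes a: "tangent \<sigma> x a" and x: "x \<in> chart \<sigma>"
    and "germ_deriv \<sigma> x a f d" and q: "q \<in> coordinate_ring \<sigma>" "q x \<noteq> 0"
    and eq: "\<And>y. y \<in> chart \<sigma> \<Longrightarrow> q y \<noteq> 0 \<Longrightarrow> f y = f' y"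
  shows "germ_deriv \<sigma> x a f' d"
proof -
  obtain g h where gh0: "local_fraction \<sigma> x f g h" and gh1: "d = (g a * h x - g x * h a) / (h x)\<^sup>2"
    using assms(3) by (rule germ_derivE)
  note gh = local_fractionD[OF gh0] gh1
  obtain g' where g'0: "ring_product \<sigma> g q g'"
    using ring_productE[OF gh(1) q(1)] .
  note g' = ring_productD[OF g'0]
  obtain h' where h'0: "ring_product \<sigma> h q h'"
    using ring_productE[OF gh(2) q(1)] .
  note h' = ring_productD[OF h'0]
  have "d = (g' a * h' x - g' x * h' a) / (h' x)\<^sup>2"
    unfolding gh(5) g'(2)[OF x] h'(2)[OF x] g'(3)[OF a] h'(3)[OF a] by (rule quotient_rule_cancel[OF q(2)])
  moreover have "f' y = g' y / h' y" if "y \<in> chart \<sigma>" "h' y \<noteq> 0" for y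
    using that g'(2) h'(2) gh(4)[of y] eq[of y, symmetric] by auto
  ultimately show ?thesis
    using h'(2)[OF x] gh(3) q(2) by (intro germ_derivI[of g' \<sigma> h'] g' h') auto
qed

lemma local_fraction_nonzero:
  assumes "local_fraction \<sigma> x f g h" "x \<in> chart \<sigma>" "f x \<noteq> 0"
  shows "\<exists>q\<in>coordinate_ring \<sigma>. q x \<noteq> 0 \<and> (\<forall>y\<in>chart \<sigma>. q y \<noteq> 0 \<longrightarrow> f y \<noteq> 0)"
proof -
  have gh: "g \<in> coordinate_ring \<sigma>" "h \<in> coordinate_ring \<sigma>" "h x \<noteq> 0"
      "\<And>y. y \<in> chart \<sigma> \<Longrightarrow> h y \<noteq> 0 \<Longrightarrow> f y = g y / h y"
    using assms(1) by (auto simp: local_fraction_def)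
  obtain q where q0: "ring_product \<sigma> g h q"
    using ring_productE[OF gh(1,2)] .
  note q = ring_productD[OF q0]
  then show ?thesis
    using gh assms(2,3) by (intro bexI[of _ q]) auto
qed

subsection \<open>Push-forward of tangent vectors\<close>

text \<open>Seen in the chart of \<open>\<sigma>\<close>, the chart of \<open>\<tau>\<close> is the
  principal open set of a character cutting out the face
  \<open>\<sigma> \<inter> \<tau>\<close>.\<close>

lemma openin_chart_image:
  fixes \<Sigma> :: "'v set set"
  assumes fan: "fan \<Sigma>" and \<tau>: "\<tau> \<in> \<Sigma>"
  shows "openin (toric_topology \<Sigma>) (chart_map \<Sigma> \<tau> ` (chart \<tau> :: ('v, 'k::field) chart_point set))"
  unfolding openin_toric_topology
proof (intro conjI ballI)
  show "chart_map \<Sigma> \<tau> ` (chart \<tau> :: ('v, 'k) chart_point set) \<subseteq> toric_variety \<Sigma>"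
    using chart_map_mem[OF \<tau>] by blast
  fix \<sigma> assume \<sigma>: "\<sigma> \<in> \<Sigma>"
  obtain u where u: "u \<in> dual_monoid \<sigma>" "\<sigma> \<inter> \<tau> = {v \<in> \<sigma>. u v = 0}"
    using face_by_dual_monoid[OF fan_Int_face[OF fan \<sigma> \<tau>]] by blast
  have "{x \<in> chart \<sigma>. chart_map \<Sigma> \<sigma> x \<in> chart_map \<Sigma> \<tau> ` chart \<tau>} =
      {x \<in> chart \<sigma>. x u \<noteq> (0 :: 'k)}"
  proof (intro subset_antisym subsetI; elim CollectE conjE; intro CollectI conjI)
    fix x :: "('v, 'k) chart_point"
    assume x: "x \<in> chart \<sigma>" "chart_map \<Sigma> \<sigma> x \<in> chart_map \<Sigma> \<tau> ` chart \<tau>"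
    then obtain y where y: "y \<in> chart \<tau>" "chart_map \<Sigma> \<sigma> x = chart_map \<Sigma> \<tau> y" by blast
    obtain z where z: "z \<in> chart (\<sigma> \<inter> \<tau>)" "x = restrict z (dual_monoid \<sigma>)"
      using y(2) unfolding chart_map_eq_iff[OF fan \<sigma> \<tau> x(1) y(1)] by blast
    then show "x u \<noteq> 0"
      using face_unit[OF u(1), of z] u by simp
  next
    fix x :: "('v, 'k) chart_point"
    assume x: "x \<in> chart \<sigma>" "x u \<noteq> 0"
    then obtain z where z: "z \<in> chart (\<sigma> \<inter> \<tau>)" "restrict z (dual_monoid \<sigma>) = x"
      using face_point_exists[OF fan_rational[OF fan \<sigma>] u(1) x] u(2) by auto
    have "chart_map \<Sigma> \<sigma> x = chart_map \<Sigma> \<tau> (restrict z (dual_monoid \<tau>))"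
      unfolding chart_map_eq_iff[OF fan \<sigma> \<tau> x(1) chart_restrict[OF Int_lower2 z(1)]]
      using z by blast
    then show "chart_map \<Sigma> \<sigma> x \<in> chart_map \<Sigma> \<tau> ` chart \<tau>"
      using chart_restrict[OF Int_lower2 z(1)] by blast
  qed auto
  then show "openin (chart_topology \<sigma>)
      {x \<in> chart \<sigma>. chart_map \<Sigma> \<sigma> x \<in> chart_map \<Sigma> \<tau> ` (chart \<tau> :: ('v, 'k) chart_point set)}"
    using openin_principal[OF coordinate_ring_char[OF u(1)]] by simp
qed

lemma endomorphism_preimage:
  assumes "endomorphism \<Sigma> \<phi>" "openin (toric_topology \<Sigma>) U" "\<sigma> \<in> \<Sigma>" "x \<in> chart \<sigma>"
    and "\<phi> (chart_map \<Sigma> \<sigma> x) \<in> U"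
  shows "\<exists>q\<in>coordinate_ring \<sigma>. q x \<noteq> 0 \<and> (\<forall>y\<in>chart \<sigma>. q y \<noteq> 0 \<longrightarrow> \<phi> (chart_map \<Sigma> \<sigma> y) \<in> U)"
proof -
  have "openin (toric_topology \<Sigma>) {p \<in> toric_variety \<Sigma>. \<phi> p \<in> U}"
    using assms(1,2) openin_continuous_map_preimage[of "toric_topology \<Sigma>" "toric_topology \<Sigma>" \<phi> U]
    by (simp add: endomorphism_def topspace_toric_topology)
  then have op: "openin (chart_topology \<sigma>) {x \<in> chart \<sigma>. chart_map \<Sigma> \<sigma> x \<in> {p \<in> toric_variety \<Sigma>. \<phi> p \<in> U}}"
    using assms(3) by (simp add: openin_toric_topology)
  have "x \<in> {x \<in> chart \<sigma>. chart_map \<Sigma> \<sigma> x \<in> {p \<in> toric_variety \<Sigma>. \<phi> p \<in> U}}"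
    using assms(4,5) chart_map_mem[OF assms(3,4)] by simp
  then obtain q where q: "q \<in> coordinate_ring \<sigma>" "q x \<noteq> 0"
      "{y \<in> chart \<sigma>. q y \<noteq> 0} \<subseteq> {x \<in> chart \<sigma>. chart_map \<Sigma> \<sigma> x \<in> {p \<in> toric_variety \<Sigma>. \<phi> p \<in> U}}"
    using op unfolding openin_chart_topology by blast
  then show ?thesis
    by (intro bexI[of _ q]) auto
qed

text \<open>The differential of \<open>\<phi>\<close>. The vector \<open>b\<close> assigns to
  \<open>m\<close> the derivative along \<open>a\<close> of the character of \<open>m\<close>
  composed with \<open>\<phi>\<close>. The Leibniz rule makes \<open>b\<close> tangent, and
  linearity in the characters together with the quotient rule extends the chain rule to all
  germs.\<close>

lemma push_forward:
  fixes \<phi> :: "('v, 'k::field_char_0) toric_point \<Rightarrow> ('v, 'k) toric_point"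
  assumes fan: "fan \<Sigma>" and \<phi>: "endomorphism \<Sigma> \<phi>"
    and \<sigma>: "\<sigma> \<in> \<Sigma>" and x: "x \<in> chart \<sigma>" and \<tau>: "\<tau> \<in> \<Sigma>" and y: "y \<in> chart \<tau>"
    and xy: "\<phi> (chart_map \<Sigma> \<sigma> x) = chart_map \<Sigma> \<tau> y" and a: "tangent \<sigma> x a"
  shows "\<exists>b. tangent \<tau> y b \<and> (\<forall>F d. germ_deriv \<tau> y b (F \<circ> chart_map \<Sigma> \<tau>) d \<longrightarrow>
     germ_deriv \<sigma> x a (F \<circ> \<phi> \<circ> chart_map \<Sigma> \<sigma>) d)"
proof -
  note \<sigma>0 = fan_zero[OF fan \<sigma>]
  define f where "f = (\<lambda>m. character \<Sigma> m \<circ> \<phi> \<circ> chart_map \<Sigma> \<sigma> :: ('v, 'k) chart_point \<Rightarrow> 'k)"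
  have fx: "f m x = y m" if "m \<in> dual_monoid \<tau>" for m
    using character_eq[OF fan \<tau> y that] xy by (simp add: f_def)
  have "\<exists>d. germ_deriv \<sigma> x a (f m) d" if m: "m \<in> dual_monoid \<tau>" for m
  proof -
    have "regular_at \<Sigma> (chart_map \<Sigma> \<sigma> x) (character \<Sigma> m \<circ> \<phi>)"
      using character_regular_at[OF fan \<tau> y m] xy
      by (intro endomorphism_regular_at[OF fan \<phi> chart_map_mem[OF \<sigma> x]]) simp
    then obtain g h where "local_fraction \<sigma> x (character \<Sigma> m \<circ> \<phi> \<circ> chart_map \<Sigma> \<sigma>) g h"
      by (rule regular_atE[OF fan \<sigma> x])
    then show ?thesis
      unfolding f_def by (rule germ_deriv_exists)
  qed
  then obtain b where b: "\<And>m. m \<in> dual_monoid \<tau> \<Longrightarrow> germ_deriv \<sigma> x a (f m) (b m)"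
    by metis
  \<comment> \<open>Near \<open>x\<close> the map lands in the chart of \<open>\<tau>\<close>. Only
    there do the characters of \<open>\<tau>\<close> have meaningful and multiplicative
    values.\<close>
  obtain q where q: "q \<in> coordinate_ring \<sigma>" "q x \<noteq> 0"
      "\<And>x'. x' \<in> chart \<sigma> \<Longrightarrow> q x' \<noteq> 0 \<Longrightarrow> \<phi> (chart_map \<Sigma> \<sigma> x') \<in> chart_map \<Sigma> \<tau> ` chart \<tau>"
    using endomorphism_preimage[OF \<phi> openin_chart_image[OF fan \<tau>] \<sigma> x] xy y by auto
  have lift: "\<exists>y'\<in>chart \<tau>. \<phi> (chart_map \<Sigma> \<sigma> x') = chart_map \<Sigma> \<tau> y' \<and> (\<forall>m\<in>dual_monoid \<tau>. f m x' = y' m)"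
    if x': "x' \<in> chart \<sigma>" "q x' \<noteq> 0" for x'
  proof -
    obtain y' where y': "y' \<in> chart \<tau>" "\<phi> (chart_map \<Sigma> \<sigma> x') = chart_map \<Sigma> \<tau> y'"
      using q(3)[OF x'] by blast
    then show ?thesis
      using character_eq[OF fan \<tau> y'(1)] by (intro bexI[of _ y']) (simp_all add: f_def)
  qed
  have tangent: "tangent \<tau> y b"
    unfolding tangent_def
  proof (intro ballI)
    fix m m' assume m: "m \<in> dual_monoid \<tau>" "m' \<in> dual_monoid \<tau>"
    note mm = add_mem_dual_monoid[OF m]
    have "germ_deriv \<sigma> x a (\<lambda>x'. f m x' * f m' x') (b m * f m' x + f m x * b m')"
      by (rule germ_deriv_mult[OF a x b[OF m(1)] b[OF m(2)]])
    then have "germ_deriv \<sigma> x a (f (\<lambda>v. m v + m' v)) (b m * f m' x + f m x * b m')"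
    proof (rule germ_deriv_cong[OF a x _ q(1,2)])
      fix x' assume x': "x' \<in> chart \<sigma>" "q x' \<noteq> 0"
      obtain y' where "y' \<in> chart \<tau>" "\<forall>m\<in>dual_monoid \<tau>. f m x' = y' m"
        using lift[OF x'] by blast
      then show "f m x' * f m' x' = f (\<lambda>v. m v + m' v) x'"
        using m mm chart_mult[of y' \<tau>] by simp
    qed
    then show "b (\<lambda>v. m v + m' v) = b m * y m' + y m * b m'"
      using germ_deriv_unique[OF a x \<sigma>0 b[OF mm]] fx m by simp
  qed
  have combo: "germ_deriv \<sigma> x a (\<lambda>x'. \<Sum>m\<in>F. c m * f m x') (\<Sum>m\<in>F. c m * b m)"
    if "F \<subseteq> dual_monoid \<tau>" for F c
    using that by (intro germ_deriv_sum[OF a x] germ_deriv_cmult b) auto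
  have "germ_deriv \<sigma> x a (F \<circ> \<phi> \<circ> chart_map \<Sigma> \<sigma>) d"
    if F: "germ_deriv \<tau> y b (F \<circ> chart_map \<Sigma> \<tau>) d" for F d
  proof -
    obtain g h where gh0: "local_fraction \<tau> y (F \<circ> chart_map \<Sigma> \<tau>) g h" and gh1: "d = (g b * h y - g y * h b) / (h y)\<^sup>2"
      using F by (rule germ_derivE)
  note gh = local_fractionD[OF gh0] gh1
    obtain I c where I: "finite I" "I \<subseteq> dual_monoid \<tau>" "g = (\<lambda>x. \<Sum>m\<in>I. c m * x m)"
      using gh(1) by (rule coordinate_ringE)
    obtain I' c' where I': "finite I'" "I' \<subseteq> dual_monoid \<tau>" "h = (\<lambda>x. \<Sum>m\<in>I'. c' m * x m)"
      using gh(2) by (rule coordinate_ringE)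
    define fg where "fg = (\<lambda>x'. \<Sum>m\<in>I. c m * f m x')"
    define fh where "fh = (\<lambda>x'. \<Sum>m\<in>I'. c' m * f m x')"
    have fgx: "fg x' = g y'" and fhx: "fh x' = h y'" if "\<forall>m\<in>dual_monoid \<tau>. f m x' = y' m" for x' y'
      unfolding fg_def fh_def I(3) I'(3) using that I(2) I'(2) by (auto intro!: sum.cong)
    have fx': "\<forall>m\<in>dual_monoid \<tau>. f m x = y m"
      using fx by blast
    have dg: "germ_deriv \<sigma> x a fg (g b)" and dh: "germ_deriv \<sigma> x a fh (h b)"
      using combo[OF I(2), of c] combo[OF I'(2), of c'] by (simp_all add: fg_def fh_def I(3) I'(3))
    have fh0: "fh x \<noteq> 0"
      using fhx[OF fx'] gh(3) by simp
    obtain g1 h1 where lf: "local_fraction \<sigma> x fh g1 h1"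
      using dh unfolding germ_deriv_def by blast
    obtain r where r: "r \<in> coordinate_ring \<sigma>" "r x \<noteq> 0" "\<forall>x'\<in>chart \<sigma>. r x' \<noteq> 0 \<longrightarrow> fh x' \<noteq> 0"
      using local_fraction_nonzero[OF lf x fh0] by blast
    obtain s where s0: "ring_product \<sigma> q r s"
      using ring_productE[OF q(1) r(1)] .
    note s = ring_productD[OF s0]
    have "germ_deriv \<sigma> x a (\<lambda>x'. fg x' * inverse (fh x'))
        (g b * inverse (fh x) + fg x * (- h b / (fh x)\<^sup>2))"
      by (rule germ_deriv_mult[OF a x dg germ_deriv_inverse[OF a x dh fh0]])
    then have "germ_deriv \<sigma> x a (F \<circ> \<phi> \<circ> chart_map \<Sigma> \<sigma>)
        (g b * inverse (fh x) + fg x * (- h b / (fh x)\<^sup>2))"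
    proof (rule germ_deriv_cong[OF a x _ s(1)])
      show "s x \<noteq> 0"
        using s(2)[OF x] q(2) r(2) by simp
      fix x' assume x': "x' \<in> chart \<sigma>" "s x' \<noteq> 0"
      then have qr: "q x' \<noteq> 0" "r x' \<noteq> 0"
        using s(2)[OF x'(1)] by auto
      obtain y' where y': "y' \<in> chart \<tau>" "\<phi> (chart_map \<Sigma> \<sigma> x') = chart_map \<Sigma> \<tau> y'"
          "\<forall>m\<in>dual_monoid \<tau>. f m x' = y' m"
        using lift[OF x'(1) qr(1)] by blast
      have "h y' \<noteq> 0"
        using r(3) x'(1) qr(2) fhx[OF y'(3)] by auto
      then show "fg x' * inverse (fh x') = (F \<circ> \<phi> \<circ> chart_map \<Sigma> \<sigma>) x'"
        using gh(4)[OF y'(1)] fgx[OF y'(3)] fhx[OF y'(3)] y'(2) by (simp add: divide_inverse)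
    qed
    moreover have "g b * inverse (fh x) + fg x * (- h b / (fh x)\<^sup>2) = d"
      using gh(3) by (simp add: fgx[OF fx'] fhx[OF fx'] gh(5) divide_simps power2_eq_square)
    ultimately show ?thesis by simp
  qed
  then show ?thesis
    using tangent by blast
qed

end

text \<open>The hypothesis factors the identity matrix of \<open>H\<close> through coordinates
  indexed by \<open>B\<close>. Pairing a relation between the rows of \<open>A\<close> with a column
  of \<open>J\<close> isolates one coefficient, so the rows are independent in a space spanned by at
  most \<open>card B\<close> vectors.\<close>

lemma card_le_by_pairing:
  fixes A :: "'h \<Rightarrow> 'b \<Rightarrow> 'k::field"
  assumes "finite H" "finite B"
    and pair: "\<And>h h'. h \<in> H \<Longrightarrow> h' \<in> H \<Longrightarrow> (\<Sum>c\<in>B. A h c * J c h') = (if h = h' then 1 else 0)"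
  shows "card H \<le> card B"
proof -
  interpret fs: vector_space "\<lambda>(a :: 'k) (f :: 'b \<Rightarrow> 'k) x. a * f x"
    by unfold_locales (auto simp: fun_eq_iff algebra_simps)
  define w where "w = (\<lambda>h c. if c \<in> B then A h c else 0)"
  define e where "e = (\<lambda>(c :: 'b) x. if x = c then 1 else 0 :: 'k)"
  have w_eq: "w h = (\<Sum>c\<in>B. (\<lambda>x. A h c * e c x))" for h
  proof
    fix x
    have "(\<Sum>c\<in>B. (\<lambda>x. A h c * e c x)) x = (\<Sum>c\<in>B. A h c * e c x)"
      using assms(2) by (induction B) auto
    also have "\<dots> = (\<Sum>c\<in>B. if c = x then A h c else 0)"
      by (intro sum.cong) (auto simp: e_def)
    finally show "w h x = (\<Sum>c\<in>B. (\<lambda>x. A h c * e c x)) x"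
      using assms(2) by (simp add: w_def)
  qed
  have span: "w ` H \<subseteq> fs.span (e ` B)"
    unfolding w_eq by (auto intro!: fs.span_sum fs.span_scale intro: fs.span_base)
  have pair_w: "(\<Sum>c\<in>B. w h c * J c h') = (if h = h' then 1 else 0)" if "h \<in> H" "h' \<in> H" for h h'
    using pair[OF that] by (simp add: w_def cong: sum.cong)
  have inj: "inj_on w H"
  proof (rule inj_onI)
    fix h h' assume h: "h \<in> H" "h' \<in> H" "w h = w h'"
    then have "(if h = h' then 1 else 0) = (1 :: 'k)"
      using pair_w[OF h(1,2)] pair_w[OF h(2,2)] by simp
    then show "h = h'"
      by (simp split: if_splits)
  qed
  have "\<not> fs.dependent (w ` H)"
  proof
    assume "fs.dependent (w ` H)"
    then obtain u where u: "\<exists>v\<in>w ` H. u v \<noteq> 0" "(\<Sum>v\<in>w ` H. (\<lambda>x. u v * v x)) = 0"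
      using fs.dependent_finite[of "w ` H"] assms(1) by auto
    have "u (w h') = 0" if h': "h' \<in> H" for h'
    proof -
      have zero: "(\<Sum>h\<in>H. u (w h) * w h c) = 0" for c
      proof -
        have "(\<Sum>h\<in>H. u (w h) * w h c) = (\<Sum>v\<in>w ` H. (\<lambda>x. u v * v x)) c"
          unfolding sum.reindex[OF inj] o_def using assms(1) by (induction H) auto
        then show ?thesis
          by (simp add: u(2))
      qed
      have "u (w h') = (\<Sum>h\<in>H. u (w h) * (if h = h' then 1 else 0))"
        using assms(1) h' by (simp add: if_distrib cong: if_cong)
      also have "\<dots> = (\<Sum>h\<in>H. u (w h) * (\<Sum>c\<in>B. w h c * J c h'))"
        using pair_w h' by (intro sum.cong) auto
      also have "\<dots> = (\<Sum>c\<in>B. (\<Sum>h\<in>H. u (w h) * w h c) * J c h')"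
        unfolding sum_distrib_left sum_distrib_right by (subst sum.swap) (simp add: mult.assoc)
      finally show ?thesis
        by (simp add: zero)
    qed
    then show False
      using u(1) by auto
  qed
  then have "card (w ` H) \<le> card (e ` B)"
    using fs.independent_span_bound[of "e ` B" "w ` H"] span assms(2) by auto
  also have "\<dots> \<le> card B"
    by (rule card_image_le[OF assms(2)])
  finally show ?thesis
    by (simp add: card_image[OF inj])
qed

context toric_lattice
begin

subsection \<open>Torus-fixed points\<close>

lemma not_full_dimensional_form:
  assumes "\<not> full_dimensional \<sigma>"
  shows "\<exists>m\<in>dual_lattice. m \<noteq> (\<lambda>_. 0) \<and> (\<forall>v\<in>\<sigma>. m v = 0)"
proof -
  have "span \<sigma> \<noteq> UNIV"
  proof
    assume "span \<sigma> = UNIV"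
    then have "dim \<sigma> = n"
      unfolding dim_univ[symmetric] using dim_span[of \<sigma>] by simp
    then show False
      using assms by (simp add: full_dimensional_def)
  qed
  then obtain v where "v \<notin> span \<sigma>" by blast
  then obtain m where m: "lin m" "\<forall>a\<in>\<sigma>. m a = 0" "m v = 1"
    using separating_form by blast
  obtain k :: nat where k: "k > 0" "(\<lambda>v. of_nat k * m v) \<in> dual_lattice"
    using integral_multiple[OF m(1)] by blast
  have "(\<lambda>v. of_nat k * m v) \<noteq> (\<lambda>_. 0)"
    using m(3) k(1) by (metis mult.right_neutral of_nat_eq_0_iff less_irrefl)
  then show ?thesis
    using k(2) m(2) by (intro bexI[of _ "\<lambda>v. of_nat k * m v"]) auto
qed

text \<open>Invariance gives \<open>t m * x m = x m\<close> for all torus points \<open>t\<close>,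
  and the torus separates \<open>m\<close> from the trivial character, so \<open>x m = 0\<close> for
  nonzero \<open>m\<close>. A nonzero integral form vanishing on the cone would be a unit at
  \<open>x\<close>, so the cone is full-dimensional.\<close>

lemma torus_invariant_point:
  fixes p :: "('v, 'k::field_char_0) toric_point"
  assumes fan: "fan \<Sigma>" and "torus_invariant \<Sigma> p"
  obtains \<sigma> x where "\<sigma> \<in> \<Sigma>" "x \<in> chart \<sigma>" "p = chart_map \<Sigma> \<sigma> x" "full_dimensional \<sigma>"
    "\<forall>m\<in>dual_monoid \<sigma>. m \<noteq> (\<lambda>_. 0) \<longrightarrow> x m = 0"
proof -
  have p: "p \<in> toric_variety \<Sigma>" "\<And>t. t \<in> chart {0} \<Longrightarrow> torus_act t p = p"
    using assms(2) by (auto simp: torus_invariant_def)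
  obtain \<sigma> x where \<sigma>: "\<sigma> \<in> \<Sigma>" "x \<in> chart \<sigma>" "p = chart_map \<Sigma> \<sigma> x"
    using p(1) by (rule toric_varietyE)
  have vanish: "x m = 0" if m: "m \<in> dual_monoid \<sigma>" "m \<noteq> (\<lambda>_. 0)" for m
  proof -
    obtain t :: "('v, 'k) chart_point" where t: "t \<in> chart {0}" "t m \<noteq> t (\<lambda>_. 0)"
      using torus_separates[OF dual_monoid_dual_lattice[OF m(1)] zero_mem_dual_monoid m(2)] by blast
    have "chart_map \<Sigma> \<sigma> (chart_act t \<sigma> x) = chart_map \<Sigma> \<sigma> x"
      using torus_act_chart_map[OF t(1) fan_zero[OF fan] \<sigma>(1,2)] p(2)[OF t(1)] \<sigma>(3) by simp
    then have "chart_act t \<sigma> x = x"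
      by (rule chart_map_inj[OF fan \<sigma>(1) chart_act_mem[OF t(1) \<sigma>(2) fan_zero[OF fan \<sigma>(1)]] \<sigma>(2)])
    then have "chart_act t \<sigma> x m = x m"
      by simp
    then have "t m * x m = x m"
      using m(1) unfolding chart_act_def by simp
    then show ?thesis
      using t chart_one[OF t(1)] by auto
  qed
  have "full_dimensional \<sigma>"
  proof (rule ccontr)
    assume "\<not> full_dimensional \<sigma>"
    then obtain m where m: "m \<in> dual_lattice" "m \<noteq> (\<lambda>_. 0)" "\<forall>v\<in>\<sigma>. m v = 0"
      using not_full_dimensional_form by blast
    have "m \<in> dual_monoid \<sigma>" "(\<lambda>v. - m v) \<in> dual_monoid \<sigma>"
      using m dual_lattice_uminus[OF m(1)] by (auto simp: dual_monoid_iff[of _ \<sigma>])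
    then show False
      using chart_unit[OF \<sigma>(2)] vanish m(2) by fastforce
  qed
  then show thesis
    using that[OF \<sigma>] vanish by blast
qed

text \<open>The irreducible elements of the monoid; for a full-dimensional rational cone they form
  its Hilbert basis.\<close>

definition indecomposable :: "'v set \<Rightarrow> ('v \<Rightarrow> rat) \<Rightarrow> bool" where
  "indecomposable \<sigma> h \<longleftrightarrow> h \<in> dual_monoid \<sigma> \<and> h \<noteq> (\<lambda>_. 0) \<and>
     (\<forall>m\<in>dual_monoid \<sigma>. \<forall>m'\<in>dual_monoid \<sigma>. h = (\<lambda>v. m v + m' v) \<longrightarrow> m = (\<lambda>_. 0) \<or> m' = (\<lambda>_. 0))"

text \<open>As \<open>x\<close> kills every nonzero character, the Leibniz rule only demands the
  value 0 at sums of two nonzero elements, and \<open>h\<close> is not such a sum. These vectors are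
  dual to the indecomposables in the cotangent space at \<open>x\<close>.\<close>

lemma indecomposable_tangent:
  assumes x: "x \<in> chart \<sigma>" "\<forall>m\<in>dual_monoid \<sigma>. m \<noteq> (\<lambda>_. 0) \<longrightarrow> x m = 0"
    and h: "indecomposable \<sigma> h"
  shows "tangent \<sigma> x (\<lambda>m. if m = h then 1 else 0)"
  unfolding tangent_def
proof (intro ballI)
  fix m m' assume m: "m \<in> dual_monoid \<sigma>" "m' \<in> dual_monoid \<sigma>"
  have h0: "h \<noteq> (\<lambda>_. 0)"
    using h by (simp add: indecomposable_def)
  consider "m = (\<lambda>_. 0)" | "m' = (\<lambda>_. 0)" | "m \<noteq> (\<lambda>_. 0)" "m' \<noteq> (\<lambda>_. 0)" by blast
  then show "(if (\<lambda>v. m v + m' v) = h then 1 else 0) =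
      (if m = h then 1 else 0) * x m' + x m * (if m' = h then 1 else 0)"
  proof cases
    case 1
    then show ?thesis
      using chart_one[OF x(1)] h0 by auto
  next
    case 2
    then show ?thesis
      using chart_one[OF x(1)] h0 by auto
  next
    case 3
    then have "(\<lambda>v. m v + m' v) \<noteq> h"
      using h m unfolding indecomposable_def by blast
    then show ?thesis
      using x(2) m 3 by simp
  qed
qed

text \<open>The velocity at \<open>c = 1\<close> of the orbit of \<open>x\<close> under the
  one-parameter subgroup of \<open>v\<close>.\<close>

definition log_tangent :: "'v \<Rightarrow> ('v, 'k::field) chart_point \<Rightarrow> ('v \<Rightarrow> rat) \<Rightarrow> 'k" where
  "log_tangent v x = (\<lambda>m. of_int \<lfloor>m v\<rfloor> * x m)"

lemma log_tangent_tangent: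
  assumes "v \<in> N" "x \<in> chart \<sigma>"
  shows "tangent \<sigma> x (log_tangent v x)"
  unfolding tangent_def
proof (intro ballI)
  fix m m' assume m: "m \<in> dual_monoid \<sigma>" "m' \<in> dual_monoid \<sigma>"
  show "log_tangent v x (\<lambda>v. m v + m' v) = log_tangent v x m * x m' + x m * log_tangent v x m'"
    unfolding log_tangent_def chart_mult[OF assms(2) m] of_int_add
      floor_add_lattice[OF dual_monoid_dual_lattice[OF m(1)] dual_monoid_dual_lattice[OF m(2)] assms(1)]
    by (simp add: algebra_simps)
qed

lemma dual_lattice_expand:
  assumes B: "int_basis scale B N"
    and d: "\<forall>b\<in>B. d b \<in> dual_lattice \<and> (\<forall>b'\<in>B. d b b' = (if b' = b then 1 else 0))"
    and m: "m \<in> dual_lattice"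
  shows "m = (\<lambda>v. \<Sum>b\<in>B. of_int \<lfloor>m b\<rfloor> * d b v)"
proof
  fix v
  have "m v = m (\<Sum>b\<in>B. scale (d b v) b)"
    by (rule arg_cong[OF dual_basis_expand[OF B d]])
  also have "\<dots> = (\<Sum>b\<in>B. d b v * m b)"
    by (rule lin_comb[OF dual_lattice_lin[OF m]])
  also have "\<dots> = (\<Sum>b\<in>B. of_int \<lfloor>m b\<rfloor> * d b v)"
    by (intro sum.cong refl) (simp only: dual_lattice_floor[OF m int_basis_mem[OF B]] mult.commute)
  finally show "m v = (\<Sum>b\<in>B. of_int \<lfloor>m b\<rfloor> * d b v)" .
qed

lemma additive_on_dual_lattice:
  fixes l :: "('v \<Rightarrow> rat) \<Rightarrow> 'k::field"
  assumes add: "\<And>m m'. m \<in> dual_lattice \<Longrightarrow> m' \<in> dual_lattice \<Longrightarrow> l (\<lambda>v. m v + m' v) = l m + l m'"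
  shows additive_int: "m \<in> dual_lattice \<Longrightarrow> l (\<lambda>v. of_int k * m v) = of_int k * l m"
    and additive_sum: "finite I \<Longrightarrow> (\<And>i. i \<in> I \<Longrightarrow> f i \<in> dual_lattice) \<Longrightarrow> l (\<lambda>v. \<Sum>i\<in>I. f i v) = (\<Sum>i\<in>I. l (f i))"
proof -
  have zero: "l (\<lambda>_. 0) = 0"
    using add[OF zero_mem_dual_monoid zero_mem_dual_monoid] unfolding add_0 add_cancel_right_right .
  have nat: "l (\<lambda>v. of_nat j * m v) = of_nat j * l m" if m: "m \<in> dual_lattice" for m j
  proof (induction j)
    case (Suc j)
    have "l (\<lambda>v. m v + of_nat j * m v) = l m + l (\<lambda>v. of_nat j * m v)"
      by (rule add[OF m dual_monoid_nat[OF m]])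
    then show ?case
      using Suc by (simp add: distrib_right)
  qed (simp add: zero)
  show "l (\<lambda>v. of_int k * m v) = of_int k * l m" if m: "m \<in> dual_lattice"
  proof (cases k rule: int_cases2)
    case (nonneg j)
    then show ?thesis
      using nat[OF m, of j] by simp
  next
    case (nonpos j)
    have "l (\<lambda>v. of_nat j * m v + - (of_nat j * m v)) = l (\<lambda>v. of_nat j * m v) + l (\<lambda>v. - (of_nat j * m v))"
      by (intro add dual_lattice_uminus dual_monoid_nat m)
    then have "l (\<lambda>v. - (of_nat j * m v)) = - (of_nat j * l m)"
      using zero nat[OF m, of j] by (simp add: eq_neg_iff_add_eq_0 add.commute)
    then show ?thesis
      using nonpos by simp
  qed
  show "l (\<lambda>v. \<Sum>i\<in>I. f i v) = (\<Sum>i\<in>I. l (f i))" if "finite I" "\<And>i. i \<in> I \<Longrightarrow> f i \<in> dual_lattice"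
    using that
  proof (induction I)
    case (insert i I)
    have "l (\<lambda>v. f i v + (\<Sum>i\<in>I. f i v)) = l (f i) + l (\<lambda>v. \<Sum>i\<in>I. f i v)"
      using insert.prems by (intro add dual_monoid_sum) auto
    then show ?case
      using insert by simp
  qed (simp add: zero)
qed

text \<open>On the torus no character vanishes, and dividing the Leibniz rule by the values of the
  characters makes \<open>a m / t m\<close> additive in \<open>m\<close>. It is thus determined on
  the dual basis.\<close>

lemma torus_tangent_expand:
  assumes B: "int_basis scale B N"
    and d: "\<forall>b\<in>B. d b \<in> dual_lattice \<and> (\<forall>b'\<in>B. d b b' = (if b' = b then 1 else 0))"
    and t: "t \<in> chart {0}" and a: "tangent {0} t a" and m: "m \<in> dual_lattice"
  shows "a m = (\<Sum>b\<in>B. (a (d b) / t (d b)) * log_tangent b t m)"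
proof -
  define l where "l = (\<lambda>m. a m / t m)"
  have add: "l (\<lambda>v. m v + m' v) = l m + l m'" if "m \<in> dual_lattice" "m' \<in> dual_lattice" for m m'
    using a that torus_nonzero[OF t that(1)] torus_nonzero[OF t that(2)]
    by (simp add: l_def tangent_def chart_mult[OF t that] divide_simps)
  have fin: "finite B"
    using B by (simp add: int_basis_def)
  have "l m = l (\<lambda>v. \<Sum>b\<in>B. of_int \<lfloor>m b\<rfloor> * d b v)"
    by (rule arg_cong[OF dual_lattice_expand[OF B d m]])
  also have "\<dots> = (\<Sum>b\<in>B. l (\<lambda>v. of_int \<lfloor>m b\<rfloor> * d b v))"
    using d dual_lattice_int by (intro additive_sum[where l = l, OF add fin]) auto
  also have "\<dots> = (\<Sum>b\<in>B. of_int \<lfloor>m b\<rfloor> * l (d b))"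
    using d by (intro sum.cong refl additive_int[where l = l, OF add]) auto
  finally have "l m * t m = (\<Sum>b\<in>B. of_int \<lfloor>m b\<rfloor> * l (d b)) * t m"
    by simp
  moreover have "l m * t m = a m"
    using torus_nonzero[OF t m] by (simp add: l_def)
  ultimately have "a m = (\<Sum>b\<in>B. of_int \<lfloor>m b\<rfloor> * l (d b)) * t m"
    by simp
  then show ?thesis
    unfolding log_tangent_def l_def sum_distrib_right by (simp only: mult.assoc mult.left_commute mult.commute)
qed

lemma coordinate_ring_linear:
  assumes "g \<in> coordinate_ring \<sigma>"
  shows "g (\<lambda>m. \<Sum>i\<in>I. c i * a i m) = (\<Sum>i\<in>I. c i * g (a i))"
proof -
  obtain F b where F: "finite F" "F \<subseteq> dual_monoid \<sigma>" "g = (\<lambda>x. \<Sum>m\<in>F. b m * x m)"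
    using assms by (rule coordinate_ringE)
  show ?thesis
    unfolding F(3) sum_distrib_left by (subst sum.swap) (simp add: algebra_simps)
qed

text \<open>The row \<open>A h\<close> consists of the coordinates, in the basis of one-parameter
  subgroups, of the push-forward under \<open>\<phi>\<close> of the vector dual to \<open>h\<close>;
  \<open>J c h'\<close> is the derivative of the character of \<open>h'\<close> pulled back by
  \<open>\<psi>\<close>. Since \<open>\<psi>\<close> undoes \<open>\<phi>\<close>, pairing them
  returns the derivative of \<open>h'\<close> along the vector dual to \<open>h\<close>. The entries
  of \<open>J\<close> are kept explicit because they reappear as values of vector fields.\<close>

lemma tangent_pairing:
  fixes \<phi> \<psi> :: "('v, 'k::field_char_0) toric_point \<Rightarrow> ('v, 'k) toric_point"
  assumes fan: "fan \<Sigma>" and \<phi>: "endomorphism \<Sigma> \<phi>" and \<psi>: "endomorphism \<Sigma> \<psi>"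
    and inv: "\<And>p. p \<in> toric_variety \<Sigma> \<Longrightarrow> \<psi> (\<phi> p) = p"
    and \<sigma>: "\<sigma> \<in> \<Sigma>" and x: "x \<in> chart \<sigma>" "\<forall>m\<in>dual_monoid \<sigma>. m \<noteq> (\<lambda>_. 0) \<longrightarrow> x m = 0"
    and t: "t \<in> chart {0}" "\<phi> (chart_map \<Sigma> \<sigma> x) = chart_map \<Sigma> {0} t"
    and B: "int_basis scale B N"
  shows "\<exists>A J. (\<forall>h c. indecomposable \<sigma> h \<longrightarrow> c \<in> B \<longrightarrow>
        germ_deriv {0} t (log_tangent c t) (character \<Sigma> h \<circ> \<psi> \<circ> chart_map \<Sigma> {0}) (J c h)) \<and>
      (\<forall>h h'. indecomposable \<sigma> h \<longrightarrow> indecomposable \<sigma> h' \<longrightarrow>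
        (\<Sum>c\<in>B. A h c * J c h') = (if h = h' then 1 else 0))"
proof -
  obtain d where d: "\<forall>b\<in>B. d b \<in> dual_lattice \<and> (\<forall>b'\<in>B. d b b' = (if b' = b then 1 else 0))"
    using dual_basis[OF B] by blast
  have zero: "{0} \<in> \<Sigma>"
    by (rule fan_zero_cone[OF fan])
  have \<psi>t: "\<psi> (chart_map \<Sigma> {0} t) = chart_map \<Sigma> \<sigma> x"
    using inv[OF chart_map_mem[OF \<sigma> x(1)]] t(2) by simp
  have "\<exists>g h'. local_fraction {0} t (character \<Sigma> h \<circ> \<psi> \<circ> chart_map \<Sigma> {0}) g h'"
    if h: "indecomposable \<sigma> h" for h
  proof -
    have "h \<in> dual_monoid \<sigma>"
      using h by (simp add: indecomposable_def)
    then have "regular_at \<Sigma> (chart_map \<Sigma> {0} t) (character \<Sigma> h \<circ> \<psi>)"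
      using character_regular_at[OF fan \<sigma> x(1)] \<psi>t
      by (intro endomorphism_regular_at[OF fan \<psi> chart_map_mem[OF zero t(1)]]) simp
    then show ?thesis
      by (rule regular_atE[OF fan zero t(1)]) blast
  qed
  then obtain G H where GH: "\<And>h. indecomposable \<sigma> h \<Longrightarrow>
      local_fraction {0} t (character \<Sigma> h \<circ> \<psi> \<circ> chart_map \<Sigma> {0}) (G h) (H h)"
    by metis
  \<comment> \<open>One fraction is fixed for each \<open>h\<close>, so that \<open>D\<close> is
    linear in the tangent vector.\<close>
  define D where "D = (\<lambda>a h. (G h a * H h t - G h t * H h a) / (H h t)\<^sup>2)"
  have D: "germ_deriv {0} t a (character \<Sigma> h \<circ> \<psi> \<circ> chart_map \<Sigma> {0}) (D a h)" if "indecomposable \<sigma> h" for a h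
    unfolding germ_deriv_def D_def using GH[OF that] by blast
  have "\<exists>b. tangent {0} t b \<and> (\<forall>F d. germ_deriv {0} t b (F \<circ> chart_map \<Sigma> {0}) d \<longrightarrow>
      germ_deriv \<sigma> x (\<lambda>m. if m = h then 1 else 0) (F \<circ> \<phi> \<circ> chart_map \<Sigma> \<sigma>) d)"
    if h: "indecomposable \<sigma> h" for h
    by (rule push_forward[OF fan \<phi> \<sigma> x(1) zero t(1,2) indecomposable_tangent[OF x h]])
  then obtain b where b: "\<And>h. indecomposable \<sigma> h \<Longrightarrow> tangent {0} t (b h)"
      "\<And>h F d. indecomposable \<sigma> h \<Longrightarrow> germ_deriv {0} t (b h) (F \<circ> chart_map \<Sigma> {0}) d \<Longrightarrow>
        germ_deriv \<sigma> x (\<lambda>m. if m = h then 1 else 0) (F \<circ> \<phi> \<circ> chart_map \<Sigma> \<sigma>) d"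
    by metis
  define A where "A = (\<lambda>h c. b h (d c) / t (d c))"
  have "(\<Sum>c\<in>B. A h c * D (log_tangent c t) h') = (if h = h' then 1 else 0)"
    if h: "indecomposable \<sigma> h" and h': "indecomposable \<sigma> h'" for h h'
  proof -
    have h'd: "h' \<in> dual_monoid \<sigma>"
      using h' by (simp add: indecomposable_def)
    have lin: "g (b h) = (\<Sum>c\<in>B. A h c * g (log_tangent c t))" if g: "g \<in> coordinate_ring {0}" for g
    proof -
      have "g (b h) = g (\<lambda>m. \<Sum>c\<in>B. A h c * log_tangent c t m)"
        using torus_tangent_expand[OF B d t(1) b(1)[OF h]] by (intro coordinate_ring_cong[OF g]) (simp add: A_def)
      then show ?thesis
        using coordinate_ring_linear[OF g] by simp
    qed
    have GH': "G h' \<in> coordinate_ring {0}" "H h' \<in> coordinate_ring {0}"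
      using GH[OF h'] by (simp_all add: local_fraction_def)
    have "(\<Sum>c\<in>B. A h c * D (log_tangent c t) h') = D (b h) h'"
      unfolding D_def lin[OF GH'(1)] lin[OF GH'(2)]
      by (simp add: sum_divide_distrib[symmetric] sum_distrib_left sum_distrib_right sum_subtractf right_diff_distrib
          algebra_simps flip: sum_divide_distrib)
    have "germ_deriv \<sigma> x (\<lambda>m. if m = h then 1 else 0) (character \<Sigma> h' \<circ> \<psi> \<circ> \<phi> \<circ> chart_map \<Sigma> \<sigma>) (D (b h) h')"
      by (rule b(2)[OF h D[OF h']])
    then have "germ_deriv \<sigma> x (\<lambda>m. if m = h then 1 else 0) (\<lambda>y. y h') (D (b h) h')"
    proof (rule germ_deriv_cong[OF indecomposable_tangent[OF x h] x(1) _ coordinate_ring_char[OF zero_mem_dual_monoid]])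
      show "x (\<lambda>_. 0) \<noteq> 0"
        using chart_one[OF x(1)] by simp
      show "(character \<Sigma> h' \<circ> \<psi> \<circ> \<phi> \<circ> chart_map \<Sigma> \<sigma>) y = y h'" if "y \<in> chart \<sigma>" for y
        using character_eq[OF fan \<sigma> that h'd] inv[OF chart_map_mem[OF \<sigma> that]] by simp
    qed
    then have "D (b h) h' = (if h' = h then 1 else 0)"
      using germ_deriv_unique[OF indecomposable_tangent[OF x h] x(1) fan_zero[OF fan \<sigma>] _
          germ_deriv_character[OF indecomposable_tangent[OF x h] x(1) h'd]] by blast
    then show ?thesis
      using \<open>(\<Sum>c\<in>B. A h c * D (log_tangent c t) h') = D (b h) h'\<close> by auto
  qed
  then show ?thesis
    using D by (intro exI[of _ A] exI[of _ "\<lambda>c. D (log_tangent c t)"]) auto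
qed

subsection \<open>Smoothness\<close>

text \<open>The sum of the values on generators of the cone is an additive height. It is positive on
  nonzero elements because a form vanishing on a full-dimensional cone is zero, so decomposing
  terminates.\<close>

lemma indecomposables_generate:
  assumes \<sigma>: "rational_cone \<sigma>" "full_dimensional \<sigma>" and fin: "finite {h. indecomposable \<sigma> h}"
    and m: "m \<in> dual_monoid \<sigma>"
  shows "\<exists>c :: ('v \<Rightarrow> rat) \<Rightarrow> nat. m = (\<lambda>v. \<Sum>h\<in>{h. indecomposable \<sigma> h}. of_nat (c h) * h v)"
proof -
  obtain S where S: "finite S" "S \<subseteq> N" "\<sigma> = cone_hull S"
    using \<sigma>(1) by (auto simp: rational_cone_iff)
  have S_cone: "s \<in> \<sigma>" if "s \<in> S" for s
    using cone_hull_gen[OF S(1) that] S(3) by simp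
  have floor_nonneg: "0 \<le> \<lfloor>m s\<rfloor>" if "m \<in> dual_monoid \<sigma>" "s \<in> S" for m s
    using that S_cone[OF that(2)] by (auto simp: dual_monoid_def)
  define ht where "ht = (\<lambda>m :: 'v \<Rightarrow> rat. \<Sum>s\<in>S. nat \<lfloor>m s\<rfloor>)"
  have ht_add: "ht (\<lambda>v. m v + m' v) = ht m + ht m'" if "m \<in> dual_monoid \<sigma>" "m' \<in> dual_monoid \<sigma>" for m m'
    unfolding ht_def sum.distrib[symmetric]
  proof (intro sum.cong refl)
    fix s assume s: "s \<in> S"
    have "\<lfloor>m s + m' s\<rfloor> = \<lfloor>m s\<rfloor> + \<lfloor>m' s\<rfloor>"
      using s S(2) by (intro floor_add_lattice dual_monoid_dual_lattice[OF that(1)] dual_monoid_dual_lattice[OF that(2)]) auto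
    then show "nat \<lfloor>m s + m' s\<rfloor> = nat \<lfloor>m s\<rfloor> + nat \<lfloor>m' s\<rfloor>"
      using floor_nonneg[OF that(1) s] floor_nonneg[OF that(2) s] by (simp add: nat_add_distrib)
  qed
  have ht_pos: "0 < ht m" if m: "m \<in> dual_monoid \<sigma>" "m \<noteq> (\<lambda>_. 0)" for m
  proof (rule ccontr)
    assume "\<not> 0 < ht m"
    then have "\<forall>s\<in>S. nat \<lfloor>m s\<rfloor> = 0"
      using S(1) by (simp add: ht_def)
    moreover have "of_int \<lfloor>m s\<rfloor> = m s" if "s \<in> S" for s
      using that S(2) by (intro dual_lattice_floor dual_monoid_dual_lattice[OF m(1)]) auto
    ultimately have "\<forall>s\<in>S. m s = 0"
      using floor_nonneg[OF m(1)] by (metis nat_eq_iff of_int_0 of_nat_0 le_antisym nat_0_iff)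
    then have zero: "m v = 0" if "v \<in> \<sigma>" for v
      using that by (auto simp: S(3) lin_comb[OF dual_monoid_lin[OF m(1)]] elim!: cone_hullE)
    have "m v = 0" for v
      using form_eq_0_on_span[OF dual_monoid_lin[OF m(1)], of \<sigma> v] zero full_dimensional_span[OF \<sigma>(2)] by blast
    then show False
      using m(2) by blast
  qed
  show ?thesis
    using m
  proof (induction "ht m" arbitrary: m rule: less_induct)
    case less
    show ?case
    proof (cases "m = (\<lambda>_. 0)")
      case True
      then show ?thesis
        by (intro exI[of _ "\<lambda>_. 0"]) simp
    next
      case nonzero: False
      show ?thesis
      proof (cases "indecomposable \<sigma> m")
        case True
        have "m v = (\<Sum>h\<in>{h. indecomposable \<sigma> h}. of_nat (if h = m then 1 else 0) * h v)" for v
        proof -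
          have "(\<Sum>h\<in>{h. indecomposable \<sigma> h}. of_nat (if h = m then 1 else 0) * h v) =
              (\<Sum>h\<in>{h. indecomposable \<sigma> h}. if h = m then h v else 0)"
            by (intro sum.cong) auto
          then show ?thesis
            using True fin by simp
        qed
        then show ?thesis
          by (intro exI[of _ "\<lambda>h. if h = m then 1 else 0"] ext)
      next
        case False
        then obtain a b where ab: "a \<in> dual_monoid \<sigma>" "b \<in> dual_monoid \<sigma>" "m = (\<lambda>v. a v + b v)"
            "a \<noteq> (\<lambda>_. 0)" "b \<noteq> (\<lambda>_. 0)"
          using less.prems nonzero unfolding indecomposable_def by blast
        have "ht a < ht m" "ht b < ht m"
          using ht_add[OF ab(1,2)] ht_pos[OF ab(1,4)] ht_pos[OF ab(2,5)] ab(3) by auto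
        then obtain c d :: "('v \<Rightarrow> rat) \<Rightarrow> nat" where
            "a = (\<lambda>v. \<Sum>h\<in>{h. indecomposable \<sigma> h}. of_nat (c h) * h v)"
            "b = (\<lambda>v. \<Sum>h\<in>{h. indecomposable \<sigma> h}. of_nat (d h) * h v)"
          using less.hyps[OF _ ab(1)] less.hyps[OF _ ab(2)] by blast
        then have "m = (\<lambda>v. \<Sum>h\<in>{h. indecomposable \<sigma> h}. of_nat (c h + d h) * h v)"
          by (simp add: ab(3) distrib_right sum.distrib)
        then show ?thesis by (rule exI[of _ "\<lambda>h. c h + d h"])
      qed
    qed
  qed
qed

text \<open>The indecomposables generate the monoid, and differences of monoid elements exhaust the
  dual lattice. A generating set with at most \<open>n\<close> members is then a basis; the vectors
  \<open>w h\<close> dual to it turn out to be the primitive generators of the rays.\<close>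

lemma smooth_if_few_indecomposables:
  assumes \<sigma>: "rational_cone \<sigma>" "strongly_convex \<sigma>" "full_dimensional \<sigma>"
    and few: "\<And>H. finite H \<Longrightarrow> (\<And>h. h \<in> H \<Longrightarrow> indecomposable \<sigma> h) \<Longrightarrow> card H \<le> n"
  shows "smooth_cone \<sigma>"
proof -
  define H where "H = {h. indecomposable \<sigma> h}"
  have H: "finite H" "card H \<le> n"
    using finite_if_finite_subsets_card_bdd[of H n] few by (auto simp: H_def subset_iff)
  have H_dual: "h \<in> dual_monoid \<sigma>" if "h \<in> H" for h
    using that by (simp add: H_def indecomposable_def)
  have gen: "\<exists>c :: ('v \<Rightarrow> rat) \<Rightarrow> nat. m = (\<lambda>v. \<Sum>h\<in>H. of_nat (c h) * h v)" if "m \<in> dual_monoid \<sigma>" for m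
    using indecomposables_generate[OF \<sigma>(1,3) _ that] H(1) by (simp add: H_def)
  obtain p where p: "p \<in> dual_monoid \<sigma>" "\<forall>v\<in>\<sigma>. v \<noteq> 0 \<longrightarrow> 0 < p v"
    using positive_form[OF \<sigma>(1,2)] by blast
  have face0: "{v \<in> \<sigma>. p v = 0} = {0}"
    using p rational_cone_zero[OF \<sigma>(1)] lin_zero[OF dual_monoid_lin[OF p(1)]] by force
  \<comment> \<open>The face \<open>p = 0\<close> is the zero cone, so adding a multiple of
    \<open>p\<close> moves any integral form into the dual monoid.\<close>
  have gen_int: "\<exists>c :: ('v \<Rightarrow> rat) \<Rightarrow> int. m = (\<lambda>v. \<Sum>h\<in>H. of_int (c h) * h v)" if m: "m \<in> dual_lattice" for m
  proof -
    have "m \<in> dual_monoid {v \<in> \<sigma>. p v = 0}"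
      using m unfolding face0 .
    then obtain k :: nat where k: "(\<lambda>v. m v + of_nat k * p v) \<in> dual_monoid \<sigma>"
      using dual_monoid_face_shift[OF \<sigma>(1) p(1)] by blast
    obtain c :: "('v \<Rightarrow> rat) \<Rightarrow> nat" where c: "(\<lambda>v. m v + of_nat k * p v) = (\<lambda>v. \<Sum>h\<in>H. of_nat (c h) * h v)"
      using gen[OF k] by blast
    obtain d :: "('v \<Rightarrow> rat) \<Rightarrow> nat" where d: "p = (\<lambda>v. \<Sum>h\<in>H. of_nat (d h) * h v)"
      using gen[OF p(1)] by blast
    have "m v = (\<Sum>h\<in>H. of_int (int (c h) - int k * int (d h)) * h v)" for v
    proof -
      have "m v = (\<Sum>h\<in>H. of_nat (c h) * h v) - of_nat k * (\<Sum>h\<in>H. of_nat (d h) * h v)"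
        using fun_cong[OF c, of v] fun_cong[OF d, of v] by simp
      also have "\<dots> = (\<Sum>h\<in>H. of_int (int (c h) - int k * int (d h)) * h v)"
        by (simp add: sum_distrib_left sum_subtractf left_diff_distrib mult.assoc)
      finally show ?thesis .
    qed
    then show ?thesis
      by (intro exI[of _ "\<lambda>h. int (c h) - int k * int (d h)"] ext)
  qed
  have separate: "v = 0" if v: "\<And>h. h \<in> H \<Longrightarrow> h v = 0" for v
  proof (rule ccontr)
    assume "v \<noteq> 0"
    then obtain m where m: "lin m" "m v \<noteq> 0"
      using form_nonzero by blast
    obtain k :: nat where k: "k > 0" "(\<lambda>v. of_nat k * m v) \<in> dual_lattice"
      using integral_multiple[OF m(1)] by blast
    obtain c :: "('v \<Rightarrow> rat) \<Rightarrow> int" where "(\<lambda>v. of_nat k * m v) = (\<lambda>v. \<Sum>h\<in>H. of_int (c h) * h v)"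
      using gen_int[OF k(2)] by blast
    then have "of_nat k * m v = (\<Sum>h\<in>H. of_int (c h) * h v)"
      by (rule fun_cong)
    also have "\<dots> = 0"
    proof (intro sum.neutral ballI)
      show "of_int (c h) * h v = 0" if "h \<in> H" for h
        using v[OF that] by simp
    qed
    finally show False
      using m(2) k(1) by simp
  qed
  obtain B where B: "int_basis scale B N"
    using free_of_rank by blast
  have finB: "finite B"
    using B by (simp add: int_basis_def)
  obtain d where d: "\<forall>b\<in>B. d b \<in> dual_lattice \<and> (\<forall>b'\<in>B. d b b' = (if b' = b then 1 else 0))"
    using dual_basis[OF B] by blast
  \<comment> \<open>The injection into a lattice basis turns evaluation at all members of
    \<open>H\<close> into an endomorphism \<open>f\<close> of the space. It is injective because
    \<open>H\<close> separates vectors, hence surjective, and preimages of the vectors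
    \<open>\<iota> h\<close> are the dual vectors sought.\<close>
  obtain \<iota> where \<iota>: "\<iota> ` H \<subseteq> B" "inj_on \<iota> H"
    using card_le_inj[OF H(1) finB] H(2) int_basis_card[OF B] by auto
  define f where "f = (\<lambda>v. \<Sum>h\<in>H. scale (h v) (\<iota> h))"
  have coord: "d (\<iota> h) (f v) = h v" if h: "h \<in> H" for h v
  proof -
    have hB: "\<iota> h \<in> B"
      using \<iota>(1) h by blast
    have "d (\<iota> h) (f v) = (\<Sum>h'\<in>H. h' v * d (\<iota> h) (\<iota> h'))"
      using d hB by (simp add: f_def lin_sum lin_scale dual_lattice_lin)
    also have "\<dots> = (\<Sum>h'\<in>H. if h' = h then h' v else 0)"
    proof (intro sum.cong refl)
      fix h' assume h': "h' \<in> H"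
      then have "\<iota> h' \<in> B" "\<iota> h' = \<iota> h \<longleftrightarrow> h' = h"
        using \<iota> h by (auto dest: inj_onD)
      then show "h' v * d (\<iota> h) (\<iota> h') = (if h' = h then h' v else 0)"
        using d hB by simp
    qed
    finally show ?thesis
      using h H(1) by simp
  qed
  interpret fd: finite_dimensional_vector_space scale B
    by (rule finite_dimensional[OF B])
  have lin_f: "Vector_Spaces.linear scale scale f"
  proof (intro Vector_Spaces.linear.intro module_hom.intro module_hom_axioms.intro vector_space_axioms module_axioms)
    show "f (x + y) = f x + f y" for x y
      unfolding f_def sum.distrib[symmetric]
    proof (intro sum.cong refl)
      show "scale (h (x + y)) (\<iota> h) = scale (h x) (\<iota> h) + scale (h y) (\<iota> h)" if h: "h \<in> H" for h
        by (simp add: lin_add[OF dual_monoid_lin[OF H_dual[OF h]]] scale_left_distrib)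
    qed
    show "f (scale a x) = scale a (f x)" for a x
      unfolding f_def scale_sum_right
    proof (intro sum.cong refl)
      show "scale (h (scale a x)) (\<iota> h) = scale a (scale (h x) (\<iota> h))" if h: "h \<in> H" for h
        by (simp add: lin_scale[OF dual_monoid_lin[OF H_dual[OF h]]])
    qed
  qed
  have "inj f"
  proof (rule injI)
    fix x y assume xy: "f x = f y"
    have "x - y = 0"
    proof (rule separate)
      fix h assume h: "h \<in> H"
      show "h (x - y) = 0"
        using coord[OF h, of x] coord[OF h, of y] xy by (simp add: lin_diff[OF dual_monoid_lin[OF H_dual[OF h]]])
    qed
    then show "x = y" by simp
  qed
  then have "surj f"
    using fd.linear_inj_imp_surj[OF lin_f] by blast
  then have "\<forall>h. \<exists>v. f v = \<iota> h"
    by (metis surjD)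
  then obtain w where w: "\<And>h. f (w h) = \<iota> h"
    by metis
  have hw: "h' (w h) = (if h' = h then 1 else 0)" if "h \<in> H" "h' \<in> H" for h h'
  proof -
    have "\<iota> h' \<in> B" "\<iota> h \<in> B" "\<iota> h = \<iota> h' \<longleftrightarrow> h' = h"
      using \<iota> that by (auto dest: inj_onD)
    then show ?thesis
      using coord[OF that(2), of "w h"] d by (simp add: w)
  qed
  have comb: "h (\<Sum>h\<in>H. scale (a h) (w h)) = a h" if "h \<in> H" for h a
  proof -
    have "h (\<Sum>h\<in>H. scale (a h) (w h)) = (\<Sum>h'\<in>H. a h' * h (w h'))"
      by (simp add: lin_sum[OF dual_monoid_lin[OF H_dual[OF that]]] lin_scale[OF dual_monoid_lin[OF H_dual[OF that]]])
    also have "\<dots> = (\<Sum>h'\<in>H. if h' = h then a h' else 0)"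
    proof (intro sum.cong refl)
      show "a h' * h (w h') = (if h' = h then a h' else 0)" if "h' \<in> H" for h'
        using hw[OF that \<open>h \<in> H\<close>] by simp
    qed
    finally show ?thesis
      using that H(1) by simp
  qed
  have expand: "v = (\<Sum>h\<in>H. scale (h v) (w h))" for v
  proof -
    have "v - (\<Sum>h\<in>H. scale (h v) (w h)) = 0"
    proof (rule separate)
      fix h assume h: "h \<in> H"
      show "h (v - (\<Sum>h\<in>H. scale (h v) (w h))) = 0"
        using comb[OF h, of "\<lambda>h. h v"] by (simp add: lin_diff[OF dual_monoid_lin[OF H_dual[OF h]]])
    qed
    then show ?thesis by simp
  qed
  have inj_w: "inj_on w H"
  proof (rule inj_onI)
    fix h h' assume h: "h \<in> H" "h' \<in> H" "w h = w h'"
    then have "(if h = h' then 1 else 0) = (1 :: rat)"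
      using hw[OF h(1,1)] hw[OF h(2,1)] by simp
    then show "h = h'"
      by (simp split: if_splits)
  qed
  have w_lattice: "w h \<in> N" if h: "h \<in> H" for h
  proof (rule lattice_of_integral)
    fix m assume "m \<in> dual_lattice"
    then obtain c :: "('v \<Rightarrow> rat) \<Rightarrow> int" where "m = (\<lambda>v. \<Sum>h\<in>H. of_int (c h) * h v)"
      using gen_int by blast
    then have "m (w h) = (\<Sum>h'\<in>H. of_int (c h') * h' (w h))"
      by (rule fun_cong)
    also have "\<dots> \<in> \<int>"
    proof (intro Ints_sum Ints_mult[OF Ints_of_int])
      show "h' (w h) \<in> \<int>" if "h' \<in> H" for h'
        using hw[OF h that] by simp
    qed
    finally show "m (w h) \<in> \<int>" .
  qed
  have w_cone: "w h \<in> \<sigma>" if h: "h \<in> H" for h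
  proof (rule mem_cone_if_dual_nonneg[OF \<sigma>(1)])
    fix m assume "m \<in> dual_monoid \<sigma>"
    then obtain c :: "('v \<Rightarrow> rat) \<Rightarrow> nat" where "m = (\<lambda>v. \<Sum>h\<in>H. of_nat (c h) * h v)"
      using gen by blast
    then have "m (w h) = (\<Sum>h'\<in>H. of_nat (c h') * h' (w h))"
      by (rule fun_cong)
    also have "\<dots> \<ge> 0"
    proof (intro sum_nonneg mult_nonneg_nonneg of_nat_0_le_iff)
      show "0 \<le> h' (w h)" if "h' \<in> H" for h'
        using hw[OF h that] by simp
    qed
    finally show "0 \<le> m (w h)" .
  qed
  have w_nonzero: "w h \<noteq> 0" if h: "h \<in> H" for h
    using hw[OF h h] lin_zero[OF dual_monoid_lin[OF H_dual[OF h]]] by auto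
  have gens: "primitive_generators \<sigma> = w ` H"
  proof (intro subset_antisym subsetI)
    fix v assume "v \<in> primitive_generators \<sigma>"
    then obtain \<rho> where v: "primitive v" "\<rho> \<in> cone_rays \<sigma>" "v \<in> \<rho>"
      by (auto simp: primitive_generators_def)
    have v': "v \<in> N" "v \<noteq> 0" "\<And>x k. x \<in> N \<Longrightarrow> v = scale (of_nat k) x \<Longrightarrow> k = 1"
      using v(1) by (auto simp: primitive_def)
    have \<rho>: "face_of \<rho> \<sigma>" "dim \<rho> = 1"
      using v(2) by (auto simp: cone_rays_def)
    obtain m where m: "m \<in> dual_monoid \<sigma>" "\<rho> = {v \<in> \<sigma>. m v = 0}"
      using face_by_dual_monoid[OF \<rho>(1)] by blast
    have v\<sigma>: "v \<in> \<sigma>" "m v = 0"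
      using v(3) m(2) by auto
    have nonneg: "0 \<le> h v" if "h \<in> H" for h
      using H_dual[OF that] v\<sigma>(1) by (simp add: dual_monoid_def)
    \<comment> \<open>The vector \<open>v\<close> is a nonnegative combination of the
      \<open>w h\<close>, so each \<open>w h\<close> with nonzero coefficient lies in the same face.
      As that face is a ray, \<open>v\<close> is a multiple of one \<open>w h\<close>, and
      primitivity makes the factor 1.\<close>
    have "m v = (\<Sum>h\<in>H. h v * m (w h))"
      by (subst expand[of v]) (simp add: lin_sum[OF dual_monoid_lin[OF m(1)]] lin_scale[OF dual_monoid_lin[OF m(1)]])
    moreover have "0 \<le> h v * m (w h)" if "h \<in> H" for h
      using nonneg[OF that] w_cone[OF that] m(1) by (simp add: dual_monoid_def)
    ultimately have "\<forall>h\<in>H. h v * m (w h) = 0"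
      using sum_nonneg_eq_0_iff[OF H(1), of "\<lambda>h. h v * m (w h)"] v\<sigma>(2) by simp
    moreover obtain h where h: "h \<in> H" "h v \<noteq> 0"
      using separate[of v] v'(2) by blast
    ultimately have "w h \<in> \<rho>"
      using m(2) w_cone[OF h(1)] by auto
    then have "v \<in> span {w h}"
      using dim_one_subset_span[OF \<rho>(2) _ w_nonzero[OF h(1)]] v(3) by blast
    then obtain c where c: "v = scale c (w h)"
      using span_breakdown[of "w h" "{w h}" v] by auto
    have "h v = c"
      using hw[OF h(1,1)] by (simp add: c lin_scale[OF dual_monoid_lin[OF H_dual[OF h(1)]]])
    moreover have "of_int \<lfloor>h v\<rfloor> = h v"
      by (rule dual_lattice_floor[OF dual_monoid_dual_lattice[OF H_dual[OF h(1)]] v'(1)])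
    ultimately have floor_c: "rat_of_int \<lfloor>c\<rfloor> = c" "0 \<le> c"
      using nonneg[OF h(1)] by (simp_all only:)
    have "rat_of_nat (nat \<lfloor>c\<rfloor>) = rat_of_int (int (nat \<lfloor>c\<rfloor>))"
      by (simp only: of_int_of_nat_eq)
    also have "int (nat \<lfloor>c\<rfloor>) = \<lfloor>c\<rfloor>"
      using floor_c(2) by simp
    finally have "c = of_nat (nat \<lfloor>c\<rfloor>)"
      by (simp only: floor_c(1))
    then have "nat \<lfloor>c\<rfloor> = 1"
      using v'(3)[OF w_lattice[OF h(1)], of "nat \<lfloor>c\<rfloor>"] c by simp
    then have "v = w h"
      using c \<open>c = of_nat (nat \<lfloor>c\<rfloor>)\<close> by simp
    then show "v \<in> w ` H"
      using h(1) by blast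
  next
    fix v assume "v \<in> w ` H"
    then obtain h where h: "h \<in> H" "v = w h" by blast
    have "primitive v"
      unfolding primitive_def
    proof (intro conjI ballI allI impI)
      show "v \<in> N" "v \<noteq> 0"
        using h w_lattice w_nonzero by auto
      fix x :: 'v and k :: nat assume x: "x \<in> N" "v = scale (of_nat k) x"
      have "rat_of_nat k * h x = 1"
        using hw[OF h(1,1)] x(2) h(2) lin_scale[OF dual_monoid_lin[OF H_dual[OF h(1)]], of "of_nat k" x] by simp
      moreover have "of_int \<lfloor>h x\<rfloor> = h x"
        by (rule dual_lattice_floor[OF dual_monoid_dual_lattice[OF H_dual[OF h(1)]] x(1)])
      ultimately have "rat_of_int (int k * \<lfloor>h x\<rfloor>) = of_int 1"
        by (simp only: of_int_mult of_int_of_nat_eq of_int_1)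
      then have "int k * \<lfloor>h x\<rfloor> = 1"
        by (simp only: of_int_eq_iff)
      then show "k = 1"
        using zmult_eq_1_iff[of "int k" "\<lfloor>h x\<rfloor>"] by auto
    qed
    moreover have "cone_hull {v} \<in> cone_rays \<sigma>"
    proof -
      \<comment> \<open>On the cone all members of \<open>H\<close> are nonnegative, so
        \<open>q\<close> vanishes exactly where all coordinates but that of \<open>h\<close>
        do.\<close>
      define q where "q = (\<lambda>x. \<Sum>h'\<in>H - {h}. h' x)"
      have q: "q \<in> dual_monoid \<sigma>"
        unfolding q_def using H_dual by (intro dual_monoid_sum) auto
      have "cone_hull {v} = {x \<in> \<sigma>. q x = 0}"
      proof (intro subset_antisym subsetI)
        fix x assume "x \<in> cone_hull {v}"
        then obtain c where c: "0 \<le> c" "x = scale c v"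
          by (auto simp: cone_hull_single)
        have "q v = 0"
          unfolding q_def
        proof (intro sum.neutral ballI)
          show "h' v = 0" if "h' \<in> H - {h}" for h'
            using hw[OF h(1), of h'] h(2) that by simp
        qed
        then show "x \<in> {x \<in> \<sigma>. q x = 0}"
          using c rational_cone_scale[OF \<sigma>(1) w_cone[OF h(1)] c(1)] h(2)
          by (simp add: lin_scale[OF dual_monoid_lin[OF q]])
      next
        fix x assume x: "x \<in> {x \<in> \<sigma>. q x = 0}"
        have nonneg: "0 \<le> h' x" if "h' \<in> H" for h'
          using H_dual[OF that] x by (simp add: dual_monoid_def)
        have "\<forall>h'\<in>H - {h}. h' x = 0"
        proof (subst sum_nonneg_eq_0_iff[symmetric, of _ "\<lambda>h'. h' x"])
          show "0 \<le> h' x" if "h' \<in> H - {h}" for h'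
            using nonneg[of h'] that by simp
        qed (use x H(1) in \<open>simp_all add: q_def\<close>)
        then have "(\<Sum>h'\<in>H - {h}. scale (h' x) (w h')) = 0"
          by (intro sum.neutral ballI) simp
        then have "(\<Sum>h\<in>H. scale (h x) (w h)) = scale (h x) (w h)"
          using H(1) h(1) by (subst sum.remove[of H h]) auto
        then have "x = scale (h x) v"
          using expand[of x] h(2) by simp
        then show "x \<in> cone_hull {v}"
          using nonneg[OF h(1)] by (auto simp: cone_hull_single)
      qed
      then have "face_of (cone_hull {v}) \<sigma>"
        by (rule face_ofI[OF q])
      moreover have "dim (cone_hull {v}) = 1"
        using w_nonzero[OF h(1)] h(2) by (intro dim_ray) simp
      ultimately show ?thesis
        unfolding cone_rays_def by (intro CollectI conjI)
    qed
    ultimately show "v \<in> primitive_generators \<sigma>"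
      using cone_hull_gen[of "{v}" v] by (auto simp: primitive_generators_def)
  qed
  show ?thesis
    unfolding smooth_cone_def gens int_basis_def
  proof (intro conjI)
    show "finite (w ` H)"
      using H(1) by simp
    show "N = {\<Sum>b\<in>w ` H. scale (of_int (c b)) b | c. True}"
    proof (intro subset_antisym subsetI)
      fix v assume v: "v \<in> N"
      define c where "c = (\<lambda>b. \<lfloor>inv_into H w b v\<rfloor>)"
      have "v = (\<Sum>h\<in>H. scale (h v) (w h))"
        by (rule expand)
      also have "\<dots> = (\<Sum>h\<in>H. scale (of_int (c (w h))) (w h))"
      proof (intro sum.cong refl)
        show "scale (h v) (w h) = scale (of_int (c (w h))) (w h)" if h: "h \<in> H" for h
          unfolding c_def inv_into_f_f[OF inj_w h]
            dual_lattice_floor[OF dual_monoid_dual_lattice[OF H_dual[OF h]] v] ..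
      qed
      also have "\<dots> = (\<Sum>b\<in>w ` H. scale (of_int (c b)) b)"
        by (simp add: sum.reindex[OF inj_w])
      finally show "v \<in> {\<Sum>b\<in>w ` H. scale (of_int (c b)) b | c. True}" by blast
    next
      fix v assume "v \<in> {\<Sum>b\<in>w ` H. scale (of_int (c b)) b | c. True}"
      then show "v \<in> N"
        using w_lattice by (auto intro!: lattice_sum lattice_int)
    qed
    show "\<forall>c :: 'v \<Rightarrow> int. (\<Sum>b\<in>w ` H. scale (of_int (c b)) b) = 0 \<longrightarrow> (\<forall>b\<in>w ` H. c b = 0)"
    proof (intro allI impI ballI)
      fix c :: "'v \<Rightarrow> int" and b
      assume c: "(\<Sum>b\<in>w ` H. scale (of_int (c b)) b) = 0" and "b \<in> w ` H"
      then obtain h where h: "h \<in> H" "b = w h" by blast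
      have "(\<Sum>h\<in>H. scale (of_int (c (w h))) (w h)) = 0"
        using c by (simp add: sum.reindex[OF inj_w])
      then have "rat_of_int (c (w h)) = 0"
        using comb[OF h(1), of "\<lambda>h. of_int (c (w h))"] lin_zero[OF dual_monoid_lin[OF H_dual[OF h(1)]]] by simp
      then show "c b = 0"
        using h(2) by simp
    qed
  qed
qed

end

subsection \<open>Regular functions on the affine line and on the punctured plane\<close>

lemma poly_zero_off_roots:
  fixes p q :: "'k::field_char_0 poly"
  assumes "q \<noteq> 0" "\<And>y. poly q y \<noteq> 0 \<Longrightarrow> poly p y = 0"
  shows "p = 0"
proof -
  have "poly (p * q) y = 0" for y
    using assms(2)[of y] by auto
  then have "p * q = 0"
    using poly_all_0_iff_0 by blast
  then show ?thesis
    using assms(1) by simp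
qed

text \<open>Descent on the degree of a denominator. Algebraic closedness provides a root
  \<open>a\<close> of \<open>H\<close>; comparison with a fraction defined at \<open>a\<close> shows
  that the numerator vanishes there too, and a linear factor cancels.\<close>

lemma locally_rational_is_polynomial:
  fixes f :: "'k::{alg_closed_field, field_char_0} \<Rightarrow> 'k"
  assumes loc: "\<And>a. \<exists>G H. poly H a \<noteq> 0 \<and> (\<forall>y. poly H y \<noteq> 0 \<longrightarrow> f y = poly G y / poly H y)"
  shows "\<exists>P. \<forall>y. f y = poly P y"
proof -
  define R where "R = (\<lambda>G H. H \<noteq> 0 \<and> (\<forall>y. poly H y \<noteq> 0 \<longrightarrow> f y = poly G y / poly H y))"
  have "\<exists>P. \<forall>y. f y = poly P y" if "R G H" for G H
    using that
  proof (induction "degree H" arbitrary: G H rule: less_induct)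
    case less
    have GH: "H \<noteq> 0" "\<And>y. poly H y \<noteq> 0 \<Longrightarrow> f y = poly G y / poly H y"
      using less.prems by (auto simp: R_def)
    show ?case
    proof (cases "degree H = 0")
      case True
      then obtain c where c: "H = [:c:]"
        by (rule degree_eq_zeroE)
      then have "f y = poly (smult (inverse c) G) y" for y
        using GH by (simp add: divide_inverse mult.commute)
      then show ?thesis by blast
    next
      case False
      then obtain a where a: "poly H a = 0"
        using alg_closed_imp_poly_has_root[of H] by auto
      obtain G' H' where GH': "poly H' a \<noteq> 0" "\<And>y. poly H' y \<noteq> 0 \<Longrightarrow> f y = poly G' y / poly H' y"
        using loc[of a] by blast
      have "H' \<noteq> 0"
        using GH'(1) by auto
      have "G * H' - G' * H = 0"
      proof (rule poly_zero_off_roots)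
        show "H * H' \<noteq> 0"
          using GH(1) \<open>H' \<noteq> 0\<close> by simp
        show "poly (G * H' - G' * H) y = 0" if "poly (H * H') y \<noteq> 0" for y
          using that GH(2)[of y] GH'(2)[of y] by (simp add: frac_eq_eq)
      qed
      then have eq: "G * H' = G' * H" by simp
      have "poly G a = 0"
        using arg_cong[OF eq, of "\<lambda>p. poly p a"] a GH'(1) by simp
      then obtain G1 where G1: "G = [:- a, 1:] * G1"
        using poly_eq_0_iff_dvd by (metis dvdE)
      obtain H1 where H1: "H = [:- a, 1:] * H1"
        using a poly_eq_0_iff_dvd by (metis dvdE)
      have H1_nz: "H1 \<noteq> 0"
        using H1 GH(1) by auto
      have "[:- a, 1:] * (G1 * H') = [:- a, 1:] * (G' * H1)"
        using eq unfolding G1 H1 by (simp only: mult.assoc mult.left_commute)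
      then have eq1: "G1 * H' = G' * H1"
        by (subst (asm) mult_left_cancel) auto
      \<comment> \<open>At \<open>a\<close> the original fraction says nothing about
        \<open>f\<close>; the value comes from the second representation.\<close>
      have "f y = poly G1 y / poly H1 y" if y: "poly H1 y \<noteq> 0" for y
      proof (cases "y = a")
        case True
        have "poly G1 a * poly H' a = poly G' a * poly H1 a"
          using arg_cong[OF eq1, of "\<lambda>p. poly p a"] by simp
        then show ?thesis
          using GH'(1) GH'(2)[of a] y True by (simp add: frac_eq_eq)
      next
        case False
        have GH1: "poly G y = (y - a) * poly G1 y" "poly H y = (y - a) * poly H1 y"
          by (simp_all add: G1 H1 algebra_simps)
        then have "poly H y \<noteq> 0"
          using False y by simp
        then have "f y = ((y - a) * poly G1 y) / ((y - a) * poly H1 y)"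
          using GH(2)[of y] GH1 by simp
        also have "\<dots> = poly G1 y / poly H1 y"
          using False by (intro mult_divide_mult_cancel_left) simp
        finally show ?thesis .
      qed
      then have "R G1 H1"
        using H1_nz by (simp add: R_def)
      moreover have "degree H = degree [:- a, 1:] + degree H1"
        unfolding H1 by (rule degree_mult_eq) (use H1_nz in auto)
      then have "degree H1 < degree H"
        by simp
      ultimately show ?thesis
        using less.hyps by blast
    qed
  qed
  moreover obtain G H where "poly H 0 \<noteq> 0" "\<forall>y. poly H y \<noteq> 0 \<longrightarrow> f y = poly G y / poly H y"
    using loc[of 0] by blast
  then have "R G H"
    by (auto simp: R_def)
  ultimately show ?thesis by blast
qed

text \<open>Lagrange interpolation with the nodes 1 to \<open>D + 1\<close>; the weights are the
  values at 0 of the Lagrange polynomials. The nodes avoid 0 because the samples are to be taken off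
  an axis.\<close>

lemma value_at_0_from_samples:
  "\<exists>w :: nat \<Rightarrow> 'k::field_char_0. \<forall>P. degree P \<le> D \<longrightarrow> poly P 0 = (\<Sum>k\<le>D. w k * poly P (of_nat (Suc k)))"
proof -
  define L where "L = (\<lambda>k. \<Prod>j\<in>{..D} - {k}. smult (inverse (of_nat (Suc k) - of_nat (Suc j))) [:- of_nat (Suc j), 1 :: 'k:])"
  have degL: "degree (L k) \<le> D" if "k \<le> D" for k
  proof -
    have "degree (L k) \<le> sum (degree \<circ> (\<lambda>j. smult (inverse (of_nat (Suc k) - of_nat (Suc j))) [:- of_nat (Suc j), 1 :: 'k:]))
        ({..D} - {k})"
      unfolding L_def by (rule degree_prod_sum_le) simp
    also have "\<dots> \<le> (\<Sum>j\<in>{..D} - {k}. 1)"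
      by (intro sum_mono) (simp add: order_trans[OF degree_smult_le])
    also have "\<dots> = D"
      using that by simp
    finally show ?thesis .
  qed
  have Lval: "poly (L k) (of_nat (Suc i)) = (if i = k then 1 else 0)" if "i \<le> D" "k \<le> D" for i k
  proof (cases "i = k")
    case True
    have "poly (L k) (of_nat (Suc k)) = (\<Prod>j\<in>{..D} - {k}. inverse (of_nat (Suc k) - of_nat (Suc j)) * (of_nat (Suc k) - of_nat (Suc j)))"
      unfolding L_def poly_prod by (intro prod.cong refl) (simp add: algebra_simps del: of_nat_Suc)
    also have "\<dots> = 1"
    proof (intro prod.neutral ballI left_inverse)
      fix j assume "j \<in> {..D} - {k}"
      then have "Suc k \<noteq> Suc j" by auto
      then show "of_nat (Suc k) - of_nat (Suc j) \<noteq> (0 :: 'k)"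
        by (simp only: right_minus_eq of_nat_eq_iff not_False_eq_True)
    qed
    finally show ?thesis
      using True by simp
  next
    case False
    have "poly (L k) (of_nat (Suc i)) = 0"
      unfolding L_def poly_prod using that False by (intro prod_zero bexI[of _ i]) (auto simp: algebra_simps simp del: of_nat_Suc)
    then show ?thesis
      using False by simp
  qed
  have "poly P 0 = (\<Sum>k\<le>D. poly (L k) 0 * poly P (of_nat (Suc k)))" if P: "degree P \<le> D" for P
  proof -
    let ?Q = "\<Sum>k\<le>D. smult (poly P (of_nat (Suc k))) (L k)"
    let ?A = "(\<lambda>k. of_nat (Suc k) :: 'k) ` {..D}"
    have card: "card ?A = Suc D"
      by (subst card_image) (auto simp: inj_on_def)
    have degQ: "degree ?Q \<le> D"
      using degL by (intro degree_sum_le) (auto intro: order_trans[OF degree_smult_le])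
    have "P = ?Q"
    proof (rule poly_eqI_degree[of ?A])
      show "card ?A > degree P" "card ?A > degree ?Q"
        using P degQ card by auto
      fix x assume "x \<in> ?A"
      then obtain i where i: "i \<le> D" "x = of_nat (Suc i)" by auto
      have "poly ?Q x = (\<Sum>k\<le>D. if i = k then poly P (of_nat (Suc k)) else 0)"
        unfolding i(2) poly_sum poly_smult using i(1) by (intro sum.cong refl) (simp add: Lval del: of_nat_Suc)
      then show "poly P x = poly ?Q x"
        using i by (simp del: of_nat_Suc)
    qed
    then have "poly P 0 = poly ?Q 0"
      by (rule arg_cong)
    then show ?thesis
      unfolding poly_sum poly_smult by (simp only: mult.commute)
  qed
  then show ?thesis
    by (intro exI[of _ "\<lambda>k. poly (L k) 0"]) auto
qed

text \<open>Hartogs in dimension two: a regular function off the origin cannot be a nonzero constant on one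
  axis and zero on the other.  Interpolation in the first variable replaces the extension.\<close>

lemma axes_contradiction:
  fixes f :: "'k::field_char_0 \<Rightarrow> 'k \<Rightarrow> 'k"
  assumes poly2: "\<And>r. r \<noteq> 0 \<Longrightarrow> \<exists>P. \<forall>s. f r s = poly P s"
    and poly1: "finite Z" "\<And>s. s \<notin> Z \<Longrightarrow> \<exists>P. degree P \<le> D \<and> (\<forall>r. f r s = poly P r)"
    and axis1: "\<And>s. s \<noteq> 0 \<Longrightarrow> f 0 s = c" and axis2: "\<And>r. r \<noteq> 0 \<Longrightarrow> f r 0 = 0"
  shows "c = 0"
proof -
  obtain w :: "nat \<Rightarrow> 'k" where w: "\<And>P. degree P \<le> D \<Longrightarrow> poly P 0 = (\<Sum>k\<le>D. w k * poly P (of_nat (Suc k)))"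
    using value_at_0_from_samples[of D] by blast
  have "\<forall>k. \<exists>P. \<forall>s. f (of_nat (Suc k)) s = poly P s"
    using poly2 by (metis of_nat_neq_0)
  then obtain P where P: "\<And>k s. f (of_nat (Suc k)) s = poly (P k) s"
    by metis
  \<comment> \<open>\<open>Q\<close> interpolates the values on the axis \<open>r = 0\<close> from
    the lines through the nodes. It equals \<open>c\<close> for all but finitely many
    \<open>s\<close>, hence identically, whereas at \<open>s = 0\<close> all samples are
    zero.\<close>
  define Q where "Q = (\<Sum>k\<le>D. smult (w k) (P k))"
  have Q: "poly Q s = (\<Sum>k\<le>D. w k * f (of_nat (Suc k)) s)" for s
    by (simp only: Q_def poly_sum poly_smult P)
  have "poly (Q - [:c:]) s = 0" if s: "s \<notin> insert 0 Z" for s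
  proof -
    obtain R where R: "degree R \<le> D" "\<And>r. f r s = poly R r"
      using poly1(2)[of s] s by auto
    have "poly Q s = poly R 0"
      unfolding Q w[OF R(1)] R(2) ..
    then show ?thesis
      using axis1[of s] s R(2)[of 0] by simp
  qed
  then have "UNIV - insert 0 Z \<subseteq> {s. poly (Q - [:c:]) s = 0}"
    by blast
  then have "infinite {s. poly (Q - [:c:]) s = 0}"
    using poly1(1) infinite_UNIV_char_0[where 'a = 'k] by (metis Diff_infinite_finite finite_insert finite_subset)
  then have "Q - [:c:] = 0"
    using poly_roots_finite by blast
  then have "poly Q 0 = c" by simp
  moreover have "f (of_nat (Suc k)) 0 = 0" for k
    by (rule axis2) (rule of_nat_neq_0)
  ultimately show ?thesis
    by (simp add: Q del: of_nat_Suc)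
qed

context toric_lattice
begin

subsection \<open>Vector fields of one-parameter subgroups\<close>

text \<open>The invariant vector field of the one-parameter subgroup of \<open>v\<close>, applied to
  a function; it is meaningful at points where the function is regular.\<close>

definition log_derivation ::
    "'v set set \<Rightarrow> 'v \<Rightarrow> (('v, 'k::field) toric_point \<Rightarrow> 'k) \<Rightarrow> ('v, 'k) toric_point \<Rightarrow> 'k" where
  "log_derivation \<Sigma> v F p = (THE d. \<exists>\<tau>\<in>\<Sigma>. \<exists>w\<in>chart \<tau>. p = chart_map \<Sigma> \<tau> w \<and>
     germ_deriv \<tau> w (log_tangent v w) (F \<circ> chart_map \<Sigma> \<tau>) d)"

lemma germ_deriv_down:
  fixes F :: "('v, 'k::field) toric_point \<Rightarrow> 'k"
  assumes fan: "fan \<Sigma>" and "\<tau> \<in> \<Sigma>" "\<omega> \<in> \<Sigma>" "\<omega> \<subseteq> \<tau>" "z \<in> chart \<omega>"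
    and "germ_deriv \<tau> (restrict z (dual_monoid \<tau>)) (log_tangent v (restrict z (dual_monoid \<tau>))) (F \<circ> chart_map \<Sigma> \<tau>) d"
  shows "germ_deriv \<omega> z (log_tangent v z) (F \<circ> chart_map \<Sigma> \<omega>) d"
proof -
  let ?w = "restrict z (dual_monoid \<tau>)"
  obtain g h where gh: "local_fraction \<tau> ?w (F \<circ> chart_map \<Sigma> \<tau>) g h"
      and d: "d = (g (log_tangent v ?w) * h ?w - g ?w * h (log_tangent v ?w)) / (h ?w)\<^sup>2"
    using assms(6) by (rule germ_derivE)
  have eq: "k (log_tangent v ?w) = k (log_tangent v z)" if "k \<in> coordinate_ring \<tau>" for k :: "('v, 'k) chart_point \<Rightarrow> 'k"
    by (rule coordinate_ring_cong[OF that]) (simp add: log_tangent_def)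
  have "d = (g (log_tangent v z) * h z - g z * h (log_tangent v z)) / (h z)\<^sup>2"
    unfolding d eq[OF local_fractionD(1)[OF gh]] eq[OF local_fractionD(2)[OF gh]]
      coordinate_ring_restrict[OF local_fractionD(1)[OF gh]] coordinate_ring_restrict[OF local_fractionD(2)[OF gh]] ..
  then show ?thesis
    using local_fraction_down[OF assms(1-5) gh] unfolding germ_deriv_def by blast
qed

text \<open>The field is given by the same formula in every chart, so values from two charts are
  both derivatives on the intersection, where they are unique.\<close>

lemma log_derivation_eq:
  fixes F :: "('v, 'k::field_char_0) toric_point \<Rightarrow> 'k"
  assumes fan: "fan \<Sigma>" and v: "v \<in> N" and \<tau>: "\<tau> \<in> \<Sigma>" "w \<in> chart \<tau>"
    and d: "germ_deriv \<tau> w (log_tangent v w) (F \<circ> chart_map \<Sigma> \<tau>) d"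
  shows "log_derivation \<Sigma> v F (chart_map \<Sigma> \<tau> w) = d"
  unfolding log_derivation_def
proof (rule the_equality)
  fix d' assume "\<exists>\<tau>'\<in>\<Sigma>. \<exists>w'\<in>chart \<tau>'. chart_map \<Sigma> \<tau> w = chart_map \<Sigma> \<tau>' w' \<and>
    germ_deriv \<tau>' w' (log_tangent v w') (F \<circ> chart_map \<Sigma> \<tau>') d'"
  then obtain \<tau>' w' where \<tau>': "\<tau>' \<in> \<Sigma>" "w' \<in> chart \<tau>'" "chart_map \<Sigma> \<tau> w = chart_map \<Sigma> \<tau>' w'"
      and d': "germ_deriv \<tau>' w' (log_tangent v w') (F \<circ> chart_map \<Sigma> \<tau>') d'"
    by blast
  obtain z where z: "z \<in> chart (\<tau> \<inter> \<tau>')" "w = restrict z (dual_monoid \<tau>)" "w' = restrict z (dual_monoid \<tau>')"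
    using \<tau>'(3) unfolding chart_map_eq_iff[OF fan \<tau>(1) \<tau>'(1) \<tau>(2) \<tau>'(2)] by blast
  have \<omega>: "\<tau> \<inter> \<tau>' \<in> \<Sigma>"
    by (rule fan_Int[OF fan \<tau>(1) \<tau>'(1)])
  show "d' = d"
    by (rule germ_deriv_unique[OF log_tangent_tangent[OF v z(1)] z(1) fan_zero[OF fan \<omega>]
          germ_deriv_down[OF fan \<tau>'(1) \<omega> Int_lower2 z(1) d'[unfolded z(3)]]
          germ_deriv_down[OF fan \<tau>(1) \<omega> Int_lower1 z(1) d[unfolded z(2)]]])
qed (use assms in blast)

lemma log_derivation_germ:
  fixes F :: "('v, 'k::field_char_0) toric_point \<Rightarrow> 'k"
  assumes fan: "fan \<Sigma>" and v: "v \<in> N" and \<tau>: "\<tau> \<in> \<Sigma>" "w \<in> chart \<tau>"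
    and F: "regular_at \<Sigma> (chart_map \<Sigma> \<tau> w) F"
  shows "germ_deriv \<tau> w (log_tangent v w) (F \<circ> chart_map \<Sigma> \<tau>) (log_derivation \<Sigma> v F (chart_map \<Sigma> \<tau> w))"
proof -
  obtain g h where "local_fraction \<tau> w (F \<circ> chart_map \<Sigma> \<tau>) g h"
    using regular_atE[OF fan \<tau> F] .
  then obtain d where "germ_deriv \<tau> w (log_tangent v w) (F \<circ> chart_map \<Sigma> \<tau>) d"
    using germ_deriv_exists by blast
  then show ?thesis
    using log_derivation_eq[OF fan v \<tau>] by simp
qed

lemma log_derivation_mult:
  fixes F G :: "('v, 'k::field_char_0) toric_point \<Rightarrow> 'k"
  assumes fan: "fan \<Sigma>" and v: "v \<in> N" and p: "p \<in> toric_variety \<Sigma>"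
    and F: "regular_at \<Sigma> p F" and G: "regular_at \<Sigma> p G"
    and U: "openin (toric_topology \<Sigma>) U" "p \<in> U" "\<And>q. q \<in> U \<Longrightarrow> E q = F q * G q"
  shows "log_derivation \<Sigma> v E p = log_derivation \<Sigma> v F p * G p + F p * log_derivation \<Sigma> v G p"
proof -
  obtain \<tau> w where \<tau>: "\<tau> \<in> \<Sigma>" "w \<in> chart \<tau>" "p = chart_map \<Sigma> \<tau> w"
    using p by (rule toric_varietyE)
  note tan = log_tangent_tangent[OF v \<tau>(2)]
  have "openin (chart_topology \<tau>) {x \<in> chart \<tau>. chart_map \<Sigma> \<tau> x \<in> U}"
    using U(1) \<tau>(1) by (simp add: openin_toric_topology)
  moreover have "w \<in> {x \<in> chart \<tau>. chart_map \<Sigma> \<tau> x \<in> U}"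
    using \<tau>(2,3) U(2) by simp
  ultimately obtain q where q: "q \<in> coordinate_ring \<tau>" "q w \<noteq> 0"
      "{y \<in> chart \<tau>. q y \<noteq> 0} \<subseteq> {x \<in> chart \<tau>. chart_map \<Sigma> \<tau> x \<in> U}"
    unfolding openin_chart_topology by blast
  have "germ_deriv \<tau> w (log_tangent v w) (\<lambda>y. (F \<circ> chart_map \<Sigma> \<tau>) y * (G \<circ> chart_map \<Sigma> \<tau>) y)
      (log_derivation \<Sigma> v F p * (G \<circ> chart_map \<Sigma> \<tau>) w + (F \<circ> chart_map \<Sigma> \<tau>) w * log_derivation \<Sigma> v G p)"
    using F G unfolding \<tau>(3) by (intro germ_deriv_mult[OF tan \<tau>(2)] log_derivation_germ[OF fan v \<tau>(1,2)])
  then have "germ_deriv \<tau> w (log_tangent v w) (E \<circ> chart_map \<Sigma> \<tau>)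
      (log_derivation \<Sigma> v F p * (G \<circ> chart_map \<Sigma> \<tau>) w + (F \<circ> chart_map \<Sigma> \<tau>) w * log_derivation \<Sigma> v G p)"
  proof (rule germ_deriv_cong[OF tan \<tau>(2) _ q(1,2)])
    fix y assume "y \<in> chart \<tau>" "q y \<noteq> 0"
    then have "chart_map \<Sigma> \<tau> y \<in> U"
      using q(3) by blast
    then show "(F \<circ> chart_map \<Sigma> \<tau>) y * (G \<circ> chart_map \<Sigma> \<tau>) y = (E \<circ> chart_map \<Sigma> \<tau>) y"
      using U(3) by simp
  qed
  then show ?thesis
    using log_derivation_eq[OF fan v \<tau>(1,2)] \<tau>(3) by simp
qed

text \<open>Characters are eigenvectors of the invariant field, with eigenvalue \<open>m v\<close>,
  so the coordinate ring is mapped to itself.\<close>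

lemma log_derivation_coordinate_ring:
  assumes "g \<in> coordinate_ring \<tau>"
  shows "(\<lambda>y. g (log_tangent v y)) \<in> coordinate_ring \<tau>"
proof -
  obtain F c where F: "finite F" "F \<subseteq> dual_monoid \<tau>" "g = (\<lambda>x. \<Sum>m\<in>F. c m * x m)"
    using assms by (rule coordinate_ringE)
  show ?thesis
    unfolding F(3) log_tangent_def mult.assoc[symmetric] using F(1,2) by (rule coordinate_ringI)
qed

lemma log_derivation_regular_at:
  fixes F :: "('v, 'k::field_char_0) toric_point \<Rightarrow> 'k"
  assumes fan: "fan \<Sigma>" and v: "v \<in> N" and p: "p \<in> toric_variety \<Sigma>" and F: "regular_at \<Sigma> p F"
  shows "regular_at \<Sigma> p (log_derivation \<Sigma> v F)"
proof -
  obtain \<tau> w where \<tau>: "\<tau> \<in> \<Sigma>" "w \<in> chart \<tau>" "p = chart_map \<Sigma> \<tau> w"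
    using p by (rule toric_varietyE)
  obtain g h where gh0: "local_fraction \<tau> w (F \<circ> chart_map \<Sigma> \<tau>) g h"
    using regular_atE[OF fan \<tau>(1,2) F[unfolded \<tau>(3)]] .
  note gh = local_fractionD[OF gh0]
  let ?D = "\<lambda>k y. k (log_tangent v y)"
  obtain a where a0: "ring_product \<tau> (?D g) h a"
    using ring_productE[OF log_derivation_coordinate_ring[OF gh(1)] gh(2)] .
  obtain b where b0: "ring_product \<tau> g (?D h) b"
    using ring_productE[OF gh(1) log_derivation_coordinate_ring[OF gh(2)]] .
  obtain c where c0: "ring_product \<tau> h h c"
    using ring_productE[OF gh(2,2)] .
  note a = ring_productD[OF a0] and b = ring_productD[OF b0] and c = ring_productD[OF c0]
  have "local_fraction \<tau> w (log_derivation \<Sigma> v F \<circ> chart_map \<Sigma> \<tau>) (\<lambda>y. a y + (- 1) * b y) c"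
    unfolding local_fraction_def
  proof (intro conjI ballI impI coordinate_ring_add coordinate_ring_cmult a(1) b(1) c(1))
    show "c w \<noteq> 0"
      using c(2)[OF \<tau>(2)] gh(3) by simp
    fix y assume y: "y \<in> chart \<tau>" "c y \<noteq> 0"
    then have hy: "h y \<noteq> 0"
      using c(2) by auto
    then have "local_fraction \<tau> y (F \<circ> chart_map \<Sigma> \<tau>) g h"
      using gh0 by (simp add: local_fraction_def)
    then have "germ_deriv \<tau> y (log_tangent v y) (F \<circ> chart_map \<Sigma> \<tau>) ((?D g y * h y - g y * ?D h y) / (h y)\<^sup>2)"
      unfolding germ_deriv_def by blast
    then show "(log_derivation \<Sigma> v F \<circ> chart_map \<Sigma> \<tau>) y = (a y + (- 1) * b y) / c y"
      using log_derivation_eq[OF fan v \<tau>(1) y(1)] by (simp add: a(2)[OF y(1)] b(2)[OF y(1)] c(2)[OF y(1)] power2_eq_square)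
  qed
  then show ?thesis
    unfolding \<tau>(3) by (rule regular_atI[OF fan \<tau>(1,2)])
qed

end

text \<open>Multiplying by the power \<open>K\<close> of the variable clears negative exponents. The
  resulting polynomial is nonzero because its value at 1 is the sum of the coefficients.\<close>

lemma laurent_sum_finite_zeros:
  fixes c :: "'m \<Rightarrow> 'k::field_char_0" and \<beta> :: "'m \<Rightarrow> int"
  assumes "finite F" "(\<Sum>m\<in>F. c m) \<noteq> 0"
  shows "finite {s. s \<noteq> 0 \<and> (\<Sum>m\<in>F. c m * s powi \<beta> m) = 0}"
proof -
  define K where "K = (\<Sum>m\<in>F. \<bar>\<beta> m\<bar>)"
  have K: "0 \<le> K + \<beta> m" if "m \<in> F" for m
    using member_le_sum[OF that, of "\<lambda>m. \<bar>\<beta> m\<bar>"] assms(1) by (simp add: K_def)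
  define Q where "Q = (\<Sum>m\<in>F. smult (c m) (monom 1 (nat (K + \<beta> m))))"
  have Q: "poly Q s = (\<Sum>m\<in>F. c m * s ^ nat (K + \<beta> m))" for s
    by (simp add: Q_def poly_sum poly_monom)
  have "poly Q 1 \<noteq> 0"
    using assms(2) by (simp add: Q)
  then have "Q \<noteq> 0" by auto
  moreover have "poly Q s = 0" if s: "s \<noteq> 0" "(\<Sum>m\<in>F. c m * s powi \<beta> m) = 0" for s
  proof -
    have "poly Q s = (\<Sum>m\<in>F. s powi K * (c m * s powi \<beta> m))"
      unfolding Q
    proof (intro sum.cong refl)
      fix m assume m: "m \<in> F"
      have "s ^ nat (K + \<beta> m) = s powi (K + \<beta> m)"
        using K[OF m] by (simp add: power_int_def)
      also have "\<dots> = s powi K * s powi \<beta> m"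
        using s(1) by (simp add: power_int_add)
      finally show "c m * s ^ nat (K + \<beta> m) = s powi K * (c m * s powi \<beta> m)"
        by simp
    qed
    then show ?thesis
      using s(2) by (simp flip: sum_distrib_left)
  qed
  ultimately show ?thesis
    using poly_roots_finite[of Q] by (auto elim: rev_finite_subset)
qed

context toric_lattice
begin

subsection \<open>Curves through charts\<close>

lemma coordinate_ring_curve:
  assumes "g \<in> coordinate_ring \<tau>" "\<And>m. m \<in> dual_monoid \<tau> \<Longrightarrow> \<exists>P. \<forall>r. w r m = poly P r"
  shows "\<exists>P. \<forall>r. g (w r) = poly P (r :: 'k::field_char_0)"
proof -
  obtain F c where F: "finite F" "F \<subseteq> dual_monoid \<tau>" "g = (\<lambda>x. \<Sum>m\<in>F. c m * x m)"
    using assms(1) by (rule coordinate_ringE)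
  obtain P where P: "\<And>m r. m \<in> dual_monoid \<tau> \<Longrightarrow> w r m = poly (P m) r"
    using assms(2) by metis
  have "g (w r) = poly (\<Sum>m\<in>F. smult (c m) (P m)) r" for r
    unfolding F(3) poly_sum poly_smult using F(2) by (intro sum.cong refl) (auto simp: P)
  then show ?thesis by blast
qed

text \<open>Local fractions pull back along a curve with polynomial coordinates to local fractions
  on the affine line.\<close>

lemma regular_curve_polynomial:
  fixes w :: "'k::{alg_closed_field, field_char_0} \<Rightarrow> ('v, 'k) chart_point"
  assumes fan: "fan \<Sigma>" and \<tau>: "\<tau> \<in> \<Sigma>" and w: "\<And>r. w r \<in> chart \<tau>"
    and poly: "\<And>m. m \<in> dual_monoid \<tau> \<Longrightarrow> \<exists>P. \<forall>r. w r m = poly P r"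
    and F: "\<And>r. regular_at \<Sigma> (chart_map \<Sigma> \<tau> (w r)) F"
  shows "\<exists>P. \<forall>r. F (chart_map \<Sigma> \<tau> (w r)) = poly P r"
proof (rule locally_rational_is_polynomial)
  fix a
  obtain g h where gh0: "local_fraction \<tau> (w a) (F \<circ> chart_map \<Sigma> \<tau>) g h"
    using regular_atE[OF fan \<tau> w F] .
  note gh = local_fractionD[OF gh0]
  obtain G where G: "\<And>r. g (w r) = poly G r"
    using coordinate_ring_curve[where w = w, OF gh(1) poly] by blast
  obtain H where H: "\<And>r. h (w r) = poly H r"
    using coordinate_ring_curve[where w = w, OF gh(2) poly] by blast
  have "poly H a \<noteq> 0"
    using gh(3) by (simp add: H)
  moreover have "F (chart_map \<Sigma> \<tau> (w y)) = poly G y / poly H y" if "poly H y \<noteq> 0" for y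
    using gh(4)[OF w[of y]] that by (simp add: G H)
  ultimately show "\<exists>G H. poly H a \<noteq> 0 \<and> (\<forall>y. poly H y \<noteq> 0 \<longrightarrow> F (chart_map \<Sigma> \<tau> (w y)) = poly G y / poly H y)"
    by blast
qed

text \<open>Interpolation needs a degree bound uniform in \<open>s\<close>. One fraction, chosen at
  \<open>\<gamma> 1 1\<close>, serves every nonzero \<open>s\<close> for which its denominator is
  nonzero at \<open>r = 1\<close>; the polynomial in \<open>r\<close> then divides the numerator,
  whose degree is bounded independently of \<open>s\<close>.\<close>

lemma regular_curve_degree_bound:
  fixes \<gamma> :: "'k::{alg_closed_field, field_char_0} \<Rightarrow> 'k \<Rightarrow> ('v, 'k) chart_point"
  assumes fan: "fan \<Sigma>" and \<tau>: "\<tau> \<in> \<Sigma>" and \<gamma>: "\<And>r s. s \<noteq> 0 \<Longrightarrow> \<gamma> r s \<in> chart \<tau>"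
    and mono: "\<And>r s m. m \<in> dual_monoid \<tau> \<Longrightarrow> \<gamma> r s m = r ^ \<alpha> m * s powi \<beta> m"
    and F: "\<And>r s. s \<noteq> 0 \<Longrightarrow> regular_at \<Sigma> (chart_map \<Sigma> \<tau> (\<gamma> r s)) F"
  shows "\<exists>D Z. finite Z \<and> 0 \<in> Z \<and>
    (\<forall>s. s \<notin> Z \<longrightarrow> (\<exists>P. degree P \<le> D \<and> (\<forall>r. F (chart_map \<Sigma> \<tau> (\<gamma> r s)) = poly P r)))"
proof -
  obtain g h where gh0: "local_fraction \<tau> (\<gamma> 1 1) (F \<circ> chart_map \<Sigma> \<tau>) g h"
    using regular_atE[OF fan \<tau> \<gamma>[OF one_neq_zero] F[OF one_neq_zero]] .
  note gh = local_fractionD[OF gh0]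
  obtain A a where A: "finite A" "A \<subseteq> dual_monoid \<tau>" "g = (\<lambda>x. \<Sum>m\<in>A. a m * x m)"
    using gh(1) by (rule coordinate_ringE)
  obtain B b where B: "finite B" "B \<subseteq> dual_monoid \<tau>" "h = (\<lambda>x. \<Sum>m\<in>B. b m * x m)"
    using gh(2) by (rule coordinate_ringE)
  define G where "G = (\<lambda>s. \<Sum>m\<in>A. monom (a m * s powi \<beta> m) (\<alpha> m))"
  define H where "H = (\<lambda>s. \<Sum>m\<in>B. monom (b m * s powi \<beta> m) (\<alpha> m))"
  have G: "poly (G s) r = g (\<gamma> r s)" for r s
    unfolding G_def A(3) poly_sum poly_monom using A(2) by (intro sum.cong refl) (auto simp: mono algebra_simps)
  have H: "poly (H s) r = h (\<gamma> r s)" for r s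
    unfolding H_def B(3) poly_sum poly_monom using B(2) by (intro sum.cong refl) (auto simp: mono algebra_simps)
  have degG: "degree (G s) \<le> (\<Sum>m\<in>A. \<alpha> m)" for s
    unfolding G_def using member_le_sum[of _ A \<alpha>] A(1)
    by (intro degree_sum_le) (auto intro: order_trans[OF degree_monom_le])
  define Z where "Z = insert 0 {s. s \<noteq> 0 \<and> (\<Sum>m\<in>B. b m * s powi \<beta> m) = 0}"
  have "h (\<gamma> 1 1) = (\<Sum>m\<in>B. b m)"
    unfolding B(3) using B(2) by (intro sum.cong refl) (auto simp: mono)
  then have "finite Z"
    using laurent_sum_finite_zeros[OF B(1)] gh(3) by (simp add: Z_def)
  moreover have "\<exists>P. degree P \<le> (\<Sum>m\<in>A. \<alpha> m) \<and> (\<forall>r. F (chart_map \<Sigma> \<tau> (\<gamma> r s)) = poly P r)"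
    if s: "s \<notin> Z" for s
  proof -
    have s0: "s \<noteq> 0"
      using s by (auto simp: Z_def)
    have "\<exists>P. \<forall>r. \<gamma> r s m = poly P r" if "m \<in> dual_monoid \<tau>" for m
      using mono[OF that] by (intro exI[of _ "monom (s powi \<beta> m) (\<alpha> m)"]) (simp add: poly_monom)
    then obtain P where P: "\<And>r. F (chart_map \<Sigma> \<tau> (\<gamma> r s)) = poly P r"
      using regular_curve_polynomial[OF fan \<tau>, of "\<lambda>r. \<gamma> r s" F] \<gamma>[OF s0] F[OF s0] by blast
    have "poly (H s) 1 = (\<Sum>m\<in>B. b m * s powi \<beta> m)"
      unfolding H B(3) using B(2) by (intro sum.cong refl) (auto simp: mono)
    then have "poly (H s) 1 \<noteq> 0"
      using s s0 by (simp add: Z_def)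
    then have Hs: "H s \<noteq> 0" by auto
    have "P * H s - G s = 0"
    proof (rule poly_zero_off_roots[OF Hs])
      fix r assume r: "poly (H s) r \<noteq> 0"
      have "poly P r = g (\<gamma> r s) / h (\<gamma> r s)"
        using gh(4)[OF \<gamma>[OF s0]] r P[of r] by (simp add: H)
      then show "poly (P * H s - G s) r = 0"
        using r by (simp add: G H)
    qed
    then have eq: "P * H s = G s" by simp
    have "degree P \<le> degree (G s)"
    proof (cases "P = 0")
      case False
      then have "degree (G s) = degree P + degree (H s)"
        unfolding eq[symmetric] using Hs by (rule degree_mult_eq)
      then show ?thesis by simp
    qed simp
    then show ?thesis
      using degG[of s] P by (intro exI[of _ P]) auto
  qed
  ultimately show ?thesis
    by (intro exI[of _ "\<Sum>m\<in>A. \<alpha> m"] exI[of _ Z]) (auto simp: Z_def)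
qed

text \<open>A two-parameter family of torus points extended to \<open>r = 0\<close>: the natural
  exponent is legitimate if \<open>m v\<close> is nonnegative, and \<open>0 ^ 0 = 1\<close> retains
  the characters with \<open>m v = 0\<close>.\<close>

definition monomial_point :: "'v set \<Rightarrow> 'v \<Rightarrow> 'v \<Rightarrow> 'k::field \<Rightarrow> 'k \<Rightarrow> ('v, 'k) chart_point" where
  "monomial_point \<tau> v u r s = restrict (\<lambda>m. r ^ nat \<lfloor>m v\<rfloor> * s powi \<lfloor>m u\<rfloor>) (dual_monoid \<tau>)"

lemma monomial_point_mem:
  assumes "v \<in> N" "u \<in> N" "s \<noteq> 0" "\<And>m. m \<in> dual_monoid \<tau> \<Longrightarrow> 0 \<le> m v"
  shows "monomial_point \<tau> v u r s \<in> chart \<tau>"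
proof (rule chartI)
  show "monomial_point \<tau> v u r s (\<lambda>_. 0) = 1"
    by (simp add: monomial_point_def zero_mem_dual_monoid)
  fix m m' assume m: "m \<in> dual_monoid \<tau>" "m' \<in> dual_monoid \<tau>"
  note l = dual_monoid_dual_lattice[OF m(1)] dual_monoid_dual_lattice[OF m(2)]
  have "nat (\<lfloor>m v\<rfloor> + \<lfloor>m' v\<rfloor>) = nat \<lfloor>m v\<rfloor> + nat \<lfloor>m' v\<rfloor>"
    using assms(4)[OF m(1)] assms(4)[OF m(2)] by (intro nat_add_distrib) auto
  then show "monomial_point \<tau> v u r s (\<lambda>v. m v + m' v) = monomial_point \<tau> v u r s m * monomial_point \<tau> v u r s m'"
    unfolding monomial_point_def restrict_apply'[OF m(1)] restrict_apply'[OF m(2)]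
      restrict_apply'[OF add_mem_dual_monoid[OF m]] floor_add_lattice[OF l assms(1)] floor_add_lattice[OF l assms(2)]
    using assms(3) by (simp add: power_add power_int_add)
qed (simp add: monomial_point_def)

definition torus_point :: "'v \<Rightarrow> 'v \<Rightarrow> 'k::field \<Rightarrow> 'k \<Rightarrow> ('v, 'k) chart_point" where
  "torus_point v u r s = restrict (\<lambda>m. r powi \<lfloor>m v\<rfloor> * s powi \<lfloor>m u\<rfloor>) dual_lattice"

lemma torus_point_commute: "torus_point v u r s = torus_point u v s r"
  by (simp add: torus_point_def mult.commute)

lemma torus_point_mem:
  assumes "v \<in> N" "u \<in> N" "r \<noteq> 0" "s \<noteq> 0"
  shows "torus_point v u r s \<in> chart {0}"
proof -
  have "torus_point v u r s = restrict (\<lambda>m. cocharacter v r m * cocharacter u s m) dual_lattice"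
    by (auto simp: torus_point_def cocharacter_def)
  then show ?thesis
    using chart_times[OF cocharacter_mem[OF assms(1,3)] cocharacter_mem[OF assms(2,4)]] by simp
qed

lemma monomial_point_torus:
  assumes fan: "fan \<Sigma>" and \<tau>: "\<tau> \<in> \<Sigma>" and "v \<in> N" "u \<in> N" "r \<noteq> 0" "s \<noteq> 0"
    and nonneg: "\<And>m. m \<in> dual_monoid \<tau> \<Longrightarrow> 0 \<le> m v"
  shows "chart_map \<Sigma> \<tau> (monomial_point \<tau> v u r s) = chart_map \<Sigma> {0} (torus_point v u r s)"
proof -
  have "monomial_point \<tau> v u r s = restrict (torus_point v u r s) (dual_monoid \<tau>)"
  proof (rule extensionalityI[of _ "dual_monoid \<tau>"])
    fix m assume m: "m \<in> dual_monoid \<tau>"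
    have "0 \<le> \<lfloor>m v\<rfloor>"
      using nonneg[OF m] by simp
    then have "r powi \<lfloor>m v\<rfloor> = r ^ nat \<lfloor>m v\<rfloor>"
      by (simp add: power_int_def)
    then show "monomial_point \<tau> v u r s m = restrict (torus_point v u r s) (dual_monoid \<tau>) m"
      using m dual_monoid_dual_lattice[OF m] by (simp add: monomial_point_def torus_point_def)
  qed (auto simp: monomial_point_def)
  then show ?thesis
    using chart_map_restrict[OF fan \<tau> fan_zero_cone[OF fan] _ torus_point_mem[OF assms(3-6)]] fan_zero[OF fan \<tau>] by simp
qed

end

subsection \<open>The vector field obtained from an automorphism\<close>

text \<open>\<open>\<delta>\<close> is the vector field of the one-parameter subgroup of \<open>v\<close>, transported by the
  automorphism \<open>\<phi>\<close> with inverse \<open>\<psi>\<close> and applied to a character.\<close>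

locale transported_vector_field = toric_lattice scale N n
  for scale :: "rat \<Rightarrow> 'v::ab_group_add \<Rightarrow> 'v" and N n +
  fixes \<Sigma> :: "'v set set"
    and \<phi> \<psi> :: "('v, 'k::{alg_closed_field, field_char_0}) toric_point \<Rightarrow> ('v, 'k) toric_point"
    and v :: 'v
  assumes fan: "fan \<Sigma>" and \<phi>: "endomorphism \<Sigma> \<phi>" and \<psi>: "endomorphism \<Sigma> \<psi>"
    and \<psi>\<phi>: "\<And>p. p \<in> toric_variety \<Sigma> \<Longrightarrow> \<psi> (\<phi> p) = p"
    and v: "v \<in> N"
begin

definition \<delta> :: "('v \<Rightarrow> rat) \<Rightarrow> ('v, 'k) toric_point \<Rightarrow> 'k" where
  "\<delta> m = log_derivation \<Sigma> v (character \<Sigma> m \<circ> \<psi>) \<circ> \<phi>"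

lemma source_regular:
  assumes "\<tau> \<in> \<Sigma>" "y \<in> chart \<tau>" "m \<in> dual_monoid \<tau>"
  shows "regular_at \<Sigma> (\<phi> (chart_map \<Sigma> \<tau> y)) (character \<Sigma> m \<circ> \<psi>)"
  using character_regular_at[OF fan assms] \<psi>\<phi>[OF chart_map_mem[OF assms(1,2)]]
  by (intro endomorphism_regular_at[OF fan \<psi> endomorphism_mem[OF \<phi> chart_map_mem[OF assms(1,2)]]]) simp

lemma \<delta>_regular:
  assumes "\<tau> \<in> \<Sigma>" "y \<in> chart \<tau>" "m \<in> dual_monoid \<tau>"
  shows "regular_at \<Sigma> (chart_map \<Sigma> \<tau> y) (\<delta> m)"
  unfolding \<delta>_def
  by (intro endomorphism_regular_at[OF fan \<phi> chart_map_mem[OF assms(1,2)]]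
      log_derivation_regular_at[OF fan v endomorphism_mem[OF \<phi> chart_map_mem[OF assms(1,2)]]] source_regular assms)

text \<open>Pulled back by \<open>\<psi>\<close>, the characters multiply only where
  \<open>\<psi>\<close> lands in the chart of \<open>\<tau>\<close>. This is an open neighbourhood
  of the image of the point under \<open>\<phi>\<close>, and derivations are local.\<close>

lemma \<delta>_mult:
  assumes \<tau>: "\<tau> \<in> \<Sigma>" "y \<in> chart \<tau>" and m: "m \<in> dual_monoid \<tau>" "m' \<in> dual_monoid \<tau>"
  shows "\<delta> (\<lambda>v. m v + m' v) (chart_map \<Sigma> \<tau> y) =
    \<delta> m (chart_map \<Sigma> \<tau> y) * y m' + y m * \<delta> m' (chart_map \<Sigma> \<tau> y)"
proof -
  let ?p = "chart_map \<Sigma> \<tau> y"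
  let ?U = "{q \<in> toric_variety \<Sigma>. \<psi> q \<in> chart_map \<Sigma> \<tau> ` chart \<tau>}"
  note p = chart_map_mem[OF \<tau>]
  have "openin (toric_topology \<Sigma>) ?U"
    using \<psi> openin_chart_image[OF fan \<tau>(1)]
      openin_continuous_map_preimage[of "toric_topology \<Sigma>" "toric_topology \<Sigma>" \<psi> "chart_map \<Sigma> \<tau> ` chart \<tau>"]
    by (simp add: endomorphism_def topspace_toric_topology)
  moreover have "\<phi> ?p \<in> ?U"
    using endomorphism_mem[OF \<phi> p] \<psi>\<phi>[OF p] \<tau>(2) by simp
  moreover have "(character \<Sigma> (\<lambda>v. m v + m' v) \<circ> \<psi>) q = (character \<Sigma> m \<circ> \<psi>) q * (character \<Sigma> m' \<circ> \<psi>) q"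
    if q: "q \<in> ?U" for q
  proof -
    obtain y' where y': "y' \<in> chart \<tau>" "\<psi> q = chart_map \<Sigma> \<tau> y'"
      using q by blast
    show ?thesis
      using character_eq[OF fan \<tau>(1) y'(1)] m add_mem_dual_monoid[OF m] chart_mult[OF y'(1) m]
      by (simp add: y'(2))
  qed
  ultimately have "log_derivation \<Sigma> v (character \<Sigma> (\<lambda>v. m v + m' v) \<circ> \<psi>) (\<phi> ?p) =
      log_derivation \<Sigma> v (character \<Sigma> m \<circ> \<psi>) (\<phi> ?p) * (character \<Sigma> m' \<circ> \<psi>) (\<phi> ?p) +
      (character \<Sigma> m \<circ> \<psi>) (\<phi> ?p) * log_derivation \<Sigma> v (character \<Sigma> m' \<circ> \<psi>) (\<phi> ?p)"
    by (rule log_derivation_mult[OF fan v endomorphism_mem[OF \<phi> p] source_regular[OF \<tau> m(1)] source_regular[OF \<tau> m(2)]])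
  then show ?thesis
    using character_eq[OF fan \<tau> m(1)] character_eq[OF fan \<tau> m(2)] by (simp add: \<delta>_def \<psi>\<phi>[OF p])
qed

text \<open>Division by the character turns the Leibniz rule into additivity, which covers negative
  coefficients as well.\<close>

lemma \<delta>_logarithmic:
  assumes t: "t \<in> chart {0}" and m: "m \<in> dual_lattice" "m' \<in> dual_lattice"
  shows "\<delta> (\<lambda>v. of_int a * m v + of_int b * m' v) (chart_map \<Sigma> {0} t) / t (\<lambda>v. of_int a * m v + of_int b * m' v) =
    of_int a * (\<delta> m (chart_map \<Sigma> {0} t) / t m) + of_int b * (\<delta> m' (chart_map \<Sigma> {0} t) / t m')"
proof -
  define l where "l = (\<lambda>m. \<delta> m (chart_map \<Sigma> {0} t) / t m)"
  have add: "l (\<lambda>v. m v + m' v) = l m + l m'" if "m \<in> dual_lattice" "m' \<in> dual_lattice" for m m'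
    using \<delta>_mult[OF fan_zero_cone[OF fan] t that] torus_nonzero[OF t that(1)] torus_nonzero[OF t that(2)]
    by (simp add: l_def chart_mult[OF t that] divide_simps)
  have "l (\<lambda>v. of_int a * m v + of_int b * m' v) = l (\<lambda>v. of_int a * m v) + l (\<lambda>v. of_int b * m' v)"
    by (intro add dual_lattice_int m)
  also have "\<dots> = of_int a * l m + of_int b * l m'"
    by (simp add: additive_int[where l = l, OF add m(1)] additive_int[where l = l, OF add m(2)])
  finally show ?thesis
    by (simp add: l_def)
qed

text \<open>Write \<open>x\<^sub>k\<close> for the coordinate dual to \<open>k \<in> B\<close>, \<open>a = d i w\<close>, \<open>b = d j w\<close>.  With \<open>m = b d i - a d j\<close>, the
  function \<open>x\<^sub>i \<chi>\<^bsup>-m\<^esup> \<delta>(\<chi>\<^sup>m) = b \<delta>(x\<^sub>i) - a x\<^sub>i x\<^sub>j\<^bsup>-1\<^esup> \<delta>(x\<^sub>j)\<close> is restricted to the surface \<open>r\<^sup>e s\<^sup>w\<close>: for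
  \<open>r = 0\<close> it has the value \<open>b \<delta>(x\<^sub>i)\<close> at the fixed point, for \<open>s = 0\<close> it vanishes.\<close>

lemma ray_contradiction:
  assumes \<sigma>: "\<sigma> \<in> \<Sigma>" and B: "int_basis scale B N"
    and d: "\<forall>b\<in>B. d b \<in> dual_lattice \<and> (\<forall>b'\<in>B. d b b' = (if b' = b then 1 else 0))"
    and d_dual: "\<And>b. b \<in> B \<Longrightarrow> d b \<in> dual_monoid \<sigma>" and B_cone: "B \<subseteq> \<sigma>"
    and x: "x \<in> chart \<sigma>" "\<forall>m\<in>dual_monoid \<sigma>. m \<noteq> (\<lambda>_. 0) \<longrightarrow> x m = 0"
    and w: "w \<in> N" "cone_hull {w} \<in> \<Sigma>"
    and ij: "i \<in> B" "j \<in> B" "j \<noteq> i" and pos: "0 < d i w" and nonzero: "d j w \<noteq> 0"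
    and \<delta>_nonzero: "\<delta> (d i) (chart_map \<Sigma> \<sigma> x) \<noteq> 0"
  shows False
proof -
  have fin: "finite B"
    using B by (simp add: int_basis_def)
  let ?\<rho> = "cone_hull {w}"
  \<comment> \<open>Positive coordinates make every nontrivial character of the chart vanish as
    \<open>r\<close> tends to 0, so the surface meets the fixed point. Counting \<open>i\<close>
    twice gives \<open>x_i\<close> the order 2 and \<open>x_j\<close> the order 1 in
    \<open>r\<close>, whence \<open>x_i / x_j\<close> still vanishes at
    \<open>r = 0\<close>.\<close>
  define e where "e = i + (\<Sum>b\<in>B. b)"
  have e: "e \<in> N"
    unfolding e_def by (intro lattice_add lattice_sum int_basis_mem[OF B] ij(1))
  have val_e: "m e = m i + (\<Sum>b\<in>B. m b)" if "m \<in> dual_lattice" for m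
    using dual_lattice_lin[OF that] by (simp add: e_def lin_add[OF dual_lattice_lin[OF that]] lin_sum[OF dual_lattice_lin[OF that]])
  have B_nonneg: "0 \<le> m b" if "m \<in> dual_monoid \<sigma>" "b \<in> B" for m b
    using that B_cone by (auto simp: dual_monoid_def)
  have e_nonneg: "0 \<le> m e" if "m \<in> dual_monoid \<sigma>" for m
    unfolding val_e[OF dual_monoid_dual_lattice[OF that]]
    using B_nonneg[OF that] ij(1) by (intro add_nonneg_nonneg sum_nonneg) auto
  have e_pos: "0 < m e" if m: "m \<in> dual_monoid \<sigma>" "m \<noteq> (\<lambda>_. 0)" for m
  proof -
    have "\<exists>b\<in>B. m b \<noteq> 0"
      using lin_eq_on_basis[OF B dual_monoid_lin[OF m(1)] lin_0] m(2) by blast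
    then obtain b where b: "b \<in> B" "m b \<noteq> 0" by blast
    then have "0 < m b"
      using B_nonneg[OF m(1) b(1)] by simp
    then have "0 < (\<Sum>b\<in>B. m b)"
      using b(1) fin B_nonneg[OF m(1)] by (intro sum_pos2[of _ b]) auto
    then show ?thesis
      using B_nonneg[OF m(1) ij(1)] val_e[OF dual_monoid_dual_lattice[OF m(1)]] by simp
  qed
  have sum_d: "(\<Sum>b\<in>B. d k b) = 1" if "k \<in> B" for k
  proof -
    have "(\<Sum>b\<in>B. d k b) = (\<Sum>b\<in>B. if b = k then 1 else 0)"
      using d that by (intro sum.cong) auto
    then show ?thesis
      using fin that by simp
  qed
  have d_e: "d i e = 2" "d j e = 1"
    using val_e[of "d i"] val_e[of "d j"] sum_d[OF ij(1)] sum_d[OF ij(2)] d ij by auto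
  define a where "a = \<lfloor>d i w\<rfloor>"
  define b where "b = \<lfloor>d j w\<rfloor>"
  have d_lattice: "d i \<in> dual_lattice" "d j \<in> dual_lattice"
    using d ij by auto
  have ab: "of_int a = d i w" "of_int b = d j w"
    unfolding a_def b_def by (rule dual_lattice_floor[OF d_lattice(1) w(1)], rule dual_lattice_floor[OF d_lattice(2) w(1)])
  have a_pos: "0 < a"
    using pos unfolding ab(1)[symmetric] by simp
  have b_nz: "b \<noteq> 0"
    using nonzero unfolding ab(2)[symmetric] by simp
  \<comment> \<open>The coefficients are chosen so that \<open>m w = 0\<close>: the character is a
    unit on the chart of the ray, and \<open>\<delta> m\<close> is regular there.\<close>
  define m where "m = (\<lambda>v. of_int b * d i v + of_int (- a) * d j v)"
  have m: "m \<in> dual_lattice"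
    unfolding m_def using d ij by (intro dual_lattice_add dual_lattice_int) auto
  have mw: "m w = 0"
    by (simp add: m_def flip: ab)
  have m_ray: "m \<in> dual_monoid ?\<rho>"
    using m mw by (simp add: dual_monoid_cone_hull)
  have ray_nonneg: "0 \<le> m w" if "m \<in> dual_monoid ?\<rho>" for m
    using that by (simp add: dual_monoid_cone_hull)
  define \<gamma> where "\<gamma> = (monomial_point \<sigma> e w :: 'k \<Rightarrow> 'k \<Rightarrow> ('v, 'k) chart_point)"
  \<comment> \<open>The same surface seen in the chart of the ray. Now \<open>s\<close> may be 0 but
    \<open>r\<close> may not, and together with \<open>\<gamma>\<close> the plane without the origin
    is covered.\<close>
  define \<eta> where "\<eta> = (\<lambda>r s. monomial_point ?\<rho> w e s r :: ('v, 'k) chart_point)"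
  define T where "T = (torus_point e w :: 'k \<Rightarrow> 'k \<Rightarrow> ('v, 'k) chart_point)"
  have \<gamma>_mem: "\<gamma> r s \<in> chart \<sigma>" if "s \<noteq> 0" for r s
    unfolding \<gamma>_def using e w(1) that e_nonneg by (rule monomial_point_mem)
  have \<eta>_mem: "\<eta> r s \<in> chart ?\<rho>" if "r \<noteq> 0" for r s
    unfolding \<eta>_def using w(1) e that ray_nonneg by (rule monomial_point_mem)
  have T_mem: "T r s \<in> chart {0}" if "r \<noteq> 0" "s \<noteq> 0" for r s
    unfolding T_def using e w(1) that by (rule torus_point_mem)
  have \<gamma>_T: "chart_map \<Sigma> \<sigma> (\<gamma> r s) = chart_map \<Sigma> {0} (T r s)" if "r \<noteq> 0" "s \<noteq> 0" for r s
    unfolding \<gamma>_def T_def using fan \<sigma> e w(1) that e_nonneg by (rule monomial_point_torus)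
  have \<eta>_T: "chart_map \<Sigma> ?\<rho> (\<eta> r s) = chart_map \<Sigma> {0} (T r s)" if "r \<noteq> 0" "s \<noteq> 0" for r s
    unfolding \<eta>_def T_def torus_point_commute[of e w]
    using fan w(2,1) e that(2,1) ray_nonneg by (rule monomial_point_torus)
  \<comment> \<open>The value on the axis \<open>s = 0\<close> is set by hand; that it continues the
    rest polynomially is checked in \<open>poly2\<close>.\<close>
  define f where "f = (\<lambda>r s. if s = 0 then 0 else
      of_int b * \<delta> (d i) (chart_map \<Sigma> \<sigma> (\<gamma> r s)) -
      of_int a * (r * s powi (a - b)) * \<delta> (d j) (chart_map \<Sigma> \<sigma> (\<gamma> r s)))"
  have "of_int b * \<delta> (d i) (chart_map \<Sigma> \<sigma> x) = 0"
  proof -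
    have axis1: "f 0 s = of_int b * \<delta> (d i) (chart_map \<Sigma> \<sigma> x)" if s: "s \<noteq> 0" for s
    proof -
      have "\<gamma> 0 s = x"
      proof (rule chart_eqI[OF \<gamma>_mem[OF s] x(1)])
        fix m' assume m': "m' \<in> dual_monoid \<sigma>"
        show "\<gamma> 0 s m' = x m'"
        proof (cases "m' = (\<lambda>_. 0)")
          case True
          then show ?thesis
            using chart_one[OF \<gamma>_mem[OF s]] chart_one[OF x(1)] by simp
        next
          case False
          have "of_int \<lfloor>m' e\<rfloor> = m' e"
            by (rule dual_lattice_floor[OF dual_monoid_dual_lattice[OF m'] e])
          then have "0 < \<lfloor>m' e\<rfloor>"
            using e_pos[OF m' False] by linarith
          then show ?thesis
            using x(2) m' False by (simp add: \<gamma>_def monomial_point_def)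
        qed
      qed
      then show ?thesis
        using s by (simp add: f_def)
    qed
    have \<gamma>_eval: "\<gamma> r s m' = r ^ nat \<lfloor>m' e\<rfloor> * s powi \<lfloor>m' w\<rfloor>" if "m' \<in> dual_monoid \<sigma>" for r s m'
      using that by (simp add: \<gamma>_def monomial_point_def)
    obtain D1 Z1 where Z1: "finite Z1" "0 \<in> Z1" "\<And>s. s \<notin> Z1 \<Longrightarrow>
        \<exists>P. degree P \<le> D1 \<and> (\<forall>r. \<delta> (d i) (chart_map \<Sigma> \<sigma> (\<gamma> r s)) = poly P r)"
      using regular_curve_degree_bound[where \<gamma> = \<gamma> and F = "\<delta> (d i)", OF fan \<sigma> \<gamma>_mem \<gamma>_eval
          \<delta>_regular[OF \<sigma> \<gamma>_mem d_dual[OF ij(1)]]] by blast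
    obtain D2 Z2 where Z2: "finite Z2" "\<And>s. s \<notin> Z2 \<Longrightarrow>
        \<exists>P. degree P \<le> D2 \<and> (\<forall>r. \<delta> (d j) (chart_map \<Sigma> \<sigma> (\<gamma> r s)) = poly P r)"
      using regular_curve_degree_bound[where \<gamma> = \<gamma> and F = "\<delta> (d j)", OF fan \<sigma> \<gamma>_mem \<gamma>_eval
          \<delta>_regular[OF \<sigma> \<gamma>_mem d_dual[OF ij(2)]]] by blast
    have poly1: "\<exists>P. degree P \<le> max D1 (Suc D2) \<and> (\<forall>r. f r s = poly P r)" if s: "s \<notin> Z1 \<union> Z2" for s
    proof -
      obtain P1 where P1: "degree P1 \<le> D1" "\<And>r. \<delta> (d i) (chart_map \<Sigma> \<sigma> (\<gamma> r s)) = poly P1 r"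
        using Z1(3)[of s] s by blast
      obtain P2 where P2: "degree P2 \<le> D2" "\<And>r. \<delta> (d j) (chart_map \<Sigma> \<sigma> (\<gamma> r s)) = poly P2 r"
        using Z2(2)[of s] s by blast
      \<comment> \<open>The factor \<open>r\<close> in the second term raises its degree by one,
        hence the bound \<open>Suc D2\<close>.\<close>
      let ?P = "smult (of_int b) P1 - smult (of_int a * s powi (a - b)) (pCons 0 P2)"
      have "degree ?P \<le> max D1 (Suc D2)"
      proof (rule degree_diff_le)
        show "degree (smult (of_int b) P1) \<le> max D1 (Suc D2)"
          using P1(1) by (intro order_trans[OF degree_smult_le]) simp
        show "degree (smult (of_int a * s powi (a - b)) (pCons 0 P2)) \<le> max D1 (Suc D2)"
          using P2(1) by (intro order_trans[OF degree_smult_le] order_trans[OF degree_pCons_le]) simp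
      qed
      moreover have "f r s = poly ?P r" for r
        using s Z1(2) by (auto simp: f_def P1(2) P2(2) algebra_simps)
      ultimately show ?thesis by blast
    qed
    have poly2: "\<exists>P. \<forall>s. f r s = poly P s" if r: "r \<noteq> 0" for r
    proof -
      have "\<exists>P. \<forall>s. \<eta> r s m' = poly P s" if "m' \<in> dual_monoid ?\<rho>" for m'
        using that by (intro exI[of _ "monom (r powi \<lfloor>m' e\<rfloor>) (nat \<lfloor>m' w\<rfloor>)"])
          (simp add: \<eta>_def monomial_point_def poly_monom)
      then obtain E where E: "\<And>s. \<delta> m (chart_map \<Sigma> ?\<rho> (\<eta> r s)) = poly E s"
        using regular_curve_polynomial[where w = "\<eta> r" and F = "\<delta> m", OF fan w(2) \<eta>_mem[OF r] _
            \<delta>_regular[OF w(2) \<eta>_mem[OF r] m_ray]] by blast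
      \<comment> \<open>On the surface \<open>x_i\<close> is \<open>r ^ 2 * s ^ a\<close>, and the
        character of \<open>m\<close> depends on \<open>r\<close> alone since
        \<open>m w = 0\<close>. Dividing the former by the latter leaves \<open>s ^ a\<close> times
        a constant in \<open>s\<close>, and this power vanishes at \<open>s = 0\<close> because
        \<open>a\<close> is positive.\<close>
      define \<kappa> where "\<kappa> = r ^ 2 / r powi \<lfloor>m e\<rfloor>"
      have "f r s = \<kappa> * s ^ nat a * poly E s" for s
      proof (cases "s = 0")
        case True
        then show ?thesis
          using a_pos by (simp add: f_def)
      next
        case False
        let ?y = "chart_map \<Sigma> {0} (T r s)"
        note t = T_mem[OF r False]
        have T_eval: "T r s m' = r powi \<lfloor>m' e\<rfloor> * s powi \<lfloor>m' w\<rfloor>" if "m' \<in> dual_lattice" for m'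
          using that by (simp add: T_def torus_point_def)
        have Ti: "T r s (d i) = r ^ 2 * s powi a"
          using d ij(1) by (simp add: T_eval d_e a_def power_int_numeral)
        have Tj: "T r s (d j) = r * s powi b"
          using d ij(2) by (simp add: T_eval d_e b_def)
        have Tm: "T r s m = r powi \<lfloor>m e\<rfloor>"
          using T_eval[OF m] mw by simp
        have log: "\<delta> m ?y / T r s m = of_int b * (\<delta> (d i) ?y / T r s (d i)) + of_int (- a) * (\<delta> (d j) ?y / T r s (d j))"
          unfolding m_def using d ij by (intro \<delta>_logarithmic t) auto
        have "s powi (a - b) = s powi a / s powi b"
          using False by (simp add: power_int_diff)
        then have "f r s = of_int b * \<delta> (d i) ?y - of_int a * (r * (s powi a / s powi b)) * \<delta> (d j) ?y"
          using False by (simp add: f_def \<gamma>_T[OF r False])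
        also have "\<dots> = (r ^ 2 * s powi a) * (of_int b * (\<delta> (d i) ?y / (r ^ 2 * s powi a)) + of_int (- a) * (\<delta> (d j) ?y / (r * s powi b)))"
          using r False by (simp add: field_simps power2_eq_square)
        also have "\<dots> = (r ^ 2 * s powi a) * (\<delta> m ?y / r powi \<lfloor>m e\<rfloor>)"
          using log unfolding Ti Tj Tm by simp
        also have "\<dots> = \<kappa> * s ^ nat a * poly E s"
          using a_pos E[of s] by (simp add: \<kappa>_def \<eta>_T[OF r False] power_int_def)
        finally show ?thesis .
      qed
      then show ?thesis
        by (intro exI[of _ "smult \<kappa> (monom 1 (nat a) * E)"]) (simp add: poly_monom mult.assoc)
    qed
    show ?thesis
    proof (rule axes_contradiction[of f "Z1 \<union> Z2" "max D1 (Suc D2)"])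
      show "f r 0 = 0" for r
        by (simp add: f_def)
    qed (use poly1 poly2 axis1 Z1(1) Z2(1) in auto)
  qed
  then show False
    using b_nz \<delta>_nonzero by simp
qed

end

section \<open>The cone of a fixed point that is moved into the torus\<close>

context toric_lattice
begin

text \<open>On the basis both summands take nonnegative integral values adding up to 0 or, only at
  \<open>i\<close>, to 1. One of them therefore vanishes on the whole basis.\<close>

lemma dual_basis_indecomposable:
  assumes B: "int_basis scale B N"
    and d: "\<forall>b\<in>B. d b \<in> dual_lattice \<and> (\<forall>b'\<in>B. d b b' = (if b' = b then 1 else 0))"
    and d_dual: "d i \<in> dual_monoid \<sigma>" and B_cone: "B \<subseteq> \<sigma>" and i: "i \<in> B"
  shows "indecomposable \<sigma> (d i)"
  unfolding indecomposable_def
proof (intro conjI ballI impI)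
  show "d i \<noteq> (\<lambda>_. 0)"
    using d i by (metis zero_neq_one)
  fix m m' assume m: "m \<in> dual_monoid \<sigma>" "m' \<in> dual_monoid \<sigma>" and eq: "d i = (\<lambda>v. m v + m' v)"
  have nonneg: "0 \<le> m b" "0 \<le> m' b" if "b \<in> B" for b
    using m that B_cone by (auto simp: dual_monoid_def)
  have sum: "m b + m' b = (if b = i then 1 else 0)" if "b \<in> B" for b
    using d i that fun_cong[OF eq, of b] by simp
  have other: "m b = 0" "m' b = 0" if "b \<in> B" "b \<noteq> i" for b
    using nonneg[OF that(1)] sum[OF that(1)] that(2) by auto
  have "m i = 0 \<or> m' i = 0"
  proof -
    have fl: "of_int \<lfloor>m i\<rfloor> = m i" "of_int \<lfloor>m' i\<rfloor> = m' i"
      by (rule dual_lattice_floor[OF dual_monoid_dual_lattice[OF m(1)] int_basis_mem[OF B i]],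
        rule dual_lattice_floor[OF dual_monoid_dual_lattice[OF m(2)] int_basis_mem[OF B i]])
    have "rat_of_int (\<lfloor>m i\<rfloor> + \<lfloor>m' i\<rfloor>) = of_int 1"
      using sum[OF i] fl by (simp only: of_int_add of_int_1 refl if_True)
    then have "\<lfloor>m i\<rfloor> + \<lfloor>m' i\<rfloor> = 1"
      by (simp only: of_int_eq_iff)
    moreover have "0 \<le> \<lfloor>m i\<rfloor>" "0 \<le> \<lfloor>m' i\<rfloor>"
      using nonneg[OF i] by auto
    ultimately have "\<lfloor>m i\<rfloor> = 0 \<or> \<lfloor>m' i\<rfloor> = 0" by linarith
    then show ?thesis
      using fl by (metis of_int_0)
  qed
  then show "m = (\<lambda>_. 0) \<or> m' = (\<lambda>_. 0)"
  proof
    assume "m i = 0"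
    then have "m v = 0" if "v \<in> B" for v
      using other(1) that by (cases "v = i") auto
    then have "m = (\<lambda>_. 0)"
      by (rule lin_eq_on_basis[OF B dual_monoid_lin[OF m(1)] lin_0])
    then show ?thesis ..
  next
    assume "m' i = 0"
    then have "m' v = 0" if "v \<in> B" for v
      using other(2) that by (cases "v = i") auto
    then have "m' = (\<lambda>_. 0)"
      by (rule lin_eq_on_basis[OF B dual_monoid_lin[OF m(2)] lin_0])
    then show ?thesis ..
  qed
qed (use d_dual in auto)

lemma cone_hull_single_scale:
  assumes "0 < c"
  shows "cone_hull {scale c x} = cone_hull {x}"
proof (intro subset_antisym cone_hull_least)
  show "{scale c x} \<subseteq> cone_hull {x}"
    using assms by (auto simp: cone_hull_single)
  have "\<exists>d. x = scale d (scale c x) \<and> 0 \<le> d"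
    using assms by (intro exI[of _ "1 / c"]) simp
  then show "{x} \<subseteq> cone_hull {scale c x}"
    unfolding cone_hull_single insert_subset mem_Collect_eq by (intro conjI empty_subsetI)
qed

lemma moved_fixed_point_cone:
  fixes \<phi> :: "('v, 'k::{alg_closed_field, field_char_0}) toric_point \<Rightarrow> ('v, 'k) toric_point"
  assumes fan: "fan \<Sigma>" and "automorphism \<Sigma> \<phi>" and "torus_invariant \<Sigma> p" and "\<phi> p \<in> dense_torus \<Sigma>"
  shows "\<exists>\<sigma>\<in>\<Sigma>. full_dimensional \<sigma> \<and> smooth_cone \<sigma> \<and>
    (\<forall>\<rho>\<in>fan_rays \<Sigma> - cone_rays \<sigma>. \<rho> \<subseteq> uminus ` \<sigma>)"
proof -
  have \<phi>: "endomorphism \<Sigma> \<phi>"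
    and "\<exists>\<psi>. endomorphism \<Sigma> \<psi> \<and> (\<forall>p\<in>toric_variety \<Sigma>. \<psi> (\<phi> p) = p \<and> \<phi> (\<psi> p) = p)"
    using assms(2) by (simp_all only: automorphism_def)
  then obtain \<psi> where \<psi>: "endomorphism \<Sigma> \<psi>"
      and \<psi>_inv: "\<forall>p\<in>toric_variety \<Sigma>. \<psi> (\<phi> p) = p \<and> \<phi> (\<psi> p) = p"
    by (elim exE conjE)
  then have inv: "\<psi> (\<phi> p) = p" if "p \<in> toric_variety \<Sigma>" for p
    using that by simp
  obtain \<sigma> x where \<sigma>: "\<sigma> \<in> \<Sigma>" and x: "x \<in> chart \<sigma>" "p = chart_map \<Sigma> \<sigma> x" and full: "full_dimensional \<sigma>"
      and x0: "\<forall>m\<in>dual_monoid \<sigma>. m \<noteq> (\<lambda>_. 0) \<longrightarrow> x m = 0"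
    using torus_invariant_point[OF fan assms(3)] .
  obtain t where t: "t \<in> chart {0}" "\<phi> (chart_map \<Sigma> \<sigma> x) = chart_map \<Sigma> {0} t"
    using assms(4) by (auto simp: dense_torus_def x(2))
  obtain C where C: "int_basis scale C N"
    using free_of_rank by blast
  have "\<exists>A J. (\<forall>h c. indecomposable \<sigma> h \<longrightarrow> c \<in> C \<longrightarrow>
        germ_deriv {0} t (log_tangent c t) (character \<Sigma> h \<circ> \<psi> \<circ> chart_map \<Sigma> {0}) (J c h)) \<and>
      (\<forall>h h'. indecomposable \<sigma> h \<longrightarrow> indecomposable \<sigma> h' \<longrightarrow>
        (\<Sum>c\<in>C. A h c * J c h') = (if h = h' then 1 else 0))"
    by (rule tangent_pairing[OF fan \<phi> \<psi> _ \<sigma> x(1) x0 t C]) (rule inv)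
  then obtain A J where AJ: "\<forall>h c. indecomposable \<sigma> h \<longrightarrow> c \<in> C \<longrightarrow>
        germ_deriv {0} t (log_tangent c t) (character \<Sigma> h \<circ> \<psi> \<circ> chart_map \<Sigma> {0}) (J c h)"
      "\<forall>h h'. indecomposable \<sigma> h \<longrightarrow> indecomposable \<sigma> h' \<longrightarrow>
        (\<Sum>c\<in>C. A h c * J c h') = (if h = h' then 1 else 0)"
    by (elim exE conjE)
  have J: "germ_deriv {0} t (log_tangent c t) (character \<Sigma> h \<circ> \<psi> \<circ> chart_map \<Sigma> {0}) (J c h)"
    if "indecomposable \<sigma> h" "c \<in> C" for h c
    using AJ(1) that by (elim allE impE)
  have pair: "(\<Sum>c\<in>C. A h c * J c h') = (if h = h' then 1 else 0)"
    if "indecomposable \<sigma> h" "indecomposable \<sigma> h'" for h h'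
    using AJ(2) that by (elim allE impE)
  have "card H \<le> n" if "finite H" "\<And>h. h \<in> H \<Longrightarrow> indecomposable \<sigma> h" for H
    using card_le_by_pairing[OF that(1), of C A J] C pair that(2) int_basis_card[OF C]
    by (simp add: int_basis_def)
  then have smooth: "smooth_cone \<sigma>"
    by (rule smooth_if_few_indecomposables[OF fan_rational[OF fan \<sigma>] fan_convex[OF fan \<sigma>] full])
  define B where "B = primitive_generators \<sigma>"
  have B: "int_basis scale B N"
    using smooth by (simp add: smooth_cone_def B_def)
  have fin: "finite B"
    using B by (simp add: int_basis_def)
  obtain d where d: "\<forall>b\<in>B. d b \<in> dual_lattice \<and> (\<forall>b'\<in>B. d b b' = (if b' = b then 1 else 0))"
    using dual_basis[OF B] by blast
  have d_dual: "d b \<in> dual_monoid \<sigma>" if "b \<in> B" for b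
    using smooth_cone_dual_basis[OF fan \<sigma> B[unfolded B_def] d[unfolded B_def]] that by (simp add: B_def)
  have B_cone: "B \<subseteq> \<sigma>"
    by (auto simp: B_def primitive_generators_def cone_rays_def face_of_def)
  have "\<rho> \<subseteq> uminus ` \<sigma>" if \<rho>: "\<rho> \<in> fan_rays \<Sigma> - cone_rays \<sigma>" for \<rho>
  proof -
    have \<rho>': "\<rho> \<in> \<Sigma>" "dim \<rho> = 1"
      using \<rho> by (auto simp: fan_rays_def)
    obtain w where w: "primitive w" "\<rho> = cone_hull {w}"
      using ray_generator[OF fan_rational[OF fan \<rho>'(1)] fan_convex[OF fan \<rho>'(1)] \<rho>'(2)] .
    have wN: "w \<in> N"
      using w(1) by (simp add: primitive_def)
    have nonpos: "d i w \<le> 0" if i: "i \<in> B" for i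
    proof (rule ccontr)
      assume "\<not> d i w \<le> 0"
      then have pos: "0 < d i w" by simp
      \<comment> \<open>Otherwise \<open>w\<close> would be a positive multiple of \<open>i\<close>,
        and its ray would be one of the rays of the cone.\<close>
      have "\<exists>j\<in>B. j \<noteq> i \<and> d j w \<noteq> 0"
      proof (rule ccontr)
        assume "\<not> ?thesis"
        then have "(\<Sum>b\<in>B - {i}. scale (d b w) b) = 0"
          by (intro sum.neutral) auto
        then have wi: "w = scale (d i w) i"
          using dual_basis_expand[OF B d, of w] i fin by (simp add: sum.remove[of B i])
        obtain \<tau> where \<tau>: "\<tau> \<in> cone_rays \<sigma>" "i \<in> \<tau>"
          using i by (auto simp: B_def primitive_generators_def)
        have \<tau>': "\<tau> \<in> \<Sigma>" "dim \<tau> = 1"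
          using \<tau>(1) fan_face[OF fan \<sigma>] by (auto simp: cone_rays_def)
        obtain y where y: "primitive y" "\<tau> = cone_hull {y}"
          using ray_generator[OF fan_rational[OF fan \<tau>'(1)] fan_convex[OF fan \<tau>'(1)] \<tau>'(2)] .
        obtain c where c: "0 \<le> c" "i = scale c y"
          using \<tau>(2) by (auto simp: y(2) cone_hull_single)
        have "i \<noteq> 0"
          using i by (auto simp: B_def primitive_generators_def primitive_def)
        then have "0 < c"
          using c by (cases "c = 0") auto
        then have "cone_hull {i} = \<tau>"
          using cone_hull_single_scale[of c y] c(2) y(2) by simp
        moreover have "cone_hull {w} = cone_hull {i}"
          using cone_hull_single_scale[OF pos, of i] wi by simp
        ultimately have "\<rho> \<in> cone_rays \<sigma>"
          using \<tau>(1) w(2) by simp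
        then show False
          using \<rho> by blast
      qed
      then obtain j where j: "j \<in> B" "j \<noteq> i" "d j w \<noteq> 0" by blast
      have ind: "indecomposable \<sigma> (d i)"
        by (rule dual_basis_indecomposable[OF B d d_dual[OF i] B_cone i])
      \<comment> \<open>The diagonal entry of the pairing is 1, so the transported field of some
        one-parameter subgroup \<open>c\<close> has a nonzero \<open>i\<close>-th component at the
        fixed point.\<close>
      have "(\<Sum>c\<in>C. A (d i) c * J c (d i)) \<noteq> 0"
        using pair[OF ind ind] by simp
      then have "\<exists>c\<in>C. J c (d i) \<noteq> 0"
        by (rule contrapos_np) (intro sum.neutral, simp)
      then obtain c where c: "c \<in> C" "J c (d i) \<noteq> 0"
        by (elim bexE)
      have cN: "c \<in> N"
        by (rule int_basis_mem[OF C c(1)])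
      interpret transported_vector_field scale N n \<Sigma> \<phi> \<psi> c
        by unfold_locales (use fan \<phi> \<psi> inv cN in auto)
      have "germ_deriv {0} t (log_tangent c t) ((character \<Sigma> (d i) \<circ> \<psi>) \<circ> chart_map \<Sigma> {0}) (J c (d i))"
        using J[OF ind c(1)] .
      then have "\<delta> (d i) (chart_map \<Sigma> \<sigma> x) = J c (d i)"
        using log_derivation_eq[OF fan cN fan_zero_cone[OF fan] t(1)] t(2) by (simp add: \<delta>_def)
      then show False
        using ray_contradiction[OF \<sigma> B d d_dual B_cone x(1) x0 wN _ i j(1,2) pos j(3)] \<rho>'(1) w(2) c(2) by simp
    qed
    show ?thesis
    proof
      fix v assume "v \<in> \<rho>"
      then obtain c where c: "0 \<le> c" "v = scale c w"
        by (auto simp: w(2) cone_hull_single)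
      \<comment> \<open>Biduality: all coordinates of \<open>w\<close> are nonpositive and the basis
        lies in the cone, so every element of the dual monoid is nonpositive at
        \<open>w\<close>.\<close>
      have "- v \<in> \<sigma>"
      proof (rule mem_cone_if_dual_nonneg[OF fan_rational[OF fan \<sigma>]])
        fix m assume m: "m \<in> dual_monoid \<sigma>"
        note lin = dual_monoid_lin[OF m]
        have "m w = (\<Sum>b\<in>B. d b w * m b)"
          by (subst dual_basis_expand[OF B d, of w]) (rule lin_comb[OF lin])
        also have "\<dots> \<le> 0"
          using nonpos m B_cone by (intro sum_nonpos mult_nonpos_nonneg) (auto simp: dual_monoid_def)
        finally have "c * m w \<le> 0"
          by (rule mult_nonneg_nonpos[OF c(1)])
        then show "0 \<le> m (- v)"
          by (simp add: c(2) lin_neg[OF lin] lin_scale[OF lin])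
      qed
      then show "v \<in> uminus ` \<sigma>"
        using imageI[of "- v" \<sigma> uminus] by simp
    qed
  qed
  then show ?thesis
    using \<sigma> full smooth by blast
qed

end

theorem theorem1:
  fixes scale :: "rat \<Rightarrow> 'v::ab_group_add \<Rightarrow> 'v"
    and N :: "'v set" and n :: nat and \<Sigma> :: "'v set set"
  assumes "toric_lattice scale N n"
    and "toric_lattice.complete_fan scale N \<Sigma>"
  shows "((\<exists>\<phi> :: ('v, 'k::{alg_closed_field, field_char_0}) toric_point
               \<Rightarrow> ('v, 'k) toric_point.
            toric_lattice.automorphism scale N \<Sigma> \<phi> \<and>
            (\<exists>p. toric_lattice.torus_invariant scale N \<Sigma> p \<and>
                 \<phi> p \<in> toric_lattice.dense_torus scale N \<Sigma>))
         \<longleftrightarrow>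
         (\<exists>\<sigma>\<in>\<Sigma>. toric_lattice.full_dimensional scale n \<sigma> \<and>
            toric_lattice.smooth_cone scale N \<sigma> \<and>
            (\<forall>\<rho> \<in> toric_lattice.fan_rays scale \<Sigma> - toric_lattice.cone_rays scale \<sigma>.
               \<rho> \<subseteq> uminus ` \<sigma>)))
         \<and>
         (\<forall>\<sigma>\<in>\<Sigma>. toric_lattice.full_dimensional scale n \<sigma> \<and>
            toric_lattice.smooth_cone scale N \<sigma> \<and>
            (\<forall>\<rho> \<in> toric_lattice.fan_rays scale \<Sigma> - toric_lattice.cone_rays scale \<sigma>.
               \<rho> \<subseteq> uminus ` \<sigma>) \<longrightarrow>
            (\<exists>\<phi> :: ('v, 'k) toric_point \<Rightarrow> ('v, 'k) toric_point.
               toric_lattice.automorphism scale N \<Sigma> \<phi> \<and>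
               \<phi> (toric_lattice.distinguished_point scale N \<Sigma> \<sigma>)
                 \<in> toric_lattice.dense_torus scale N \<Sigma>))"
proof -
  interpret toric_lattice scale N n by (fact assms(1))
  have complete: "complete_fan \<Sigma>" and fan: "fan \<Sigma>"
    using assms(2) by (auto simp: complete_fan_def)
  have moves: "\<exists>\<phi> :: ('v, 'k) toric_point \<Rightarrow> ('v, 'k) toric_point.
      automorphism \<Sigma> \<phi> \<and> \<phi> (distinguished_point \<Sigma> \<sigma>) \<in> dense_torus \<Sigma>"
    if "\<sigma> \<in> \<Sigma>" "smooth_cone \<sigma>" "\<forall>\<rho>\<in>fan_rays \<Sigma> - cone_rays \<sigma>. \<rho> \<subseteq> uminus ` \<sigma>" for \<sigma>
    by (rule smooth_cone_moves_into_torus[OF complete that])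
  show ?thesis
  proof (intro conjI iffI ballI impI)
    assume "\<exists>\<phi> :: ('v, 'k) toric_point \<Rightarrow> ('v, 'k) toric_point. automorphism \<Sigma> \<phi> \<and>
      (\<exists>p. torus_invariant \<Sigma> p \<and> \<phi> p \<in> dense_torus \<Sigma>)"
    then show "\<exists>\<sigma>\<in>\<Sigma>. full_dimensional \<sigma> \<and> smooth_cone \<sigma> \<and>
        (\<forall>\<rho>\<in>fan_rays \<Sigma> - cone_rays \<sigma>. \<rho> \<subseteq> uminus ` \<sigma>)"
      using moved_fixed_point_cone[OF fan] by blast
  next
    assume "\<exists>\<sigma>\<in>\<Sigma>. full_dimensional \<sigma> \<and> smooth_cone \<sigma> \<and>
        (\<forall>\<rho>\<in>fan_rays \<Sigma> - cone_rays \<sigma>. \<rho> \<subseteq> uminus ` \<sigma>)"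
    then obtain \<sigma> where \<sigma>: "\<sigma> \<in> \<Sigma>" "full_dimensional \<sigma>" "smooth_cone \<sigma>"
        "\<forall>\<rho>\<in>fan_rays \<Sigma> - cone_rays \<sigma>. \<rho> \<subseteq> uminus ` \<sigma>"
      by blast
    then show "\<exists>\<phi> :: ('v, 'k) toric_point \<Rightarrow> ('v, 'k) toric_point. automorphism \<Sigma> \<phi> \<and>
        (\<exists>p. torus_invariant \<Sigma> p \<and> \<phi> p \<in> dense_torus \<Sigma>)"
      using moves[OF \<sigma>(1,3,4)] distinguished_point_invariant[OF fan \<sigma>(1,2)] by blast
  qed (use moves in blast)
qed

end
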